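(* Let $\mathfrak g$ be a finite-dimensional complex simple Lie algebra, let $\Gamma\subset \mathrm{SL}(2,\mathbb Z)$ be a finite index subgroup, let $\bar\rho:\mathrm{SL}(2,\mathbb C)\to \mathrm{Aut}(\mathfrak g)^0$ be a homomorphism of complex Lie groups into the identity component of the automorphism group of $\mathfrak g$, and let $\rho=\bar\rho|_\Gamma:\Gamma\to\mathrm{Aut}(\mathfrak g)$. Equip $\mathfrak g$ with the $\mathbb Z$-grading $\mathfrak g=\bigoplus_k \mathfrak g_k$, where $\mathfrak g_k$ is the eigenspace with eigenvalue $k$ of $H=\mathrm d\bar\rho\begin{pmatrix}1&0\\0&-1\end{pmatrix}$. Then there is an isomorphism of $\mathbb Z$-graded Lie algebras and of $\mathbb Z$-graded $M_\ast(\Gamma)$-modules $$\mathfrak M_\ast(\mathfrak g,\Gamma,\rho)\cong \mathfrak g\otimes_{\mathbb C} M_\ast(\Gamma),$$ and an isomorphism of $\mathbb Z$-graded Lie algebras and of $\mathbb Z$-graded $M^!_\ast(\Gamma)$-modules $$\mathfrak M^!_\ast(\mathfrak g,\Gamma,\rho)\cong \mathfrak g\otimes_{\mathbb C} M^!_\ast(\Gamma),$$ where the right-hand sides carry the total grading (the weight of $A\otimes f$ is $k+l$ for $A\in\mathfrak g_k$ and $f$ of weight $l$).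
   Context: $\mathbb H^2=\{\tau\in\mathbb C:\operatorname{Im}\tau>0\}$, with $\gamma\tau=\frac{a\tau+b}{c\tau+d}$ for $\gamma=\begin{pmatrix}a&b\\c&d\end{pmatrix}\in\mathrm{SL}(2,\mathbb Z)$. Growth: let $V$ be a finite-dimensional complex vector space with a norm. For a cusp $s\in\mathbb Q\cup\{\infty\}$ choose $g\in\mathrm{SL}(2,\mathbb Z)$ with $gs=\infty$ and put $\tau_s=g\tau$. A function $f:\mathbb H^2\to V$ has polynomial (resp. exponential) growth at $s$ if there are constants $C,N$ (resp. $C,M$) with $\|f(\tau)\|<C|\tau_s|^N$ (resp. $\|f(\tau)\|<Ce^{M|\tau_s|}$) whenever $\operatorname{Im}\tau_s$ is large enough. For a representation $\rho:\Gamma\to \mathrm{Aut}(\mathfrak g)$ and $k\in\mathbb Z$, $\mathfrak M_k(\mathfrak g,\Gamma,\rho)$ (resp. $\mathfrak M^!_k(\mathfrak g,\Gamma,\rho)$) is the space of holomorphic $f:\mathbb H^2\to\mathfrak g$ with $f(\gamma\tau)=(c\tau+d)^k\rho(\gamma)f(\tau)$ for all $\gamma\in\Gamma,\tau\in\mathbb H^2$, having polynomial (resp. exponential) growth at every cusp. $\mathfrak M_\ast=\bigoplus_{k\in\mathbb Z}\mathfrak M_k$ and $\mathfrak M^!_\ast=\bigoplus_{k\in\mathbb Z}\mathfrak M^!_k$ are $\mathbb Z$-graded Lie algebras under the pointwise bracket. $M_k(\Gamma)$ and $M^!_k(\Gamma)$ are the scalar analogues (functions $f:\mathbb H^2\to\mathbb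 C$ with $f(\gamma\tau)=(c\tau+d)^kf(\tau)$ and the same growth conditions), $M_\ast(\Gamma)=\bigoplus_k M_k(\Gamma)$, $M^!_\ast(\Gamma)=\bigoplus_k M^!_k(\Gamma)$. *)

theory Defs
  imports
    "HOL-Analysis.Analysis"
    "HOL-Library.Poly_Mapping"
    "HOL-Algebra.Coset"
    "HOL-Algebra.AbelCoset"
    "HOL-Algebra.Module"
    "HOL-Algebra.Algebraic_Closure_Type"
begin

section \<open>Complex normed spaces and holomorphic maps\<close>

locale complex_normed_space = vector_space scale
  for scale :: "complex \<Rightarrow> 'v::real_normed_vector \<Rightarrow> 'v" +
  assumes scale_of_real: "scale (complex_of_real r) x = r *\<^sub>R x"
    and norm_scale: "norm (scale c x) = cmod c * norm x"

text \<open>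
  The analogue of \<^const>\<open>holomorphic_on\<close> for maps between complex normed spaces with scalar
  multiplications s1 and s2: at each point of S there is a derivative within S that is
  complex linear. On an open set, or on a complex submanifold S of a finite-dimensional space,
  this is holomorphy in the usual sense.
\<close>

definition holomorphic_map ::
  "(complex \<Rightarrow> 'v \<Rightarrow> 'v) \<Rightarrow> (complex \<Rightarrow> 'w \<Rightarrow> 'w) \<Rightarrow>
   ('v::real_normed_vector \<Rightarrow> 'w::real_normed_vector) \<Rightarrow> 'v set \<Rightarrow> bool" where
  "holomorphic_map s1 s2 f S \<longleftrightarrow>
     (\<forall>x\<in>S. \<exists>D. Vector_Spaces.linear s1 s2 D \<and> (f has_derivative D) (at x within S))"

lemma holomorphic_map_complex_iff:
  fixes f :: "complex \<Rightarrow> complex"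
  shows "holomorphic_map (*) (*) f S \<longleftrightarrow> f holomorphic_on S"
proof -
  have vs: "vector_space ((*) :: complex \<Rightarrow> complex \<Rightarrow> complex)"
    by unfold_locales (auto simp: algebra_simps)
  have lin: "Vector_Spaces.linear (*) (*) D \<longleftrightarrow> (\<exists>c. D = (*) c)"
    for D :: "complex \<Rightarrow> complex"
  proof
    assume "Vector_Spaces.linear (*) (*) D"
    then interpret Vector_Spaces.linear "(*)" "(*)" D .
    have "D x = D 1 * x" for x
      using scale[of x 1] by (simp add: mult.commute)
    then show "\<exists>c. D = (*) c" by blast
  next
    assume "\<exists>c. D = (*) c"
    then show "Vector_Spaces.linear (*) (*) D"
      by (auto intro!: Vector_Spaces.linear_iff[THEN iffD2] simp: vs algebra_simps)
  qed
  show ?thesis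
    unfolding holomorphic_map_def holomorphic_on_def field_differentiable_def
      has_field_derivative_def lin by blast
qed


section \<open>The groups SL(2)\<close>

definition SL2 :: "('a::comm_ring_1^2^2) monoid" where
  "SL2 = \<lparr>carrier = {A. det A = 1}, monoid.mult = (**), one = mat 1\<rparr>"

abbreviation SL2_Z :: "(int^2^2) monoid" where "SL2_Z \<equiv> SL2"

abbreviation SL2_C :: "(complex^2^2) monoid" where "SL2_C \<equiv> SL2"

abbreviation matrix_scale :: "complex \<Rightarrow> complex^2^2 \<Rightarrow> complex^2^2" where
  "matrix_scale c \<equiv> map_matrix ((*) c)"

definition upper_half_plane :: "complex set" where
  "upper_half_plane = {\<tau>. Im \<tau> > 0}"

definition automorphy_factor :: "int^2^2 \<Rightarrow> complex \<Rightarrow> complex" where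
  "automorphy_factor \<gamma> \<tau> = of_int (\<gamma>$2$1) * \<tau> + of_int (\<gamma>$2$2)"

definition moebius :: "int^2^2 \<Rightarrow> complex \<Rightarrow> complex" where
  "moebius \<gamma> \<tau> = (of_int (\<gamma>$1$1) * \<tau> + of_int (\<gamma>$1$2)) / automorphy_factor \<gamma> \<tau>"

text \<open>Cusps are elements of \<^typ>\<open>rat option\<close>, with \<^term>\<open>None\<close> standing for the cusp at infinity.\<close>

fun cusp_action :: "int^2^2 \<Rightarrow> rat option \<Rightarrow> rat option" where
  "cusp_action g None =
     (if g$2$1 = 0 then None else Some (of_int (g$1$1) / of_int (g$2$1)))"
| "cusp_action g (Some x) =
     (if of_int (g$2$1) * x + of_int (g$2$2) = 0 then None
      else Some ((of_int (g$1$1) * x + of_int (g$1$2)) / (of_int (g$2$1) * x + of_int (g$2$2))))"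


section \<open>Vector-valued modular forms\<close>

datatype growth = Polynomial | Exponential

fun growth_bound :: "growth \<Rightarrow> real \<Rightarrow> real \<Rightarrow> real \<Rightarrow> real" where
  "growth_bound Polynomial C N r = C * r powr N"
| "growth_bound Exponential C M r = C * exp (M * r)"

definition has_growth_at :: "growth \<Rightarrow> (complex \<Rightarrow> 'v::real_normed_vector) \<Rightarrow> rat option \<Rightarrow> bool" where
  "has_growth_at gr f s \<longleftrightarrow>
     (\<exists>g\<in>carrier SL2_Z. cusp_action g s = None \<and>
        (\<exists>C N Y. \<forall>\<tau>\<in>upper_half_plane. Im (moebius g \<tau>) > Y \<longrightarrow>
           norm (f \<tau>) < growth_bound gr C N (cmod (moebius g \<tau>))))"

text \<open>
  A function on the upper half-plane is represented by a total function that vanishes elsewhere,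
  so that equality of functions is equality on the half-plane.
\<close>

definition modular_forms ::
  "growth \<Rightarrow> (complex \<Rightarrow> 'v::real_normed_vector \<Rightarrow> 'v) \<Rightarrow> (int^2^2) set \<Rightarrow> (int^2^2 \<Rightarrow> 'v \<Rightarrow> 'v) \<Rightarrow>
   int \<Rightarrow> (complex \<Rightarrow> 'v) set" where
  "modular_forms gr sc \<Gamma> \<rho> k =
     {f. holomorphic_map (*) sc f upper_half_plane
       \<and> (\<forall>\<tau>. \<tau> \<notin> upper_half_plane \<longrightarrow> f \<tau> = 0)
       \<and> (\<forall>\<gamma>\<in>\<Gamma>. \<forall>\<tau>\<in>upper_half_plane.
             f (moebius \<gamma> \<tau>) = sc (automorphy_factor \<gamma> \<tau> powi k) (\<rho> \<gamma> (f \<tau>)))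
       \<and> (\<forall>s. has_growth_at gr f s)}"


section \<open>Graded algebraic structures\<close>

text \<open>
  The product of the underlying module record is the Lie bracket in the case of
  a Lie algebra; the field one plays no role there.
\<close>

record ('s, 'a) graded_module = "('s, 'a) module" +
  graded_part :: "int \<Rightarrow> 'a set"

abbreviation complex_field :: "complex ring" where
  "complex_field \<equiv> ring_of_type_algebra"

definition grading :: "('s, 'a, 'm) graded_module_scheme \<Rightarrow> bool" where
  "grading M \<longleftrightarrow>
     (\<forall>k. additive_subgroup (graded_part M k) M) \<and>
     (\<forall>x\<in>carrier M. \<exists>!c. (\<forall>k. c k \<in> graded_part M k) \<and> finite {k. c k \<noteq> \<zero>\<^bsub>M\<^esub>} \<and>
        x = finsum M c {k. c k \<noteq> \<zero>\<^bsub>M\<^esub>})"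

definition lie_algebra :: "(complex, 'a, 'm) module_scheme \<Rightarrow> bool" where
  "lie_algebra L \<longleftrightarrow>
     Module.module complex_field L \<and>
     (\<forall>x\<in>carrier L. \<forall>y\<in>carrier L. x \<otimes>\<^bsub>L\<^esub> y \<in> carrier L) \<and>
     (\<forall>x\<in>carrier L. \<forall>y\<in>carrier L. \<forall>z\<in>carrier L.
        (x \<oplus>\<^bsub>L\<^esub> y) \<otimes>\<^bsub>L\<^esub> z = x \<otimes>\<^bsub>L\<^esub> z \<oplus>\<^bsub>L\<^esub> y \<otimes>\<^bsub>L\<^esub> z \<and>
        z \<otimes>\<^bsub>L\<^esub> (x \<oplus>\<^bsub>L\<^esub> y) = z \<otimes>\<^bsub>L\<^esub> x \<oplus>\<^bsub>L\<^esub> z \<otimes>\<^bsub>L\<^esub> y) \<and>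
     (\<forall>c. \<forall>x\<in>carrier L. \<forall>y\<in>carrier L.
        (c \<odot>\<^bsub>L\<^esub> x) \<otimes>\<^bsub>L\<^esub> y = c \<odot>\<^bsub>L\<^esub> (x \<otimes>\<^bsub>L\<^esub> y) \<and>
        x \<otimes>\<^bsub>L\<^esub> (c \<odot>\<^bsub>L\<^esub> y) = c \<odot>\<^bsub>L\<^esub> (x \<otimes>\<^bsub>L\<^esub> y)) \<and>
     (\<forall>x\<in>carrier L. x \<otimes>\<^bsub>L\<^esub> x = \<zero>\<^bsub>L\<^esub>) \<and>
     (\<forall>x\<in>carrier L. \<forall>y\<in>carrier L. \<forall>z\<in>carrier L.
        x \<otimes>\<^bsub>L\<^esub> (y \<otimes>\<^bsub>L\<^esub> z) \<oplus>\<^bsub>L\<^esub> y \<otimes>\<^bsub>L\<^esub> (z \<otimes>\<^bsub>L\<^esub> x) \<oplus>\<^bsub>L\<^esub> z \<otimes>\<^bsub>L\<^esub> (x \<otimes>\<^bsub>L\<^esub> y) = \<zero>\<^bsub>L\<^esub>)"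

definition lie_ideal :: "'a set \<Rightarrow> (complex, 'a, 'm) module_scheme \<Rightarrow> bool" where
  "lie_ideal I L \<longleftrightarrow>
     submodule I complex_field L \<and> (\<forall>x\<in>carrier L. \<forall>y\<in>I. x \<otimes>\<^bsub>L\<^esub> y \<in> I)"

definition simple_lie_algebra :: "(complex, 'a, 'm) module_scheme \<Rightarrow> bool" where
  "simple_lie_algebra L \<longleftrightarrow>
     lie_algebra L \<and>
     (\<exists>x\<in>carrier L. \<exists>y\<in>carrier L. x \<otimes>\<^bsub>L\<^esub> y \<noteq> \<zero>\<^bsub>L\<^esub>) \<and>
     (\<forall>I. lie_ideal I L \<longrightarrow> I = {\<zero>\<^bsub>L\<^esub>} \<or> I = carrier L)"

definition graded_lie_algebra :: "(complex, 'a, 'm) graded_module_scheme \<Rightarrow> bool" where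
  "graded_lie_algebra L \<longleftrightarrow>
     lie_algebra L \<and> grading L \<and>
     (\<forall>k. submodule (graded_part L k) complex_field L) \<and>
     (\<forall>k l. \<forall>x\<in>graded_part L k. \<forall>y\<in>graded_part L l. x \<otimes>\<^bsub>L\<^esub> y \<in> graded_part L (k + l))"

definition graded_lie_iso ::
  "(complex, 'a, 'm) graded_module_scheme \<Rightarrow> (complex, 'b, 'n) graded_module_scheme \<Rightarrow>
   ('a \<Rightarrow> 'b) \<Rightarrow> bool" where
  "graded_lie_iso L L' \<Phi> \<longleftrightarrow>
     graded_lie_algebra L \<and> graded_lie_algebra L' \<and>
     bij_betw \<Phi> (carrier L) (carrier L') \<and>
     (\<forall>x\<in>carrier L. \<forall>y\<in>carrier L. \<Phi> (x \<oplus>\<^bsub>L\<^esub> y) = \<Phi> x \<oplus>\<^bsub>L'\<^esub> \<Phi> y) \<and>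
     (\<forall>c. \<forall>x\<in>carrier L. \<Phi> (c \<odot>\<^bsub>L\<^esub> x) = c \<odot>\<^bsub>L'\<^esub> \<Phi> x) \<and>
     (\<forall>x\<in>carrier L. \<forall>y\<in>carrier L. \<Phi> (x \<otimes>\<^bsub>L\<^esub> y) = \<Phi> x \<otimes>\<^bsub>L'\<^esub> \<Phi> y) \<and>
     (\<forall>k. \<Phi> ` graded_part L k = graded_part L' k)"

definition graded_ring :: "('s, 'r, 'm) graded_module_scheme \<Rightarrow> bool" where
  "graded_ring R \<longleftrightarrow>
     cring R \<and> grading R \<and> \<one>\<^bsub>R\<^esub> \<in> graded_part R 0 \<and>
     (\<forall>k l. \<forall>r\<in>graded_part R k. \<forall>s\<in>graded_part R l. r \<otimes>\<^bsub>R\<^esub> s \<in> graded_part R (k + l))"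

definition graded_module_over ::
  "('s, 'r, 'm) graded_module_scheme \<Rightarrow> ('r, 'a, 'n) graded_module_scheme \<Rightarrow> bool" where
  "graded_module_over R M \<longleftrightarrow>
     graded_ring R \<and> Module.module R M \<and> grading M \<and>
     (\<forall>k l. \<forall>r\<in>graded_part R k. \<forall>x\<in>graded_part M l. r \<odot>\<^bsub>M\<^esub> x \<in> graded_part M (k + l))"

definition graded_module_iso ::
  "('s, 'r, 'm) graded_module_scheme \<Rightarrow> ('r, 'a, 'n) graded_module_scheme \<Rightarrow>
   ('r, 'b, 'p) graded_module_scheme \<Rightarrow> ('a \<Rightarrow> 'b) \<Rightarrow> bool" where
  "graded_module_iso R M M' \<Phi> \<longleftrightarrow>
     graded_module_over R M \<and> graded_module_over R M' \<and>
     bij_betw \<Phi> (carrier M) (carrier M') \<and>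
     (\<forall>x\<in>carrier M. \<forall>y\<in>carrier M. \<Phi> (x \<oplus>\<^bsub>M\<^esub> y) = \<Phi> x \<oplus>\<^bsub>M'\<^esub> \<Phi> y) \<and>
     (\<forall>r\<in>carrier R. \<forall>x\<in>carrier M. \<Phi> (r \<odot>\<^bsub>M\<^esub> x) = r \<odot>\<^bsub>M'\<^esub> \<Phi> x) \<and>
     (\<forall>k. \<Phi> ` graded_part M k = graded_part M' k)"

definition with_scalars ::
  "('r \<Rightarrow> 'a \<Rightarrow> 'a) \<Rightarrow> ('s, 'a) graded_module \<Rightarrow> ('r, 'a) graded_module" where
  "with_scalars act M =
     \<lparr>carrier = carrier M, monoid.mult = monoid.mult M, one = one M, zero = zero M, add = add M,
      smult = act, graded_part = graded_part M\<rparr>"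


section \<open>The graded algebras of modular forms\<close>

text \<open>
  Elements of the (external) direct sum over all weights are families of forms indexed by the
  weight, almost all of which are zero. Pointwise products of forms extend to such families by
  convolution in the weight.
\<close>

definition weight_convolution ::
  "('u \<Rightarrow> 'v \<Rightarrow> 'w) \<Rightarrow> (int \<Rightarrow> complex \<Rightarrow> 'u::zero) \<Rightarrow> (int \<Rightarrow> complex \<Rightarrow> 'v) \<Rightarrow>
   (int \<Rightarrow> complex \<Rightarrow> 'w::comm_monoid_add)" where
  "weight_convolution prd F G =
     (\<lambda>n \<tau>. \<Sum>k\<in>{k. F k \<noteq> (\<lambda>_. 0)}. prd (F k \<tau>) (G (n - k) \<tau>))"

definition modular_forms_sum ::
  "growth \<Rightarrow> (complex \<Rightarrow> 'v::real_normed_vector \<Rightarrow> 'v) \<Rightarrow> (int^2^2) set \<Rightarrow> (int^2^2 \<Rightarrow> 'v \<Rightarrow> 'v) \<Rightarrow>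
   (int \<Rightarrow> complex \<Rightarrow> 'v) set" where
  "modular_forms_sum gr sc \<Gamma> \<rho> =
     {F. (\<forall>k. F k \<in> modular_forms gr sc \<Gamma> \<rho> k) \<and> finite {k. F k \<noteq> (\<lambda>_. 0)}}"

definition modular_algebra ::
  "growth \<Rightarrow> (complex \<Rightarrow> 'v::real_normed_vector \<Rightarrow> 'v) \<Rightarrow> ('v \<Rightarrow> 'v \<Rightarrow> 'v) \<Rightarrow> 'v \<Rightarrow>
   (int^2^2) set \<Rightarrow> (int^2^2 \<Rightarrow> 'v \<Rightarrow> 'v) \<Rightarrow> (complex, int \<Rightarrow> complex \<Rightarrow> 'v) graded_module" where
  "modular_algebra gr sc prd u \<Gamma> \<rho> =
     \<lparr>carrier = modular_forms_sum gr sc \<Gamma> \<rho>,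
      monoid.mult = weight_convolution prd,
      one = (\<lambda>k \<tau>. if k = 0 \<and> \<tau> \<in> upper_half_plane then u else 0),
      zero = (\<lambda>k \<tau>. 0),
      add = (\<lambda>F G k \<tau>. F k \<tau> + G k \<tau>),
      smult = (\<lambda>c F k \<tau>. sc c (F k \<tau>)),
      graded_part = (\<lambda>k. {F \<in> modular_forms_sum gr sc \<Gamma> \<rho>. \<forall>l. l \<noteq> k \<longrightarrow> F l = (\<lambda>_. 0)})\<rparr>"

definition scalar_modular_forms ::
  "growth \<Rightarrow> (int^2^2) set \<Rightarrow> (complex, int \<Rightarrow> complex \<Rightarrow> complex) graded_module" where
  "scalar_modular_forms gr \<Gamma> = modular_algebra gr (*) (*) 1 \<Gamma> (\<lambda>_ z. z)"

definition lie_modular_forms ::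
  "growth \<Rightarrow> (complex \<Rightarrow> 'g::real_normed_vector \<Rightarrow> 'g) \<Rightarrow> ('g \<Rightarrow> 'g \<Rightarrow> 'g) \<Rightarrow>
   (int^2^2) set \<Rightarrow> (int^2^2 \<Rightarrow> 'g \<Rightarrow> 'g) \<Rightarrow> (complex, int \<Rightarrow> complex \<Rightarrow> 'g) graded_module" where
  "lie_modular_forms gr sc br \<Gamma> \<rho> = modular_algebra gr sc br 0 \<Gamma> \<rho>"

definition lie_modular_forms_module ::
  "growth \<Rightarrow> (complex \<Rightarrow> 'g::real_normed_vector \<Rightarrow> 'g) \<Rightarrow> ('g \<Rightarrow> 'g \<Rightarrow> 'g) \<Rightarrow>
   (int^2^2) set \<Rightarrow> (int^2^2 \<Rightarrow> 'g \<Rightarrow> 'g) \<Rightarrow>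
   (int \<Rightarrow> complex \<Rightarrow> complex, int \<Rightarrow> complex \<Rightarrow> 'g) graded_module" where
  "lie_modular_forms_module gr sc br \<Gamma> \<rho> =
     with_scalars (weight_convolution sc) (lie_modular_forms gr sc br \<Gamma> \<rho>)"


section \<open>Tensor products of graded complex algebras\<close>

text \<open>
  The tensor product of A and B over the complex numbers is the free complex vector space on
  pairs of elements modulo the bilinearity relations. Operations on classes are
  defined on representatives, in the style of \<^theory>\<open>HOL.Equiv_Relations\<close>.
\<close>

type_synonym ('a, 'b) formal_sum = "('a \<times> 'b) \<Rightarrow>\<^sub>0 complex"

abbreviation formal_scale :: "complex \<Rightarrow> ('a, 'b) formal_sum \<Rightarrow> ('a, 'b) formal_sum" where
  "formal_scale c \<equiv> Poly_Mapping.map ((*) c)"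

abbreviation formal_tensor :: "'a \<Rightarrow> 'b \<Rightarrow> ('a, 'b) formal_sum" where
  "formal_tensor a b \<equiv> Poly_Mapping.single (a, b) 1"

definition tensor_relators ::
  "(complex, 'a, 'm) module_scheme \<Rightarrow> (complex, 'b, 'n) module_scheme \<Rightarrow> ('a, 'b) formal_sum set" where
  "tensor_relators A B =
     {formal_tensor (a \<oplus>\<^bsub>A\<^esub> a') b - formal_tensor a b - formal_tensor a' b | a a' b.
        a \<in> carrier A \<and> a' \<in> carrier A \<and> b \<in> carrier B} \<union>
     {formal_tensor a (b \<oplus>\<^bsub>B\<^esub> b') - formal_tensor a b - formal_tensor a b' | a b b'.
        a \<in> carrier A \<and> b \<in> carrier B \<and> b' \<in> carrier B} \<union>
     {formal_tensor (c \<odot>\<^bsub>A\<^esub> a) b - formal_scale c (formal_tensor a b) | c a b.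
        a \<in> carrier A \<and> b \<in> carrier B} \<union>
     {formal_tensor a (c \<odot>\<^bsub>B\<^esub> b) - formal_scale c (formal_tensor a b) | c a b.
        a \<in> carrier A \<and> b \<in> carrier B}"

definition formal_sums ::
  "(complex, 'a, 'm) module_scheme \<Rightarrow> (complex, 'b, 'n) module_scheme \<Rightarrow> ('a, 'b) formal_sum set" where
  "formal_sums A B = {x. Poly_Mapping.keys x \<subseteq> carrier A \<times> carrier B}"

definition tensor_rel ::
  "(complex, 'a, 'm) module_scheme \<Rightarrow> (complex, 'b, 'n) module_scheme \<Rightarrow> ('a, 'b) formal_sum rel" where
  "tensor_rel A B =
     {(x, y). x \<in> formal_sums A B \<and> y \<in> formal_sums A B \<and>
        x - y \<in> Modules.module.span formal_scale (tensor_relators A B)}"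

definition formal_mult ::
  "(complex, 'a, 'm) module_scheme \<Rightarrow> (complex, 'b, 'n) module_scheme \<Rightarrow>
   ('a, 'b) formal_sum \<Rightarrow> ('a, 'b) formal_sum \<Rightarrow> ('a, 'b) formal_sum" where
  "formal_mult A B x y =
     (\<Sum>(a, b)\<in>Poly_Mapping.keys x. \<Sum>(a', b')\<in>Poly_Mapping.keys y.
        formal_scale (Poly_Mapping.lookup x (a, b) * Poly_Mapping.lookup y (a', b'))
          (formal_tensor (a \<otimes>\<^bsub>A\<^esub> a') (b \<otimes>\<^bsub>B\<^esub> b')))"

definition formal_action ::
  "(complex, 'b, 'n) module_scheme \<Rightarrow> 'b \<Rightarrow> ('a, 'b) formal_sum \<Rightarrow> ('a, 'b) formal_sum" where
  "formal_action B r x =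
     (\<Sum>(a, b)\<in>Poly_Mapping.keys x.
        formal_scale (Poly_Mapping.lookup x (a, b)) (formal_tensor a (r \<otimes>\<^bsub>B\<^esub> b)))"

definition tensor_algebra ::
  "(complex, 'a, 'm) graded_module_scheme \<Rightarrow> (complex, 'b, 'n) graded_module_scheme \<Rightarrow>
   (complex, ('a, 'b) formal_sum set) graded_module" where
  "tensor_algebra A B =
     \<lparr>carrier = formal_sums A B // tensor_rel A B,
      monoid.mult = (\<lambda>P Q. \<Union>x\<in>P. \<Union>y\<in>Q. tensor_rel A B `` {formal_mult A B x y}),
      one = tensor_rel A B `` {formal_tensor (\<one>\<^bsub>A\<^esub>) (\<one>\<^bsub>B\<^esub>)},
      zero = tensor_rel A B `` {0},
      add = (\<lambda>P Q. \<Union>x\<in>P. \<Union>y\<in>Q. tensor_rel A B `` {x + y}),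
      smult = (\<lambda>c P. \<Union>x\<in>P. tensor_rel A B `` {formal_scale c x}),
      graded_part = (\<lambda>n. (\<lambda>x. tensor_rel A B `` {x}) `
        Modules.module.span formal_scale
          {formal_tensor a b | a b k l.
             a \<in> graded_part A k \<and> b \<in> graded_part B l \<and> k + l = n})\<rparr>"

definition tensor_module ::
  "(complex, 'a, 'm) graded_module_scheme \<Rightarrow> (complex, 'b, 'n) graded_module_scheme \<Rightarrow>
   ('b, ('a, 'b) formal_sum set) graded_module" where
  "tensor_module A B =
     with_scalars (\<lambda>r P. \<Union>x\<in>P. tensor_rel A B `` {formal_action B r x}) (tensor_algebra A B)"


section \<open>Representations by Lie algebra automorphisms\<close>

definition lie_algebra_of ::
  "(complex \<Rightarrow> 'g::ab_group_add \<Rightarrow> 'g) \<Rightarrow> ('g \<Rightarrow> 'g \<Rightarrow> 'g) \<Rightarrow> (complex, 'g) module" where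
  "lie_algebra_of sc br =
     \<lparr>carrier = UNIV, monoid.mult = br, one = 0, zero = 0, add = (+), smult = sc\<rparr>"

definition lie_automorphisms ::
  "(complex \<Rightarrow> 'g::ab_group_add \<Rightarrow> 'g) \<Rightarrow> ('g \<Rightarrow> 'g \<Rightarrow> 'g) \<Rightarrow> ('g \<Rightarrow> 'g) set" where
  "lie_automorphisms sc br =
     {\<phi>. bij \<phi> \<and> Vector_Spaces.linear sc sc \<phi> \<and> (\<forall>x y. \<phi> (br x y) = br (\<phi> x) (\<phi> y))}"

text \<open>
  The topology on \<^typ>\<open>'g \<Rightarrow> 'g\<close> is that of pointwise convergence; for finite-dimensional \<^typ>\<open>'g\<close>
  it induces the usual topology on the linear endomorphisms.
\<close>

definition lie_automorphisms_0 ::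
  "(complex \<Rightarrow> 'g::real_normed_vector \<Rightarrow> 'g) \<Rightarrow> ('g \<Rightarrow> 'g \<Rightarrow> 'g) \<Rightarrow> ('g \<Rightarrow> 'g) monoid" where
  "lie_automorphisms_0 sc br =
     \<lparr>carrier = connected_component_set (lie_automorphisms sc br) id,
      monoid.mult = (\<circ>), one = id\<rparr>"

text \<open>
  The complex structure on the automorphism group is inherited from the linear endomorphisms,
  so a map into it is holomorphic iff its evaluation at each vector is.
\<close>

definition complex_lie_group_hom ::
  "(complex \<Rightarrow> 'g::real_normed_vector \<Rightarrow> 'g) \<Rightarrow> ('g \<Rightarrow> 'g \<Rightarrow> 'g) \<Rightarrow> (complex^2^2 \<Rightarrow> 'g \<Rightarrow> 'g) \<Rightarrow> bool" where
  "complex_lie_group_hom sc br \<rho> \<longleftrightarrow>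
     \<rho> \<in> hom SL2_C (lie_automorphisms_0 sc br) \<and>
     (\<forall>v. holomorphic_map matrix_scale sc (\<lambda>A. \<rho> A v) (carrier SL2_C))"

text \<open>
  The derivative within SL(2) is determined only on tangent vectors, i.e. Z should be
  a traceless matrix.
\<close>

definition lie_differential ::
  "(complex^2^2 \<Rightarrow> 'g::real_normed_vector \<Rightarrow> 'g) \<Rightarrow> complex^2^2 \<Rightarrow> 'g \<Rightarrow> 'g" where
  "lie_differential \<rho> Z v = frechet_derivative (\<lambda>A. \<rho> A v) (at (mat 1) within carrier SL2_C) Z"

definition weight_graded_lie_algebra ::
  "(complex \<Rightarrow> 'g::real_normed_vector \<Rightarrow> 'g) \<Rightarrow> ('g \<Rightarrow> 'g \<Rightarrow> 'g) \<Rightarrow> (complex^2^2 \<Rightarrow> 'g \<Rightarrow> 'g) \<Rightarrow>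
   (complex, 'g) graded_module" where
  "weight_graded_lie_algebra sc br \<rho> =
     \<lparr>carrier = UNIV, monoid.mult = br, one = 0, zero = 0, add = (+), smult = sc,
      graded_part = (\<lambda>k. {v. lie_differential \<rho> (vector [vector [1, 0], vector [0, -1]]) v
                             = sc (of_int k) v})\<rparr>"

definition restrict_to_SL2_Z :: "(complex^2^2 \<Rightarrow> 'g \<Rightarrow> 'g) \<Rightarrow> int^2^2 \<Rightarrow> 'g \<Rightarrow> 'g" where
  "restrict_to_SL2_Z \<rho> \<gamma> = \<rho> (map_matrix of_int \<gamma>)"

end

theory Submission
  imports Defs "HOL-Complex_Analysis.Complex_Analysis"
begin

text \<open>
  The normalised Eisenstein series \<open>\<phi> = (\<pi> i / 6) E\<^sub>2\<close> satisfies
  \<open>\<phi>(\<gamma>\<tau>) = j\<^sup>2 \<phi>(\<tau>) + c j\<close> with \<open>j = c \<tau> + d\<close>. Let \<open>P(\<tau>)\<close> be the product of the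
  upper unipotent matrix with entry \<open>\<tau>\<close> and the lower unipotent matrix with entry \<open>\<phi>(\<tau>)\<close>. Then
  \<open>\<gamma> P(\<tau>) = P(\<gamma>\<tau>) diag(1/j, j)\<close> for every \<open>\<gamma>\<close> in SL(2, Z). Since the torus acts on the
  \<open>k\<close>-th eigenspace of \<open>H\<close> by \<open>a \<mapsto> a\<^sup>k\<close>, the function \<open>f\<close> is a form of weight \<open>n\<close> and type
  \<open>\<rho>\<close> iff the components of \<open>\<rho>(P)\<^sup>-\<^sup>1 f\<close> in the \<open>k\<close>-th eigenspace are scalar forms of weight
  \<open>n - k\<close>; the polynomial growth of \<open>\<phi>\<close> makes this compatible with both growth conditions.
  As \<open>\<rho>(P(\<tau>))\<close> is a Lie algebra automorphism, the resulting bijection respects brackets.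
\<close>

text \<open>The obstacle is that the series of \<open>1 / (m * \<tau> + n)\<^sup>2\<close> converges
  only conditionally. The two orders of summation differ, and this difference is the anomaly
  \<open>c j\<close>, which makes the lower left entries of \<open>\<gamma> P(\<tau>)\<close> and
  \<open>P(\<gamma>\<tau>) diag(1/j, j)\<close> agree. Since P is equivariant under all of SL(2, Z),
  one P serves every subgroup, and its growth at each cusp follows from its growth at infinity.
  Growth survives \<rho> because the torus acts by monomials and the unipotent matrix with entry
  \<open>c\<^sup>2\<close> is a torus conjugate of the one with entry 1. A family of forms over all
  weights is encoded by a Laurent polynomial in z; there a tensor of v and F becomes F(z) times
  \<rho>(P) \<rho>(diag(z, 1/z)) v, so brackets can be compared pointwise. The tensor product is a
  quotient of formal sums: once the kernel of the map to forms is identified with the span of the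
  bilinearity relations, all its axioms are inherited along that map.\<close>

unbundle no Formal_Power_Series.fps_syntax

section \<open>The Eisenstein series of weight 2\<close>

text \<open>Logarithmic differentiation of the reflection formula for Gamma gives the cotangent as a
  difference of Digamma values. Passing to \<open>Digamma (1 + w) - Digamma (1 - w)\<close> splits
  off \<open>1 / w\<close>, and the limit formula for Digamma turns this difference into the
  series.\<close>

lemma pi_cot_expansion:
  fixes w :: complex
  assumes w: "w \<notin> \<int>"
  shows "(\<lambda>n. 1 / (of_nat (Suc n) - w) - 1 / (of_nat (Suc n) + w)) sums (1 / w - of_real pi * cot (of_real pi * w))"
proof -
  have nz: "w \<noteq> 0" using w by auto
  have nw: "w \<notin> \<int>\<^sub>\<le>\<^sub>0" "1 - w \<notin> \<int>\<^sub>\<le>\<^sub>0" "1 + w \<notin> \<int>\<^sub>\<le>\<^sub>0"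
    using w nonpos_Ints_subset_Ints Ints_diff[of 1 "1-w"] Ints_diff[of "1+w" 1] by auto
  have s0: "sin (of_real pi * w) \<noteq> 0"
    using w by (auto simp: sin_eq_0)
  have "((\<lambda>z. Gamma z * Gamma (1 - z) * sin (of_real pi * z)) has_field_derivative
      (Gamma w * Digamma w * Gamma (1 - w) + Gamma w * (Gamma (1 - w) * Digamma (1 - w) * (-1))) * sin (of_real pi * w)
      + Gamma w * Gamma (1 - w) * (cos (of_real pi * w) * of_real pi)) (at w)"
    using nw by (auto intro!: derivative_eq_intros simp: algebra_simps)
  moreover have "((\<lambda>z. Gamma z * Gamma (1 - z) * sin (of_real pi * z)) has_field_derivative 0) (at w)"
  proof (rule has_field_derivative_transform_within_open[where S="- \<int>"])
    show "((\<lambda>z. of_real pi) has_field_derivative 0) (at w)" by simp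
    show "open (- \<int> :: complex set)" using closed_Ints by blast
    show "w \<in> - \<int>" using w by simp
  next
    fix z :: complex assume "z \<in> - \<int>"
    then have "sin (of_real pi * z) \<noteq> 0" by (auto simp: sin_eq_0)
    then show "of_real pi = Gamma z * Gamma (1 - z) * sin (of_real pi * z)"
      using Gamma_reflection_complex[of z] by (simp add: field_simps)
  qed
  ultimately have "(Gamma w * Digamma w * Gamma (1 - w) + Gamma w * (Gamma (1 - w) * Digamma (1 - w) * (-1))) * sin (of_real pi * w)
      + Gamma w * Gamma (1 - w) * (cos (of_real pi * w) * of_real pi) = 0"
    by (rule DERIV_unique)
  then have "Gamma w * Gamma (1 - w) * ((Digamma w - Digamma (1 - w)) * sin (of_real pi * w) + cos (of_real pi * w) * of_real pi) = 0"
    by (simp add: algebra_simps)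
  moreover have "Gamma w \<noteq> 0" "Gamma (1 - w) \<noteq> 0" using nw by (auto simp: Gamma_eq_zero_iff)
  ultimately have "(Digamma w - Digamma (1 - w)) * sin (of_real pi * w) = - (cos (of_real pi * w) * of_real pi)"
    by (simp add: eq_neg_iff_add_eq_0)
  then have D: "Digamma w - Digamma (1 - w) = - (of_real pi * cot (of_real pi * w))"
    using s0 by (simp add: cot_def field_simps)
  have D2: "Digamma (1 + w) - Digamma (1 - w) = 1 / w - of_real pi * cot (of_real pi * w)"
    using D Digamma_plus1[OF nz] by (simp add: add.commute)
  have "(\<lambda>m. (of_real (ln (real m)) - (\<Sum>n<m. inverse ((1 + w) + of_nat n)))
            - (of_real (ln (real m)) - (\<Sum>n<m. inverse ((1 - w) + of_nat n)))) \<longlonglongrightarrow> Digamma (1 + w) - Digamma (1 - w)"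
    using Digamma_LIMSEQ[of "1+w"] Digamma_LIMSEQ[of "1-w"] nw
    by (intro tendsto_diff) (metis zero_in_nonpos_Ints)+
  then show ?thesis unfolding sums_def D2
    by (rule filterlim_cong[THEN iffD1, rotated -1])
       (auto simp: sum_subtractf field_simps intro!: always_eventually)
qed

text \<open>Isolates the part of cot that vanishes as Im x tends to minus infinity, where
  \<open>exp (2 * \<i> * x)\<close> is unbounded.\<close>

lemma cot_minus_ii:
  assumes "Im x \<noteq> 0" shows "cot x = \<i> + 2 * \<i> / (exp (2 * \<i> * x) - 1)"
proof -
  have e: "exp (2 * \<i> * x) = exp (\<i> * x) * exp (\<i> * x)" by (simp flip: exp_add add: algebra_simps)
  have n: "norm (exp (2*\<i>*x)) \<noteq> 1" using assms by simp
  then have n1: "exp (\<i> * x) * exp (\<i> * x) \<noteq> 1" unfolding e by auto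
  define E where "E = exp (\<i> * x)"
  have E: "E \<noteq> 0" "E * E \<noteq> 1" "exp (- (\<i> * x)) = 1 / E" using n1 by (auto simp: E_def exp_minus field_simps)
  have "E + 1 / E = (E * E + 1) / E" "E - 1 / E = (E * E - 1) / E"
    using E(1) by (simp_all add: add_divide_distrib diff_divide_distrib)
  moreover have "\<i> + 2 * \<i> / (E * E - 1) = \<i> * (E * E + 1) / (E * E - 1)"
    using E(2) by (simp add: add_divide_eq_iff algebra_simps)
  moreover have "S / E / 2 / (D / E / (2 * \<i>)) = \<i> * S / D" for S D
  proof -
    have "S / E / 2 / (D / E / (2 * \<i>)) = - (S / (\<i> * D))" using E(1) by simp
    then show ?thesis by (metis divide_divide_eq_left divide_i minus_divide_left minus_mult_left minus_minus)
  qed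
  ultimately show ?thesis
    unfolding cot_def sin_exp_eq cos_exp_eq e E(3) E_def[symmetric] by (simp only:)
qed

lemma cot_tendsto_ii:
  assumes "filterlim (\<lambda>n. Im (f n)) at_bot F"
  shows "((\<lambda>n. cot (f n)) \<longlongrightarrow> \<i>) F"
proof -
  have ev: "\<forall>\<^sub>F n in F. Im (f n) < 0" using assms by (simp add: filterlim_at_bot_dense)
  have "filterlim (\<lambda>n. - (2 * Im (f n))) at_top F"
    using filterlim_tendsto_pos_mult_at_bot[OF tendsto_const _ assms, of 2]
    by (simp add: filterlim_uminus_at_top)
  then have "filterlim (\<lambda>n. exp (- (2 * Im (f n)))) at_top F"
    by (rule filterlim_compose[OF exp_at_top])
  then have "filterlim (\<lambda>n. exp (2 * \<i> * f n)) at_infinity F"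
    by (simp add: filterlim_at_infinity_conv_norm_at_top)
  then have "filterlim (\<lambda>n. exp (2 * \<i> * f n) + (-1)) at_infinity F"
    using tendsto_add_filterlim_at_infinity'[of "\<lambda>n. exp (2 * \<i> * f n)" F "\<lambda>_. -1"] by auto
  then have "((\<lambda>n. 2 * \<i> / (exp (2 * \<i> * f n) - 1)) \<longlongrightarrow> 0) F"
    by (intro tendsto_divide_0[OF tendsto_const]) simp
  then have "((\<lambda>n. \<i> + 2 * \<i> / (exp (2 * \<i> * f n) - 1)) \<longlongrightarrow> \<i> + 0) F"
    by (intro tendsto_add tendsto_const)
  moreover have "\<forall>\<^sub>F n in F. \<i> + 2 * \<i> / (exp (2 * \<i> * f n) - 1) = cot (f n)"
    using ev by (auto simp: cot_minus_ii elim!: eventually_mono)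
  ultimately show ?thesis by (simp add: Lim_transform_eventually)
qed

text \<open>The window from -N + 1 to N is chosen so that sums of \<open>f (n - 1) - f n\<close>
  over it telescope to the two end points -N and N.\<close>

lemma has_sum_int_symmetric_limit:
  fixes f :: "int \<Rightarrow> 'a::{topological_comm_monoid_add}"
  assumes "(f has_sum s) UNIV"
  shows "(\<lambda>N. \<Sum>n\<in>{- int N + 1..int N}. f n) \<longlonglongrightarrow> s"
proof -
  have "filterlim (\<lambda>N. {- int N + 1..int N}) (finite_subsets_at_top UNIV) sequentially"
    unfolding filterlim_finite_subsets_at_top
  proof (intro allI impI)
    fix P :: "int set" assume "finite P \<and> P \<subseteq> UNIV"
    then obtain K where K: "\<forall>x\<in>P. \<bar>x\<bar> \<le> K"
      using bdd_above_finite[of "abs ` P"] by (auto simp: bdd_above_def)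
    have "P \<subseteq> {- int N + 1..int N}" if "nat K + 1 \<le> N" for N
      using K that by (smt (verit) atLeastAtMost_iff int_ops(1) nat_less_iff of_nat_1 of_nat_add of_nat_mono subsetI zero_le_imp_eq_int int_nat_eq)
    then show "\<forall>\<^sub>F y in sequentially. finite {- int y + 1..int y} \<and> P \<subseteq> {- int y + 1..int y} \<and> {- int y + 1..int y} \<subseteq> UNIV"
      by (auto simp: eventually_sequentially)
  qed
  with assms show ?thesis unfolding has_sum_def by (rule filterlim_compose)
qed

text \<open>As \<open>max a b ^ 3 \<ge> (a * b) powr (3/2)\<close>, products of these weights are a summable majorant of
  \<open>max \<bar>m\<bar> \<bar>n\<bar> powr (-3)\<close>.\<close>

definition lattice_weight :: "int \<Rightarrow> real" where
  "lattice_weight n = max 1 \<bar>real_of_int n\<bar> powr (-3/2)"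

lemma lattice_weight_pos: "lattice_weight n > 0" by (simp add: lattice_weight_def)

lemma summable_on_even_int:
  fixes f :: "int \<Rightarrow> real"
  assumes "\<And>n. f n \<ge> 0" "summable (\<lambda>n. f (int n))" "\<And>n. f (- n) = f n"
  shows "f summable_on UNIV"
proof -
  have "(\<lambda>n. f (int n)) summable_on UNIV"
    using assms by (subst summable_on_UNIV_nonneg_real_iff) auto
  then have 1: "f summable_on range int"
    by (subst summable_on_reindex) (auto simp: o_def)
  have "(\<lambda>n. f n) summable_on uminus ` (range int)"
    by (subst summable_on_reindex) (auto simp: o_def assms 1)
  with 1 have "f summable_on (range int \<union> uminus ` range int)"
    by (intro summable_on_union) auto
  moreover have "range int \<union> uminus ` range int = (UNIV :: int set)"
  proof -
    have "x \<in> range int \<union> uminus ` range int" for x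
      by (cases x rule: int_cases2) auto
    then show ?thesis by blast
  qed
  ultimately show ?thesis by simp
qed

lemma lattice_weight_summable: "lattice_weight summable_on UNIV"
proof (rule summable_on_even_int)
  have "summable (\<lambda>n. real (Suc n) powr (-3/2))"
    using summable_Suc_iff[of "\<lambda>n. real n powr (-3/2)"] by (subst summable_Suc_iff) (simp add: summable_real_powr_iff)
  then have "summable (\<lambda>n. lattice_weight (int (Suc n)))"
    by (simp add: lattice_weight_def max_def)
  then show "summable (\<lambda>n. lattice_weight (int n))" by (subst (asm) summable_Suc_iff)
qed (auto simp: lattice_weight_def)

lemma lattice_weight_summable2: "(\<lambda>(m,n). lattice_weight m * lattice_weight n) summable_on UNIV"
proof -
  have "(\<lambda>(m,n). lattice_weight m * lattice_weight n) summable_on (SIGMA m:UNIV. UNIV)"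
    by (rule summable_on_SigmaI[where g="\<lambda>m. lattice_weight m * infsum lattice_weight UNIV"])
      (auto intro!: has_sum_cmult_right summable_on_cmult_left lattice_weight_summable has_sum_infsum
        simp: lattice_weight_pos less_imp_le)
  then show ?thesis by simp
qed

text \<open>A factor by which |m \<tau> + x| dominates max(|m|, |x|) for nonzero m. The first entry
  comes from the imaginary part; the second from |x| \<le> |z| + |m| |\<tau>| with z = m \<tau> + x,
  after bounding |m| by |z| / Im \<tau>.\<close>

definition lattice_gap :: "complex \<Rightarrow> real" where
  "lattice_gap \<tau> = min (Im \<tau>) (Im \<tau> / (Im \<tau> + cmod \<tau>))"

lemma lattice_gap_pos: "Im \<tau> > 0 \<Longrightarrow> lattice_gap \<tau> > 0"
  by (auto simp: lattice_gap_def intro!: divide_pos_pos add_pos_nonneg)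

lemma lattice_gap_bound:
  assumes y: "Im \<tau> > 0" and m: "m \<noteq> 0"
  shows "lattice_gap \<tau> * max \<bar>of_int m\<bar> \<bar>x\<bar> \<le> cmod (of_int m * \<tau> + of_real x)"
proof -
  let ?z = "of_int m * \<tau> + of_real x"
  have 1: "\<bar>of_int m\<bar> * Im \<tau> \<le> cmod ?z"
    using abs_Im_le_cmod[of ?z] y by (simp add: abs_mult)
  have "\<bar>x\<bar> = cmod (?z - of_int m * \<tau>)" by simp
  also have "\<dots> \<le> cmod ?z + \<bar>of_int m\<bar> * cmod \<tau>"
    using norm_triangle_ineq4[of ?z "of_int m * \<tau>"] by (simp add: norm_mult)
  also have "\<dots> \<le> cmod ?z + (cmod ?z / Im \<tau>) * cmod \<tau>"
    using 1 y by (intro add_left_mono mult_right_mono) (auto simp: field_simps)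
  finally have "\<bar>x\<bar> * Im \<tau> \<le> (cmod ?z + cmod ?z / Im \<tau> * cmod \<tau>) * Im \<tau>"
    using y by (intro mult_right_mono) auto
  also have "\<dots> = cmod ?z * (Im \<tau> + cmod \<tau>)"
    using y by (simp add: distrib_left distrib_right)
  finally have "\<bar>x\<bar> * Im \<tau> \<le> cmod ?z * (Im \<tau> + cmod \<tau>)" .
  then have 2: "(Im \<tau> / (Im \<tau> + cmod \<tau>)) * \<bar>x\<bar> \<le> cmod ?z"
    using add_pos_nonneg[OF y norm_ge_zero[of \<tau>]]
    by (simp only: pos_divide_le_eq times_divide_eq_left mult.commute[of "Im \<tau>"])
  have "lattice_gap \<tau> * \<bar>of_int m\<bar> \<le> Im \<tau> * \<bar>of_int m\<bar>"
       "lattice_gap \<tau> * \<bar>x\<bar> \<le> (Im \<tau> / (Im \<tau> + cmod \<tau>)) * \<bar>x\<bar>"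
    unfolding lattice_gap_def by (intro mult_right_mono; simp)+
  with 1 2 show ?thesis by (auto simp: max_def mult.commute)
qed

lemma lattice_point_nonzero:
  assumes y: "Im \<tau> > 0" and m: "m \<noteq> 0"
  shows "of_int m * \<tau> + of_real x \<noteq> 0"
proof -
  have "0 < lattice_gap \<tau> * max \<bar>of_int m\<bar> \<bar>x\<bar>"
    using lattice_gap_pos[OF y] m by (auto simp: max_def)
  with lattice_gap_bound[OF assms, of x] show ?thesis by force
qed

lemma lattice_weight_bound:
  assumes m: "m \<noteq> 0" and M: "M = max \<bar>of_int m\<bar> \<bar>real_of_int n\<bar>"
  shows "1 / M ^ 3 \<le> lattice_weight m * lattice_weight n"
proof -
  have M1: "1 \<le> M" using m M by linarith
  have "1 / M ^ 3 = M powr (-3/2) * M powr (-3/2)"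
    using M1 by (simp flip: powr_add add: powr_minus_divide)
  also have "\<dots> \<le> lattice_weight m * lattice_weight n"
    unfolding lattice_weight_def using M M1 by (intro mult_mono powr_mono2') auto
  finally show ?thesis .
qed

text \<open>The subtracted term telescopes to 0 in the sum over n and makes the double series of
  \<open>1 / (m * \<tau> + n)\<^sup>2\<close> absolutely convergent.\<close>

definition eisenstein_term :: "complex \<Rightarrow> int \<times> int \<Rightarrow> complex" where
  "eisenstein_term \<tau> = (\<lambda>(m, n). 1 / (of_int m * \<tau> + of_int n)\<^sup>2
     - (1 / (of_int m * \<tau> + of_int (n - 1)) - 1 / (of_int m * \<tau> + of_int n)))"

text \<open>With z = m \<tau> + n the term equals -1 / (z^2 (z - 1)), so it decays cubically. The
  bound is stated for any d below the gap, so that a single d can serve a whole disc of values of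
  \<tau>.\<close>

lemma eisenstein_term_bound:
  assumes y: "Im \<tau> > 0" and m: "m \<noteq> 0" and d: "0 < d" "d \<le> lattice_gap \<tau>"
  shows "cmod (eisenstein_term \<tau> (m, n)) \<le> 2 / d ^ 3 * (lattice_weight m * lattice_weight n)"
proof -
  define M where "M = max \<bar>of_int m\<bar> \<bar>real_of_int n\<bar>"
  have M1: "1 \<le> M" using m M_def by linarith
  define z where "z = of_int m * \<tau> + of_int n"
  have z: "d * M \<le> cmod z"
    using order_trans[OF mult_right_mono[OF d(2), of M] lattice_gap_bound[OF y m, of "of_int n", folded M_def]] M1
    by (simp add: z_def)
  \<comment> \<open>Replacing n by n - 1 at most halves the maximum: |n| \<ge> 2 gives |n - 1| \<ge>
    |n| / 2, and otherwise |m| \<ge> 1 already attains it.\<close>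
  have M2: "M / 2 \<le> max \<bar>of_int m\<bar> \<bar>real_of_int (n - 1)\<bar>"
    using m M_def by linarith
  have "d * (M / 2) \<le> lattice_gap \<tau> * max \<bar>of_int m\<bar> \<bar>real_of_int (n - 1)\<bar>"
    using d M1 M2 by (intro mult_mono) auto
  also have "\<dots> \<le> cmod (z - 1)"
    using lattice_gap_bound[OF y m, of "of_int (n - 1)"] by (simp add: z_def add_diff_eq)
  finally have z1: "d * M / 2 \<le> cmod (z - 1)" by simp
  have nz: "z \<noteq> 0" "z - 1 \<noteq> 0" using less_le_trans[OF _ z, of 0] less_le_trans[OF _ z1, of 0] d(1) M1 by force+
  have "eisenstein_term \<tau> (m, n) = 1 / z\<^sup>2 - (1 / (z - 1) - 1 / z)"
    by (simp add: eisenstein_term_def z_def add_diff_eq)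
  also have "\<dots> = - 1 / (z\<^sup>2 * (z - 1))" using nz by (simp add: field_simps power2_eq_square)
  finally have "cmod (eisenstein_term \<tau> (m, n)) = 1 / ((cmod z)\<^sup>2 * cmod (z - 1))"
    by (simp add: norm_divide norm_mult norm_power)
  also have "\<dots> \<le> 1 / ((d * M)\<^sup>2 * (d * M / 2))"
    using z z1 d M1 nz by (intro divide_left_mono mult_mono power_mono mult_pos_pos) auto
  also have "\<dots> = 2 / d ^ 3 * (1 / M ^ 3)" by (simp add: power2_eq_square power3_eq_cube)
  also have "\<dots> \<le> 2 / d ^ 3 * (lattice_weight m * lattice_weight n)"
    using lattice_weight_bound[OF m M_def] d by (intro mult_left_mono) auto
  finally show ?thesis .
qed

text \<open>The weight 2 Eisenstein series without its row m = 0. That row contributes the constant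
  \<open>Z\<close> of \<open>eisenstein_sum_inversion\<close>.\<close>

definition eisenstein_sum :: "complex \<Rightarrow> complex" where
  "eisenstein_sum \<tau> = infsum (eisenstein_term \<tau>) ((- {0}) \<times> UNIV)"

lemma lattice_weight_summable_on: "(\<lambda>p. c * (case p of (m,n) \<Rightarrow> lattice_weight m * lattice_weight n)) summable_on A"
  by (intro summable_on_cmult_right summable_on_subset_banach[OF lattice_weight_summable2]) auto

lemma eisenstein_term_abs_summable:
  assumes "Im \<tau> > 0"
  shows "(\<lambda>p. norm (eisenstein_term \<tau> p)) summable_on ((- {0}) \<times> UNIV)"
  by (rule summable_on_comparison_test[OF lattice_weight_summable_on[of "2 / lattice_gap \<tau> ^ 3"]])
    (use assms eisenstein_term_bound[OF assms _ lattice_gap_pos[OF assms] order_refl] in \<open>auto\<close>)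

lemma eisenstein_sum_bound:
  assumes y: "Im \<tau> > 0" and d: "0 < d" "d \<le> lattice_gap \<tau>"
  shows "cmod (eisenstein_sum \<tau>) \<le> 2 / d ^ 3 * infsum (\<lambda>(m,n). lattice_weight m * lattice_weight n) UNIV"
proof -
  let ?w = "\<lambda>(m,n). lattice_weight m * lattice_weight n"
  have "cmod (eisenstein_sum \<tau>) \<le> infsum (\<lambda>p. norm (eisenstein_term \<tau> p)) ((- {0}) \<times> UNIV)"
    unfolding eisenstein_sum_def by (rule norm_infsum_bound[OF eisenstein_term_abs_summable[OF y]])
  also have "\<dots> \<le> infsum (\<lambda>p. 2 / d ^ 3 * ?w p) UNIV"
    using eisenstein_term_bound[OF y _ d] d
    by (intro infsum_mono_neutral eisenstein_term_abs_summable[OF y] lattice_weight_summable_on)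
      (auto simp: lattice_weight_pos less_imp_le)
  also have "\<dots> = 2 / d ^ 3 * infsum ?w UNIV" by (rule infsum_cmult_right')
  finally show ?thesis .
qed

lemma eisenstein_sum_holomorphic: "eisenstein_sum holomorphic_on {\<tau>. Im \<tau> > 0}"
proof -
  have "eisenstein_sum field_differentiable (at z)" if z: "Im z > 0" for z
  proof -
    \<comment> \<open>Half the height keeps the closed disc of radius e inside the
      half-plane.\<close>
    define e where "e = Im z / 2"
    have e: "e > 0" using z by (simp add: e_def)
    define U where "U = cball z e"
    \<comment> \<open>A lower bound for the gap on the whole disc: there Im \<tau> \<ge> e and
      |\<tau>| \<le> |z| + e, and t / (t + s) increases in t and decreases in s.\<close>
    define d where "d = min e (e / (e + (cmod z + e)))"
    have d: "d > 0" using e by (auto simp: d_def intro!: divide_pos_pos add_pos_nonneg)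
    have U: "Im \<tau> \<ge> e" "d \<le> lattice_gap \<tau>" if "\<tau> \<in> U" for \<tau>
    proof -
      have dz: "cmod (z - \<tau>) \<le> e" using that by (simp add: U_def dist_norm)
      then show i: "Im \<tau> \<ge> e" using abs_Im_le_cmod[of "z - \<tau>"] by (simp add: e_def)
      have n: "cmod \<tau> \<le> cmod z + e" using dz norm_triangle_ineq2[of \<tau> z] by (simp add: norm_minus_commute)
      have "e / (e + (cmod z + e)) \<le> e / (e + cmod \<tau>)"
        using e n by (intro divide_left_mono mult_pos_pos) (auto simp: add_pos_nonneg)
      also have "\<dots> \<le> Im \<tau> / (Im \<tau> + cmod \<tau>)"
        using i e mult_right_mono[OF i, of "cmod \<tau>"] by (simp add: divide_simps add_pos_nonneg add_nonneg_eq_0_iff) (auto simp: algebra_simps)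
      finally show "d \<le> lattice_gap \<tau>" using i by (auto simp: d_def lattice_gap_def)
    qed
    have ul: "uniform_limit U (\<lambda>P \<tau>. \<Sum>p\<in>P. eisenstein_term \<tau> p) eisenstein_sum (finite_subsets_at_top ((- {0}) \<times> UNIV))"
      unfolding eisenstein_sum_def[abs_def]
      by (rule Weierstrass_m_test_general[OF _ lattice_weight_summable_on[of "2 / d ^ 3"]])
        (use eisenstein_term_bound[OF less_le_trans[OF e U(1)] _ d U(2)] in auto)
    have "eisenstein_sum holomorphic_on ball z e"
    proof (rule holomorphic_uniform_limit[OF _ ul[unfolded U_def], THEN conjunct2])
      have "(\<lambda>\<tau>. \<Sum>p\<in>P. eisenstein_term \<tau> p) holomorphic_on U"
        if "P \<subseteq> (- {0}) \<times> UNIV" for P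
      proof (rule holomorphic_on_sum)
        fix p assume "p \<in> P"
        then obtain m n where p: "p = (m, n)" "m \<noteq> 0" using \<open>P \<subseteq> _\<close> by (cases p) auto
        have "of_int m * \<tau> + of_int k \<noteq> 0" if "\<tau> \<in> U" for \<tau> k
          using lattice_point_nonzero[of \<tau> m "of_int k"] U(1)[OF that] e p by auto
        then show "(\<lambda>\<tau>. eisenstein_term \<tau> p) holomorphic_on U"
          unfolding p eisenstein_term_def prod.case by (intro holomorphic_intros) (auto simp del: of_int_diff)
      qed
      then show "\<forall>\<^sub>F P in finite_subsets_at_top ((- {0}) \<times> UNIV).
          continuous_on (cball z e) (\<lambda>\<tau>. \<Sum>p\<in>P. eisenstein_term \<tau> p) \<and>
          (\<lambda>\<tau>. \<Sum>p\<in>P. eisenstein_term \<tau> p) holomorphic_on ball z e"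
        by (intro eventually_finite_subsets_at_top_weakI)
          (auto simp: U_def intro: holomorphic_on_imp_continuous_on holomorphic_on_subset[OF _ ball_subset_cball])
    qed auto
    then show ?thesis using e by (intro holomorphic_on_imp_differentiable_at[of _ "ball z e"]) auto
  qed
  then show ?thesis by (auto simp: holomorphic_on_def intro: field_differentiable_at_within)
qed

section \<open>Translation and inversion of the weight 2 Eisenstein series\<close>

lemma eisenstein_sum_plus_one:
  assumes "Im \<tau> > 0"
  shows "eisenstein_sum (\<tau> + 1) = eisenstein_sum \<tau>"
proof -
  have "bij_betw (\<lambda>(m, n). (m, n + m)) ((- {0}) \<times> UNIV) ((- {0::int}) \<times> (UNIV::int set))"
    by (rule bij_betwI[where g="\<lambda>(m, n). (m, n - m)"]) auto
  then have "eisenstein_sum \<tau> = infsum (\<lambda>p. eisenstein_term \<tau> (case p of (m, n) \<Rightarrow> (m, n + m))) ((- {0}) \<times> UNIV)"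
    unfolding eisenstein_sum_def by (rule infsum_reindex_bij_betw[symmetric])
  also have "\<dots> = eisenstein_sum (\<tau> + 1)"
    unfolding eisenstein_sum_def
    by (intro infsum_cong) (auto simp: eisenstein_term_def algebra_simps)
  finally show ?thesis by simp
qed

text \<open>Along a single row or column one index is fixed, so quadratic decay suffices for
  absolute convergence; it beats the exponent 3/2 of the weights.\<close>

lemma inverse_square_bound:
  assumes y: "Im \<tau> > 0" and m: "m \<noteq> 0"
  shows "cmod (1 / (of_int m * \<tau> + of_int n)\<^sup>2) \<le> 1 / (lattice_gap \<tau>)\<^sup>2 * lattice_weight n"
    and "cmod (1 / (of_int m * \<tau> + of_int n)\<^sup>2) \<le> 1 / (lattice_gap \<tau>)\<^sup>2 * lattice_weight m"
proof -
  define d where "d = lattice_gap \<tau>"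
  have d: "d > 0" using lattice_gap_pos y d_def by simp
  define M where "M = max \<bar>of_int m\<bar> \<bar>real_of_int n\<bar>"
  have M1: "1 \<le> M" using m M_def by linarith
  have "cmod (1 / (of_int m * \<tau> + of_int n)\<^sup>2) = 1 / (cmod (of_int m * \<tau> + of_int n))\<^sup>2"
    by (simp add: norm_divide norm_power)
  also have "\<dots> \<le> 1 / (d * M)\<^sup>2"
    using lattice_gap_bound[OF y m, of "of_int n", folded M_def d_def] M1 d
    using lattice_point_nonzero[OF y m, of "of_int n"]
    by (intro divide_left_mono power_mono mult_pos_pos zero_less_power) auto
  also have "\<dots> = 1 / d\<^sup>2 * (1 / M\<^sup>2)" by (simp add: power_mult_distrib)
  also have "1 / M\<^sup>2 = M powr (-2)" using M1 by (simp add: powr_minus_divide)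
  finally have 1: "cmod (1 / (of_int m * \<tau> + of_int n)\<^sup>2) \<le> 1 / d\<^sup>2 * M powr (-2)" .
  have "M powr (-2) \<le> M powr (-3/2)" using M1 by (intro powr_mono) auto
  also have "\<dots> \<le> lattice_weight k" if "max 1 \<bar>real_of_int k\<bar> \<le> M" for k
    unfolding lattice_weight_def using that by (intro powr_mono2') auto
  finally have "1 / d\<^sup>2 * M powr (-2) \<le> 1 / d\<^sup>2 * lattice_weight k" if "max 1 \<bar>real_of_int k\<bar> \<le> M" for k
    using that d by (intro mult_left_mono) auto
  from order_trans[OF 1 this] M1 show "cmod (1 / (of_int m * \<tau> + of_int n)\<^sup>2) \<le> 1 / (lattice_gap \<tau>)\<^sup>2 * lattice_weight n"
    and "cmod (1 / (of_int m * \<tau> + of_int n)\<^sup>2) \<le> 1 / (lattice_gap \<tau>)\<^sup>2 * lattice_weight m"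
    unfolding d_def by (simp_all add: M_def)
qed

lemma inverse_square_summable:
  assumes y: "Im \<tau> > 0"
  shows "m \<noteq> 0 \<Longrightarrow> (\<lambda>n. 1 / (of_int m * \<tau> + of_int n)\<^sup>2) summable_on UNIV"
    and "(\<lambda>m. 1 / (of_int m * \<tau> + of_int n)\<^sup>2) summable_on - {0}"
proof -
  have s: "(\<lambda>k. 1 / (lattice_gap \<tau>)\<^sup>2 * lattice_weight k) summable_on A" for A
    by (intro summable_on_cmult_right summable_on_subset_banach[OF lattice_weight_summable]) auto
  show "m \<noteq> 0 \<Longrightarrow> (\<lambda>n. 1 / (of_int m * \<tau> + of_int n)\<^sup>2) summable_on UNIV"
    by (rule abs_summable_summable, rule summable_on_comparison_test[OF s])
       (use inverse_square_bound[OF y] in auto)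
  show "(\<lambda>m. 1 / (of_int m * \<tau> + of_int n)\<^sup>2) summable_on - {0}"
    by (rule abs_summable_summable, rule summable_on_comparison_test[OF s])
       (use inverse_square_bound[OF y] in auto)
qed

lemma telescope_symmetric:
  fixes f :: "int \<Rightarrow> 'a::ab_group_add"
  shows "(\<Sum>n\<in>{- int N + 1..int N}. f (n - 1) - f n) = f (- int N) - f (int N)"
proof (induction N)
  case (Suc N)
  have "{- int (Suc N) + 1..int (Suc N)} = insert (- int N) (insert (int N + 1) {- int N + 1..int N})" by auto
  moreover have "f (- int (Suc N)) = f (- int N - 1)" "f (int (Suc N)) = f (int N + 1)"
    by (rule arg_cong[of _ _ f], simp)+
  ultimately show ?case using Suc by (cases "N = 0") (simp_all add: algebra_simps del: of_nat_Suc)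
qed simp

text \<open>The telescoping correction is summable along the row, being the difference of two
  summable families. Its sum may therefore be computed along the windows, where it is the limit of
  \<open>f (- N) - f N\<close>, namely 0.\<close>

lemma eisenstein_term_row:
  assumes y: "Im \<tau> > 0" and m: "m \<noteq> 0"
  shows "((\<lambda>n. eisenstein_term \<tau> (m, n)) has_sum (\<Sum>\<^sub>\<infinity>n. 1 / (of_int m * \<tau> + of_int n)\<^sup>2)) UNIV"
proof -
  define f where "f n = 1 / (of_int m * \<tau> + of_int n)" for n :: int
  define a where "a n = 1 / (of_int m * \<tau> + of_int n)\<^sup>2" for n :: int
  have t: "eisenstein_term \<tau> (m, n) = a n - (f (n - 1) - f n)" for n
    by (simp add: eisenstein_term_def a_def f_def)
  have "(\<lambda>n. eisenstein_term \<tau> (m, n)) summable_on UNIV"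
    using summable_on_SigmaD1[of "\<lambda>m n. eisenstein_term \<tau> (m, n)" "- {0}" "\<lambda>_. UNIV" m]
      abs_summable_summable[OF eisenstein_term_abs_summable[OF y]] m by simp
  then have ts: "((\<lambda>n. eisenstein_term \<tau> (m, n)) has_sum (infsum (\<lambda>n. eisenstein_term \<tau> (m, n)) UNIV)) UNIV"
    by (rule has_sum_infsum)
  have as: "(a has_sum infsum a UNIV) UNIV"
    using inverse_square_summable(1)[OF y m] unfolding a_def by (rule has_sum_infsum)
  have b: "((\<lambda>n. f (n - 1) - f n) has_sum (infsum a UNIV - infsum (\<lambda>n. eisenstein_term \<tau> (m, n)) UNIV)) UNIV"
    using has_sum_add[OF as has_sum_uminusI[OF ts]] by (simp add: t)
  have fn: "filterlim (\<lambda>N. of_int m * \<tau> + of_int (int N)) at_infinity sequentially"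
    "filterlim (\<lambda>N. of_int m * \<tau> + of_int (- int N)) at_infinity sequentially"
    by (rule tendsto_add_filterlim_at_infinity[OF tendsto_const],
        simp add: filterlim_at_infinity_conv_norm_at_top filterlim_real_sequentially)+
  have "(\<lambda>N. f (- int N) - f (int N)) \<longlonglongrightarrow> 0 - 0"
    unfolding f_def by (intro tendsto_diff tendsto_divide_0[OF tendsto_const] fn)
  moreover have "(\<lambda>N. f (- int N) - f (int N)) \<longlonglongrightarrow> infsum a UNIV - infsum (\<lambda>n. eisenstein_term \<tau> (m, n)) UNIV"
    using has_sum_int_symmetric_limit[OF b] unfolding telescope_symmetric .
  ultimately have "infsum a UNIV = infsum (\<lambda>n. eisenstein_term \<tau> (m, n)) UNIV"
    using LIMSEQ_unique by fastforce
  with ts show ?thesis unfolding a_def by simp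
qed

lemma has_sum_finite_sum:
  fixes f :: "'i \<Rightarrow> 'a \<Rightarrow> 'b::topological_comm_monoid_add"
  assumes "finite I" "\<And>i. i \<in> I \<Longrightarrow> (f i has_sum s i) A"
  shows "((\<lambda>x. \<Sum>i\<in>I. f i x) has_sum (\<Sum>i\<in>I. s i)) A"
  using assms by (induction I rule: finite_induct) (auto intro!: has_sum_add)

lemma eisenstein_sum_rows:
  assumes y: "Im \<tau> > 0"
  shows "((\<lambda>m. \<Sum>\<^sub>\<infinity>n. 1 / (of_int m * \<tau> + of_int n)\<^sup>2) has_sum eisenstein_sum \<tau>) (- {0})"
  by (rule has_sum_SigmaD[OF has_sum_infsum[OF abs_summable_summable[OF eisenstein_term_abs_summable[OF y]], folded eisenstein_sum_def]])
    (simp add: eisenstein_term_row[OF y])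

lemma has_sum_even_int:
  fixes h :: "int \<Rightarrow> complex"
  assumes h: "(h has_sum s) (- {0})" and even: "\<And>m. h (- m) = h m" and t: "(\<lambda>n. h (int (Suc n))) sums t"
  shows "s = 2 * t"
proof -
  have U: "- {0} = (range (int \<circ> Suc)) \<union> (range (uminus \<circ> int \<circ> Suc))"
  proof -
    have "x \<in> (range (int \<circ> Suc)) \<union> (range (uminus \<circ> int \<circ> Suc))" if "x \<noteq> 0" for x
      using that by (cases x rule: int_cases3) (auto simp: image_iff gr0_conv_Suc)
    then show ?thesis by auto
  qed
  have inj: "inj (int \<circ> Suc)" "inj (uminus \<circ> int \<circ> Suc)" by (auto simp: inj_on_def)
  have "h summable_on range (int \<circ> Suc)"
    using summable_on_subset_banach[OF has_sum_imp_summable[OF h]] U by blast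
  then have 1: "(h has_sum t) (range (int \<circ> Suc))"
    unfolding has_sum_reindex[OF inj(1)] summable_on_reindex[OF inj(1)]
    by (metis (no_types, lifting) t comp_apply ext has_sum_imp_sums has_sum_infsum sums_unique2)
  have 2: "(h has_sum t) (range (uminus \<circ> int \<circ> Suc))"
    using 1 unfolding has_sum_reindex[OF inj(1)] has_sum_reindex[OF inj(2)] by (simp add: o_def even del: of_nat_Suc)
  have "(h has_sum (t + t)) (- {0})" unfolding U using 1 2 by (intro has_sum_Un_disjoint) auto
  with h show ?thesis using has_sum_unique by fastforce
qed

lemma Im_of_nat_divide: "Im (of_nat N / \<tau>) = - real N * (Im \<tau> / (cmod \<tau>)\<^sup>2)"
  by (simp add: Im_divide cmod_power2)

text \<open>The obstruction to exchanging the two summations in the weight 2 Eisenstein series.\<close>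
lemma eisenstein_defect:
  assumes y: "Im \<tau> > 0" and N: "N > 0"
    and V: "((\<lambda>m. 1 / (of_int m * \<tau> - of_nat N) - 1 / (of_int m * \<tau> + of_nat N)) has_sum V) (- {0})"
  shows "V = 2 / \<tau> * (\<tau> / of_nat N - of_real pi * cot (of_real pi * (of_nat N / \<tau>)))"
proof -
  \<comment> \<open>Dividing by \<tau> turns the sum over m into the cotangent expansion at N /
    \<tau>, which is not an integer because its imaginary part is negative.\<close>
  define w where "w = of_nat N / \<tau>"
  have t0: "\<tau> \<noteq> 0" using y by auto
  have "Im w < 0" unfolding w_def Im_of_nat_divide using N y t0 by auto
  then have w: "w \<notin> \<int>" by (auto elim!: Ints_cases)
  have wm: "of_nat (Suc n) - w \<noteq> 0" "of_nat (Suc n) + w \<noteq> 0" for n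
    using \<open>Im w < 0\<close> by (auto simp: complex_eq_iff)
  have "1 / (of_int (int (Suc n)) * \<tau> - of_nat N) - 1 / (of_int (int (Suc n)) * \<tau> + of_nat N)
      = (1 / (of_nat (Suc n) - w) - 1 / (of_nat (Suc n) + w)) / \<tau>" for n
  proof -
    have "of_nat N = w * \<tau>" using t0 by (simp add: w_def)
    then show ?thesis using t0 wm[of n]
      by (simp add: diff_divide_distrib flip: left_diff_distrib distrib_right)
  qed
  with sums_divide[OF pi_cot_expansion[OF w], of \<tau>]
  have "(\<lambda>n. 1 / (of_int (int (Suc n)) * \<tau> - of_nat N) - 1 / (of_int (int (Suc n)) * \<tau> + of_nat N))
      sums ((1 / w - of_real pi * cot (of_real pi * w)) / \<tau>)" by simp
  moreover have neg: "1 / (of_int (- m) * \<tau> - of_nat N) - 1 / (of_int (- m) * \<tau> + of_nat N) =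
      1 / (of_int m * \<tau> - of_nat N) - 1 / (of_int m * \<tau> + of_nat N)" for m :: int
  proof -
    have "of_int (- m) * \<tau> - of_nat N = - (of_int m * \<tau> + of_nat N)"
      "of_int (- m) * \<tau> + of_nat N = - (of_int m * \<tau> - of_nat N)" by auto
    then show ?thesis by (simp only: divide_minus_right) simp
  qed
  ultimately have "V = 2 * ((1 / w - of_real pi * cot (of_real pi * w)) / \<tau>)"
    by (intro has_sum_even_int[OF V])
  then show ?thesis by (simp add: w_def)
qed

text \<open>The corrected terms converge absolutely, so their row sums and their column sums have
  the same total. The columns of the plain squares are, up to scaling, the rows of the series at
  -1/\<tau>. The two kinds of column sums differ by the columns of the correction, which telescope
  over a window to a cotangent at N / \<tau>; its limit is the anomaly.\<close>

theorem eisenstein_sum_inversion: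
  assumes y: "Im \<tau> > 0"
  defines "Z \<equiv> \<Sum>\<^sub>\<infinity>n\<in>- {0::int}. 1 / (of_int n :: complex)\<^sup>2"
  shows "eisenstein_sum (- 1 / \<tau>) + Z = \<tau>\<^sup>2 * (eisenstein_sum \<tau> + Z) - 2 * of_real pi * \<i> * \<tau>"
proof -
  have t0: "\<tau> \<noteq> 0" using y by auto
  define \<tau>' where "\<tau>' = - 1 / \<tau>"
  have y': "Im \<tau>' > 0" using y t0 by (simp add: \<tau>'_def Im_divide flip: cmod_power2)
  define R where "R n = (\<Sum>\<^sub>\<infinity>m\<in>- {0}. 1 / (of_int m * \<tau> + of_int n)\<^sup>2)" for n :: int
  define A where "A n = (\<Sum>\<^sub>\<infinity>m. 1 / (of_int n * \<tau>' + of_int m)\<^sup>2)" for n :: int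
  have R: "((\<lambda>m. 1 / (of_int m * \<tau> + of_int n)\<^sup>2) has_sum R n) (- {0})" for n
    unfolding R_def by (rule has_sum_infsum[OF inverse_square_summable(2)[OF y]])
  have Z: "((\<lambda>n. 1 / (of_int n)\<^sup>2) has_sum Z) (- {0::int})"
  proof -
    have "(\<lambda>m. \<tau>\<^sup>2 * (1 / (of_int m * \<tau> + of_int 0)\<^sup>2)) summable_on - {0}"
      by (intro summable_on_cmult_right inverse_square_summable(2)[OF y])
    also have "(\<lambda>m. \<tau>\<^sup>2 * (1 / (of_int m * \<tau> + of_int 0)\<^sup>2)) = (\<lambda>n::int. 1 / (of_int n)\<^sup>2)"
      using t0 by (auto simp: power_mult_distrib)
    finally show ?thesis unfolding Z_def by (rule has_sum_infsum)
  qed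
  have scale: "1 / (of_int (- n) * \<tau>' + of_int m)\<^sup>2 = \<tau>\<^sup>2 * (1 / (of_int m * \<tau> + of_int n)\<^sup>2)" for m n
  proof -
    have "of_int (- n) * \<tau>' + of_int m = (of_int m * \<tau> + of_int n) / \<tau>"
      using t0 by (simp add: \<tau>'_def)
    then show ?thesis by (simp add: power_divide)
  qed
  \<comment> \<open>Scaling by \<tau>^2 identifies the column n with the row -n of the series at
    -1/\<tau>, except that the column lacks its entry at m = 0.\<close>
  have Rn: "R n = A (- n) / \<tau>\<^sup>2 - 1 / (of_int n)\<^sup>2" if n: "n \<noteq> 0" for n
  proof -
    have "((\<lambda>m. 1 / (of_int m * \<tau> + of_int n)\<^sup>2) has_sum (1 / (of_int 0 * \<tau> + of_int n)\<^sup>2 + R n)) (insert 0 (- {0}))"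
      by (intro has_sum_insert R) auto
    moreover have "insert 0 (- {0}) = (UNIV :: int set)" by auto
    ultimately have "((\<lambda>m. \<tau>\<^sup>2 * (1 / (of_int m * \<tau> + of_int n)\<^sup>2)) has_sum \<tau>\<^sup>2 * (1 / (of_int n)\<^sup>2 + R n)) UNIV"
      by (intro has_sum_cmult_right) simp
    then have "A (- n) = \<tau>\<^sup>2 * (1 / (of_int n)\<^sup>2 + R n)"
      unfolding A_def scale by (rule infsumI)
    then show ?thesis using t0 by (simp add: field_simps)
  qed
  have R0: "R 0 = Z / \<tau>\<^sup>2"
  proof -
    have "((\<lambda>m. (1 / \<tau>\<^sup>2) * (1 / (of_int m)\<^sup>2)) has_sum (1 / \<tau>\<^sup>2) * Z) (- {0::int})"
      by (intro has_sum_cmult_right Z)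
    then have "((\<lambda>m. 1 / (of_int m * \<tau> + of_int 0)\<^sup>2) has_sum (1 / \<tau>\<^sup>2) * Z) (- {0::int})"
      by (simp add: power_mult_distrib mult.commute)
    from has_sum_unique[OF this R[of 0]] show ?thesis by simp
  qed
  have "(A has_sum eisenstein_sum \<tau>') (- {0})"
    using eisenstein_sum_rows[OF y'] unfolding A_def .
  moreover have "bij_betw uminus (- {0::int}) (- {0})"
    by (rule bij_betwI[where g=uminus]) auto
  ultimately have "((\<lambda>n. A (- n)) has_sum eisenstein_sum \<tau>') (- {0})"
    using has_sum_reindex_bij_betw[of uminus "- {0::int}" "- {0}" A] by simp
  then have "((\<lambda>n. (1 / \<tau>\<^sup>2) * A (- n) + - (1 / (of_int n)\<^sup>2)) has_sum ((1 / \<tau>\<^sup>2) * eisenstein_sum \<tau>' + - Z)) (- {0})"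
    by (intro has_sum_add has_sum_cmult_right has_sum_uminusI Z)
  then have "(R has_sum (eisenstein_sum \<tau>' / \<tau>\<^sup>2 - Z)) (- {0})"
    by (subst has_sum_cong[where g="\<lambda>n. (1 / \<tau>\<^sup>2) * A (- n) + - (1 / (of_int n)\<^sup>2)"]) (auto simp: Rn)
  then have "(R has_sum (R 0 + (eisenstein_sum \<tau>' / \<tau>\<^sup>2 - Z))) (insert 0 (- {0}))"
    by (intro has_sum_insert) auto
  moreover have "insert 0 (- {0}) = (UNIV :: int set)" by auto
  ultimately have RU: "(R has_sum ((eisenstein_sum \<tau>' + Z) / \<tau>\<^sup>2 - Z)) UNIV"
    by (simp add: R0 add_divide_distrib algebra_simps)

  \<comment> \<open>The columns of the corrected terms; for these, unlike for the plain squares in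
    \<open>R\<close>, the order of summation may be exchanged.\<close>
  define T where "T n = (\<Sum>\<^sub>\<infinity>m\<in>- {0}. eisenstein_term \<tau> (m, n))" for n
  have all: "((\<lambda>(n, m). eisenstein_term \<tau> (m, n)) has_sum eisenstein_sum \<tau>) (UNIV \<times> - {0})"
    using has_sum_infsum[OF abs_summable_summable[OF eisenstein_term_abs_summable[OF y]]]
    by (subst has_sum_swap[symmetric]) (simp add: eisenstein_sum_def)
  have T: "((\<lambda>m. eisenstein_term \<tau> (m, n)) has_sum T n) (- {0})" for n
    unfolding T_def using summable_on_SigmaD1[OF has_sum_imp_summable[OF all], of n]
    by (intro has_sum_infsum) simp
  have TU: "(T has_sum eisenstein_sum \<tau>) UNIV"
    by (rule has_sum_SigmaD[OF all]) (simp add: T)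
  have D: "((\<lambda>m. 1 / (of_int m * \<tau> + of_int (n - 1)) - 1 / (of_int m * \<tau> + of_int n)) has_sum (R n - T n)) (- {0})" for n
    using has_sum_add[OF R[of n] has_sum_uminusI[OF T[of n]]] by (simp add: eisenstein_term_def)
  define V where "V N = (\<Sum>n\<in>{- int N + 1..int N}. R n - T n)" for N
  have V1: "V \<longlonglongrightarrow> (eisenstein_sum \<tau>' + Z) / \<tau>\<^sup>2 - Z - eisenstein_sum \<tau>"
    unfolding V_def using has_sum_add[OF RU has_sum_uminusI[OF TU]]
    by (intro has_sum_int_symmetric_limit) simp
  have "V N = 2 / \<tau> * (\<tau> / of_nat N - of_real pi * cot (of_real pi * (of_nat N / \<tau>)))" if "N > 0" for N
  proof (rule eisenstein_defect[OF y that])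
    have "((\<lambda>m. \<Sum>n\<in>{- int N + 1..int N}. 1 / (of_int m * \<tau> + of_int (n - 1)) - 1 / (of_int m * \<tau> + of_int n)) has_sum V N) (- {0})"
      unfolding V_def by (intro has_sum_finite_sum D) auto
    then show "((\<lambda>m. 1 / (of_int m * \<tau> - of_nat N) - 1 / (of_int m * \<tau> + of_nat N)) has_sum V N) (- {0})"
      by (subst (asm) telescope_symmetric) simp
  qed
  then have "\<forall>\<^sub>F N in sequentially. 2 / \<tau> * (\<tau> * (1 / of_nat N) - of_real pi * cot (of_real pi * (of_nat N / \<tau>))) = V N"
    by (intro eventually_sequentiallyI[of 1]) auto
  moreover have "(\<lambda>N. 2 / \<tau> * (\<tau> * (1 / of_nat N) - of_real pi * cot (of_real pi * (of_nat N / \<tau>)))) \<longlonglongrightarrow> 2 / \<tau> * (\<tau> * 0 - of_real pi * \<i>)"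
  proof (intro tendsto_mult tendsto_diff tendsto_const cot_tendsto_ii lim_1_over_n)
    \<comment> \<open>The arguments move down the lower half-plane, so the cotangent tends to
      \<open>\<i>\<close> rather than \<open>- \<i>\<close>; this fixes the sign of the
      anomaly.\<close>
    have "filterlim (\<lambda>N. - (pi * (Im \<tau> / (cmod \<tau>)\<^sup>2)) * real N) at_bot sequentially"
      using y t0 by (intro filterlim_tendsto_neg_mult_at_bot[OF tendsto_const _ filterlim_real_sequentially]) auto
    moreover have "Im (of_real pi * (of_nat N / \<tau>)) = - (pi * (Im \<tau> / (cmod \<tau>)\<^sup>2)) * real N" for N
    proof -
      have "Im (of_real pi * w) = pi * Im w" for w by simp
      then show ?thesis by (simp only: Im_of_nat_divide) simp
    qed
    ultimately show "filterlim (\<lambda>N. Im (of_real pi * (of_nat N / \<tau>))) at_bot sequentially" by presburger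
  qed
  ultimately have "V \<longlonglongrightarrow> 2 / \<tau> * (\<tau> * 0 - of_real pi * \<i>)"
    by (rule Lim_transform_eventually[rotated])
  with V1 have "(eisenstein_sum \<tau>' + Z) / \<tau>\<^sup>2 - Z - eisenstein_sum \<tau> = 2 / \<tau> * (\<tau> * 0 - of_real pi * \<i>)"
    by (rule LIMSEQ_unique)
  then have "(eisenstein_sum \<tau>' + Z) / \<tau>\<^sup>2 = eisenstein_sum \<tau> + Z - 2 * of_real pi * \<i> / \<tau>"
    by (simp add: algebra_simps)
  then have "eisenstein_sum \<tau>' + Z = (eisenstein_sum \<tau> + Z - 2 * of_real pi * \<i> / \<tau>) * \<tau>\<^sup>2"
    using t0 by (simp add: divide_eq_eq)
  also have "\<dots> = \<tau>\<^sup>2 * (eisenstein_sum \<tau> + Z) - 2 * of_real pi * \<i> * \<tau>"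
    using t0 by (simp add: field_simps power2_eq_square)
  finally show ?thesis unfolding \<tau>'_def .
qed

lemma quasimodular_connection:
  obtains \<phi> :: "complex \<Rightarrow> complex" and K :: real
  where "\<phi> holomorphic_on {\<tau>. Im \<tau> > 0}"
    and "\<And>\<tau>. Im \<tau> > 0 \<Longrightarrow> \<phi> (\<tau> + 1) = \<phi> \<tau>"
    and "\<And>\<tau>. Im \<tau> > 0 \<Longrightarrow> \<phi> (- 1 / \<tau>) = \<tau>\<^sup>2 * \<phi> \<tau> + \<tau>"
    and "\<And>\<tau>. Im \<tau> \<ge> 1 \<Longrightarrow> cmod (\<phi> \<tau>) \<le> K * cmod \<tau> ^ 3"
proof -
  define Z where "Z = (\<Sum>\<^sub>\<infinity>n\<in>- {0::int}. 1 / (of_int n :: complex)\<^sup>2)"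
  \<comment> \<open>The factor i / (2 pi) turns the anomaly -2 pi i \<tau> of the inversion formula
    into \<tau>.\<close>
  define \<phi> where "\<phi> \<tau> = \<i> / (2 * of_real pi) * (eisenstein_sum \<tau> + Z)" for \<tau>
  define W where "W = infsum (\<lambda>(m,n). lattice_weight m * lattice_weight n) UNIV"
  show ?thesis
  proof (rule that[of \<phi> "1 / (2 * pi) * (16 * W + cmod Z)"])
    show "\<phi> holomorphic_on {\<tau>. Im \<tau> > 0}"
      unfolding \<phi>_def by (intro holomorphic_intros eisenstein_sum_holomorphic) auto
    show "\<phi> (\<tau> + 1) = \<phi> \<tau>" if "Im \<tau> > 0" for \<tau>
      using eisenstein_sum_plus_one[OF that] by (simp add: \<phi>_def)
    show "\<phi> (- 1 / \<tau>) = \<tau>\<^sup>2 * \<phi> \<tau> + \<tau>" if "Im \<tau> > 0" for \<tau>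
      unfolding \<phi>_def Z_def eisenstein_sum_inversion[OF that] by (simp add: algebra_simps)
    show "cmod (\<phi> \<tau>) \<le> 1 / (2 * pi) * (16 * W + cmod Z) * cmod \<tau> ^ 3" if y: "Im \<tau> \<ge> 1" for \<tau>
    proof -
      have t1: "cmod \<tau> \<ge> 1" using y abs_Im_le_cmod[of \<tau>] by linarith
      \<comment> \<open>As 1 \<le> Im \<tau> \<le> |\<tau>|, the gap is at least 1 / (2 |\<tau>|).
        Its inverse cube accounts for the exponent 3 and for 16 = 2 * 2^3.\<close>
      have "1 / (2 * cmod \<tau>) \<le> Im \<tau> / (Im \<tau> + cmod \<tau>)"
        using y abs_Im_le_cmod[of \<tau>] t1 mult_left_mono[OF y, of "cmod \<tau>"] by (simp add: divide_simps) (simp add: algebra_simps)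
      moreover have "1 / (2 * cmod \<tau>) \<le> 1" using t1 by (subst divide_le_eq_1_pos) auto
      ultimately have "1 / (2 * cmod \<tau>) \<le> lattice_gap \<tau>" using y unfolding lattice_gap_def by simp
      then have "cmod (eisenstein_sum \<tau>) \<le> 2 / (1 / (2 * cmod \<tau>)) ^ 3 * W"
        unfolding W_def using y t1 by (intro eisenstein_sum_bound) auto
      also have "\<dots> = 16 * W * cmod \<tau> ^ 3" by (simp add: power_divide power_mult_distrib)
      finally have 1: "cmod (eisenstein_sum \<tau>) \<le> 16 * W * cmod \<tau> ^ 3" .
      have 2: "cmod Z \<le> cmod Z * cmod \<tau> ^ 3" using mult_left_mono[OF one_le_power[OF t1, of 3], of "cmod Z"] by simp
      have "cmod (\<phi> \<tau>) = 1 / (2 * pi) * cmod (eisenstein_sum \<tau> + Z)"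
        by (simp add: \<phi>_def norm_mult norm_divide)
      also have "\<dots> \<le> 1 / (2 * pi) * (16 * W * cmod \<tau> ^ 3 + cmod Z * cmod \<tau> ^ 3)"
        using 1 2 norm_triangle_ineq[of "eisenstein_sum \<tau>" Z] by (intro mult_left_mono) auto
      finally show ?thesis by (simp add: algebra_simps)
    qed
  qed
qed

section \<open>Finite-dimensional complex normed spaces\<close>

context complex_normed_space begin

lemma bounded_bilinear_scale: "bounded_bilinear scale"
proof
  show "scale (r *\<^sub>R a) b = r *\<^sub>R scale a b" for r a b
    by (metis scale_scale scaleR_conv_of_real scale_of_real)
  show "scale a (r *\<^sub>R b) = r *\<^sub>R scale a b" for r a b
    by (metis scale_scale mult.commute scale_of_real)
  show "\<exists>K. \<forall>a b. norm (scale a b) \<le> norm a * norm b * K"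
    by (rule exI[of _ 1]) (simp add: norm_scale)
qed (simp_all add: scale_left_distrib scale_right_distrib)

lemma tendsto_scale: "(f \<longlongrightarrow> a) F \<Longrightarrow> (g \<longlongrightarrow> b) F \<Longrightarrow> ((\<lambda>x. scale (f x) (g x)) \<longlongrightarrow> scale a b) F"
  by (rule bounded_bilinear.tendsto[OF bounded_bilinear_scale])

text \<open>The point x has positive distance from the span of B because that span is closed: along
  a sequence of norms tending to 0 the assumed bound makes the coefficients Cauchy, and their limits
  would express x in terms of B.\<close>

lemma independent_dist_bound:
  assumes B: "finite B" and x: "x \<notin> span B"
    and c: "\<And>a. (\<Sum>b\<in>B. cmod (a b)) \<le> c * norm (\<Sum>b\<in>B. scale (a b) b)"
  shows "\<exists>\<delta>>0. \<forall>a. \<delta> \<le> norm (x + (\<Sum>b\<in>B. scale (a b) b))"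
proof (rule ccontr)
  assume "\<not> ?thesis"
  then have "\<forall>n. \<exists>a. norm (x + (\<Sum>b\<in>B. scale (a b) b)) < 1 / real (Suc n)"
    by (metis not_le of_nat_0_less_iff zero_less_Suc zero_less_divide_1_iff)
  then obtain a where a: "\<And>n. norm (x + (\<Sum>b\<in>B. scale (a n b) b)) < 1 / real (Suc n)" by metis
  have c1: "\<bar>c\<bar> + 1 > 0" by simp
  have diff: "cmod (a n b - a m b) \<le> (\<bar>c\<bar> + 1) * (1 / real (Suc n) + 1 / real (Suc m))" if "b \<in> B" for n m b
  proof -
    have "cmod (a n b - a m b) \<le> (\<Sum>b\<in>B. cmod (a n b - a m b))"
      using B that by (intro member_le_sum) auto
    also have "\<dots> \<le> c * norm (\<Sum>b\<in>B. scale (a n b - a m b) b)" by (rule c)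
    also have "\<dots> \<le> (\<bar>c\<bar> + 1) * norm (\<Sum>b\<in>B. scale (a n b - a m b) b)"
      by (intro mult_right_mono) auto
    also have "(\<Sum>b\<in>B. scale (a n b - a m b) b) = (x + (\<Sum>b\<in>B. scale (a n b) b)) - (x + (\<Sum>b\<in>B. scale (a m b) b))"
      by (simp add: scale_left_diff_distrib sum_subtractf)
    also have "norm \<dots> \<le> 1 / real (Suc n) + 1 / real (Suc m)"
      using norm_triangle_ineq4[of "x + (\<Sum>b\<in>B. scale (a n b) b)" "x + (\<Sum>b\<in>B. scale (a m b) b)"] a[of n] a[of m] by linarith
    finally show ?thesis using c1 by simp
  qed
  have "convergent (\<lambda>n. a n b)" if b: "b \<in> B" for b
  proof -
    have "Cauchy (\<lambda>n. a n b)"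
    proof (rule metric_CauchyI)
      fix e :: real assume e: "e > 0"
      obtain M where M: "inverse (real (Suc M)) < e / (2 * (\<bar>c\<bar> + 1))"
        using reals_Archimedean[of "e / (2 * (\<bar>c\<bar> + 1))"] e c1 by auto
      have "dist (a m b) (a n b) < e" if "m \<ge> M" "n \<ge> M" for m n
      proof -
        have "1 / real (Suc k) < e / (2 * (\<bar>c\<bar> + 1))" if "k \<ge> M" for k
          by (rule le_less_trans[OF _ M]) (use that in \<open>simp add: inverse_eq_divide divide_simps\<close>)
        from this[of m] this[of n] that
        have "1 / real (Suc m) + 1 / real (Suc n) < e / (2 * (\<bar>c\<bar> + 1)) + e / (2 * (\<bar>c\<bar> + 1))" by (intro add_strict_mono)
        also have "\<dots> = e / (\<bar>c\<bar> + 1)" using c1 by (simp add: divide_simps)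
        finally have "1 / real (Suc m) + 1 / real (Suc n) < e / (\<bar>c\<bar> + 1)" .
        then have "(\<bar>c\<bar> + 1) * (1 / real (Suc m) + 1 / real (Suc n)) < e"
          using c1 by (metis mult.commute pos_less_divide_eq)
        with diff[OF b, of m n] show ?thesis by (simp add: dist_norm)
      qed
      then show "\<exists>M. \<forall>m\<ge>M. \<forall>n\<ge>M. dist (a m b) (a n b) < e" by blast
    qed
    then show ?thesis by (simp add: Cauchy_convergent_iff)
  qed
  then obtain l where l: "\<And>b. b \<in> B \<Longrightarrow> (\<lambda>n. a n b) \<longlonglongrightarrow> l b" unfolding convergent_def by metis
  have "(\<lambda>n. x + (\<Sum>b\<in>B. scale (a n b) b)) \<longlonglongrightarrow> x + (\<Sum>b\<in>B. scale (l b) b)"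
    by (intro tendsto_intros tendsto_scale l)
  moreover have "(\<lambda>n. x + (\<Sum>b\<in>B. scale (a n b) b)) \<longlonglongrightarrow> 0"
    by (rule Lim_null_comparison[OF _ lim_1_over_n[THEN LIMSEQ_Suc]])
      (use a in \<open>auto intro!: always_eventually less_imp_le\<close>)
  ultimately have "x + (\<Sum>b\<in>B. scale (l b) b) = 0" by (rule LIMSEQ_unique)
  then have "x = - (\<Sum>b\<in>B. scale (l b) b)" by (simp add: eq_neg_iff_add_eq_0)
  then have "x \<in> span B" by (simp add: span_neg span_sum span_scale span_base)
  with x show False by simp
qed

text \<open>Equivalence of the given norm with the sum norm of the coordinates, by induction on the
  basis. It makes coordinates and linear maps bounded.\<close>

lemma independent_coefficient_bound:
  assumes "finite B" "independent B"
  shows "\<exists>c. \<forall>a. (\<Sum>b\<in>B. cmod (a b)) \<le> c * norm (\<Sum>b\<in>B. scale (a b) b)"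
  using assms
proof (induction B rule: finite_induct)
  case (insert x B)
  then have ind: "independent B" "x \<notin> span B" by (auto simp: independent_insert)
  from insert.IH[OF ind(1)] obtain c where "\<forall>a. (\<Sum>b\<in>B. cmod (a b)) \<le> c * norm (\<Sum>b\<in>B. scale (a b) b)" ..
  then have c: "(\<Sum>b\<in>B. cmod (a b)) \<le> c * norm (\<Sum>b\<in>B. scale (a b) b)" for a ..
  from independent_dist_bound[OF insert(1) ind(2) c] obtain \<delta>
    where d: "\<delta> > 0" "\<forall>a. \<delta> \<le> norm (x + (\<Sum>b\<in>B. scale (a b) b))" by (elim exE conjE)
  \<comment> \<open>The coefficient of x is at most norm v / \<delta>, by dividing v by it.
    Subtracting its contribution leaves a vector of norm at most (1 + norm x / \<delta>) norm v, to
    which the bound for B applies.\<close>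
  have "(\<Sum>b\<in>insert x B. cmod (a b)) \<le> (1 / \<delta> + \<bar>c\<bar> * (1 + norm x / \<delta>)) * norm (\<Sum>b\<in>insert x B. scale (a b) b)" for a
  proof -
    define w where "w = (\<Sum>b\<in>B. scale (a b) b)"
    define v where "v = scale (a x) x + w"
    have v: "v = (\<Sum>b\<in>insert x B. scale (a b) b)" using insert by (simp add: v_def w_def)
    have 1: "cmod (a x) \<le> norm v / \<delta>"
    proof (cases "a x = 0")
      case False
      have "v = scale (a x) (x + (\<Sum>b\<in>B. scale (a b / a x) b))"
        using False by (simp add: v_def w_def scale_right_distrib scale_sum_right)
      then have "norm v = cmod (a x) * norm (x + (\<Sum>b\<in>B. scale (a b / a x) b))" by (simp only: norm_scale)
      then have "cmod (a x) * \<delta> \<le> norm v" using d(2)[THEN spec, of "\<lambda>b. a b / a x"] by (simp add: mult_left_mono)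
      then show ?thesis using d by (simp add: field_simps)
    qed (use d in auto)
    have "norm w \<le> norm v + cmod (a x) * norm x"
      using norm_triangle_ineq4[of v "scale (a x) x"] by (simp add: v_def norm_scale)
    also have "\<dots> \<le> norm v + norm v / \<delta> * norm x" using 1 by (intro add_left_mono mult_right_mono) auto
    finally have 2: "norm w \<le> (1 + norm x / \<delta>) * norm v" by (simp add: algebra_simps)
    have "(\<Sum>b\<in>B. cmod (a b)) \<le> c * norm w" using c by (simp add: w_def)
    also have "\<dots> \<le> \<bar>c\<bar> * norm w" by (intro mult_right_mono) auto
    also have "\<dots> \<le> \<bar>c\<bar> * ((1 + norm x / \<delta>) * norm v)" using 2 by (intro mult_left_mono) auto
    finally have "(\<Sum>b\<in>insert x B. cmod (a b)) \<le> norm v / \<delta> + \<bar>c\<bar> * ((1 + norm x / \<delta>) * norm v)"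
      using 1 insert by simp
    then show ?thesis unfolding v[symmetric] by (simp add: algebra_simps)
  qed
  then show ?case by (intro exI[of _ "1 / \<delta> + \<bar>c\<bar> * (1 + norm x / \<delta>)"] allI)
qed (auto intro: exI[of _ 0])

end

text \<open>The basis is a parameter because it is replaced later: an arbitrary basis is used to
  find one that consists of weight vectors.\<close>

locale finite_basis = complex_normed_space sc
  for sc :: "complex \<Rightarrow> 'v::real_normed_vector \<Rightarrow> 'v" +
  fixes B :: "'v set"
  assumes finite_B: "finite B" and independent_B: "independent B" and span_B: "span B = UNIV"
begin

abbreviation coord :: "'v \<Rightarrow> 'v \<Rightarrow> complex" where "coord b v \<equiv> representation B v b"

lemma coord_add: "coord b (u + v) = coord b u + coord b v"
  using representation_add[OF independent_B] span_B by simp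

lemma coord_scale: "coord b (sc c v) = c * coord b v"
  using representation_scale[OF independent_B] span_B by simp

lemma coord_zero [simp]: "coord b 0 = 0" by (simp add: representation_zero)

lemma coord_sum: "coord b (sum f A) = (\<Sum>i\<in>A. coord b (f i))"
  using representation_sum[OF independent_B, of A f] span_B by simp

lemma coord_basis: "b' \<in> B \<Longrightarrow> coord b b' = (if b = b' then 1 else 0)"
  using representation_basis[OF independent_B] by auto

lemma coord_expansion: "(\<Sum>b\<in>B. sc (coord b v) b) = v"
  using sum_representation_eq[OF independent_B _ finite_B order_refl] span_B by simp

lemma coord_unique:
  assumes "(\<Sum>b\<in>B. sc (a b) b) = v" "b \<in> B" shows "coord b v = a b"
proof -
  have "coord b v = (\<Sum>b'\<in>B. a b' * coord b b')"
    unfolding assms(1)[symmetric] by (simp only: coord_sum coord_scale)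
  also have "\<dots> = (\<Sum>b'\<in>B. if b = b' then a b' else 0)"
    by (rule sum.cong) (auto simp: coord_basis)
  finally show ?thesis using assms finite_B by simp
qed

lemma coord_eqI:
  assumes "\<And>b. b \<in> B \<Longrightarrow> coord b u = coord b v" shows "u = v"
proof -
  have "(\<Sum>b\<in>B. sc (coord b u) b) = (\<Sum>b\<in>B. sc (coord b v) b)" using assms by simp
  then show ?thesis by (simp only: coord_expansion)
qed

lemma coord_bound: obtains K where "K > 0" "\<And>b v. b \<in> B \<Longrightarrow> cmod (coord b v) \<le> K * norm v"
proof -
  from independent_coefficient_bound[OF finite_B independent_B]
  obtain c where c: "\<forall>a. (\<Sum>b\<in>B. cmod (a b)) \<le> c * norm (\<Sum>b\<in>B. sc (a b) b)" ..
  show ?thesis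
  proof (rule that[of "\<bar>c\<bar> + 1"])
    fix b v assume "b \<in> B"
    then have "cmod (coord b v) \<le> (\<Sum>b\<in>B. cmod (coord b v))" using finite_B by (intro member_le_sum) auto
    also have "\<dots> \<le> c * norm v" using c[THEN spec, of "\<lambda>b. coord b v"] by (simp add: coord_expansion)
    also have "\<dots> \<le> (\<bar>c\<bar> + 1) * norm v" by (intro mult_right_mono) auto
    finally show "cmod (coord b v) \<le> (\<bar>c\<bar> + 1) * norm v" .
  qed simp
qed

lemma bounded_linear_coord: "b \<in> B \<Longrightarrow> bounded_linear (coord b)"
proof -
  assume b: "b \<in> B"
  obtain K where K: "\<And>b v. b \<in> B \<Longrightarrow> cmod (coord b v) \<le> K * norm v" using coord_bound by blast
  show ?thesis
    by (rule bounded_linear_intro[of _ K])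
      (use K[OF b] in \<open>auto simp: coord_add mult.commute[of _ K] coord_scale scaleR_conv_of_real scale_of_real[symmetric]\<close>)
qed

lemma linear_expansion:
  assumes "Vector_Spaces.linear sc sc f" shows "f v = (\<Sum>b\<in>B. sc (coord b v) (f b))"
proof -
  interpret f: Vector_Spaces.linear sc sc f by fact
  have "f v = f (\<Sum>b\<in>B. sc (coord b v) b)" by (simp add: coord_expansion)
  then show ?thesis by (simp add: f.sum f.scale)
qed

lemma bounded_linear_of_linear:
  assumes "Vector_Spaces.linear sc sc f" shows "bounded_linear f"
proof -
  have "bounded_linear (\<lambda>v. \<Sum>b\<in>B. sc (coord b v) (f b))"
    by (intro bounded_linear_sum
        bounded_linear_compose[OF bounded_bilinear.bounded_linear_left[OF bounded_bilinear_scale]] bounded_linear_coord)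
  moreover have "(\<lambda>v. \<Sum>b\<in>B. sc (coord b v) (f b)) = f"
    by (rule ext) (rule linear_expansion[OF assms, symmetric])
  ultimately show ?thesis by simp
qed

text \<open>Coordinates are bounded complex linear functionals, and a vector is the finite sum of
  its coordinates times basis vectors. So holomorphy of vector-valued functions reduces to the
  scalar notion.\<close>

lemma holomorphic_map_iff_coord:
  "holomorphic_map (*) sc f S \<longleftrightarrow> (\<forall>b\<in>B. (\<lambda>\<tau>. coord b (f \<tau>)) holomorphic_on S)"
proof (intro iffI ballI)
  fix b assume h: "holomorphic_map (*) sc f S" and b: "b \<in> B"
  show "(\<lambda>\<tau>. coord b (f \<tau>)) holomorphic_on S"
    unfolding holomorphic_on_def field_differentiable_def
  proof
    fix x assume "x \<in> S"
    then obtain D where D: "Vector_Spaces.linear (*) sc D" "(f has_derivative D) (at x within S)"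
      using h by (auto simp: holomorphic_map_def)
    interpret D: Vector_Spaces.linear "(*)" sc D by fact
    have "coord b (D h) = coord b (D 1) * h" for h
    proof -
      have "D h = sc h (D 1)" using D.scale[of h 1] by simp
      then have "coord b (D h) = h * coord b (D 1)" by (simp only: coord_scale)
      then show ?thesis by (simp only: mult.commute)
    qed
    then have eq: "(\<lambda>h. coord b (D h)) = (\<lambda>h. coord b (D 1) * h)" by (rule ext)
    have "((\<lambda>\<tau>. coord b (f \<tau>)) has_derivative (\<lambda>h. coord b (D 1) * h)) (at x within S)"
      using bounded_linear.has_derivative[OF bounded_linear_coord[OF b] D(2)] unfolding eq .
    then show "\<exists>f'. ((\<lambda>\<tau>. coord b (f \<tau>)) has_field_derivative f') (at x within S)"
      unfolding has_field_derivative_def by blast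
  qed
next
  assume h: "\<forall>b\<in>B. (\<lambda>\<tau>. coord b (f \<tau>)) holomorphic_on S"
  show "holomorphic_map (*) sc f S" unfolding holomorphic_map_def
  proof
    fix x assume x: "x \<in> S"
    have "\<forall>b\<in>B. \<exists>d. ((\<lambda>\<tau>. coord b (f \<tau>)) has_derivative (\<lambda>h. d * h)) (at x within S)"
      using h x unfolding holomorphic_on_def field_differentiable_def has_field_derivative_def by blast
    then obtain d where d: "\<And>b. b \<in> B \<Longrightarrow> ((\<lambda>\<tau>. coord b (f \<tau>)) has_derivative (\<lambda>h. d b * h)) (at x within S)" by metis
    have "((\<lambda>\<tau>. \<Sum>b\<in>B. sc (coord b (f \<tau>)) b) has_derivative (\<lambda>h. \<Sum>b\<in>B. sc (d b * h) b)) (at x within S)"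
      by (intro has_derivative_sum bounded_linear.has_derivative[OF bounded_bilinear.bounded_linear_left[OF bounded_bilinear_scale]] d)
    moreover have "Vector_Spaces.linear (*) sc (\<lambda>h. \<Sum>b\<in>B. sc (d b * h) b)"
    proof (rule Vector_Spaces.linear_iff[THEN iffD2], intro conjI allI)
      show "vector_space ((*) :: complex \<Rightarrow> complex \<Rightarrow> complex)" by unfold_locales (auto simp: algebra_simps)
      show "vector_space sc" by unfold_locales
    qed (simp_all add: distrib_left scale_left_distrib sum.distrib scale_sum_right mult.left_commute)
    ultimately show "\<exists>D. Vector_Spaces.linear (*) sc D \<and> (f has_derivative D) (at x within S)"
      unfolding coord_expansion by (intro exI[of _ "\<lambda>h. \<Sum>b\<in>B. sc (d b * h) b"] conjI)
  qed
qed

end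

section \<open>Representations of SL(2)\<close>

definition mat2 :: "'a::zero \<Rightarrow> 'a \<Rightarrow> 'a \<Rightarrow> 'a \<Rightarrow> 'a^2^2" where
  "mat2 a b c d = vector [vector [a, b], vector [c, d]]"

lemma mat2_nth [simp]:
  fixes a :: "'a::zero"
  shows "mat2 a b c d $ 1 $ 1 = a" "mat2 a b c d $ 1 $ 2 = b"
    "mat2 a b c d $ 2 $ 1 = c" "mat2 a b c d $ 2 $ 2 = d"
  unfolding mat2_def vector_2 by (rule refl)+

lemma mat2_eq_iff: "A = B \<longleftrightarrow> A$1$1 = B$1$1 \<and> A$1$2 = B$1$2 \<and> A$2$1 = B$2$1 \<and> A$2$2 = B$2$2"
  for A B :: "'a^2^2"
  by (auto simp: vec_eq_iff forall_2)

lemma det_mat2 [simp]: "det (mat2 a b c d) = a * d - b * c" for a :: "'a::comm_ring_1"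
  by (simp add: det_2)

lemma mat2_mult: "mat2 a b c d ** mat2 a' b' c' d' =
    mat2 (a * a' + b * c') (a * b' + b * d') (c * a' + d * c') (c * b' + d * d')" for a :: "'a::comm_ring_1"
  by (simp add: mat2_eq_iff matrix_matrix_mult_def sum_2)

lemma mat2_one: "mat 1 = mat2 1 0 0 (1 :: 'a::comm_ring_1)"
  by (simp add: mat2_eq_iff mat_def)

lemma matrix_scale_mat2: "matrix_scale h (mat2 a b c d) = mat2 (h * a) (h * b) (h * c) (h * d)"
  by (simp add: mat2_eq_iff map_matrix_def)

lemma mat2_has_derivative:
  fixes p q r s :: "complex \<Rightarrow> complex"
  assumes "(p has_field_derivative p') (at x within S)" "(q has_field_derivative q') (at x within S)"
    "(r has_field_derivative r') (at x within S)" "(s has_field_derivative s') (at x within S)"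
  shows "((\<lambda>z. mat2 (p z) (q z) (r z) (s z)) has_derivative (\<lambda>h. matrix_scale h (mat2 p' q' r' s'))) (at x within S)"
proof -
  have lin: "linear (\<lambda>(a, b, c, d). mat2 a b c d :: complex^2^2)"
    by (intro linearI) (auto simp: mat2_eq_iff)
  have "((\<lambda>z. (p z, q z, r z, s z)) has_derivative (\<lambda>h. (p' * h, q' * h, r' * h, s' * h))) (at x within S)"
    using assms unfolding has_field_derivative_def by (intro has_derivative_Pair)
  from bounded_linear.has_derivative[OF lin[THEN linear_conv_bounded_linear[THEN iffD1]] this]
  show ?thesis by (simp add: matrix_scale_mat2 mult.commute)
qed

abbreviation torus :: "complex \<Rightarrow> complex^2^2" where "torus a \<equiv> mat2 a 0 0 (1 / a)"

abbreviation weight_operator :: "(complex^2^2 \<Rightarrow> 'v::real_normed_vector \<Rightarrow> 'v) \<Rightarrow> 'v \<Rightarrow> 'v" where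
  "weight_operator \<rho> \<equiv> lie_differential \<rho> (mat2 1 0 0 (-1))"

text \<open>Only the linear representation is recorded here; compatibility with the bracket enters
  in \<open>framed_lie_forms\<close>.\<close>

locale sl2_representation = finite_basis sc B
  for sc :: "complex \<Rightarrow> 'v::real_normed_vector \<Rightarrow> 'v" and B +
  fixes \<rho> :: "complex^2^2 \<Rightarrow> 'v \<Rightarrow> 'v"
  assumes rho_mult: "det A = 1 \<Longrightarrow> det A' = 1 \<Longrightarrow> \<rho> (A ** A') v = \<rho> A (\<rho> A' v)"
    and rho_one: "\<rho> (mat 1) v = v"
    and rho_linear: "det A = 1 \<Longrightarrow> Vector_Spaces.linear sc sc (\<rho> A)"
    and rho_holomorphic: "holomorphic_map matrix_scale sc (\<lambda>A. \<rho> A v) {A. det A = 1}"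
begin

lemma rho_add: "det A = 1 \<Longrightarrow> \<rho> A (u + v) = \<rho> A u + \<rho> A v"
  using rho_linear[of A] by (simp add: Vector_Spaces.linear_iff)

lemma rho_scale: "det A = 1 \<Longrightarrow> \<rho> A (sc c v) = sc c (\<rho> A v)"
  using rho_linear[of A] by (simp add: Vector_Spaces.linear_iff)

lemma rho_zero: "det A = 1 \<Longrightarrow> \<rho> A 0 = 0"
  using rho_scale[of A 0 0] by simp

lemma rho_sum: "det A = 1 \<Longrightarrow> \<rho> A (sum f I) = (\<Sum>i\<in>I. \<rho> A (f i))"
  by (induction I rule: infinite_finite_induct) (auto simp: rho_add rho_zero)

lemma rho_bounded_linear: "det A = 1 \<Longrightarrow> bounded_linear (\<rho> A)"
  by (intro bounded_linear_of_linear rho_linear)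

lemma rho_mat2_mult:
  assumes "a * d - b * c = 1" "a' * d' - b' * c' = 1"
  shows "\<rho> (mat2 a b c d) (\<rho> (mat2 a' b' c' d') v) =
    \<rho> (mat2 (a * a' + b * c') (a * b' + b * d') (c * a' + d * c') (c * b' + d * d')) v"
  using rho_mult[of "mat2 a b c d" "mat2 a' b' c' d'" v] assms by (simp add: mat2_mult)

text \<open>The chain rule for a curve that stays in SL(2), where \<rho> is differentiable only
  within the group. Complex linearity of both derivatives makes the composition holomorphic.\<close>

lemma rho_curve_holomorphic:
  assumes "p holomorphic_on S" "q holomorphic_on S" "r holomorphic_on S" "s holomorphic_on S"
    and det: "\<And>x. x \<in> S \<Longrightarrow> p x * s x - q x * r x = 1"
  shows "holomorphic_map (*) sc (\<lambda>z. \<rho> (mat2 (p z) (q z) (r z) (s z)) v) S"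
  unfolding holomorphic_map_def
proof
  fix x assume x: "x \<in> S"
  from assms x obtain p' q' r' s' where d:
    "(p has_field_derivative p') (at x within S)" "(q has_field_derivative q') (at x within S)"
    "(r has_field_derivative r') (at x within S)" "(s has_field_derivative s') (at x within S)"
    unfolding holomorphic_on_def field_differentiable_def by metis
  define c where "c z = mat2 (p z) (q z) (r z) (s z)" for z
  have cS: "c ` S \<subseteq> {A. det A = 1}" using det by (auto simp: c_def)
  from rho_holomorphic[of v] cS x obtain D where D: "Vector_Spaces.linear matrix_scale sc D"
    "((\<lambda>A. \<rho> A v) has_derivative D) (at (c x) within {A. det A = 1})"
    unfolding holomorphic_map_def by blast
  interpret D: Vector_Spaces.linear matrix_scale sc D by fact
  have "((\<lambda>A. \<rho> A v) \<circ> c has_derivative (D \<circ> (\<lambda>h. matrix_scale h (mat2 p' q' r' s')))) (at x within S)"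
    by (rule diff_chain_within[OF mat2_has_derivative[OF d, folded c_def] has_derivative_subset[OF D(2) cS]])
  moreover have "Vector_Spaces.linear (*) sc (D \<circ> (\<lambda>h. matrix_scale h (mat2 p' q' r' s')))"
  proof (rule Vector_Spaces.linear_iff[THEN iffD2], intro conjI allI)
    show "vector_space ((*) :: complex \<Rightarrow> complex \<Rightarrow> complex)" by unfold_locales (auto simp: algebra_simps)
    show "vector_space sc" by unfold_locales
    fix a b :: complex
    have "matrix_scale (a + b) M = matrix_scale a M + matrix_scale b M"
      "matrix_scale (a * b) M = matrix_scale a (matrix_scale b M)" for M
      by (auto simp: mat2_eq_iff map_matrix_def algebra_simps)
    then show "(D \<circ> (\<lambda>h. matrix_scale h (mat2 p' q' r' s'))) (a + b) =
        (D \<circ> (\<lambda>h. matrix_scale h (mat2 p' q' r' s'))) a + (D \<circ> (\<lambda>h. matrix_scale h (mat2 p' q' r' s'))) b"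
      "(D \<circ> (\<lambda>h. matrix_scale h (mat2 p' q' r' s'))) (a * b) = sc a ((D \<circ> (\<lambda>h. matrix_scale h (mat2 p' q' r' s'))) b)"
      by (simp_all add: D.add D.scale)
  qed
  ultimately show "\<exists>D. Vector_Spaces.linear (*) sc D \<and> ((\<lambda>z. \<rho> (mat2 (p z) (q z) (r z) (s z)) v) has_derivative D) (at x within S)"
    unfolding c_def o_def by (intro exI conjI)
qed

text \<open>The derivative within SL(2) is not unique as an operator on all matrices, so the one
  picked by \<open>frechet_derivative\<close> need not be the complex linear one. Both give the
  derivative along the curve \<open>torus (exp z)\<close> by the chain rule, hence they agree on its
  tangent direction.\<close>

lemma torus_derivative_0:
  "((\<lambda>z. \<rho> (torus (exp z)) v) has_derivative (\<lambda>h. sc h (weight_operator \<rho> v))) (at 0)"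
proof -
  define S :: "(complex^2^2) set" where "S = {A. det A = 1}"
  define Z :: "complex^2^2" where "Z = mat2 1 0 0 (-1)"
  define c where "c = (\<lambda>z::complex. torus (exp z))"
  have c0: "c 0 = mat 1" by (simp add: c_def mat2_one)
  have cS: "c ` UNIV \<subseteq> S" by (auto simp: c_def S_def)
  have c': "(c has_derivative (\<lambda>h. matrix_scale h Z)) (at 0)"
    unfolding c_def Z_def
    by (rule mat2_has_derivative) (auto intro!: derivative_eq_intros)
  have one: "mat 1 \<in> S" by (simp add: S_def)
  from rho_holomorphic[of v] one obtain D where D: "Vector_Spaces.linear matrix_scale sc D"
    "((\<lambda>A. \<rho> A v) has_derivative D) (at (mat 1) within S)"
    unfolding holomorphic_map_def S_def by blast
  interpret D: Vector_Spaces.linear matrix_scale sc D by fact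
  have chain: "((\<lambda>z. \<rho> (c z) v) has_derivative (\<lambda>h. F (matrix_scale h Z))) (at 0)"
    if "((\<lambda>A. \<rho> A v) has_derivative F) (at (mat 1) within S)" for F
    using diff_chain_within[of c _ 0 UNIV "\<lambda>A. \<rho> A v" F, OF c'] has_derivative_subset[OF that cS]
    by (simp add: c0 o_def)
  have F: "((\<lambda>A. \<rho> A v) has_derivative frechet_derivative (\<lambda>A. \<rho> A v) (at (mat 1) within S)) (at (mat 1) within S)"
    using D(2) frechet_derivative_works differentiableI by blast
  have "(\<lambda>h. D (matrix_scale h Z)) = (\<lambda>h. frechet_derivative (\<lambda>A. \<rho> A v) (at (mat 1) within S) (matrix_scale h Z))"
    by (rule has_derivative_unique[OF chain[OF D(2)] chain[OF F]])
  from fun_cong[OF this, of 1] have "D Z = weight_operator \<rho> v"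
    by (simp add: lie_differential_def SL2_def S_def Z_def matrix_scale_mat2)
  moreover have "D (matrix_scale h Z) = sc h (D Z)" for h by (rule D.scale)
  ultimately show ?thesis using chain[OF D(2)] by (simp add: c_def)
qed

section \<open>The weight operator as generator of the torus action\<close>

lemma weight_operator_unique:
  "((\<lambda>z. \<rho> (torus (exp z)) v) has_derivative (\<lambda>h. sc h w)) (at 0) \<Longrightarrow> weight_operator \<rho> v = w"
  using fun_cong[OF has_derivative_unique[OF torus_derivative_0], of v "\<lambda>h. sc h w" 1] by simp

lemma weight_operator_add: "weight_operator \<rho> (u + v) = weight_operator \<rho> u + weight_operator \<rho> v"
proof (rule weight_operator_unique)
  show "((\<lambda>z. \<rho> (torus (exp z)) (u + v)) has_derivative (\<lambda>h. sc h (weight_operator \<rho> u + weight_operator \<rho> v))) (at 0)"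
    using has_derivative_add[OF torus_derivative_0[of u] torus_derivative_0[of v]]
    by (simp add: rho_add scale_right_distrib)
qed

lemma weight_operator_scale: "weight_operator \<rho> (sc c v) = sc c (weight_operator \<rho> v)"
proof (rule weight_operator_unique)
  have "((\<lambda>z. sc c (\<rho> (torus (exp z)) v)) has_derivative (\<lambda>h. sc c (sc h (weight_operator \<rho> v)))) (at 0)"
    by (rule bounded_linear.has_derivative[OF bounded_bilinear.bounded_linear_right[OF bounded_bilinear_scale] torus_derivative_0])
  then show "((\<lambda>z. \<rho> (torus (exp z)) (sc c v)) has_derivative (\<lambda>h. sc h (sc c (weight_operator \<rho> v)))) (at 0)"
    by (simp add: rho_scale mult.commute)
qed

lemma torus_derivative:
  "((\<lambda>z. \<rho> (torus (exp z)) v) has_derivative (\<lambda>h. sc h (\<rho> (torus (exp z)) (weight_operator \<rho> v)))) (at z)"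
proof -
  have "((\<lambda>h. \<rho> (torus (exp h)) v) has_derivative (\<lambda>h. sc h (weight_operator \<rho> v))) (at (z - z))"
    using torus_derivative_0 by simp
  moreover have "((\<lambda>x. x - z) has_derivative (\<lambda>h. h)) (at z)" by (auto intro!: derivative_eq_intros)
  ultimately have "((\<lambda>h. \<rho> (torus (exp h)) v) \<circ> (\<lambda>x. x - z) has_derivative (\<lambda>h. sc h (weight_operator \<rho> v)) \<circ> (\<lambda>h. h)) (at z)"
    by (intro diff_chain_at)
  then have "((\<lambda>x. \<rho> (torus (exp (x - z))) v) has_derivative (\<lambda>h. sc h (weight_operator \<rho> v))) (at z)"
    by (simp add: o_def)
  then have "((\<lambda>x. \<rho> (torus (exp z)) (\<rho> (torus (exp (x - z))) v)) has_derivative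
      (\<lambda>h. \<rho> (torus (exp z)) (sc h (weight_operator \<rho> v)))) (at z)"
    by (intro bounded_linear.has_derivative[OF rho_bounded_linear]) simp_all
  moreover have "\<rho> (torus (exp z)) (\<rho> (torus (exp (x - z))) v) = \<rho> (torus (exp x)) v" for x
    by (subst rho_mat2_mult) (simp_all flip: exp_add)
  ultimately show ?thesis by (simp add: rho_scale)
qed

text \<open>Solves the differential equation of the torus action on a Jordan block of size at most
  two: \<open>exp (- l * z)\<close> times the orbit of w, minus z times u, has derivative 0 and so
  keeps its value at z = 0.\<close>

lemma torus_jordan_block:
  assumes w: "weight_operator \<rho> w = sc l w + u" and u: "weight_operator \<rho> u = sc l u"
  shows "\<rho> (torus (exp z)) w = sc (exp (l * z)) (w + sc z u)"
proof -
  \<comment> \<open>Stated for general w and u because it is used twice: first for u, with 0 in the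
    role of u, to learn the action on u; then for w itself.\<close>
  have step: "sc (exp (- l * z)) (\<rho> (torus (exp z)) w) - sc z u = w"
    if w: "weight_operator \<rho> w = sc l w + u" and T: "\<And>z. \<rho> (torus (exp z)) u = sc (exp (l * z)) u" for w u z
  proof -
    define g where "g z = sc (exp (- l * z)) (\<rho> (torus (exp z)) w) - sc z u" for z
    have "(g has_derivative (\<lambda>h. 0)) (at z)" for z
    proof -
      have e: "((\<lambda>z. exp (- l * z)) has_derivative (\<lambda>h. (- l * exp (- l * z)) * h)) (at z)"
        unfolding has_field_derivative_def[symmetric] by (auto intro!: derivative_eq_intros)
      have i: "((\<lambda>z. sc z u) has_derivative (\<lambda>h. sc h u)) (at z)"
        by (rule bounded_linear.has_derivative[OF bounded_bilinear.bounded_linear_left[OF bounded_bilinear_scale] has_derivative_ident])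
      have "(g has_derivative (\<lambda>h. sc (exp (- l * z)) (sc h (\<rho> (torus (exp z)) (weight_operator \<rho> w)))
          + sc ((- l * exp (- l * z)) * h) (\<rho> (torus (exp z)) w) - sc h u)) (at z)"
        unfolding g_def
        by (rule has_derivative_diff[OF bounded_bilinear.FDERIV[OF bounded_bilinear_scale e torus_derivative] i])
      moreover have "sc (exp (- l * z)) (sc h (\<rho> (torus (exp z)) (weight_operator \<rho> w)))
          + sc ((- l * exp (- l * z)) * h) (\<rho> (torus (exp z)) w) - sc h u = 0" for h
        by (simp add: w rho_add rho_scale T scale_right_distrib mult.commute[of _ h] mult.assoc exp_minus flip: scale_left_distrib)
           (simp add: algebra_simps)
      ultimately show ?thesis by simp
    qed
    then have "g z = g 0" by (intro has_derivative_zero_unique[of UNIV g]) auto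
    then show ?thesis by (simp add: g_def rho_one flip: mat2_one)
  qed
  have flip: "\<rho> (torus (exp z)) w = sc (exp (l * z)) (w + sc z u)"
    if "sc (exp (- l * z)) (\<rho> (torus (exp z)) w) - sc z u = w" for w u z
  proof -
    have "sc (exp (- l * z)) (\<rho> (torus (exp z)) w) = w + sc z u" using that by (simp add: algebra_simps)
    then have "sc (exp (l * z)) (sc (exp (- l * z)) (\<rho> (torus (exp z)) w)) = sc (exp (l * z)) (w + sc z u)" by simp
    then show ?thesis by (simp flip: exp_add)
  qed
  have "\<rho> (torus (exp z)) u = sc (exp (l * z)) u" for z
    using flip[OF step[of u 0 z]] u by (simp add: rho_zero)
  from flip[OF step[OF w this]] show ?thesis .
qed

lemma torus_weight_vector:
  assumes "weight_operator \<rho> v = sc (of_int k) v" "a \<noteq> 0"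
  shows "\<rho> (torus a) v = sc (a powi k) v"
proof -
  have "\<rho> (torus (exp (Ln a))) v = sc (exp (of_int k * Ln a)) (v + sc (Ln a) 0)"
    by (rule torus_jordan_block) (use assms weight_operator_scale[of 0 0] in auto)
  moreover have "exp (of_int k * Ln a) = a powi k"
    using assms exp_power_int[of "Ln a" k] by (simp add: mult.commute)
  ultimately show ?thesis using assms by simp
qed

lemma weight_operator_zero: "weight_operator \<rho> 0 = 0"
  using weight_operator_scale[of 0 0] by simp

text \<open>Replaces the infinitesimal eigenvalue condition by one on group elements. These act by
  automorphisms, so the new condition is multiplicative under the bracket.\<close>

lemma weight_operator_eq_iff:
  "weight_operator \<rho> v = sc (of_int k) v \<longleftrightarrow> (\<forall>a. a \<noteq> 0 \<longrightarrow> \<rho> (torus a) v = sc (a powi k) v)"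
proof
  assume a: "\<forall>a. a \<noteq> 0 \<longrightarrow> \<rho> (torus a) v = sc (a powi k) v"
  show "weight_operator \<rho> v = sc (of_int k) v"
  proof (rule weight_operator_unique)
    have "((\<lambda>z. exp z powi k) has_field_derivative of_int k) (at (0::complex))"
      by (auto intro!: derivative_eq_intros)
    then have "((\<lambda>z. sc (exp z powi k) v) has_derivative (\<lambda>h. sc (of_int k * h) v)) (at 0)"
      unfolding has_field_derivative_def
      by (rule bounded_linear.has_derivative[OF bounded_bilinear.bounded_linear_left[OF bounded_bilinear_scale]])
    then show "((\<lambda>z. \<rho> (torus (exp z)) v) has_derivative (\<lambda>h. sc h (sc (of_int k) v))) (at 0)"
      using a by (simp add: mult.commute)
  qed
qed (use torus_weight_vector in auto)

abbreviation H where "H \<equiv> weight_operator \<rho>"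

section \<open>Diagonalisability of the weight operator with integral eigenvalues\<close>

definition weight_vectors :: "'v set" where
  "weight_vectors = {v. \<exists>k::int. H v = sc (of_int k) v}"

lemma H_sum: "H (sum f I) = (\<Sum>i\<in>I. H (f i))"
  by (induction I rule: infinite_finite_induct) (auto simp: weight_operator_add weight_operator_zero)

lemma H_neg: "H (- v) = - H v"
  using weight_operator_scale[of "-1" v] by simp

lemma H_diff: "H (u - v) = H u - H v"
  using weight_operator_add[of u "- v"] by (simp add: H_neg)

lemma span_weight_vectors_decomposition:
  assumes "u \<in> span weight_vectors"
  shows "\<exists>K uu. finite K \<and> (\<forall>k. k \<notin> K \<longrightarrow> uu k = 0) \<and> (\<forall>k::int. H (uu k) = sc (of_int k) (uu k)) \<and> u = (\<Sum>k\<in>K. uu k)"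
  using assms
proof (induction rule: span_induct_alt)
  case base
  show ?case by (intro exI[of _ "{}"] exI[of _ "\<lambda>_. 0"]) (simp add: weight_operator_zero)
next
  case (step c x y)
  from step.IH obtain K uu where 1: "finite K" "\<forall>k. k \<notin> K \<longrightarrow> uu k = 0" "\<forall>k. H (uu k) = sc (of_int k) (uu k)" "y = (\<Sum>k\<in>K. uu k)"
    by (elim exE conjE)
  obtain k0 where k0: "H x = sc (of_int k0) x" using step by (auto simp: weight_vectors_def)
  define vv where "vv k = (if k = k0 then sc c x else 0) + uu k" for k
  have "(\<Sum>k\<in>insert k0 K. vv k) = sc c x + (\<Sum>k\<in>insert k0 K. uu k)"
    using 1 by (simp add: vv_def sum.distrib)
  also have "(\<Sum>k\<in>insert k0 K. uu k) = y"
    using 1 by (auto simp: insert_absorb sum.insert_if)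
  finally have "sc c x + y = (\<Sum>k\<in>insert k0 K. vv k)" ..
  moreover have "H (vv k) = sc (of_int k) (vv k)" for k
    using 1 k0 by (auto simp: vv_def weight_operator_add weight_operator_scale weight_operator_zero scale_right_distrib mult.commute)
  moreover have "k \<notin> insert k0 K \<Longrightarrow> vv k = 0" for k using 1 by (auto simp: vv_def)
  ultimately show ?case using 1 by (intro exI[of _ "insert k0 K"] exI[of _ vv]) auto
qed

text \<open>Because \<open>exp (2 \<pi> i H) = 1\<close>, the operator H has integral eigenvalues and no nontrivial Jordan blocks.\<close>
lemma weight_vectors_step:
  assumes "H w - sc l w \<in> span weight_vectors"
  shows "w \<in> span weight_vectors"
proof -
  from span_weight_vectors_decomposition[OF assms] obtain K uu
    where uu: "finite K" "\<forall>k. k \<notin> K \<longrightarrow> uu k = 0" "\<forall>k. H (uu k) = sc (of_int k) (uu k)"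
      "H w - sc l w = (\<Sum>k\<in>K. uu k)"
    by (elim exE conjE)
  define K' where "K' = {k\<in>K. of_int k \<noteq> l}"
  \<comment> \<open>On eigenvectors of eigenvalue k other than l the operator H - l is division-free
    invertible up to the scalar k - l. So v is a preimage of that part of
    \<open>H w - sc l w\<close>, and w - v satisfies the Jordan block equation with u in the
    eigenspace of l.\<close>
  define v where "v = (\<Sum>k\<in>K'. sc (1 / (of_int k - l)) (uu k))"
  define u where "u = (\<Sum>k\<in>K - K'. uu k)"
  have fK': "finite K'" using uu(1) by (simp add: K'_def)
  have uuW: "uu k \<in> span weight_vectors" for k
    using uu(3) by (intro span_base) (auto simp: weight_vectors_def)
  have vW: "v \<in> span weight_vectors"
    unfolding v_def by (intro span_sum span_scale uuW)
  have "H v - sc l v = (\<Sum>k\<in>K'. sc (of_int k) (sc (1 / (of_int k - l)) (uu k)) - sc l (sc (1 / (of_int k - l)) (uu k)))"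
    by (simp add: v_def H_sum weight_operator_scale uu(3) scale_sum_right sum_subtractf mult.commute)
  also have "\<dots> = (\<Sum>k\<in>K'. uu k)"
  proof (rule sum.cong)
    fix k assume "k \<in> K'"
    then have "of_int k - l \<noteq> 0" by (simp add: K'_def)
    then show "sc (of_int k) (sc (1 / (of_int k - l)) (uu k)) - sc l (sc (1 / (of_int k - l)) (uu k)) = uu k"
      by (simp flip: scale_left_diff_distrib diff_divide_distrib)
  qed simp
  finally have Hv: "H v - sc l v = (\<Sum>k\<in>K'. uu k)" .
  have "(\<Sum>k\<in>K. uu k) = (\<Sum>k\<in>K'. uu k) + u"
  proof -
    have "K' \<subseteq> K" by (auto simp: K'_def)
    from sum.subset_diff[OF this uu(1), of uu] show ?thesis unfolding u_def by (simp only: add.commute)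
  qed
  with uu(4) Hv have w: "H (w - v) = sc l (w - v) + u"
    by (simp add: H_diff scale_right_diff_distrib algebra_simps)
  have Hu: "H u = sc l u"
    unfolding u_def H_sum scale_sum_right by (rule sum.cong) (use uu(3) in \<open>auto simp: K'_def\<close>)
  \<comment> \<open>At z = 2 pi i the torus element is the identity. If l is an integer the
    exponential factor is 1 and u must vanish, so w - v is a weight vector. Otherwise u is an empty
    sum, the factor is not 1, and w - v must vanish.\<close>
  have "\<rho> (torus (exp (2 * of_real pi * \<i>))) (w - v) = sc (exp (l * (2 * of_real pi * \<i>))) ((w - v) + sc (2 * of_real pi * \<i>) u)"
    by (rule torus_jordan_block[OF w Hu])
  then have eq: "w - v = sc (exp (l * (2 * of_real pi * \<i>))) ((w - v) + sc (2 * of_real pi * \<i>) u)"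
    by (simp add: rho_one flip: mat2_one)
  have "w - v \<in> span weight_vectors"
  proof (cases "\<exists>k::int. l = of_int k")
    case True
    then obtain k where l: "l = of_int k" by blast
    have "exp (l * (2 * of_real pi * \<i>)) = 1" by (auto simp: exp_eq_1 l)
    with eq have "sc (2 * of_real pi * \<i>) u = 0" by simp
    then have "u = 0" by simp
    with w l show ?thesis by (intro span_base) (auto simp: weight_vectors_def)
  next
    case False
    then have KK: "K - K' = {}" by (auto simp: K'_def)
    have u0: "u = 0" unfolding u_def KK by simp
    have "exp (l * (2 * of_real pi * \<i>)) \<noteq> 1"
    proof
      assume "exp (l * (2 * of_real pi * \<i>)) = 1"
      then obtain n :: int where "Im l = 0" "Re l * (2 * pi) = of_int (2 * n) * pi" by (auto simp: exp_eq_1)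
      then have "l = of_int n" by (auto simp: complex_eq_iff)
      with False show False by blast
    qed
    moreover have "sc (1 - exp (l * (2 * of_real pi * \<i>))) (w - v) = 0"
      using eq u0 by (simp add: scale_left_diff_distrib)
    ultimately have "w - v = 0" by simp
    then show ?thesis by (simp add: span_zero)
  qed
  from span_add[OF this vW] show ?thesis by simp
qed

definition poly_op :: "complex poly \<Rightarrow> 'v \<Rightarrow> 'v" where
  "poly_op p w = (\<Sum>i\<le>Polynomial.degree p. sc (Polynomial.coeff p i) ((H ^^ i) w))"

lemma poly_op_altdef: "Polynomial.degree p \<le> n \<Longrightarrow> poly_op p w = (\<Sum>i\<le>n. sc (Polynomial.coeff p i) ((H ^^ i) w))"
  unfolding poly_op_def by (intro sum.mono_neutral_left) (auto simp: coeff_eq_0)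

lemma funpow_H_diff: "(H ^^ i) (u - v) = (H ^^ i) u - (H ^^ i) v"
  by (induction i) (auto simp: H_diff)

lemma funpow_H_scale: "(H ^^ i) (sc c v) = sc c ((H ^^ i) v)"
  by (induction i) (auto simp: weight_operator_scale)

lemma poly_op_linear_factor: "poly_op ([:- l, 1:] * q) w = poly_op q (H w - sc l w)"
proof -
  let ?n = "Polynomial.degree q"
  have "Polynomial.degree ([:- l, 1:] * q) \<le> Suc ?n" by (rule order_trans[OF degree_mult_le]) simp
  then have "poly_op ([:- l, 1:] * q) w = (\<Sum>i\<le>Suc ?n. sc (Polynomial.coeff ([:- l, 1:] * q) i) ((H ^^ i) w))"
    by (rule poly_op_altdef)
  also have "\<dots> = (\<Sum>i\<le>Suc ?n. sc (Polynomial.coeff (pCons 0 q) i) ((H ^^ i) w)) - (\<Sum>i\<le>Suc ?n. sc (l * Polynomial.coeff q i) ((H ^^ i) w))"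
    by (simp add: scale_left_distrib scale_left_diff_distrib sum.distrib sum_subtractf algebra_simps)
  also have "(\<Sum>i\<le>Suc ?n. sc (Polynomial.coeff (pCons 0 q) i) ((H ^^ i) w)) = (\<Sum>i\<le>?n. sc (Polynomial.coeff q i) ((H ^^ i) (H w)))"
    by (subst sum.atMost_Suc_shift) (simp add: funpow_swap1)
  also have "(\<Sum>i\<le>Suc ?n. sc (l * Polynomial.coeff q i) ((H ^^ i) w)) = (\<Sum>i\<le>?n. sc (Polynomial.coeff q i) ((H ^^ i) (sc l w)))"
    by (simp add: funpow_H_scale coeff_eq_0 mult.commute)
  finally show ?thesis
    by (simp add: poly_op_def funpow_H_diff scale_right_diff_distrib sum_subtractf)
qed

text \<open>Over the complex numbers p splits off a linear factor X - l. The cofactor annihilates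
  \<open>H w - sc l w\<close>, which lies in the span by induction on the degree, and
  \<open>weight_vectors_step\<close> goes back from there to w.\<close>

lemma annihilated_in_span:
  "p \<noteq> 0 \<Longrightarrow> poly_op p w = 0 \<Longrightarrow> w \<in> span weight_vectors"
proof (induction "Polynomial.degree p" arbitrary: p w)
  case 0
  then obtain a where "p = [:a:]" "a \<noteq> 0" by (metis degree_eq_zeroE pCons_eq_0_iff)
  with 0 have "w = 0" by (simp add: poly_op_def)
  then show ?case by (simp add: span_zero)
next
  case (Suc n)
  have "\<not> constant (poly p)" using Suc.hyps(2) by (simp add: constant_degree)
  from Fundamental_Theorem_Algebra.fundamental_theorem_of_algebra[OF this] obtain l where "poly p l = 0" ..
  then have "[:- l, 1:] dvd p" by (rule poly_eq_0_iff_dvd[THEN iffD1])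
  then obtain q where q: "p = [:- l, 1:] * q" by (elim dvdE)
  with Suc.prems(1) have q0: "q \<noteq> 0" by auto
  then have "Polynomial.degree p = Suc (Polynomial.degree q)" unfolding q using q0 by (subst degree_mult_eq) simp_all
  then have "n = Polynomial.degree q" using Suc.hyps(2) by simp
  moreover have "poly_op q (H w - sc l w) = 0" using Suc.prems(2) unfolding q by (simp only: poly_op_linear_factor)
  ultimately have "H w - sc l w \<in> span weight_vectors" using q0 by (intro Suc.hyps(1)[of q])
  then show ?case by (rule weight_vectors_step)
qed

text \<open>In finite dimension the iterates of H on w satisfy a linear relation, that is, some
  nonzero polynomial in H annihilates w.\<close>

lemma span_weight_vectors: "span weight_vectors = UNIV"
proof -
  have "w \<in> span weight_vectors" for w
  proof (cases "\<exists>i j. i < j \<and> (H ^^ i) w = (H ^^ j) w")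
    case True
    then obtain i j where ij: "i < j" "(H ^^ i) w = (H ^^ j) w" by blast
    \<comment> \<open>Coinciding iterates are treated apart, with X^j - X^i: the dimension count in
      the other case concerns the set of iterates and needs them to be distinct.\<close>
    define p :: "complex poly" where "p = Polynomial.monom 1 j - Polynomial.monom 1 i"
    have c: "Polynomial.coeff p k = (if k = j then 1 else 0) - (if k = i then 1 else 0)" for k by (simp add: p_def)
    have "Polynomial.degree p \<le> j" unfolding p_def using ij by (intro degree_diff_le) (auto simp: degree_monom_eq)
    then have "poly_op p w = (\<Sum>k\<le>j. sc (Polynomial.coeff p k) ((H ^^ k) w))" by (rule poly_op_altdef)
    also have "\<dots> = (\<Sum>k\<le>j. (if k = j then (H ^^ k) w else 0) - (if k = i then (H ^^ k) w else 0))"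
      by (rule sum.cong) (auto simp: c)
    also have "\<dots> = 0" using ij by (simp add: sum_subtractf)
    finally have "poly_op p w = 0" .
    moreover have "p \<noteq> 0" using c[of j] ij by auto
    ultimately show ?thesis by (rule annihilated_in_span[rotated])
  next
    case False
    let ?n = "card B"
    have inj: "inj_on (\<lambda>i. (H ^^ i) w) {..?n}"
      by (rule linorder_inj_onI) (use False in auto)
    have "dependent ((\<lambda>i. (H ^^ i) w) ` {..?n})"
    proof (rule ccontr)
      assume "\<not> dependent ((\<lambda>i. (H ^^ i) w) ` {..?n})"
      from independent_span_bound[OF finite_B this] have "card ((\<lambda>i. (H ^^ i) w) ` {..?n}) \<le> ?n"
        by (simp add: span_B)
      with inj show False by (simp add: card_image)
    qed
    then obtain c v where c: "v \<in> (\<lambda>i. (H ^^ i) w) ` {..?n}" "c v \<noteq> 0"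
      "(\<Sum>v\<in>(\<lambda>i. (H ^^ i) w) ` {..?n}. sc (c v) v) = 0"
      using dependent_finite[of "(\<lambda>i. (H ^^ i) w) ` {..?n}"] by auto
    define p where "p = (\<Sum>i\<le>?n. Polynomial.monom (c ((H ^^ i) w)) i)"
    have cp: "Polynomial.coeff p i = (if i \<le> ?n then c ((H ^^ i) w) else 0)" for i
      by (auto simp: p_def coeff_sum)
    have "Polynomial.degree p \<le> ?n" by (rule degree_le) (auto simp: cp)
    then have "poly_op p w = (\<Sum>i\<le>?n. sc (c ((H ^^ i) w)) ((H ^^ i) w))"
      by (subst poly_op_altdef) (auto simp: cp)
    also have "\<dots> = 0" using c(3) inj by (simp add: sum.reindex)
    finally have "poly_op p w = 0" .
    moreover have "p \<noteq> 0"
    proof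
      assume "p = 0"
      then have "c ((H ^^ i) w) = 0" if "i \<le> ?n" for i using cp[of i] that by simp
      with c(1,2) show False by auto
    qed
    ultimately show ?thesis by (rule annihilated_in_span[rotated])
  qed
  then show ?thesis by blast
qed

lemma weight_basis_exists:
  obtains B' wt where "finite_basis sc B'"
    "\<And>b a. b \<in> B' \<Longrightarrow> a \<noteq> 0 \<Longrightarrow> \<rho> (torus a) b = sc (a powi wt b) b"
proof -
  obtain B' where B': "B' \<subseteq> weight_vectors" "independent B'" "weight_vectors \<subseteq> span B'"
    using maximal_independent_subset by metis
  have sB: "span B' = UNIV" using span_mono[OF B'(3)] span_weight_vectors unfolding span_span by (simp add: top.extremum_unique)
  have fB: "finite B'" using independent_span_bound[OF finite_B B'(2)] by (simp add: span_B)
  have "\<forall>b\<in>B'. \<exists>k::int. H b = sc (of_int k) b" using B'(1) by (auto simp: weight_vectors_def)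
  then obtain wt :: "'v \<Rightarrow> int" where wt: "\<And>b. b \<in> B' \<Longrightarrow> H b = sc (of_int (wt b)) b" by metis
  show ?thesis
  proof (rule that)
    show "finite_basis sc B'" by unfold_locales (use B' sB fB in auto)
    show "\<rho> (torus a) b = sc (a powi wt b) b" if "b \<in> B'" "a \<noteq> 0" for b a
      using torus_weight_vector[OF wt] that by simp
  qed
qed

end

section \<open>Polynomial bounds for the torus and for unipotent elements\<close>

locale weighted_sl2_representation = sl2_representation sc B \<rho>
  for sc :: "complex \<Rightarrow> 'v::real_normed_vector \<Rightarrow> 'v" and B \<rho> +
  fixes wt :: "'v \<Rightarrow> int"
  assumes torus_basis: "b \<in> B \<Longrightarrow> a \<noteq> 0 \<Longrightarrow> \<rho> (torus a) b = sc (a powi wt b) b"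
begin

lemma torus_expansion:
  assumes "a \<noteq> 0"
  shows "\<rho> (torus a) v = (\<Sum>b\<in>B. sc (coord b v * a powi wt b) b)"
proof -
  have "\<rho> (torus a) v = (\<Sum>b\<in>B. sc (coord b v) (\<rho> (torus a) b))"
    by (rule linear_expansion[OF rho_linear]) (use assms in simp)
  also have "\<dots> = (\<Sum>b\<in>B. sc (coord b v * a powi wt b) b)"
    by (rule sum.cong) (simp_all add: torus_basis assms)
  finally show ?thesis .
qed

lemma torus_bound:
  obtains K N where "K > 0"
    "\<And>a r v. a \<noteq> 0 \<Longrightarrow> cmod a \<le> r \<Longrightarrow> 1 / cmod a \<le> r \<Longrightarrow> norm (\<rho> (torus a) v) \<le> K * r ^ N * norm v"
proof -
  obtain K where K: "K > 0" "\<And>b v. b \<in> B \<Longrightarrow> cmod (coord b v) \<le> K * norm v" using coord_bound by metis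
  \<comment> \<open>A single exponent that dominates |wt b| for all b. Negative weights are covered
    because r also bounds 1 / |a|.\<close>
  define N where "N = (\<Sum>b\<in>B. nat \<bar>wt b\<bar>)"
  have "norm (\<rho> (torus a) v) \<le> (\<Sum>b\<in>B. K * norm b + 1) * r ^ N * norm v"
    if a: "a \<noteq> 0" and r: "cmod a \<le> r" "1 / cmod a \<le> r" for a r and v :: 'v
  proof -
    have r1: "r \<ge> 1"
    proof (cases "cmod a \<ge> 1")
      case False
      with a have "1 \<le> 1 / cmod a" by (simp add: le_divide_eq)
      with r show ?thesis by linarith
    qed (use r in linarith)
    have p: "cmod a powi wt b \<le> r ^ N" if b: "b \<in> B" for b
    proof -
      have "cmod a powi wt b \<le> r ^ nat \<bar>wt b\<bar>"
      proof (cases "wt b \<ge> 0")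
        case True
        then show ?thesis using r by (simp add: power_int_def power_mono)
      next
        case False
        then show ?thesis using r by (simp add: power_int_def power_mono inverse_eq_divide)
      qed
      also have "\<dots> \<le> r ^ N" unfolding N_def using b finite_B r1
        by (intro power_increasing member_le_sum) auto
      finally show ?thesis .
    qed
    have "norm (\<rho> (torus a) v) \<le> (\<Sum>b\<in>B. cmod (coord b v) * cmod a powi wt b * norm b)"
      unfolding torus_expansion[OF a] by (rule order_trans[OF norm_sum]) (simp add: norm_scale norm_mult norm_power_int)
    also have "\<dots> \<le> (\<Sum>b\<in>B. (K * norm v) * r ^ N * norm b)"
      using p K r1 by (intro sum_mono mult_right_mono mult_mono) auto
    also have "\<dots> = (\<Sum>b\<in>B. K * norm b) * (r ^ N * norm v)"
      unfolding sum_distrib_right by (simp add: mult_ac)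
    also have "\<dots> \<le> (\<Sum>b\<in>B. K * norm b + 1) * (r ^ N * norm v)"
      using r1 by (intro mult_right_mono sum_mono) auto
    finally show ?thesis by (simp add: mult.assoc)
  qed
  note * = this
  show ?thesis
  \<comment> \<open>The final 1 makes the constant positive even if B is empty.\<close>
  proof (rule that[of "(\<Sum>b\<in>B. K * norm b + 1) + 1" N])
    have "0 \<le> (\<Sum>b\<in>B. K * norm b + 1)" using K by (intro sum_nonneg) (simp add: add_nonneg_nonneg)
    then show "(\<Sum>b\<in>B. K * norm b + 1) + 1 > 0" by simp
    fix a r and v :: 'v assume a: "a \<noteq> 0" "cmod a \<le> r" "1 / cmod a \<le> r"
    have "r \<ge> 0" using a(2) norm_ge_zero order_trans by blast
    then have "(\<Sum>b\<in>B. K * norm b + 1) * r ^ N * norm v \<le> ((\<Sum>b\<in>B. K * norm b + 1) + 1) * r ^ N * norm v"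
      by (intro mult_right_mono) auto
    with *[OF a, of v] show "norm (\<rho> (torus a) v) \<le> ((\<Sum>b\<in>B. K * norm b + 1) + 1) * r ^ N * norm v" by linarith
  qed
qed

text \<open>\<open>U t\<close> with t = c^2 is the conjugate of the fixed \<open>U 1\<close> by a
  torus element with entries c and 1/c, so the torus bound controls it when |t| \<ge> 1. For small t
  the entry 1/c is unbounded; there t is first moved by s = 1 or s = -1 to t + s of modulus at least
  1, at the cost of a fixed factor \<open>U (- s)\<close>. The function e covers upper and lower
  triangular U, for which the roles of c and 1/c are exchanged.\<close>

lemma unipotent_bound:
  assumes det: "\<And>t. det (U t) = 1" and add: "\<And>s t. U (s + t) = U s ** U t"
    and conj: "\<And>c. c \<noteq> 0 \<Longrightarrow> U (c\<^sup>2) = torus (e c) ** (U 1 ** torus (1 / e c))"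
    and e: "\<And>c. c \<noteq> 0 \<Longrightarrow> e c = c \<or> e c = 1 / c"
  obtains K N where "K > 0" "\<And>t v. norm (\<rho> (U t) v) \<le> K * (1 + cmod t) ^ N * norm v"
proof -
  obtain K N where K: "K > 0"
    "\<And>a r v. a \<noteq> 0 \<Longrightarrow> cmod a \<le> r \<Longrightarrow> 1 / cmod a \<le> r \<Longrightarrow> norm (\<rho> (torus a) v) \<le> K * r ^ N * norm v"
    using torus_bound by metis
  have "\<exists>M>0. \<forall>v. norm (\<rho> (U s) v) \<le> norm v * M" for s
    using bounded_linear.pos_bounded[OF rho_bounded_linear[OF det]] by blast
  then obtain M where M: "\<And>s. M s > 0" "\<And>s v. norm (\<rho> (U s) v) \<le> norm v * M s" by metis
  have large: "norm (\<rho> (U t) v) \<le> K * K * M 1 * cmod t ^ (N + N) * norm v" if t: "cmod t \<ge> 1" for t v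
  proof -
    define c where "c = csqrt t"
    have c: "c\<^sup>2 = t" "c \<noteq> 0" using t by (auto simp: c_def)
    have c1: "cmod c \<ge> 1" using t by (simp add: c_def)
    have ct: "cmod c \<le> cmod t"
      using mult_mono[OF c1 order_refl, of "cmod c"] by (simp flip: c(1) add: norm_mult power2_eq_square)
    have c2: "1 / cmod c \<le> cmod t" using c1 by (intro order_trans[OF _ t], subst divide_le_eq_1_pos) linarith+
    have e0: "e c \<noteq> 0" and e1: "cmod (e c) \<le> cmod t" "1 / cmod (e c) \<le> cmod t"
      using e[OF c(2)] c ct c2 by (auto simp: norm_divide)
    have "\<rho> (U t) v = \<rho> (torus (e c)) (\<rho> (U 1) (\<rho> (torus (1 / e c)) v))"
      using conj[OF c(2)] c(1) e0 det by (simp add: rho_mult det_mul)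
    also have "norm \<dots> \<le> K * cmod t ^ N * norm (\<rho> (U 1) (\<rho> (torus (1 / e c)) v))"
      by (rule K(2)[OF e0 e1])
    also have "\<dots> \<le> K * cmod t ^ N * (norm (\<rho> (torus (1 / e c)) v) * M 1)"
      using K(1) M(2) by (intro mult_left_mono) auto
    also have "\<dots> \<le> K * cmod t ^ N * ((K * cmod t ^ N * norm v) * M 1)"
      using K(1) M(1)[of 1] e0 e1 by (intro mult_left_mono mult_right_mono K(2)) (auto simp: norm_divide)
    finally show ?thesis by (simp add: power_add mult_ac)
  qed
  define L where "L = K * K * M 1 * (M 1 + M (-1))"
  have L: "L > 0" using K(1) M(1)[of 1] M(1)[of "-1"] by (simp add: L_def)
  show ?thesis
  proof (rule that[OF L])
    fix t v
    obtain s :: complex where s: "s = 1 \<or> s = -1" "cmod (t + s) \<ge> 1"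
    proof (cases "Re t \<ge> 0")
      case True
      then have "cmod (t + 1) \<ge> 1" using abs_Re_le_cmod[of "t + 1"] by auto
      then show ?thesis using that[of 1] by simp
    next
      case False
      then have "cmod (t + (-1)) \<ge> 1" using abs_Re_le_cmod[of "t + (-1)"] by auto
      then show ?thesis using that[of "-1"] by simp
    qed
    have ts: "cmod (t + s) \<le> 1 + cmod t" using norm_triangle_ineq[of t s] s(1) by auto
    have "U t = U (t + s) ** U (- s)" by (simp flip: add)
    then have "\<rho> (U t) v = \<rho> (U (t + s)) (\<rho> (U (- s)) v)" by (simp add: rho_mult det)
    also have "norm \<dots> \<le> K * K * M 1 * cmod (t + s) ^ (N + N) * norm (\<rho> (U (- s)) v)" by (rule large[OF s(2)])
    also have "\<dots> \<le> K * K * M 1 * (1 + cmod t) ^ (N + N) * (norm v * (M 1 + M (-1)))"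
    proof -
      have "norm (\<rho> (U (- s)) v) \<le> norm v * M (- s)" by (rule M(2))
      also have "\<dots> \<le> norm v * (M 1 + M (-1))"
        using s(1) M(1)[of 1] M(1)[of "-1"] by (intro mult_left_mono) auto
      finally show ?thesis using ts K(1) M(1)[of 1]
        by (intro mult_mono power_mono mult_nonneg_nonneg) (auto intro: less_imp_le)
    qed
    finally show "norm (\<rho> (U t) v) \<le> L * (1 + cmod t) ^ (N + N) * norm v" by (simp add: L_def mult_ac)
  qed
qed

lemma upper_unipotent_bound:
  obtains K N where "K > 0" "\<And>t v. norm (\<rho> (mat2 1 t 0 1) v) \<le> K * (1 + cmod t) ^ N * norm v"
proof (rule unipotent_bound[of "\<lambda>t. mat2 1 t 0 1" "\<lambda>c. c"])
qed (auto simp: mat2_mult mat2_eq_iff power2_eq_square add.commute)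

lemma lower_unipotent_bound:
  obtains K N where "K > 0" "\<And>t v. norm (\<rho> (mat2 1 0 t 1) v) \<le> K * (1 + cmod t) ^ N * norm v"
proof (rule unipotent_bound[of "\<lambda>t. mat2 1 0 t 1" "\<lambda>c. 1 / c"])
qed (auto simp: mat2_mult mat2_eq_iff power2_eq_square add.commute)

end

section \<open>Moebius transformations and quasimodularity\<close>

lemma SL2_Z_iff: "\<gamma> \<in> carrier SL2_Z \<longleftrightarrow> \<gamma>$1$1 * \<gamma>$2$2 - \<gamma>$1$2 * \<gamma>$2$1 = 1"
  by (simp add: SL2_def det_2)

lemma upper_half_plane_iff [simp]: "\<tau> \<in> upper_half_plane \<longleftrightarrow> Im \<tau> > 0"
  by (simp add: upper_half_plane_def)

lemma automorphy_factor_nonzero: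
  assumes g: "\<gamma> \<in> carrier SL2_Z" and y: "Im \<tau> > 0"
  shows "automorphy_factor \<gamma> \<tau> \<noteq> 0"
proof
  assume "automorphy_factor \<gamma> \<tau> = 0"
  then have "\<gamma>$2$1 = 0" "\<gamma>$2$2 = 0" using y
    by (auto simp: automorphy_factor_def complex_eq_iff)
  with g show False by (simp add: SL2_Z_iff)
qed

lemma moebius_times_factor:
  assumes g: "\<gamma> \<in> carrier SL2_Z" and y: "Im \<tau> > 0"
  shows "moebius \<gamma> \<tau> * automorphy_factor \<gamma> \<tau> = of_int (\<gamma>$1$1) * \<tau> + of_int (\<gamma>$1$2)"
  using automorphy_factor_nonzero[OF assms] by (simp add: moebius_def)

lemma det_of_int:
  assumes g: "\<gamma> \<in> carrier SL2_Z"
  shows "of_int (\<gamma>$1$1) * of_int (\<gamma>$2$2) - of_int (\<gamma>$1$2) * of_int (\<gamma>$2$1) = (1 :: 'a::ring_1)"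
  using arg_cong[OF g[unfolded SL2_Z_iff], of "of_int :: int \<Rightarrow> 'a"] by simp

lemma Im_moebius:
  assumes g: "\<gamma> \<in> carrier SL2_Z" and y: "Im \<tau> > 0"
  shows "Im (moebius \<gamma> \<tau>) = Im \<tau> / (cmod (automorphy_factor \<gamma> \<tau>))\<^sup>2"
proof -
  have "Im (moebius \<gamma> \<tau>) = (of_int (\<gamma>$1$1) * of_int (\<gamma>$2$2) - of_int (\<gamma>$1$2) * of_int (\<gamma>$2$1)) * Im \<tau> / (cmod (automorphy_factor \<gamma> \<tau>))\<^sup>2"
    by (simp add: moebius_def Im_divide cmod_power2 automorphy_factor_def) (simp add: algebra_simps)
  also have "of_int (\<gamma>$1$1) * of_int (\<gamma>$2$2) - of_int (\<gamma>$1$2) * of_int (\<gamma>$2$1) = (1 :: real)"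
    by (rule det_of_int[OF g])
  finally show ?thesis by simp
qed

lemma moebius_upper_half_plane:
  assumes g: "\<gamma> \<in> carrier SL2_Z" and y: "Im \<tau> > 0"
  shows "Im (moebius \<gamma> \<tau>) > 0"
  using Im_moebius[OF assms] automorphy_factor_nonzero[OF assms] y by simp

lemma matrix_mult_nth2:
  fixes A B :: "'a::comm_ring_1^2^2"
  shows "(A ** B)$1$1 = A$1$1 * B$1$1 + A$1$2 * B$2$1" "(A ** B)$1$2 = A$1$1 * B$1$2 + A$1$2 * B$2$2"
    "(A ** B)$2$1 = A$2$1 * B$1$1 + A$2$2 * B$2$1" "(A ** B)$2$2 = A$2$1 * B$1$2 + A$2$2 * B$2$2"
  by (simp_all add: matrix_matrix_mult_def sum_2)

lemma SL2_mult_closed: "\<gamma> \<in> carrier SL2 \<Longrightarrow> \<delta> \<in> carrier SL2 \<Longrightarrow> \<gamma> ** \<delta> \<in> carrier SL2"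
  by (simp add: SL2_def det_mul)

lemma automorphy_factor_mult:
  assumes d: "\<delta> \<in> carrier SL2_Z" and y: "Im \<tau> > 0"
  shows "automorphy_factor (\<gamma> ** \<delta>) \<tau> = automorphy_factor \<gamma> (moebius \<delta> \<tau>) * automorphy_factor \<delta> \<tau>"
proof -
  have "automorphy_factor \<gamma> (moebius \<delta> \<tau>) * automorphy_factor \<delta> \<tau>
      = of_int (\<gamma>$2$1) * (moebius \<delta> \<tau> * automorphy_factor \<delta> \<tau>) + of_int (\<gamma>$2$2) * automorphy_factor \<delta> \<tau>"
    by (simp add: automorphy_factor_def[of \<gamma>] algebra_simps)
  also have "\<dots> = automorphy_factor (\<gamma> ** \<delta>) \<tau>"
    unfolding moebius_times_factor[OF assms] by (simp add: automorphy_factor_def matrix_mult_nth2 algebra_simps)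
  finally show ?thesis ..
qed

lemma moebius_mult:
  assumes g: "\<gamma> \<in> carrier SL2_Z" and d: "\<delta> \<in> carrier SL2_Z" and y: "Im \<tau> > 0"
  shows "moebius (\<gamma> ** \<delta>) \<tau> = moebius \<gamma> (moebius \<delta> \<tau>)"
proof -
  note yd = moebius_upper_half_plane[OF d y]
  have "moebius \<gamma> (moebius \<delta> \<tau>) * automorphy_factor (\<gamma> ** \<delta>) \<tau>
     = (moebius \<gamma> (moebius \<delta> \<tau>) * automorphy_factor \<gamma> (moebius \<delta> \<tau>)) * automorphy_factor \<delta> \<tau>"
    by (simp add: automorphy_factor_mult[OF d y])
  also have "\<dots> = of_int (\<gamma>$1$1) * (moebius \<delta> \<tau> * automorphy_factor \<delta> \<tau>) + of_int (\<gamma>$1$2) * automorphy_factor \<delta> \<tau>"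
    unfolding moebius_times_factor[OF g yd] by (simp add: algebra_simps)
  also have "\<dots> = of_int ((\<gamma> ** \<delta>)$1$1) * \<tau> + of_int ((\<gamma> ** \<delta>)$1$2)"
    unfolding moebius_times_factor[OF d y] by (simp add: automorphy_factor_def matrix_mult_nth2 algebra_simps)
  also have "\<dots> = moebius (\<gamma> ** \<delta>) \<tau> * automorphy_factor (\<gamma> ** \<delta>) \<tau>"
    by (rule moebius_times_factor[OF SL2_mult_closed[OF g d] y, symmetric])
  finally show ?thesis using automorphy_factor_nonzero[OF SL2_mult_closed[OF g d] y] by simp
qed

lemma moebius_one: "moebius (mat 1) \<tau> = \<tau>" "automorphy_factor (mat 1) \<tau> = 1"
  by (simp_all add: moebius_def automorphy_factor_def mat_def)

definition adjugate2 :: "'a::comm_ring_1^2^2 \<Rightarrow> 'a^2^2" where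
  "adjugate2 A = mat2 (A$2$2) (- A$1$2) (- A$2$1) (A$1$1)"

lemma det_adjugate2: "det (adjugate2 A) = det A"
  by (simp add: adjugate2_def det_2 algebra_simps)

lemma adjugate2_mult:
  assumes "det A = 1" shows "A ** adjugate2 A = mat 1" "adjugate2 A ** A = mat 1"
  using assms by (simp_all add: mat2_eq_iff matrix_mult_nth2 adjugate2_def det_2 mat_def algebra_simps)

lemma adjugate2_SL2: "A \<in> carrier SL2 \<Longrightarrow> adjugate2 A \<in> carrier SL2"
  by (simp add: SL2_def det_adjugate2)

lemma adjugate2_SL2_mult: "A \<in> carrier SL2 \<Longrightarrow> A ** adjugate2 A = mat 1"
  "A \<in> carrier SL2 \<Longrightarrow> adjugate2 A ** A = mat 1"
  by (simp_all add: SL2_def adjugate2_mult)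

lemma automorphy_factor_adjugate2:
  assumes g: "\<gamma> \<in> carrier SL2_Z" and y: "Im \<tau> > 0"
  shows "automorphy_factor (adjugate2 \<gamma>) (moebius \<gamma> \<tau>) * automorphy_factor \<gamma> \<tau> = 1"
  using automorphy_factor_mult[OF g y, of "adjugate2 \<gamma>"] by (simp add: adjugate2_SL2_mult[OF g] moebius_one)

text \<open>The transformation behaviour of \<open>E\<^sub>2\<close>, normalised so that the anomaly is \<open>c (c \<tau> + d)\<close>.\<close>
definition quasimodular :: "(complex \<Rightarrow> complex) \<Rightarrow> int^2^2 \<Rightarrow> bool" where
  "quasimodular \<phi> \<gamma> \<longleftrightarrow> (\<forall>\<tau>. Im \<tau> > 0 \<longrightarrow> \<phi> (moebius \<gamma> \<tau>) =
     (automorphy_factor \<gamma> \<tau>)\<^sup>2 * \<phi> \<tau> + of_int (\<gamma>$2$1) * automorphy_factor \<gamma> \<tau>)"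

text \<open>The anomaly is a cocycle: it reproduces itself under composition because the lower left
  entries satisfy the relation proved in the middle.\<close>

lemma quasimodular_mult:
  assumes g: "\<gamma> \<in> carrier SL2_Z" and d: "\<delta> \<in> carrier SL2_Z"
    and "quasimodular \<phi> \<gamma>" "quasimodular \<phi> \<delta>"
  shows "quasimodular \<phi> (\<gamma> ** \<delta>)"
  unfolding quasimodular_def
proof (intro allI impI)
  fix \<tau> :: complex assume y: "Im \<tau> > 0"
  define jd where "jd = automorphy_factor \<delta> \<tau>"
  define jg where "jg = automorphy_factor \<gamma> (moebius \<delta> \<tau>)"
  have "\<phi> (moebius (\<gamma> ** \<delta>) \<tau>) = jg\<^sup>2 * (jd\<^sup>2 * \<phi> \<tau> + of_int (\<delta>$2$1) * jd) + of_int (\<gamma>$2$1) * jg"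
    using assms y moebius_upper_half_plane[OF d y]
    by (simp add: moebius_mult quasimodular_def jd_def jg_def)
  also have "\<dots> = (jg * jd)\<^sup>2 * \<phi> \<tau> + jg * (jg * jd * of_int (\<delta>$2$1) + of_int (\<gamma>$2$1))"
    by (simp add: power2_eq_square algebra_simps)
  \<comment> \<open>Here jg * jd is the factor of the product, and the determinant of \<delta>
    enters through \<open>e\<close>, which replaces 1 + b c by a d.\<close>
  also have "jg * jd * of_int (\<delta>$2$1) + of_int (\<gamma>$2$1) = of_int ((\<gamma> ** \<delta>)$2$1) * jd"
  proof -
    have e: "of_int (\<delta>$1$1) * of_int (\<delta>$2$2) = (1 + of_int (\<delta>$1$2) * of_int (\<delta>$2$1) :: complex)"
      using det_of_int[OF d, where 'a=complex] by (simp add: algebra_simps)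
    have "jg * jd = automorphy_factor (\<gamma> ** \<delta>) \<tau>" by (simp add: jg_def jd_def automorphy_factor_mult[OF d y])
    also have "\<dots> * of_int (\<delta>$2$1) + of_int (\<gamma>$2$1) =
        of_int (\<gamma>$2$1) * (1 + of_int (\<delta>$1$2) * of_int (\<delta>$2$1)) + of_int (\<gamma>$2$1) * of_int (\<delta>$1$1) * of_int (\<delta>$2$1) * \<tau>
        + of_int (\<gamma>$2$2) * of_int (\<delta>$2$1) * jd"
      by (simp add: automorphy_factor_def matrix_mult_nth2 jd_def algebra_simps)
    also have "\<dots> = of_int ((\<gamma> ** \<delta>)$2$1) * jd"
      unfolding e[symmetric] by (simp add: automorphy_factor_def matrix_mult_nth2 jd_def algebra_simps)
    finally show ?thesis .
  qed
  finally show "\<phi> (moebius (\<gamma> ** \<delta>) \<tau>) = (automorphy_factor (\<gamma> ** \<delta>) \<tau>)\<^sup>2 * \<phi> \<tau>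
      + of_int ((\<gamma> ** \<delta>)$2$1) * automorphy_factor (\<gamma> ** \<delta>) \<tau>"
    by (simp add: automorphy_factor_mult[OF d y] jg_def jd_def mult_ac)
qed

lemma periodic_of_int:
  fixes \<phi> :: "complex \<Rightarrow> complex"
  assumes per: "\<And>\<tau>. Im \<tau> > 0 \<Longrightarrow> \<phi> (\<tau> + 1) = \<phi> \<tau>" and y: "Im \<tau> > 0"
  shows "\<phi> (\<tau> + of_int n) = \<phi> \<tau>"
proof -
  have nat: "\<phi> (\<sigma> + of_nat m) = \<phi> \<sigma>" if "Im \<sigma> > 0" for \<sigma> m
  proof (induction m)
    case (Suc m)
    then show ?case using per[of "\<sigma> + of_nat m"] that by (simp add: add_ac)
  qed simp
  show ?thesis
  proof (cases n rule: int_cases2)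
    case (nonneg m)
    then show ?thesis using nat[OF y] by simp
  next
    case (nonpos m)
    then show ?thesis using nat[of "\<tau> - of_nat m" m] y by simp
  qed
qed

text \<open>Generation of SL(2, Z) by translation and inversion, in the form of the Euclidean
  algorithm on the first column: each step lowers the absolute value of the lower left
  entry.\<close>

lemma quasimodular_all:
  assumes per: "\<And>\<tau>. Im \<tau> > 0 \<Longrightarrow> \<phi> (\<tau> + 1) = \<phi> \<tau>"
    and inv: "\<And>\<tau>. Im \<tau> > 0 \<Longrightarrow> \<phi> (- 1 / \<tau>) = \<tau>\<^sup>2 * \<phi> \<tau> + \<tau>"
    and g: "\<gamma> \<in> carrier SL2_Z"
  shows "quasimodular \<phi> \<gamma>"
  using g
proof (induction "nat \<bar>\<gamma>$2$1\<bar>" arbitrary: \<gamma> rule: less_induct)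
  case less
  have det: "\<gamma>$1$1 * \<gamma>$2$2 - \<gamma>$1$2 * \<gamma>$2$1 = 1" using less.prems by (simp add: SL2_Z_iff)
  show ?case
  proof (cases "\<gamma>$2$1 = 0")
    case True
    with det have "\<gamma>$1$1 * \<gamma>$2$2 = 1" by simp
    then have ad: "\<gamma>$1$1 = 1 \<and> \<gamma>$2$2 = 1 \<or> \<gamma>$1$1 = -1 \<and> \<gamma>$2$2 = -1" by (simp add: zmult_eq_1_iff)
    then have "moebius \<gamma> \<tau> = \<tau> + of_int (\<gamma>$2$2 * \<gamma>$1$2)" for \<tau>
      using True by (auto simp: moebius_def automorphy_factor_def)
    then have "\<phi> (moebius \<gamma> \<tau>) = \<phi> \<tau>" if "Im \<tau> > 0" for \<tau>
      using periodic_of_int[of \<phi> \<tau>, OF per that] by (simp only:)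
    then show ?thesis using ad True
      by (auto simp: quasimodular_def automorphy_factor_def)
  next
    case False
    define q where "q = \<gamma>$1$1 div \<gamma>$2$1"
    define r where "r = \<gamma>$1$1 mod \<gamma>$2$1"
    have a: "\<gamma>$1$1 = q * \<gamma>$2$1 + r" by (simp only: q_def r_def div_mult_mod_eq)
    have r: "nat \<bar>r\<bar> < nat \<bar>\<gamma>$2$1\<bar>" using False abs_mod_less[of "\<gamma>$2$1" "\<gamma>$1$1"] by (simp add: r_def)
    \<comment> \<open>Inversion followed by translation by q. The cofactor \<delta> has lower left
      entry -r, where r is the remainder of the division.\<close>
    define TS :: "int^2^2" where "TS = mat2 q (- 1) 1 0"
    define \<delta> where "\<delta> = mat2 (\<gamma>$2$1) (\<gamma>$2$2) (- r) (q * \<gamma>$2$2 - \<gamma>$1$2)"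
    have TS: "TS \<in> carrier SL2_Z" by (simp add: SL2_Z_iff TS_def)
    have "\<gamma> = TS ** \<delta>" by (simp add: mat2_eq_iff matrix_mult_nth2 TS_def \<delta>_def a)
    moreover have d: "\<delta> \<in> carrier SL2_Z"
      using det a by (simp add: SL2_Z_iff \<delta>_def algebra_simps)
    moreover have "quasimodular \<phi> \<delta>"
      using r by (intro less.hyps d) (simp add: \<delta>_def)
    moreover have "quasimodular \<phi> TS"
      unfolding quasimodular_def
    proof (intro allI impI)
      fix \<tau> :: complex assume y: "Im \<tau> > 0"
      have t0: "\<tau> \<noteq> 0" using y by auto
      have "Im (- 1 / \<tau>) > 0" using y t0 by (simp add: Im_divide flip: cmod_power2)
      then have "\<phi> (- 1 / \<tau> + of_int q) = \<phi> (- 1 / \<tau>)" using periodic_of_int[of \<phi> "- 1 / \<tau>", OF per] by blast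
      moreover have "moebius TS \<tau> = - 1 / \<tau> + of_int q"
        using t0 by (simp add: moebius_def automorphy_factor_def TS_def field_simps)
      ultimately show "\<phi> (moebius TS \<tau>) = (automorphy_factor TS \<tau>)\<^sup>2 * \<phi> \<tau> + of_int (TS$2$1) * automorphy_factor TS \<tau>"
        using inv[OF y] by (simp add: automorphy_factor_def TS_def)
    qed
    ultimately show ?thesis using quasimodular_mult[OF TS d] by simp
  qed
qed

section \<open>Growth at the cusps\<close>

text \<open>Exponents range over the natural numbers and \<open>growth_scale gr\<close> is multiplicative in them, so that
  both kinds of growth at the cusp that g moves to infinity are closed under products.\<close>

fun growth_scale :: "growth \<Rightarrow> nat \<Rightarrow> real \<Rightarrow> real" where
  "growth_scale Polynomial n r = r ^ n"
| "growth_scale Exponential n r = exp (real n * r)"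

lemma growth_scale_ge_1: "r \<ge> 1 \<Longrightarrow> growth_scale gr n r \<ge> 1"
  by (cases gr) auto

lemma growth_scale_add: "growth_scale gr (m + n) r = growth_scale gr m r * growth_scale gr n r"
  by (cases gr) (auto simp: power_add algebra_simps exp_add)

lemma growth_scale_mono: "r \<ge> 1 \<Longrightarrow> m \<le> n \<Longrightarrow> growth_scale gr m r \<le> growth_scale gr n r"
  using growth_scale_add[of gr m "n - m" r] growth_scale_ge_1[of r gr "n - m"] growth_scale_ge_1[of r gr m]
    mult_left_mono[of 1 "growth_scale gr (n - m) r" "growth_scale gr m r"] by simp

lemma power_le_growth_scale: "r \<ge> 1 \<Longrightarrow> r ^ n \<le> growth_scale gr n r"
proof (cases gr)
  case Exponential
  assume "r \<ge> 1"
  moreover have "r \<le> exp r" using exp_ge_add_one_self[of r] by linarith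
  ultimately have "r ^ n \<le> exp r ^ n" by (intro power_mono) auto
  also have "\<dots> = exp (real n * r)" by (simp add: exp_of_nat_mult)
  finally show ?thesis by (simp add: Exponential)
qed simp

text \<open>A dilation of the argument by A goes into the constant for polynomial growth and into
  the exponent for exponential growth. The bound allows for both at once.\<close>

lemma growth_scale_dilate:
  assumes "0 \<le> r" "r \<le> real A * r'" "r' \<ge> 1" "A \<ge> 1"
  shows "growth_scale gr n r \<le> real A ^ n * growth_scale gr (n * A) r'"
proof (cases gr)
  case Polynomial
  have "r ^ n \<le> (real A * r') ^ n" using assms by (intro power_mono) auto
  also have "\<dots> = real A ^ n * r' ^ n" by (rule power_mult_distrib)
  also have "\<dots> \<le> real A ^ n * r' ^ (n * A)"
    using assms by (intro mult_left_mono power_increasing) auto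
  finally show ?thesis by (simp add: Polynomial)
next
  case Exponential
  have "exp (real n * r) \<le> exp (real (n * A) * r')"
    using assms mult_left_mono[of r "real A * r'" "real n"] by (simp add: mult.assoc)
  also have "\<dots> \<le> real A ^ n * exp (real (n * A) * r')"
    using assms by simp
  finally show ?thesis by (simp add: Exponential)
qed

text \<open>Growth measured in the coordinate given by a matrix g instead of a cusp. K \<ge> 0
  allows the exponent to be enlarged freely, since Y \<ge> 1 keeps the coordinate of modulus at
  least 1.\<close>

definition tame :: "growth \<Rightarrow> int^2^2 \<Rightarrow> (complex \<Rightarrow> real) \<Rightarrow> bool" where
  "tame gr g F \<longleftrightarrow> (\<exists>K n Y. 0 \<le> K \<and> 1 \<le> Y \<and>
     (\<forall>\<tau>. Im \<tau> > 0 \<longrightarrow> Im (moebius g \<tau>) > Y \<longrightarrow> F \<tau> \<le> K * growth_scale gr n (cmod (moebius g \<tau>))))"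

lemma tameE:
  assumes "tame gr g F"
  obtains K n Y where "0 \<le> K" "1 \<le> Y"
    "\<And>\<tau>. Im \<tau> > 0 \<Longrightarrow> Im (moebius g \<tau>) > Y \<Longrightarrow> F \<tau> \<le> K * growth_scale gr n (cmod (moebius g \<tau>))"
proof -
  from assms obtain K n Y where K: "0 \<le> K" "1 \<le> Y"
    "\<forall>\<tau>. Im \<tau> > 0 \<longrightarrow> Im (moebius g \<tau>) > Y \<longrightarrow> F \<tau> \<le> K * growth_scale gr n (cmod (moebius g \<tau>))"
    unfolding tame_def by (elim exE conjE)
  show thesis by (rule that[OF K(1,2)]) (rule K(3)[rule_format])
qed

lemma tameI:
  assumes "0 \<le> K" "1 \<le> Y"
    "\<And>\<tau>. Im \<tau> > 0 \<Longrightarrow> Im (moebius g \<tau>) > Y \<Longrightarrow> F \<tau> \<le> K * growth_scale gr n (cmod (moebius g \<tau>))"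
  shows "tame gr g F"
  unfolding tame_def
  by (intro exI[of _ K] exI[of _ n] exI[of _ Y] conjI allI impI) (rule assms | assumption)+

lemma cmod_ge_1: "Im z > Y \<Longrightarrow> 1 \<le> Y \<Longrightarrow> 1 \<le> cmod z"
  using abs_Im_le_cmod[of z] by linarith

lemma tame_mono:
  assumes "tame gr g F" "\<And>\<tau>. Im \<tau> > 0 \<Longrightarrow> Im (moebius g \<tau>) > 1 \<Longrightarrow> G \<tau> \<le> F \<tau>"
  shows "tame gr g G"
proof -
  from assms(1) obtain K n Y where K: "0 \<le> K" "1 \<le> Y"
    "\<And>\<tau>. Im \<tau> > 0 \<Longrightarrow> Im (moebius g \<tau>) > Y \<Longrightarrow> F \<tau> \<le> K * growth_scale gr n (cmod (moebius g \<tau>))"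
    by (rule tameE) (rule that)
  have "G \<tau> \<le> K * growth_scale gr n (cmod (moebius g \<tau>))" if "Im \<tau> > 0" "Im (moebius g \<tau>) > Y" for \<tau>
    using assms(2)[of \<tau>] K(3)[OF that] that K(2) by linarith
  with K(1,2) show ?thesis by (rule tameI)
qed

lemma tame_add:
  assumes "tame gr g F" "tame gr g G" shows "tame gr g (\<lambda>\<tau>. F \<tau> + G \<tau>)"
proof -
  from assms(1) obtain K n Y where K: "0 \<le> K" "1 \<le> Y"
    "\<And>\<tau>. Im \<tau> > 0 \<Longrightarrow> Im (moebius g \<tau>) > Y \<Longrightarrow> F \<tau> \<le> K * growth_scale gr n (cmod (moebius g \<tau>))"
    by (rule tameE) (rule that)
  from assms(2) obtain K' n' Y' where K': "0 \<le> K'" "1 \<le> Y'"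
    "\<And>\<tau>. Im \<tau> > 0 \<Longrightarrow> Im (moebius g \<tau>) > Y' \<Longrightarrow> G \<tau> \<le> K' * growth_scale gr n' (cmod (moebius g \<tau>))"
    by (rule tameE) (rule that)
  have "F \<tau> + G \<tau> \<le> (K + K') * growth_scale gr (max n n') (cmod (moebius g \<tau>))"
    if y: "Im \<tau> > 0" "Im (moebius g \<tau>) > max Y Y'" for \<tau>
  proof -
    have r: "cmod (moebius g \<tau>) \<ge> 1" using cmod_ge_1[OF y(2)] K by simp
    have "F \<tau> \<le> K * growth_scale gr n (cmod (moebius g \<tau>))" using K(3) y by simp
    also have "\<dots> \<le> K * growth_scale gr (max n n') (cmod (moebius g \<tau>))"
      by (intro mult_left_mono growth_scale_mono r K) auto
    finally have 1: "F \<tau> \<le> K * growth_scale gr (max n n') (cmod (moebius g \<tau>))" .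
    have "G \<tau> \<le> K' * growth_scale gr n' (cmod (moebius g \<tau>))" using K'(3) y by simp
    also have "\<dots> \<le> K' * growth_scale gr (max n n') (cmod (moebius g \<tau>))"
      by (intro mult_left_mono growth_scale_mono r K') auto
    finally show ?thesis using 1 by (simp add: algebra_simps)
  qed
  with K(1,2) K'(1,2) show ?thesis by (intro tameI[where K="K + K'" and n="max n n'" and Y="max Y Y'"]) simp_all
qed

lemma tame_mult:
  assumes "tame gr g F" "tame gr g G" "\<And>\<tau>. Im \<tau> > 0 \<Longrightarrow> 0 \<le> F \<tau>" "\<And>\<tau>. Im \<tau> > 0 \<Longrightarrow> 0 \<le> G \<tau>"
  shows "tame gr g (\<lambda>\<tau>. F \<tau> * G \<tau>)"
proof -
  from assms(1) obtain K n Y where K: "0 \<le> K" "1 \<le> Y"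
    "\<And>\<tau>. Im \<tau> > 0 \<Longrightarrow> Im (moebius g \<tau>) > Y \<Longrightarrow> F \<tau> \<le> K * growth_scale gr n (cmod (moebius g \<tau>))"
    by (rule tameE) (rule that)
  from assms(2) obtain K' n' Y' where K': "0 \<le> K'" "1 \<le> Y'"
    "\<And>\<tau>. Im \<tau> > 0 \<Longrightarrow> Im (moebius g \<tau>) > Y' \<Longrightarrow> G \<tau> \<le> K' * growth_scale gr n' (cmod (moebius g \<tau>))"
    by (rule tameE) (rule that)
  have "F \<tau> * G \<tau> \<le> (K * K') * growth_scale gr (n + n') (cmod (moebius g \<tau>))"
    if y: "Im \<tau> > 0" "Im (moebius g \<tau>) > max Y Y'" for \<tau>
  proof -
    have r: "cmod (moebius g \<tau>) \<ge> 1" using cmod_ge_1[OF y(2)] K by simp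
    have "F \<tau> * G \<tau> \<le> (K * growth_scale gr n (cmod (moebius g \<tau>))) * (K' * growth_scale gr n' (cmod (moebius g \<tau>)))"
      using K K' y assms(3,4) growth_scale_ge_1[OF r, of gr n] by (intro mult_mono) auto
    then show ?thesis by (simp add: growth_scale_add mult_ac)
  qed
  with K(1,2) K'(1,2) show ?thesis by (intro tameI[where K="K * K'" and n="n + n'" and Y="max Y Y'"]) simp_all
qed

lemma tame_const: "tame gr g (\<lambda>_. c)"
  by (intro tameI[where K="\<bar>c\<bar>" and n=0 and Y=1]) (cases gr; simp)+

lemma tame_sum: "(\<And>i. i \<in> I \<Longrightarrow> tame gr g (F i)) \<Longrightarrow> tame gr g (\<lambda>\<tau>. \<Sum>i\<in>I. F i \<tau>)"
  by (induction I rule: infinite_finite_induct) (auto intro!: tame_add tame_const)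

lemma tame_moebius: "tame gr g (\<lambda>\<tau>. cmod (moebius g \<tau>) ^ n)"
  by (intro tameI[where K=1 and n=n and Y=1]) (simp_all add: power_le_growth_scale cmod_ge_1)

lemma tame_power:
  "tame gr g F \<Longrightarrow> (\<And>\<tau>. Im \<tau> > 0 \<Longrightarrow> 0 \<le> F \<tau>) \<Longrightarrow> tame gr g (\<lambda>\<tau>. F \<tau> ^ n)"
  by (induction n) (auto intro!: tame_mult tame_const)

lemma tame_translate:
  assumes F: "tame gr g F" and g': "\<And>\<tau>. Im \<tau> > 0 \<Longrightarrow> moebius g' \<tau> = moebius g \<tau> + of_int m"
  shows "tame gr g' F"
proof -
  from F obtain K n Y where K: "0 \<le> K" "1 \<le> Y"
    "\<And>\<tau>. Im \<tau> > 0 \<Longrightarrow> Im (moebius g \<tau>) > Y \<Longrightarrow> F \<tau> \<le> K * growth_scale gr n (cmod (moebius g \<tau>))"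
    by (rule tameE) (rule that)
  \<comment> \<open>For |z| \<ge> 1 translation by m multiplies the modulus by at most 1 +
    |m|.\<close>
  define A where "A = 1 + nat \<bar>m\<bar>"
  have "F \<tau> \<le> (K * real A ^ n) * growth_scale gr (n * A) (cmod (moebius g' \<tau>))"
    if y: "Im \<tau> > 0" "Im (moebius g' \<tau>) > Y" for \<tau>
  proof -
    have r: "cmod (moebius g' \<tau>) \<ge> 1" by (rule cmod_ge_1[OF y(2) K(2)])
    have "cmod (moebius g \<tau>) = cmod (moebius g' \<tau> - of_int m)" using g'[OF y(1)] by simp
    also have "\<dots> \<le> cmod (moebius g' \<tau>) + \<bar>of_int m\<bar>"
      using norm_triangle_ineq4[of "moebius g' \<tau>" "of_int m"] by simp
    also have "\<dots> \<le> real A * cmod (moebius g' \<tau>)"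
      using mult_left_mono[OF r, of "\<bar>real_of_int m\<bar>"] by (simp add: A_def algebra_simps)
    finally have le: "cmod (moebius g \<tau>) \<le> real A * cmod (moebius g' \<tau>)" .
    have "F \<tau> \<le> K * growth_scale gr n (cmod (moebius g \<tau>))" using K(3) y g' by simp
    also have "\<dots> \<le> K * (real A ^ n * growth_scale gr (n * A) (cmod (moebius g' \<tau>)))"
      by (intro mult_left_mono growth_scale_dilate K le r) (auto simp: A_def)
    finally show ?thesis by (simp add: mult.assoc)
  qed
  with K(1,2) show ?thesis by (intro tameI[where K="K * real A ^ n" and n="n * A" and Y="Y"]) simp_all
qed

text \<open>The bottom rows of g and g' annihilate the same cusp, so they are proportional and g'
  times the inverse of g is upper triangular. It acts as an integral translation, which makes the
  choice of g in the definition of growth immaterial.\<close>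

lemma tame_same_cusp:
  assumes g: "g \<in> carrier SL2_Z" "g' \<in> carrier SL2_Z"
    and s: "cusp_action g s = None" "cusp_action g' s = None" and F: "tame gr g F"
  shows "tame gr g' F"
proof -
  have cd: "g$2$1 * g'$2$2 = g'$2$1 * g$2$2"
  proof (cases s)
    case None
    then show ?thesis using s by (simp split: if_splits)
  next
    case (Some x)
    then have 1: "of_int (g$2$2) = - (of_int (g$2$1) * x)" "of_int (g'$2$2) = - (of_int (g'$2$1) * x)"
      using s by (auto split: if_splits simp: eq_neg_iff_add_eq_0 add.commute)
    have "(of_int (g$2$1 * g'$2$2) :: rat) = of_int (g'$2$1 * g$2$2)" by (simp add: 1)
    then show ?thesis by (simp only: of_int_eq_iff)
  qed
  define h where "h = g' ** adjugate2 g"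
  have h: "h \<in> carrier SL2_Z" unfolding h_def by (intro SL2_mult_closed adjugate2_SL2 g)
  have h21: "h$2$1 = 0" using cd by (simp add: h_def matrix_mult_nth2 adjugate2_def mult.commute)
  with h have "h$1$1 * h$2$2 = 1" by (simp add: SL2_Z_iff)
  then have ad: "h$1$1 = 1 \<and> h$2$2 = 1 \<or> h$1$1 = -1 \<and> h$2$2 = -1" by (simp add: zmult_eq_1_iff)
  have "h ** g = g'" by (simp add: h_def adjugate2_SL2_mult[OF g(1)] flip: matrix_mul_assoc)
  then have "moebius g' \<tau> = moebius g \<tau> + of_int (h$2$2 * h$1$2)" if "Im \<tau> > 0" for \<tau>
    using moebius_mult[OF h g(1) that] ad h21 by (auto simp: moebius_def[of h] automorphy_factor_def[of h])
  then show ?thesis by (rule tame_translate[OF F])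
qed

text \<open>In one direction the threshold is raised to at least 1 and the exponent rounded up to a
  natural number; in the other K is replaced by K + 1 to make the inequality strict.\<close>

lemma has_growth_at_iff_tame:
  "has_growth_at gr f s \<longleftrightarrow> (\<exists>g\<in>carrier SL2_Z. cusp_action g s = None \<and> tame gr g (\<lambda>\<tau>. norm (f \<tau>)))"
proof -
  have "(\<exists>C N Y. \<forall>\<tau>\<in>upper_half_plane. Im (moebius g \<tau>) > Y \<longrightarrow> norm (f \<tau>) < growth_bound gr C N (cmod (moebius g \<tau>)))
     \<longleftrightarrow> tame gr g (\<lambda>\<tau>. norm (f \<tau>))" (is "?L \<longleftrightarrow> ?R") for g
  proof
    assume ?L
    then obtain C N Y where "\<forall>\<tau>\<in>upper_half_plane. Im (moebius g \<tau>) > Y \<longrightarrow> norm (f \<tau>) < growth_bound gr C N (cmod (moebius g \<tau>))"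
      by (elim exE)
    then have C: "norm (f \<tau>) < growth_bound gr C N (cmod (moebius g \<tau>))" if "Im \<tau> > 0" "Im (moebius g \<tau>) > Y" for \<tau>
      using that by simp
    define n where "n = nat \<lceil>\<bar>N\<bar>\<rceil>"
    have n: "N \<le> real n" unfolding n_def by linarith
    have "norm (f \<tau>) \<le> \<bar>C\<bar> * growth_scale gr n (cmod (moebius g \<tau>))"
      if y: "Im \<tau> > 0" "Im (moebius g \<tau>) > max 1 Y" for \<tau>
    proof -
      define r where "r = cmod (moebius g \<tau>)"
      have r: "r \<ge> 1" unfolding r_def using y(2) by (intro cmod_ge_1[of 1]) auto
      have "norm (f \<tau>) \<le> growth_bound gr C N r" unfolding r_def using C y by (simp add: less_imp_le)
      also have "\<dots> \<le> \<bar>C\<bar> * growth_scale gr n r"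
      proof (cases gr)
        case Polynomial
        have "r powr N \<le> r powr real n" using r n by (intro powr_mono) auto
        also have "\<dots> = r ^ n" using r by (simp add: powr_realpow)
        finally have "\<bar>C\<bar> * r powr N \<le> \<bar>C\<bar> * r ^ n" by (intro mult_left_mono) auto
        moreover have "C * r powr N \<le> \<bar>C\<bar> * r powr N" by (intro mult_right_mono) auto
        ultimately show ?thesis by (simp add: Polynomial)
      next
        case Exponential
        have "exp (N * r) \<le> exp (real n * r)" using r n by simp
        then have "\<bar>C\<bar> * exp (N * r) \<le> \<bar>C\<bar> * exp (real n * r)" by (intro mult_left_mono) auto
        moreover have "C * exp (N * r) \<le> \<bar>C\<bar> * exp (N * r)" by (intro mult_right_mono) auto
        ultimately show ?thesis unfolding Exponential growth_bound.simps growth_scale.simps by linarith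
      qed
      finally show ?thesis by (simp add: r_def)
    qed
    then show ?R by (intro tameI[where K="\<bar>C\<bar>" and n=n and Y="max 1 Y"]) simp_all
  next
    assume ?R
    then obtain K n Y where K: "0 \<le> K" "1 \<le> Y"
      "\<And>\<tau>. Im \<tau> > 0 \<Longrightarrow> Im (moebius g \<tau>) > Y \<Longrightarrow> norm (f \<tau>) \<le> K * growth_scale gr n (cmod (moebius g \<tau>))"
      by (rule tameE) (rule that)
    have "norm (f \<tau>) < growth_bound gr (K + 1) (real n) (cmod (moebius g \<tau>))"
      if y: "Im \<tau> > 0" "Im (moebius g \<tau>) > Y" for \<tau>
    proof -
      define r where "r = cmod (moebius g \<tau>)"
      have r: "r \<ge> 1" unfolding r_def using y(2) K(2) by (rule cmod_ge_1)
      have "norm (f \<tau>) \<le> K * growth_scale gr n r" unfolding r_def by (rule K(3)[OF y])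
      also have "\<dots> < (K + 1) * growth_scale gr n r" using growth_scale_ge_1[OF r, of gr n] by (simp add: distrib_right)
      also have "\<dots> = growth_bound gr (K + 1) (real n) r" using r by (cases gr) (auto simp: powr_realpow)
      finally show ?thesis by (simp add: r_def)
    qed
    then show ?L by (intro exI[of _ "K + 1"] exI[of _ "real n"] exI[of _ Y]) auto
  qed
  then show ?thesis unfolding has_growth_at_def by simp
qed

lemma SL2_Z_to_infinity: "\<exists>g\<in>carrier SL2_Z. cusp_action g s = None"
proof (cases s)
  case None
  have "mat 1 \<in> carrier SL2_Z" by (simp add: SL2_def)
  with None show ?thesis by (intro bexI[of _ "mat 1"]) (auto simp: mat_def)
next
  case (Some x)
  obtain p q where pq: "quotient_of x = (p, q)" by force
  then have q: "q > 0" "coprime p q" "x = of_int p / of_int q"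
    using quotient_of_denom_pos quotient_of_coprime quotient_of_div by blast+
  obtain u v where uv: "u * p + v * q = 1"
    using bezout_int[of p q] q(2) by (auto simp: coprime_iff_gcd_eq_1)
  \<comment> \<open>The bottom row annihilates p / q, and the Bezout relation is the
    determinant.\<close>
  define g where "g = mat2 (- u) (- v) q (- p)"
  show ?thesis
  proof (intro bexI[of _ g])
    show "g \<in> carrier SL2_Z" using uv by (simp add: SL2_Z_iff g_def algebra_simps)
    show "cusp_action g s = None" using q by (simp add: Some g_def)
  qed
qed

lemma infinity_from_SL2_Z:
  assumes g: "g \<in> carrier SL2_Z" shows "\<exists>s. cusp_action g s = None"
proof (cases "g$2$1 = 0")
  case True
  then show ?thesis by (intro exI[of _ None]) simp
next
  case False
  then show ?thesis by (intro exI[of _ "Some (- of_int (g$2$2) / of_int (g$2$1))"]) simp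
qed

text \<open>Removes the cusps: every cusp is sent to infinity by some g, and every g sends some cusp
  there.\<close>

lemma all_growth_iff_tame:
  "(\<forall>s. has_growth_at gr f s) \<longleftrightarrow> (\<forall>g\<in>carrier SL2_Z. tame gr g (\<lambda>\<tau>. norm (f \<tau>)))"
  unfolding has_growth_at_iff_tame
  using SL2_Z_to_infinity infinity_from_SL2_Z tame_same_cusp by meson

section \<open>Operators of moderate growth\<close>

abbreviation complex_matrix :: "int^2^2 \<Rightarrow> complex^2^2" where "complex_matrix \<equiv> map_matrix of_int"

lemma complex_matrix_mat2: "complex_matrix \<gamma> = mat2 (of_int (\<gamma>$1$1)) (of_int (\<gamma>$1$2)) (of_int (\<gamma>$2$1)) (of_int (\<gamma>$2$2))"
  by (simp add: mat2_eq_iff map_matrix_def)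

lemma det_complex_matrix: "\<gamma> \<in> carrier SL2_Z \<Longrightarrow> det (complex_matrix \<gamma>) = 1"
  using det_of_int[where 'a=complex] by (simp add: complex_matrix_mat2)

lemma complex_matrix_mult: "complex_matrix (\<gamma> ** \<delta>) = complex_matrix \<gamma> ** complex_matrix \<delta>"
  by (simp add: mat2_eq_iff matrix_mult_nth2 map_matrix_def)

lemma complex_matrix_one: "complex_matrix (mat 1) = mat 1"
  by (simp add: mat2_eq_iff mat_def map_matrix_def)

text \<open>By the cocycle relation the factor of g at \<tau> is the reciprocal of c z + d, where z
  is the image of \<tau> under g and (c, d) is the bottom row of the inverse of g. As soon as Im z >
  1, this linear expression has modulus at least 1, and it grows at most linearly.\<close>

lemma tame_automorphy_factor:
  assumes g: "g \<in> carrier SL2_Z"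
  shows "tame gr g (\<lambda>\<tau>. cmod (automorphy_factor g \<tau>))" "tame gr g (\<lambda>\<tau>. 1 / cmod (automorphy_factor g \<tau>))"
proof -
  define c d where "c = adjugate2 g$2$1" and "d = adjugate2 g$2$2"
  have cd: "c \<noteq> 0 \<or> \<bar>d\<bar> = 1"
    using adjugate2_SL2[OF g] by (auto simp: SL2_Z_iff c_def d_def zmult_eq_1_iff)
  have inv: "cmod (of_int c * moebius g \<tau> + of_int d) * cmod (automorphy_factor g \<tau>) = 1"
    if "Im \<tau> > 0" for \<tau>
    using automorphy_factor_adjugate2[OF g that]
    by (simp add: automorphy_factor_def[of "adjugate2 g"] c_def d_def flip: norm_mult)
  have lower: "cmod (of_int c * \<sigma> + of_int d) \<ge> 1" if y: "Im \<sigma> > 1" for \<sigma>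
  proof (cases "c = 0")
    case False
    have "1 * 1 \<le> \<bar>real_of_int c\<bar> * \<bar>Im \<sigma>\<bar>" using False y by (intro mult_mono) auto
    also have "\<dots> \<le> cmod (of_int c * \<sigma> + of_int d)"
      using abs_Im_le_cmod[of "of_int c * \<sigma> + of_int d"] by (simp add: abs_mult)
    finally show ?thesis by simp
  qed (use cd in auto)
  show "tame gr g (\<lambda>\<tau>. cmod (automorphy_factor g \<tau>))"
  proof (rule tame_mono[OF tame_const[of gr g 1]])
    fix \<tau> assume y: "Im \<tau> > 0" "Im (moebius g \<tau>) > 1"
    show "cmod (automorphy_factor g \<tau>) \<le> 1"
      using mult_right_mono[OF lower[OF y(2)], of "cmod (automorphy_factor g \<tau>)"] inv[OF y(1)] by simp
  qed
  show "tame gr g (\<lambda>\<tau>. 1 / cmod (automorphy_factor g \<tau>))"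
  proof (rule tame_mono)
    show "tame gr g (\<lambda>\<tau>. \<bar>of_int c\<bar> * cmod (moebius g \<tau>) ^ 1 + \<bar>of_int d\<bar>)"
      by (intro tame_add tame_mult tame_const tame_moebius) auto
    fix \<tau> assume y: "Im \<tau> > 0" "Im (moebius g \<tau>) > 1"
    have "1 / cmod (automorphy_factor g \<tau>) = cmod (of_int c * moebius g \<tau> + of_int d)"
      using inv[OF y(1)] automorphy_factor_nonzero[OF g y(1)] by (simp add: field_simps)
    also have "\<dots> \<le> \<bar>of_int c\<bar> * cmod (moebius g \<tau>) + \<bar>of_int d\<bar>"
      using norm_triangle_ineq[of "of_int c * moebius g \<tau>" "of_int d"] by (simp add: norm_mult)
    finally show "1 / cmod (automorphy_factor g \<tau>) \<le> \<bar>of_int c\<bar> * cmod (moebius g \<tau>) ^ 1 + \<bar>of_int d\<bar>" by simp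
  qed
qed

context weighted_sl2_representation begin

text \<open>The bound F acts as an operator norm. Asking for one with each type of growth ensures
  that applying \<rho>(A) preserves both types.\<close>

definition tame_operator :: "int^2^2 \<Rightarrow> (complex \<Rightarrow> complex^2^2) \<Rightarrow> bool" where
  "tame_operator g A \<longleftrightarrow> (\<forall>\<tau>. Im \<tau> > 0 \<longrightarrow> det (A \<tau>) = 1) \<and> (\<forall>gr. \<exists>F. tame gr g F \<and>
     (\<forall>\<tau>. Im \<tau> > 0 \<longrightarrow> 0 \<le> F \<tau> \<and> (\<forall>v. norm (\<rho> (A \<tau>) v) \<le> F \<tau> * norm v)))"

lemma tame_operatorI:
  assumes "\<And>\<tau>. Im \<tau> > 0 \<Longrightarrow> det (A \<tau>) = 1" "\<And>gr. tame gr g F" "\<And>\<tau>. Im \<tau> > 0 \<Longrightarrow> 0 \<le> F \<tau>"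
    "\<And>\<tau> v. Im \<tau> > 0 \<Longrightarrow> norm (\<rho> (A \<tau>) v) \<le> F \<tau> * norm v"
  shows "tame_operator g A"
  unfolding tame_operator_def using assms by (intro conjI allI impI exI[of _ F]) simp_all

lemma tame_operator_mult:
  assumes A: "tame_operator g A" and A': "tame_operator g A'"
  shows "tame_operator g (\<lambda>\<tau>. A \<tau> ** A' \<tau>)"
  unfolding tame_operator_def
proof (intro conjI allI impI)
  show "det (A \<tau> ** A' \<tau>) = 1" if "Im \<tau> > 0" for \<tau>
    using A A' that by (simp add: tame_operator_def det_mul)
  fix gr
  from A obtain F where F: "tame gr g F" "\<And>\<tau>. Im \<tau> > 0 \<Longrightarrow> 0 \<le> F \<tau>"
    "\<And>\<tau> v. Im \<tau> > 0 \<Longrightarrow> norm (\<rho> (A \<tau>) v) \<le> F \<tau> * norm v" unfolding tame_operator_def by metis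
  from A' obtain F' where F': "tame gr g F'" "\<And>\<tau>. Im \<tau> > 0 \<Longrightarrow> 0 \<le> F' \<tau>"
    "\<And>\<tau> v. Im \<tau> > 0 \<Longrightarrow> norm (\<rho> (A' \<tau>) v) \<le> F' \<tau> * norm v" unfolding tame_operator_def by metis
  show "\<exists>F. tame gr g F \<and> (\<forall>\<tau>. Im \<tau> > 0 \<longrightarrow> 0 \<le> F \<tau> \<and> (\<forall>v. norm (\<rho> (A \<tau> ** A' \<tau>) v) \<le> F \<tau> * norm v))"
  proof (intro exI[of _ "\<lambda>\<tau>. F \<tau> * F' \<tau>"] conjI allI impI)
    show "tame gr g (\<lambda>\<tau>. F \<tau> * F' \<tau>)" by (intro tame_mult F F')
    fix \<tau> v assume y: "Im \<tau> > 0"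
    show "0 \<le> F \<tau> * F' \<tau>" using F F' y by simp
    have "norm (\<rho> (A \<tau> ** A' \<tau>) v) = norm (\<rho> (A \<tau>) (\<rho> (A' \<tau>) v))"
      using A A' y by (simp add: rho_mult tame_operator_def)
    also have "\<dots> \<le> F \<tau> * norm (\<rho> (A' \<tau>) v)" by (rule F(3)[OF y])
    also have "\<dots> \<le> F \<tau> * (F' \<tau> * norm v)" by (intro mult_left_mono F F' y)
    finally show "norm (\<rho> (A \<tau> ** A' \<tau>) v) \<le> F \<tau> * F' \<tau> * norm v" by (simp add: mult.assoc)
  qed
qed

lemma tame_operator_cong:
  assumes "tame_operator g A" "\<And>\<tau>. Im \<tau> > 0 \<Longrightarrow> A' \<tau> = A \<tau>"
  shows "tame_operator g A'"
  using assms by (simp add: tame_operator_def)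

lemma tame_operator_const:
  assumes "det A = 1" shows "tame_operator g (\<lambda>_. A)"
proof -
  obtain K where K: "K > 0" "\<And>v. norm (\<rho> A v) \<le> norm v * K"
    using bounded_linear.pos_bounded[OF rho_bounded_linear[OF assms]] by blast
  show ?thesis by (rule tame_operatorI[where F="\<lambda>_. K"]) (use assms K in \<open>auto intro: tame_const simp: mult.commute\<close>)
qed

lemma tame_operator_upper:
  assumes "\<And>gr. tame gr g (\<lambda>\<tau>. cmod (f \<tau>))" shows "tame_operator g (\<lambda>\<tau>. mat2 1 (f \<tau>) 0 1)"
proof -
  obtain K N where K: "K > 0" "\<And>t v. norm (\<rho> (mat2 1 t 0 1) v) \<le> K * (1 + cmod t) ^ N * norm v"
    using upper_unipotent_bound by blast
  show ?thesis
    by (rule tame_operatorI[where F="\<lambda>\<tau>. K * (1 + cmod (f \<tau>)) ^ N"])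
      (use K assms in \<open>auto intro!: tame_mult tame_power tame_add tame_const\<close>)
qed

lemma tame_operator_lower:
  assumes "\<And>gr. tame gr g (\<lambda>\<tau>. cmod (f \<tau>))" shows "tame_operator g (\<lambda>\<tau>. mat2 1 0 (f \<tau>) 1)"
proof -
  obtain K N where K: "K > 0" "\<And>t v. norm (\<rho> (mat2 1 0 t 1) v) \<le> K * (1 + cmod t) ^ N * norm v"
    using lower_unipotent_bound by blast
  show ?thesis
    by (rule tame_operatorI[where F="\<lambda>\<tau>. K * (1 + cmod (f \<tau>)) ^ N"])
      (use K assms in \<open>auto intro!: tame_mult tame_power tame_add tame_const\<close>)
qed

lemma tame_operator_torus:
  assumes "\<And>gr. tame gr g (\<lambda>\<tau>. cmod (f \<tau>))" "\<And>gr. tame gr g (\<lambda>\<tau>. 1 / cmod (f \<tau>))" "\<And>\<tau>. Im \<tau> > 0 \<Longrightarrow> f \<tau> \<noteq> 0"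
  shows "tame_operator g (\<lambda>\<tau>. torus (f \<tau>))"
proof -
  obtain K N where K: "K > 0"
    "\<And>a r v. a \<noteq> 0 \<Longrightarrow> cmod a \<le> r \<Longrightarrow> 1 / cmod a \<le> r \<Longrightarrow> norm (\<rho> (torus a) v) \<le> K * r ^ N * norm v"
    using torus_bound by metis
  show ?thesis
  proof (rule tame_operatorI[where F="\<lambda>\<tau>. K * (cmod (f \<tau>) + 1 / cmod (f \<tau>)) ^ N"])
    show "tame gr g (\<lambda>\<tau>. K * (cmod (f \<tau>) + 1 / cmod (f \<tau>)) ^ N)" for gr
      using K by (intro tame_mult tame_power tame_add tame_const assms) auto
    show "norm (\<rho> (torus (f \<tau>)) v) \<le> K * (cmod (f \<tau>) + 1 / cmod (f \<tau>)) ^ N * norm v" if "Im \<tau> > 0" for \<tau> v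
      by (intro K(2) assms(3) that) auto
  qed (use assms K in auto)
qed

end

section \<open>The equivariant frame\<close>

locale modular_frame = weighted_sl2_representation sc B \<rho> wt
  for sc :: "complex \<Rightarrow> 'v::real_normed_vector \<Rightarrow> 'v" and B \<rho> wt +
  fixes \<phi> :: "complex \<Rightarrow> complex" and K\<^sub>\<phi> :: real
  assumes phi_holomorphic: "\<phi> holomorphic_on upper_half_plane"
    and phi_quasimodular: "\<gamma> \<in> carrier SL2_Z \<Longrightarrow> quasimodular \<phi> \<gamma>"
    and phi_bound: "Im \<tau> \<ge> 1 \<Longrightarrow> cmod (\<phi> \<tau>) \<le> K\<^sub>\<phi> * cmod \<tau> ^ 3"
begin

text \<open>The matrix P, multiplied out; \<open>coframe\<close> is its inverse.\<close>

definition frame :: "complex \<Rightarrow> complex^2^2" where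
  "frame \<tau> = mat2 (1 + \<tau> * \<phi> \<tau>) \<tau> (\<phi> \<tau>) 1"

definition coframe :: "complex \<Rightarrow> complex^2^2" where
  "coframe \<tau> = mat2 1 (- \<tau>) (- \<phi> \<tau>) (1 + \<tau> * \<phi> \<tau>)"

lemma det_frame [simp]: "det (frame \<tau>) = 1" "det (coframe \<tau>) = 1"
  by (simp_all add: frame_def coframe_def algebra_simps)

lemma frame_coframe: "frame \<tau> ** coframe \<tau> = mat 1" "coframe \<tau> ** frame \<tau> = mat 1"
  by (simp_all add: frame_def coframe_def mat2_mult mat2_one mat2_eq_iff algebra_simps)

lemma rho_frame_coframe [simp]: "\<rho> (frame \<tau>) (\<rho> (coframe \<tau>) v) = v" "\<rho> (coframe \<tau>) (\<rho> (frame \<tau>) v) = v"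
  by (simp_all add: frame_coframe rho_one flip: rho_mult)

lemma frame_equivariant:
  assumes g: "\<gamma> \<in> carrier SL2_Z" and y: "Im \<tau> > 0"
  shows "frame (moebius \<gamma> \<tau>) ** torus (1 / automorphy_factor \<gamma> \<tau>) = complex_matrix \<gamma> ** frame \<tau>"
proof -
  define j where "j = automorphy_factor \<gamma> \<tau>"
  define a b c d where "a = (of_int (\<gamma>$1$1) :: complex)" and "b = (of_int (\<gamma>$1$2) :: complex)"
    and "c = (of_int (\<gamma>$2$1) :: complex)" and "d = (of_int (\<gamma>$2$2) :: complex)"
  have j0: "j \<noteq> 0" unfolding j_def by (rule automorphy_factor_nonzero[OF assms])
  have jd: "j = c * \<tau> + d" by (simp add: j_def automorphy_factor_def c_def d_def)
  have mj: "moebius \<gamma> \<tau> = (a * \<tau> + b) / j" by (simp add: moebius_def a_def b_def j_def)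
  have det: "a * d - b * c = 1" unfolding a_def b_def c_def d_def by (rule det_of_int[OF g])
  have phi: "\<phi> (moebius \<gamma> \<tau>) = j * (j * \<phi> \<tau> + c)"
    using phi_quasimodular[OF g] y by (simp add: quasimodular_def j_def c_def power2_eq_square algebra_simps)
  have "(1 + moebius \<gamma> \<tau> * \<phi> (moebius \<gamma> \<tau>)) * (1 / j) = a * (1 + \<tau> * \<phi> \<tau>) + b * \<phi> \<tau>"
  proof -
    have "1 + moebius \<gamma> \<tau> * \<phi> (moebius \<gamma> \<tau>) = 1 + (a * \<tau> + b) * (j * \<phi> \<tau> + c)"
      unfolding phi unfolding mj using j0 by simp
    \<comment> \<open>Writing 1 as a d - b c allows j = c \<tau> + d to be factored out.\<close>
    also have "\<dots> = (a * d - b * c) + (a * \<tau> + b) * (j * \<phi> \<tau> + c)" by (simp add: det)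
    also have "\<dots> = j * (a * (1 + \<tau> * \<phi> \<tau>) + b * \<phi> \<tau>)" by (simp add: jd algebra_simps)
    finally show ?thesis using j0 by simp
  qed
  moreover have "\<phi> (moebius \<gamma> \<tau>) * (1 / j) = c * (1 + \<tau> * \<phi> \<tau>) + d * \<phi> \<tau>"
    using j0 by (simp add: phi) (simp add: jd algebra_simps)
  moreover have "moebius \<gamma> \<tau> * j = a * \<tau> + b" using j0 by (simp add: mj)
  ultimately show ?thesis
    by (simp add: frame_def complex_matrix_mat2 mat2_mult mat2_eq_iff flip: j_def a_def b_def c_def d_def) (simp add: jd)
qed

lemma rho_frame_equivariant:
  assumes g: "\<gamma> \<in> carrier SL2_Z" and y: "Im \<tau> > 0"
  shows "\<rho> (frame (moebius \<gamma> \<tau>)) (\<rho> (torus (1 / automorphy_factor \<gamma> \<tau>)) v) = \<rho> (complex_matrix \<gamma>) (\<rho> (frame \<tau>) v)"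
  using frame_equivariant[OF assms] automorphy_factor_nonzero[OF assms]
  by (simp add: det_complex_matrix[OF g] flip: rho_mult)

lemma rho_coframe_equivariant:
  assumes g: "\<gamma> \<in> carrier SL2_Z" and y: "Im \<tau> > 0"
  shows "\<rho> (coframe (moebius \<gamma> \<tau>)) (\<rho> (complex_matrix \<gamma>) v) = \<rho> (torus (1 / automorphy_factor \<gamma> \<tau>)) (\<rho> (coframe \<tau>) v)"
  using arg_cong[OF rho_frame_equivariant[OF assms, of "\<rho> (coframe \<tau>) v"], of "\<rho> (coframe (moebius \<gamma> \<tau>))"] by simp

lemma tame_phi:
  assumes "g \<in> carrier SL2_Z" shows "tame gr g (\<lambda>\<tau>. cmod (\<phi> (moebius g \<tau>)))"
proof (rule tame_mono)
  show "tame gr g (\<lambda>\<tau>. \<bar>K\<^sub>\<phi>\<bar> * cmod (moebius g \<tau>) ^ 3)" by (intro tame_mult tame_const tame_moebius) auto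
  fix \<tau> assume "Im (moebius g \<tau>) > 1"
  then have "cmod (\<phi> (moebius g \<tau>)) \<le> K\<^sub>\<phi> * cmod (moebius g \<tau>) ^ 3" by (intro phi_bound) simp
  also have "\<dots> \<le> \<bar>K\<^sub>\<phi>\<bar> * cmod (moebius g \<tau>) ^ 3" by (intro mult_right_mono) auto
  finally show "cmod (\<phi> (moebius g \<tau>)) \<le> \<bar>K\<^sub>\<phi>\<bar> * cmod (moebius g \<tau>) ^ 3" .
qed

lemma tame_moebius_1: "tame gr g (\<lambda>\<tau>. cmod (moebius g \<tau>))"
  using tame_moebius[of gr g 1] by simp

text \<open>The bound on \<phi> holds only high in the half-plane. Equivariance rewrites the frame
  at \<tau> as a constant matrix times the frame at the image of \<tau> under g times a torus
  element in the automorphy factor, and each of these is tame with respect to g.\<close>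

lemma tame_operator_frame:
  assumes g: "g \<in> carrier SL2_Z"
  shows "tame_operator g frame"
proof -
  have "tame_operator g (\<lambda>\<tau>. complex_matrix (adjugate2 g) ** ((mat2 1 (moebius g \<tau>) 0 1 ** mat2 1 0 (\<phi> (moebius g \<tau>)) 1)
      ** torus (1 / automorphy_factor g \<tau>)))"
    using automorphy_factor_nonzero[OF g] tame_automorphy_factor[OF g]
    by (intro tame_operator_mult tame_operator_const tame_operator_upper tame_operator_lower tame_operator_torus
        tame_phi g tame_moebius_1 det_complex_matrix adjugate2_SL2) (simp_all add: norm_divide)
  then show ?thesis
  proof (rule tame_operator_cong)
    fix \<tau> :: complex assume y: "Im \<tau> > 0"
    have "mat2 1 (moebius g \<tau>) 0 1 ** mat2 1 0 (\<phi> (moebius g \<tau>)) 1 = frame (moebius g \<tau>)"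
      by (simp add: mat2_mult frame_def)
    moreover have "complex_matrix (adjugate2 g) ** (complex_matrix g ** frame \<tau>) = frame \<tau>"
      by (simp add: matrix_mul_assoc adjugate2_SL2_mult[OF g] complex_matrix_one flip: complex_matrix_mult)
    ultimately show "frame \<tau> = complex_matrix (adjugate2 g) ** ((mat2 1 (moebius g \<tau>) 0 1 ** mat2 1 0 (\<phi> (moebius g \<tau>)) 1)
      ** torus (1 / automorphy_factor g \<tau>))"
      by (simp only: frame_equivariant[OF g y])
  qed
qed

lemma tame_operator_coframe:
  assumes g: "g \<in> carrier SL2_Z"
  shows "tame_operator g coframe"
proof -
  have "tame_operator g (\<lambda>\<tau>. torus (automorphy_factor g \<tau>) ** ((mat2 1 0 (- \<phi> (moebius g \<tau>)) 1 ** mat2 1 (- moebius g \<tau>) 0 1)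
      ** complex_matrix g))"
    using automorphy_factor_nonzero[OF g] tame_automorphy_factor[OF g]
    by (intro tame_operator_mult tame_operator_const tame_operator_upper tame_operator_lower tame_operator_torus
        g det_complex_matrix) (simp_all add: norm_divide tame_phi[OF g] tame_moebius_1)
  then show ?thesis
  proof (rule tame_operator_cong)
    fix \<tau> :: complex assume y: "Im \<tau> > 0"
    define j where "j = automorphy_factor g \<tau>"
    have j0: "j \<noteq> 0" unfolding j_def by (rule automorphy_factor_nonzero[OF g y])
    have jj: "torus j ** torus (1 / j) = mat 1" using j0 by (simp add: mat2_mult mat2_one)
    have c: "mat2 1 0 (- \<phi> (moebius g \<tau>)) 1 ** mat2 1 (- moebius g \<tau>) 0 1 = coframe (moebius g \<tau>)"
      by (simp add: mat2_mult coframe_def mat2_eq_iff)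
    have "coframe \<tau> = torus j ** (torus (1 / j) ** coframe \<tau>)" by (simp only: matrix_mul_assoc jj matrix_mul_lid)
    also have "torus (1 / j) = coframe (moebius g \<tau>) ** (frame (moebius g \<tau>) ** torus (1 / j))"
      by (simp add: matrix_mul_assoc frame_coframe)
    also have "frame (moebius g \<tau>) ** torus (1 / j) = complex_matrix g ** frame \<tau>"
      unfolding j_def by (rule frame_equivariant[OF g y])
    also have "torus j ** (coframe (moebius g \<tau>) ** (complex_matrix g ** frame \<tau>) ** coframe \<tau>) =
        torus j ** (coframe (moebius g \<tau>) ** complex_matrix g ** (frame \<tau> ** coframe \<tau>))"
      by (simp only: matrix_mul_assoc)
    finally show "coframe \<tau> = torus (automorphy_factor g \<tau>) ** ((mat2 1 0 (- \<phi> (moebius g \<tau>)) 1 ** mat2 1 (- moebius g \<tau>) 0 1)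
      ** complex_matrix g)"
      by (simp add: frame_coframe c j_def)
  qed
qed

end

section \<open>Spaces of modular forms\<close>

lemma modular_forms_iff:
  "f \<in> modular_forms gr sc \<Gamma> \<sigma> k \<longleftrightarrow> holomorphic_map (*) sc f upper_half_plane
     \<and> (\<forall>\<tau>. \<tau> \<notin> upper_half_plane \<longrightarrow> f \<tau> = 0)
     \<and> (\<forall>\<gamma>\<in>\<Gamma>. \<forall>\<tau>. Im \<tau> > 0 \<longrightarrow> f (moebius \<gamma> \<tau>) = sc (automorphy_factor \<gamma> \<tau> powi k) (\<sigma> \<gamma> (f \<tau>)))
     \<and> (\<forall>g\<in>carrier SL2_Z. tame gr g (\<lambda>\<tau>. norm (f \<tau>)))"
  unfolding modular_forms_def all_growth_iff_tame mem_Collect_eq by (simp add: Ball_def)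

lemma finite_basis_complex: "finite_basis ((*) :: complex \<Rightarrow> complex \<Rightarrow> complex) {1}"
proof -
  interpret c: complex_normed_space "(*) :: complex \<Rightarrow> complex \<Rightarrow> complex"
    by unfold_locales (auto simp: algebra_simps scaleR_conv_of_real norm_mult)
  have "x \<in> Modules.module.span (*) {1}" for x :: complex
    using vector_space_over_itself.span_scale[OF vector_space_over_itself.span_base[of 1 "{1}"], of x] by simp
  then have "Modules.module.span (*) {1 :: complex} = UNIV" by blast
  moreover have "\<not> Modules.module.dependent (*) {1 :: complex}" by (simp add: vector_space_over_itself.dependent_single)
  ultimately show ?thesis by unfold_locales auto
qed

text \<open>Keeping \<sigma> abstract allows two uses: the restriction of \<rho>, and the trivial
  action on the complex numbers with basis {1}, which gives the scalar forms.\<close>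

locale modular_forms_space = finite_basis sc B
  for sc :: "complex \<Rightarrow> 'v::real_normed_vector \<Rightarrow> 'v" and B +
  fixes \<Gamma> :: "(int^2^2) set" and \<sigma> :: "int^2^2 \<Rightarrow> 'v \<Rightarrow> 'v"
  assumes Gamma_subset: "\<Gamma> \<subseteq> carrier SL2_Z"
    and sigma_linear: "\<gamma> \<in> \<Gamma> \<Longrightarrow> Vector_Spaces.linear sc sc (\<sigma> \<gamma>)"
begin

abbreviation forms :: "growth \<Rightarrow> int \<Rightarrow> (complex \<Rightarrow> 'v) set" where
  "forms gr k \<equiv> modular_forms gr sc \<Gamma> \<sigma> k"

abbreviation scalar_forms :: "growth \<Rightarrow> int \<Rightarrow> (complex \<Rightarrow> complex) set" where
  "scalar_forms gr k \<equiv> modular_forms gr (*) \<Gamma> (\<lambda>_ z. z) k"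

lemma sigma_add: "\<gamma> \<in> \<Gamma> \<Longrightarrow> \<sigma> \<gamma> (u + v) = \<sigma> \<gamma> u + \<sigma> \<gamma> v"
  using sigma_linear by (simp add: Vector_Spaces.linear_iff)

lemma sigma_scale: "\<gamma> \<in> \<Gamma> \<Longrightarrow> \<sigma> \<gamma> (sc c v) = sc c (\<sigma> \<gamma> v)"
  using sigma_linear by (simp add: Vector_Spaces.linear_iff)

lemma sigma_zero: "\<gamma> \<in> \<Gamma> \<Longrightarrow> \<sigma> \<gamma> 0 = 0"
  using sigma_scale[of \<gamma> 0 0] by simp

lemma automorphy_Gamma: "\<gamma> \<in> \<Gamma> \<Longrightarrow> Im \<tau> > 0 \<Longrightarrow> automorphy_factor \<gamma> \<tau> \<noteq> 0"
  using automorphy_factor_nonzero Gamma_subset by blast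

lemma forms_outside: "f \<in> forms gr k \<Longrightarrow> \<not> Im \<tau> > 0 \<Longrightarrow> f \<tau> = 0"
  by (simp add: modular_forms_iff)

lemma forms_zero: "(\<lambda>_. 0) \<in> forms gr k"
  unfolding modular_forms_iff holomorphic_map_iff_coord
  by (auto simp: sigma_zero intro: tame_const)

lemma forms_add:
  assumes "f \<in> forms gr k" "h \<in> forms gr k"
  shows "(\<lambda>\<tau>. f \<tau> + h \<tau>) \<in> forms gr k"
  unfolding modular_forms_iff
proof (intro conjI ballI allI impI)
  show "holomorphic_map (*) sc (\<lambda>\<tau>. f \<tau> + h \<tau>) upper_half_plane"
    using assms unfolding modular_forms_iff holomorphic_map_iff_coord
    by (auto simp: coord_add intro!: holomorphic_on_add)
  show "f \<tau> + h \<tau> = 0" if "\<tau> \<notin> upper_half_plane" for \<tau>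
    using assms that by (simp add: modular_forms_iff)
  show "f (moebius \<gamma> \<tau>) + h (moebius \<gamma> \<tau>) = sc (automorphy_factor \<gamma> \<tau> powi k) (\<sigma> \<gamma> (f \<tau> + h \<tau>))"
    if "\<gamma> \<in> \<Gamma>" "Im \<tau> > 0" for \<gamma> \<tau>
    using assms that by (simp add: modular_forms_iff sigma_add scale_right_distrib)
  show "tame gr g (\<lambda>\<tau>. norm (f \<tau> + h \<tau>))" if g: "g \<in> carrier SL2_Z" for g
  proof (rule tame_mono)
    show "tame gr g (\<lambda>\<tau>. norm (f \<tau>) + norm (h \<tau>))"
      using assms g by (intro tame_add) (auto simp: modular_forms_iff)
  qed (rule norm_triangle_ineq)
qed

lemma forms_mult:
  assumes h: "h \<in> scalar_forms gr l" and f: "f \<in> forms gr k" and n: "n = l + k"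
  shows "(\<lambda>\<tau>. sc (h \<tau>) (f \<tau>)) \<in> forms gr n"
  unfolding modular_forms_iff
proof (intro conjI ballI allI impI)
  show "holomorphic_map (*) sc (\<lambda>\<tau>. sc (h \<tau>) (f \<tau>)) upper_half_plane"
    using assms unfolding modular_forms_iff holomorphic_map_iff_coord holomorphic_map_complex_iff
    by (auto simp: coord_scale intro!: holomorphic_on_mult)
  show "sc (h \<tau>) (f \<tau>) = 0" if "\<tau> \<notin> upper_half_plane" for \<tau>
    using assms that by (simp add: modular_forms_iff)
  show "sc (h (moebius \<gamma> \<tau>)) (f (moebius \<gamma> \<tau>)) = sc (automorphy_factor \<gamma> \<tau> powi n) (\<sigma> \<gamma> (sc (h \<tau>) (f \<tau>)))"
    if "\<gamma> \<in> \<Gamma>" "Im \<tau> > 0" for \<gamma> \<tau>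
    using assms that automorphy_Gamma[OF that]
    by (simp add: modular_forms_iff sigma_scale power_int_add mult_ac)
  show "tame gr g (\<lambda>\<tau>. norm (sc (h \<tau>) (f \<tau>)))" if g: "g \<in> carrier SL2_Z" for g
    using assms g unfolding norm_scale by (intro tame_mult) (auto simp: modular_forms_iff)
qed

lemma forms_scale:
  assumes f: "f \<in> forms gr k" shows "(\<lambda>\<tau>. sc c (f \<tau>)) \<in> forms gr k"
  unfolding modular_forms_iff
proof (intro conjI ballI allI impI)
  show "holomorphic_map (*) sc (\<lambda>\<tau>. sc c (f \<tau>)) upper_half_plane"
    using assms unfolding modular_forms_iff holomorphic_map_iff_coord
    by (auto simp: coord_scale intro!: holomorphic_on_mult)
  show "sc c (f \<tau>) = 0" if "\<tau> \<notin> upper_half_plane" for \<tau>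
    using assms that by (simp add: modular_forms_iff)
  show "sc c (f (moebius \<gamma> \<tau>)) = sc (automorphy_factor \<gamma> \<tau> powi k) (\<sigma> \<gamma> (sc c (f \<tau>)))"
    if "\<gamma> \<in> \<Gamma>" "Im \<tau> > 0" for \<gamma> \<tau>
    using assms that by (simp add: modular_forms_iff sigma_scale mult.commute)
  show "tame gr g (\<lambda>\<tau>. norm (sc c (f \<tau>)))" if g: "g \<in> carrier SL2_Z" for g
    using assms g unfolding norm_scale by (intro tame_mult tame_const) (auto simp: modular_forms_iff)
qed

lemma forms_sum:
  "(\<And>i. i \<in> I \<Longrightarrow> f i \<in> forms gr k) \<Longrightarrow> (\<lambda>\<tau>. \<Sum>i\<in>I. f i \<tau>) \<in> forms gr k"
  by (induction I rule: infinite_finite_induct) (auto intro: forms_zero forms_add)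

text \<open>Expanding both arguments in the basis expresses the bilinear map by its structure
  constants, so holomorphy and growth reduce to products of coordinates.\<close>

lemma forms_bilinear:
  assumes br: "\<And>u v w. br (u + v) w = br u w + br v w" "\<And>u v w. br w (u + v) = br w u + br w v"
      "\<And>c u v. br (sc c u) v = sc c (br u v)" "\<And>c u v. br u (sc c v) = sc c (br u v)"
    and equiv: "\<And>\<gamma> u v. \<gamma> \<in> \<Gamma> \<Longrightarrow> \<sigma> \<gamma> (br u v) = br (\<sigma> \<gamma> u) (\<sigma> \<gamma> v)"
    and f: "f \<in> forms gr k" and h: "h \<in> forms gr l" and n: "n = k + l"
  shows "(\<lambda>\<tau>. br (f \<tau>) (h \<tau>)) \<in> forms gr n"
proof -
  have lin: "Vector_Spaces.linear sc sc (\<lambda>u. br u v)" "Vector_Spaces.linear sc sc (br v)" for v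
    by (auto simp: Vector_Spaces.linear_iff br intro: vector_space_axioms)
  have exp: "br u v = (\<Sum>b\<in>B. sc (coord b u) (\<Sum>b'\<in>B. sc (coord b' v) (br b b')))" for u v
  proof -
    have "br u v = (\<Sum>b\<in>B. sc (coord b u) (br b v))" by (rule linear_expansion[OF lin(1)])
    also have "\<dots> = (\<Sum>b\<in>B. sc (coord b u) (\<Sum>b'\<in>B. sc (coord b' v) (br b b')))"
      by (intro sum.cong refl arg_cong[where f="sc _"] linear_expansion[OF lin(2)])
    finally show ?thesis .
  qed
  show ?thesis
    unfolding modular_forms_iff
  proof (intro conjI ballI allI impI)
    show "holomorphic_map (*) sc (\<lambda>\<tau>. br (f \<tau>) (h \<tau>)) upper_half_plane"
      using f h unfolding modular_forms_iff holomorphic_map_iff_coord exp[of "f _" "h _"]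
      by (auto simp: coord_scale coord_sum intro!: holomorphic_on_sum holomorphic_on_mult)
    show "br (f \<tau>) (h \<tau>) = 0" if "\<tau> \<notin> upper_half_plane" for \<tau>
      using f that br(3)[of 0 0] by (simp add: modular_forms_iff)
    show "br (f (moebius \<gamma> \<tau>)) (h (moebius \<gamma> \<tau>)) = sc (automorphy_factor \<gamma> \<tau> powi n) (\<sigma> \<gamma> (br (f \<tau>) (h \<tau>)))"
      if "\<gamma> \<in> \<Gamma>" "Im \<tau> > 0" for \<gamma> \<tau>
      using f h n that automorphy_Gamma[OF that]
      by (simp add: modular_forms_iff equiv power_int_add br)
    show "tame gr g (\<lambda>\<tau>. norm (br (f \<tau>) (h \<tau>)))" if g: "g \<in> carrier SL2_Z" for g
    proof -
      obtain K where K: "K > 0" "\<And>b v. b \<in> B \<Longrightarrow> cmod (coord b v) \<le> K * norm v" using coord_bound by blast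
      define L where "L = (\<Sum>b\<in>B. \<Sum>b'\<in>B. norm (br b b'))"
      show ?thesis
      proof (rule tame_mono)
      show "tame gr g (\<lambda>\<tau>. (K * norm (f \<tau>)) * ((K * norm (h \<tau>)) * L))"
        using f h g K(1) unfolding L_def
        by (intro tame_mult tame_const) (auto simp: modular_forms_iff intro!: sum_nonneg mult_nonneg_nonneg)
      fix \<tau>
      have "norm (br (f \<tau>) (h \<tau>)) \<le> (\<Sum>b\<in>B. norm (sc (coord b (f \<tau>)) (\<Sum>b'\<in>B. sc (coord b' (h \<tau>)) (br b b'))))"
        unfolding exp[of "f \<tau>"] by (rule norm_sum)
      also have "\<dots> \<le> (\<Sum>b\<in>B. (K * norm (f \<tau>)) * (\<Sum>b'\<in>B. (K * norm (h \<tau>)) * norm (br b b')))"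
        unfolding norm_scale using K
        by (intro sum_mono mult_mono order_trans[OF norm_sum] sum_nonneg) (auto simp: norm_scale intro!: mult_right_mono)
      also have "\<dots> = (K * norm (f \<tau>)) * ((K * norm (h \<tau>)) * L)"
        by (simp add: L_def sum_distrib_left)
      finally show "norm (br (f \<tau>) (h \<tau>)) \<le> (K * norm (f \<tau>)) * ((K * norm (h \<tau>)) * L)" .
      qed
    qed
  qed
qed

end

section \<open>Passing between vector-valued and scalar forms by means of the frame\<close>

context modular_frame begin

lemma rho_frame_holomorphic: "holomorphic_map (*) sc (\<lambda>\<tau>. \<rho> (frame \<tau>) v) upper_half_plane"
  "holomorphic_map (*) sc (\<lambda>\<tau>. \<rho> (coframe \<tau>) v) upper_half_plane"
  unfolding frame_def coframe_def
  by (rule rho_curve_holomorphic; (intro holomorphic_intros phi_holomorphic)?; simp add: algebra_simps)+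

lemma holomorphic_map_operator:
  assumes A: "\<And>v. holomorphic_map (*) sc (\<lambda>\<tau>. \<rho> (A \<tau>) v) S" and det: "\<And>\<tau>. det (A \<tau>) = 1"
    and f: "holomorphic_map (*) sc f S"
  shows "holomorphic_map (*) sc (\<lambda>\<tau>. \<rho> (A \<tau>) (f \<tau>)) S"
proof -
  have "\<rho> (A \<tau>) (f \<tau>) = (\<Sum>b\<in>B. sc (coord b (f \<tau>)) (\<rho> (A \<tau>) b))" for \<tau>
    by (rule linear_expansion[OF rho_linear[OF det]])
  then show ?thesis
    using A f unfolding holomorphic_map_iff_coord
    by (auto simp: coord_sum coord_scale intro!: holomorphic_on_sum holomorphic_on_mult)
qed

lemma tame_operator_apply:
  assumes "tame_operator g A" "tame gr g (\<lambda>\<tau>. norm (f \<tau>))"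
  shows "tame gr g (\<lambda>\<tau>. norm (\<rho> (A \<tau>) (f \<tau>)))"
proof -
  from assms(1) obtain F where F: "tame gr g F" "\<And>\<tau>. Im \<tau> > 0 \<Longrightarrow> 0 \<le> F \<tau>"
    "\<And>\<tau> v. Im \<tau> > 0 \<Longrightarrow> norm (\<rho> (A \<tau>) v) \<le> F \<tau> * norm v" unfolding tame_operator_def by metis
  show ?thesis by (rule tame_mono[OF tame_mult[OF F(1) assms(2)]]) (use F in auto)
qed

lemma coord_torus: "a \<noteq> 0 \<Longrightarrow> b \<in> B \<Longrightarrow> coord b (\<rho> (torus a) v) = a powi wt b * coord b v"
  using coord_unique[of "\<lambda>b. coord b v * a powi wt b"] torus_expansion[of a v] by simp

end

locale framed_modular_forms = modular_frame sc B \<rho> wt \<phi> K\<^sub>\<phi> + modular_forms_space sc B \<Gamma> "restrict_to_SL2_Z \<rho>"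
  for sc :: "complex \<Rightarrow> 'v::real_normed_vector \<Rightarrow> 'v" and B \<rho> wt \<phi> K\<^sub>\<phi> \<Gamma>
begin

lemma coord_torus_inverse: "j \<noteq> 0 \<Longrightarrow> b \<in> B \<Longrightarrow> coord b (\<rho> (mat2 (1 / j) 0 0 j) v) = coord b v / j powi wt b"
  using coord_torus[of "1 / j" b v] by (simp add: power_int_divide_distrib)

text \<open>A coefficient of weight n - wt b scales by j^n j^(- wt b), and the second factor is the
  action of \<open>torus (1 / j)\<close> on b. Equivariance of the frame turns this torus element
  into the action of \<gamma>.\<close>

lemma frame_form:
  assumes u: "\<And>b. b \<in> B \<Longrightarrow> u b \<in> scalar_forms gr (n - wt b)"
  shows "(\<lambda>\<tau>. \<rho> (frame \<tau>) (\<Sum>b\<in>B. sc (u b \<tau>) b)) \<in> forms gr n"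
proof -
  define w where "w \<tau> = (\<Sum>b\<in>B. sc (u b \<tau>) b)" for \<tau>
  have cw: "coord b (w \<tau>) = u b \<tau>" if "b \<in> B" for b \<tau>
    by (rule coord_unique) (use that in \<open>simp_all add: w_def\<close>)
  have "(\<lambda>\<tau>. \<rho> (frame \<tau>) (w \<tau>)) \<in> forms gr n"
    unfolding modular_forms_iff
  proof (intro conjI ballI allI impI)
    show "holomorphic_map (*) sc (\<lambda>\<tau>. \<rho> (frame \<tau>) (w \<tau>)) upper_half_plane"
      by (rule holomorphic_map_operator[OF rho_frame_holomorphic(1) det_frame(1)])
        (use u in \<open>simp add: holomorphic_map_iff_coord cw modular_forms_iff holomorphic_map_complex_iff\<close>)
    show "\<rho> (frame \<tau>) (w \<tau>) = 0" if "\<tau> \<notin> upper_half_plane" for \<tau>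
      using u that by (simp add: w_def modular_forms_iff rho_zero)
    show "tame gr g (\<lambda>\<tau>. norm (\<rho> (frame \<tau>) (w \<tau>)))" if g: "g \<in> carrier SL2_Z" for g
    proof (rule tame_operator_apply[OF tame_operator_frame[OF g]], rule tame_mono)
      show "tame gr g (\<lambda>\<tau>. \<Sum>b\<in>B. cmod (u b \<tau>) * norm b)"
        using u g by (intro tame_sum tame_mult tame_const) (auto simp: modular_forms_iff)
      show "norm (w \<tau>) \<le> (\<Sum>b\<in>B. cmod (u b \<tau>) * norm b)" for \<tau>
        unfolding w_def by (rule order_trans[OF norm_sum]) (simp add: norm_scale)
    qed
    fix \<gamma> \<tau> assume g: "\<gamma> \<in> \<Gamma>" and y: "Im \<tau> > 0"
    define j where "j = automorphy_factor \<gamma> \<tau>"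
    have j0: "j \<noteq> 0" unfolding j_def by (rule automorphy_Gamma[OF g y])
    have gS: "\<gamma> \<in> carrier SL2_Z" using g Gamma_subset by blast
    have "w (moebius \<gamma> \<tau>) = sc (j powi n) (\<rho> (torus (1 / j)) (w \<tau>))"
    proof (rule coord_eqI)
      fix b assume b: "b \<in> B"
      show "coord b (w (moebius \<gamma> \<tau>)) = coord b (sc (j powi n) (\<rho> (torus (1 / j)) (w \<tau>)))"
        using u[OF b] b g y j0
        by (simp add: cw coord_scale coord_torus_inverse modular_forms_iff j_def[symmetric] power_int_diff power_int_divide_distrib)
    qed
    then have "\<rho> (frame (moebius \<gamma> \<tau>)) (w (moebius \<gamma> \<tau>)) = sc (j powi n) (\<rho> (frame (moebius \<gamma> \<tau>)) (\<rho> (torus (1 / j)) (w \<tau>)))"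
      by (simp add: rho_scale)
    then show "\<rho> (frame (moebius \<gamma> \<tau>)) (w (moebius \<gamma> \<tau>)) = sc (automorphy_factor \<gamma> \<tau> powi n) (restrict_to_SL2_Z \<rho> \<gamma> (\<rho> (frame \<tau>) (w \<tau>)))"
      unfolding j_def restrict_to_SL2_Z_def rho_frame_equivariant[OF gS y] .
  qed
  then show ?thesis by (simp add: w_def)
qed

lemma coframe_form:
  assumes f: "f \<in> forms gr n" and b: "b \<in> B"
  shows "(\<lambda>\<tau>. coord b (\<rho> (coframe \<tau>) (f \<tau>))) \<in> scalar_forms gr (n - wt b)"
  unfolding modular_forms_iff
proof (intro conjI ballI allI impI)
  have "holomorphic_map (*) sc (\<lambda>\<tau>. \<rho> (coframe \<tau>) (f \<tau>)) upper_half_plane"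
    by (rule holomorphic_map_operator[OF rho_frame_holomorphic(2) det_frame(2)]) (use f in \<open>simp add: modular_forms_iff\<close>)
  then show "holomorphic_map (*) (*) (\<lambda>\<tau>. coord b (\<rho> (coframe \<tau>) (f \<tau>))) upper_half_plane"
    using b by (simp add: holomorphic_map_iff_coord holomorphic_map_complex_iff)
  show "coord b (\<rho> (coframe \<tau>) (f \<tau>)) = 0" if "\<tau> \<notin> upper_half_plane" for \<tau>
    using f that by (simp add: modular_forms_iff rho_zero)
  show "tame gr g (\<lambda>\<tau>. norm (coord b (\<rho> (coframe \<tau>) (f \<tau>))))" if g: "g \<in> carrier SL2_Z" for g
  proof -
    obtain K where K: "K > 0" "\<And>b v. b \<in> B \<Longrightarrow> cmod (coord b v) \<le> K * norm v" using coord_bound by blast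
    have "tame gr g (\<lambda>\<tau>. K * norm (\<rho> (coframe \<tau>) (f \<tau>)))"
      using f g K(1) by (intro tame_mult tame_const tame_operator_apply tame_operator_coframe) (auto simp: modular_forms_iff)
    then show ?thesis by (rule tame_mono) (rule K(2)[OF b])
  qed
  fix \<gamma> \<tau> assume g: "\<gamma> \<in> \<Gamma>" and y: "Im \<tau> > 0"
  define j where "j = automorphy_factor \<gamma> \<tau>"
  have j0: "j \<noteq> 0" unfolding j_def by (rule automorphy_Gamma[OF g y])
  have gS: "\<gamma> \<in> carrier SL2_Z" using g Gamma_subset by blast
  have "f (moebius \<gamma> \<tau>) = sc (j powi n) (\<rho> (complex_matrix \<gamma>) (f \<tau>))"
    using f g y by (simp add: modular_forms_iff j_def restrict_to_SL2_Z_def)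
  then have "\<rho> (coframe (moebius \<gamma> \<tau>)) (f (moebius \<gamma> \<tau>)) = sc (j powi n) (\<rho> (torus (1 / j)) (\<rho> (coframe \<tau>) (f \<tau>)))"
    unfolding j_def by (simp add: rho_scale rho_coframe_equivariant[OF gS y])
  then show "coord b (\<rho> (coframe (moebius \<gamma> \<tau>)) (f (moebius \<gamma> \<tau>))) = automorphy_factor \<gamma> \<tau> powi (n - wt b) * coord b (\<rho> (coframe \<tau>) (f \<tau>))"
    using b j0 by (simp add: coord_scale coord_torus_inverse j_def[symmetric] power_int_diff power_int_divide_distrib)
qed

end

section \<open>Families of forms and their convolution\<close>

definition support :: "(int \<Rightarrow> complex \<Rightarrow> 'v::zero) \<Rightarrow> int set" where
  "support F = {k. F k \<noteq> (\<lambda>_. 0)}"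

lemma not_in_support: "k \<notin> support F \<Longrightarrow> F k \<tau> = 0"
  by (simp add: support_def)

text \<open>The Laurent polynomial in z with coefficients \<open>F k \<tau>\<close>: it determines the family and turns the
  convolution of families into a pointwise product, so algebraic identities can be checked
  pointwise.\<close>

definition family_eval :: "(complex \<Rightarrow> 'v \<Rightarrow> 'v) \<Rightarrow> (int \<Rightarrow> complex \<Rightarrow> 'v::real_normed_vector) \<Rightarrow> complex \<Rightarrow> complex \<Rightarrow> 'v" where
  "family_eval sc F z \<tau> = (\<Sum>k\<in>support F. sc (z powi k) (F k \<tau>))"

context complex_normed_space begin

lemma family_eval_superset:
  "finite A \<Longrightarrow> support F \<subseteq> A \<Longrightarrow> family_eval scale F z \<tau> = (\<Sum>k\<in>A. scale (z powi k) (F k \<tau>))"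
  unfolding family_eval_def by (intro sum.mono_neutral_left) (auto simp: not_in_support)

lemma family_eval_add:
  assumes "finite (support F)" "finite (support G)"
  shows "family_eval scale (\<lambda>k \<tau>. F k \<tau> + G k \<tau>) z \<tau> = family_eval scale F z \<tau> + family_eval scale G z \<tau>"
proof -
  have fin: "finite (support F \<union> support G)" using assms by simp
  have "support (\<lambda>k \<tau>. F k \<tau> + G k \<tau>) \<subseteq> support F \<union> support G"
    by (auto simp: support_def)
  then show ?thesis
    using fin by (simp add: family_eval_superset[of "support F \<union> support G"] scale_right_distrib sum.distrib)
qed

lemma family_eval_scale:
  assumes "finite (support F)"
  shows "family_eval scale (\<lambda>k \<tau>. scale c (F k \<tau>)) z \<tau> = scale c (family_eval scale F z \<tau>)"
proof -
  have "support (\<lambda>k \<tau>. scale c (F k \<tau>)) \<subseteq> support F" by (auto simp: support_def)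
  then show ?thesis
    using assms by (simp add: family_eval_superset[of "support F"] scale_sum_right mult.commute)
qed

text \<open>Subtracting 2^k0 times the relation at z from the relation at 2 z eliminates the index
  k0 and multiplies the other coefficients by differences of powers of 2, which are nonzero.\<close>

lemma laurent_coefficients_zero:
  assumes "finite K" "\<And>z. z \<noteq> 0 \<Longrightarrow> (\<Sum>k\<in>K. scale (z powi k) (u k)) = 0" "k \<in> K"
  shows "u k = 0"
  using assms
proof (induction K arbitrary: u k rule: finite_induct)
  case (insert k0 K)
  have "scale (2 powi k - 2 powi k0) (u k) = 0" if "k \<in> K" for k
  proof (rule insert.IH[OF _ that])
    fix z :: complex assume z: "z \<noteq> 0"
    have 1: "(\<Sum>k\<in>insert k0 K. scale ((2 * z) powi k) (u k)) = 0" using insert.prems(1)[of "2 * z"] z by simp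
    have 2: "(\<Sum>k\<in>insert k0 K. scale (2 powi k0 * z powi k) (u k)) = 0"
      using arg_cong[OF insert.prems(1)[OF z], of "scale (2 powi k0)"] by (simp only: scale_sum_right scale_scale scale_zero_right)
    have "(\<Sum>k\<in>K. scale (z powi k) (scale (2 powi k - 2 powi k0) (u k)))
        = (\<Sum>k\<in>insert k0 K. scale ((2 * z) powi k) (u k) - scale (2 powi k0 * z powi k) (u k))"
      using insert.hyps
      by (simp add: power_int_mult_distrib scale_left_diff_distrib[symmetric] algebra_simps del: scale_left_diff_distrib)
    also have "\<dots> = 0" by (simp only: sum_subtractf 1 2 diff_zero)
    finally show "(\<Sum>k\<in>K. scale (z powi k) (scale (2 powi k - 2 powi k0) (u k))) = 0" .
  qed
  moreover have "2 powi k \<noteq> (2 powi k0 :: complex)" if "k \<noteq> k0" for k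
  proof
    assume "2 powi k = (2 powi k0 :: complex)"
    then have "norm (2 powi k :: complex) = norm (2 powi k0 :: complex)" by simp
    then have "(2::real) powi k = 2 powi k0" by (simp add: norm_power_int)
    then have "(2::real) powr of_int k = 2 powr of_int k0" by (simp add: powr_real_of_int')
    then show False using that by (simp add: powr_inj)
  qed
  ultimately have K: "u k = 0" if "k \<in> K" for k
    using that insert.hyps(2) by (metis eq_iff_diff_eq_0 scale_eq_0_iff)
  have "u k0 = 0" using insert.prems(1)[of 1] K insert.hyps by simp
  with K insert.prems(2) show ?case by blast
qed simp

lemma family_eval_inject:
  assumes "finite (support F)" "finite (support G)"
    and eq: "\<And>z \<tau>. z \<noteq> 0 \<Longrightarrow> family_eval scale F z \<tau> = family_eval scale G z \<tau>"
  shows "F = G"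
proof (intro ext)
  fix k \<tau>
  let ?K = "support F \<union> support G"
  show "F k \<tau> = G k \<tau>"
  proof (cases "k \<in> ?K")
    case True
    have "F k \<tau> - G k \<tau> = 0"
    proof (rule laurent_coefficients_zero[of ?K "\<lambda>k. F k \<tau> - G k \<tau>", OF _ _ True])
      fix z :: complex assume "z \<noteq> 0"
      from eq[OF this, of \<tau>] show "(\<Sum>k\<in>?K. scale (z powi k) (F k \<tau> - G k \<tau>)) = 0"
        using assms by (simp add: family_eval_superset[of ?K] scale_right_diff_distrib sum_subtractf)
    qed (use assms in simp)
    then show ?thesis by simp
  qed (simp add: not_in_support)
qed

end

lemma support_weight_convolution:
  assumes "\<And>u. prd u 0 = 0"
  shows "support (weight_convolution prd F G) \<subseteq> (\<lambda>(k, l). k + l) ` (support F \<times> support G)"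
proof
  fix n assume "n \<in> support (weight_convolution prd F G)"
  then obtain \<tau> where "(\<Sum>k\<in>support F. prd (F k \<tau>) (G (n - k) \<tau>)) \<noteq> 0"
    by (auto simp: support_def weight_convolution_def)
  then obtain k where k: "k \<in> support F" "prd (F k \<tau>) (G (n - k) \<tau>) \<noteq> 0" by (meson sum.neutral)
  then have "n - k \<in> support G" using assms not_in_support[of "n - k" G \<tau>] by force
  with k(1) show "n \<in> (\<lambda>(k, l). k + l) ` (support F \<times> support G)"
    by (intro image_eqI[of _ _ "(k, n - k)"]) auto
qed

text \<open>Three spaces are allowed so that the bracket, the product of scalar forms and the action
  of scalar forms on vector-valued ones are all instances.\<close>

locale bilinear_product = V1: complex_normed_space s1 + V2: complex_normed_space s2 + V3: complex_normed_space s3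
  for s1 :: "complex \<Rightarrow> 'u::real_normed_vector \<Rightarrow> 'u" and s2 :: "complex \<Rightarrow> 'v::real_normed_vector \<Rightarrow> 'v"
    and s3 :: "complex \<Rightarrow> 'w::real_normed_vector \<Rightarrow> 'w" +
  fixes prd :: "'u \<Rightarrow> 'v \<Rightarrow> 'w"
  assumes prd_add_left: "prd (u + u') v = prd u v + prd u' v"
    and prd_add_right: "prd u (v + v') = prd u v + prd u v'"
    and prd_scale_left: "prd (s1 c u) v = s3 c (prd u v)"
    and prd_scale_right: "prd u (s2 c v) = s3 c (prd u v)"
begin

lemma prd_zero [simp]: "prd 0 v = 0" "prd u 0 = 0"
  using prd_scale_left[of 0 0 v] prd_scale_right[of u 0 0] by simp_all

lemma prd_sum_left: "prd (sum f A) v = (\<Sum>i\<in>A. prd (f i) v)"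
  by (induction A rule: infinite_finite_induct) (auto simp: prd_add_left)

lemma prd_sum_right: "prd u (sum f A) = (\<Sum>i\<in>A. prd u (f i))"
  by (induction A rule: infinite_finite_induct) (auto simp: prd_add_right)

lemma finite_support_weight_convolution:
  "finite (support F) \<Longrightarrow> finite (support G) \<Longrightarrow> finite (support (weight_convolution prd F G))"
  by (rule finite_subset[OF support_weight_convolution]) auto

lemma family_eval_weight_convolution:
  assumes fin: "finite (support F)" "finite (support G)" and z: "z \<noteq> 0"
  shows "family_eval s3 (weight_convolution prd F G) z \<tau> = prd (family_eval s1 F z \<tau>) (family_eval s2 G z \<tau>)"
proof -
  let ?A = "(\<lambda>(k, l). k + l) ` (support F \<times> support G)"
  have finA: "finite ?A" using fin by simp
  have inner: "(\<Sum>n\<in>?A. s3 (z powi n) (prd (F k \<tau>) (G (n - k) \<tau>)))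
      = (\<Sum>l\<in>support G. s3 (z powi (k + l)) (prd (F k \<tau>) (G l \<tau>)))" if k: "k \<in> support F" for k
  proof -
    have "(\<Sum>n\<in>?A. s3 (z powi n) (prd (F k \<tau>) (G (n - k) \<tau>)))
        = (\<Sum>n\<in>(+) k ` support G. s3 (z powi n) (prd (F k \<tau>) (G (n - k) \<tau>)))"
    proof (rule sum.mono_neutral_right[OF finA])
      show "(+) k ` support G \<subseteq> ?A" using k by auto
      show "\<forall>i\<in>?A - (+) k ` support G. s3 (z powi i) (prd (F k \<tau>) (G (i - k) \<tau>)) = 0"
      proof
        fix n assume "n \<in> ?A - (+) k ` support G"
        then have "n - k \<notin> support G" by (metis DiffD2 add.commute diff_add_cancel image_eqI)
        then show "s3 (z powi n) (prd (F k \<tau>) (G (n - k) \<tau>)) = 0" by (simp add: not_in_support)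
      qed
    qed
    also have "\<dots> = (\<Sum>l\<in>support G. s3 (z powi (k + l)) (prd (F k \<tau>) (G l \<tau>)))"
      by (subst sum.reindex) (auto simp: inj_on_def)
    finally show ?thesis .
  qed
  have "family_eval s3 (weight_convolution prd F G) z \<tau> =
      (\<Sum>n\<in>?A. s3 (z powi n) (\<Sum>k\<in>support F. prd (F k \<tau>) (G (n - k) \<tau>)))"
    by (subst V3.family_eval_superset[OF finA support_weight_convolution])
      (simp_all add: weight_convolution_def support_def)
  also have "\<dots> = (\<Sum>k\<in>support F. \<Sum>n\<in>?A. s3 (z powi n) (prd (F k \<tau>) (G (n - k) \<tau>)))"
    by (simp only: V3.scale_sum_right) (rule sum.swap)
  also have "\<dots> = (\<Sum>k\<in>support F. \<Sum>l\<in>support G. s3 (z powi (k + l)) (prd (F k \<tau>) (G l \<tau>)))"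
    by (rule sum.cong[OF refl inner])
  also have "\<dots> = (\<Sum>k\<in>support F. s3 (z powi k) (prd (F k \<tau>) (family_eval s2 G z \<tau>)))"
    unfolding family_eval_def using z
    by (simp add: prd_sum_right prd_scale_right V3.scale_sum_right power_int_add)
  also have "\<dots> = prd (family_eval s1 F z \<tau>) (family_eval s2 G z \<tau>)"
    unfolding family_eval_def[of s1] by (simp only: prd_sum_left prd_scale_left)
  finally show ?thesis .
qed

end

section \<open>Direct sums over all weights as graded modules\<close>

lemma modular_algebra_simps [simp]:
  "carrier (modular_algebra gr sc prd u \<Gamma> \<sigma>) = modular_forms_sum gr sc \<Gamma> \<sigma>"
  "monoid.mult (modular_algebra gr sc prd u \<Gamma> \<sigma>) = weight_convolution prd"
  "one (modular_algebra gr sc prd u \<Gamma> \<sigma>) = (\<lambda>k \<tau>. if k = 0 \<and> \<tau> \<in> upper_half_plane then u else 0)"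
  "zero (modular_algebra gr sc prd u \<Gamma> \<sigma>) = (\<lambda>k \<tau>. 0)"
  "add (modular_algebra gr sc prd u \<Gamma> \<sigma>) = (\<lambda>F G k \<tau>. F k \<tau> + G k \<tau>)"
  "module.smult (modular_algebra gr sc prd u \<Gamma> \<sigma>) = (\<lambda>c F k \<tau>. sc c (F k \<tau>))"
  "graded_part (modular_algebra gr sc prd u \<Gamma> \<sigma>) k =
     {F \<in> modular_forms_sum gr sc \<Gamma> \<sigma>. \<forall>l. l \<noteq> k \<longrightarrow> F l = (\<lambda>_. 0)}"
  by (simp_all add: modular_algebra_def)

lemma with_scalars_simps [simp]:
  "carrier (with_scalars act M) = carrier M" "monoid.mult (with_scalars act M) = monoid.mult M"
  "one (with_scalars act M) = one M" "zero (with_scalars act M) = zero M" "add (with_scalars act M) = add M"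
  "module.smult (with_scalars act M) = act" "graded_part (with_scalars act M) = graded_part M"
  by (simp_all add: with_scalars_def)

lemma complex_field_simps [simp]:
  "carrier complex_field = UNIV" "monoid.mult complex_field = (*)" "one complex_field = 1"
  "zero complex_field = 0" "add complex_field = (+)"
  by (auto simp: ring_of_type_algebra_def)

lemma family_sum_mem_iff:
  "F \<in> modular_forms_sum gr sc \<Gamma> \<sigma> \<longleftrightarrow> (\<forall>k. F k \<in> modular_forms gr sc \<Gamma> \<sigma> k) \<and> finite (support F)"
  by (simp add: modular_forms_sum_def support_def)

definition single_family :: "int \<Rightarrow> (complex \<Rightarrow> 'v::zero) \<Rightarrow> int \<Rightarrow> complex \<Rightarrow> 'v" where
  "single_family k f = (\<lambda>l. if l = k then f else (\<lambda>_. 0))"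

lemma scalar_modular_forms_space: "\<Gamma> \<subseteq> carrier SL2_Z \<Longrightarrow> modular_forms_space (*) {1} \<Gamma> (\<lambda>_ z. z)"
proof -
  assume G: "\<Gamma> \<subseteq> carrier SL2_Z"
  interpret finite_basis "(*) :: complex \<Rightarrow> complex \<Rightarrow> complex" "{1}" by (rule finite_basis_complex)
  show ?thesis using G by unfold_locales (auto simp: Vector_Spaces.linear_iff intro: vector_space_axioms)
qed

context modular_forms_space begin

abbreviation families :: "growth \<Rightarrow> (int \<Rightarrow> complex \<Rightarrow> 'v) set" where
  "families gr \<equiv> modular_forms_sum gr sc \<Gamma> \<sigma>"

abbreviation scalar_families :: "growth \<Rightarrow> (int \<Rightarrow> complex \<Rightarrow> complex) set" where
  "scalar_families gr \<equiv> modular_forms_sum gr (*) \<Gamma> (\<lambda>_ z. z)"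

lemma families_support: "F \<in> families gr \<Longrightarrow> finite (support F)"
  by (simp add: family_sum_mem_iff)

lemma families_component: "F \<in> families gr \<Longrightarrow> F k \<in> forms gr k"
  by (simp add: family_sum_mem_iff)

lemma families_zero [simp]: "(\<lambda>k \<tau>. 0) \<in> families gr"
  by (simp add: family_sum_mem_iff forms_zero support_def)

lemma families_add [simp]:
  assumes "F \<in> families gr" "G \<in> families gr" shows "(\<lambda>k \<tau>. F k \<tau> + G k \<tau>) \<in> families gr"
proof -
  have "support (\<lambda>k \<tau>. F k \<tau> + G k \<tau>) \<subseteq> support F \<union> support G" by (auto simp: support_def)
  then have "finite (support (\<lambda>k \<tau>. F k \<tau> + G k \<tau>))"
    using assms by (meson families_support finite_UnI finite_subset)
  then show ?thesis using assms by (auto simp: family_sum_mem_iff intro: forms_add)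
qed

lemma families_scale [simp]:
  assumes "F \<in> families gr" shows "(\<lambda>k \<tau>. sc c (F k \<tau>)) \<in> families gr"
proof -
  have "support (\<lambda>k \<tau>. sc c (F k \<tau>)) \<subseteq> support F" by (auto simp: support_def)
  then have "finite (support (\<lambda>k \<tau>. sc c (F k \<tau>)))"
    using assms by (meson families_support finite_subset)
  then show ?thesis using assms by (auto simp: family_sum_mem_iff intro: forms_scale)
qed

lemma families_neg: "F \<in> families gr \<Longrightarrow> (\<lambda>k \<tau>. - F k \<tau>) \<in> families gr"
  using families_scale[of F gr "-1"] by simp

lemma families_sum: "(\<And>i. i \<in> I \<Longrightarrow> f i \<in> families gr) \<Longrightarrow> (\<lambda>k \<tau>. \<Sum>i\<in>I. f i k \<tau>) \<in> families gr"
  by (induction I rule: infinite_finite_induct) auto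

lemma families_single: "f \<in> forms gr k \<Longrightarrow> single_family k f \<in> families gr"
  by (auto simp: family_sum_mem_iff single_family_def forms_zero support_def)

lemma families_eqI:
  assumes "F \<in> families gr" "G \<in> families gr" "\<And>z \<tau>. z \<noteq> 0 \<Longrightarrow> family_eval sc F z \<tau> = family_eval sc G z \<tau>"
  shows "F = G"
  by (rule family_eval_inject) (use assms families_support in auto)

lemma eval_add:
  "F \<in> families gr \<Longrightarrow> G \<in> families gr \<Longrightarrow>
     family_eval sc (\<lambda>k \<tau>. F k \<tau> + G k \<tau>) z \<tau> = family_eval sc F z \<tau> + family_eval sc G z \<tau>"
  by (intro family_eval_add families_support)

lemma eval_scale:
  "F \<in> families gr \<Longrightarrow> family_eval sc (\<lambda>k \<tau>. sc c (F k \<tau>)) z \<tau> = sc c (family_eval sc F z \<tau>)"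
  by (intro family_eval_scale families_support)

lemma modular_algebra_abelian: "abelian_group (modular_algebra gr sc prd u \<Gamma> \<sigma>)"
proof (rule abelian_groupI)
  fix F assume F: "F \<in> carrier (modular_algebra gr sc prd u \<Gamma> \<sigma>)"
  then show "\<exists>G\<in>carrier (modular_algebra gr sc prd u \<Gamma> \<sigma>). G \<oplus>\<^bsub>modular_algebra gr sc prd u \<Gamma> \<sigma>\<^esub> F = \<zero>\<^bsub>modular_algebra gr sc prd u \<Gamma> \<sigma>\<^esub>"
    by (intro bexI[of _ "\<lambda>k \<tau>. - F k \<tau>"]) (auto simp: families_neg)
qed (auto simp: add_ac)

lemma modular_algebra_module: "Module.module complex_field (modular_algebra gr sc prd u \<Gamma> \<sigma>)"
  by (rule Module.moduleI)
    (auto simp: modular_algebra_abelian scale_left_distrib scale_right_distrib)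

lemma modular_algebra_finsum:
  assumes "finite A" "\<And>i. i \<in> A \<Longrightarrow> c i \<in> families gr"
  shows "finsum (modular_algebra gr sc prd u \<Gamma> \<sigma>) c A = (\<lambda>k \<tau>. \<Sum>i\<in>A. c i k \<tau>)"
proof -
  interpret abelian_group "modular_algebra gr sc prd u \<Gamma> \<sigma>" by (rule modular_algebra_abelian)
  show ?thesis using assms
    by (induction A rule: finite_induct) (simp_all add: finsum_insert Pi_iff)
qed

lemma modular_algebra_a_inv:
  assumes "F \<in> families gr"
  shows "a_inv (modular_algebra gr sc prd u \<Gamma> \<sigma>) F = (\<lambda>k \<tau>. - F k \<tau>)"
proof -
  interpret abelian_group "modular_algebra gr sc prd u \<Gamma> \<sigma>" by (rule modular_algebra_abelian)
  show ?thesis using minus_equality[of "\<lambda>k \<tau>. - F k \<tau>" F] assms by (simp add: families_neg)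
qed

lemma graded_part_submodule:
  "submodule (graded_part (modular_algebra gr sc prd u \<Gamma> \<sigma>) k) complex_field (modular_algebra gr sc prd u \<Gamma> \<sigma>)"
  by (rule Module.module.submoduleI[OF modular_algebra_module])
    (auto simp: modular_algebra_a_inv families_neg fun_eq_iff)

lemma modular_algebra_grading: "grading (modular_algebra gr sc prd u \<Gamma> \<sigma>)"
  unfolding grading_def
proof (intro conjI allI ballI)
  let ?M = "modular_algebra gr sc prd u \<Gamma> \<sigma>"
  show "additive_subgroup (graded_part ?M k) ?M" for k
    using graded_part_submodule[of gr prd u k] by (intro additive_subgroupI) (simp add: submodule_def)
  fix F assume F: "F \<in> carrier ?M"
  then have F': "F \<in> families gr" by simp
  define c where "c k = single_family k (F k)" for k
  have c0: "{k. c k \<noteq> \<zero>\<^bsub>?M\<^esub>} = support F"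
    by (auto simp: c_def single_family_def support_def fun_eq_iff)
  show "\<exists>!c. (\<forall>k. c k \<in> graded_part ?M k) \<and> finite {k. c k \<noteq> \<zero>\<^bsub>?M\<^esub>} \<and> F = finsum ?M c {k. c k \<noteq> \<zero>\<^bsub>?M\<^esub>}"
  proof (rule ex1I[of _ c], intro conjI allI)
    show "c k \<in> graded_part ?M k" for k
      unfolding modular_algebra_simps c_def using families_single[OF families_component[OF F']]
      by (simp add: single_family_def)
    show "finite {k. c k \<noteq> \<zero>\<^bsub>?M\<^esub>}" unfolding c0 using families_support[OF F'] .
    have "finsum ?M c (support F) = (\<lambda>k \<tau>. \<Sum>i\<in>support F. c i k \<tau>)"
      by (intro modular_algebra_finsum families_support[OF F'])
        (simp add: c_def families_single families_component[OF F'])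
    also have "\<dots> = F"
    proof (intro ext)
      fix k \<tau>
      have "(\<Sum>i\<in>support F. c i k \<tau>) = (\<Sum>i\<in>support F. if k = i then F i \<tau> else 0)"
        by (intro sum.cong) (auto simp: c_def single_family_def)
      then show "(\<Sum>i\<in>support F. c i k \<tau>) = F k \<tau>"
        using families_support[OF F'] not_in_support[of k F \<tau>] by simp
    qed
    finally show "F = finsum ?M c {k. c k \<noteq> \<zero>\<^bsub>?M\<^esub>}" unfolding c0 ..
  next
    fix d assume d: "(\<forall>k. d k \<in> graded_part ?M k) \<and> finite {k. d k \<noteq> \<zero>\<^bsub>?M\<^esub>} \<and> F = finsum ?M d {k. d k \<noteq> \<zero>\<^bsub>?M\<^esub>}"
    let ?S = "{k. d k \<noteq> (\<lambda>k \<tau>. 0)}"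
    have dk: "d k \<in> families gr" "l \<noteq> k \<Longrightarrow> d k l = (\<lambda>_. 0)" for k l using d by auto
    have F_eq: "F = (\<lambda>k \<tau>. \<Sum>i\<in>?S. d i k \<tau>)"
      using d modular_algebra_finsum[of ?S d gr prd u] dk(1) by simp
    have "d k k \<tau> = F k \<tau>" for k \<tau>
    proof -
      have "F k \<tau> = (\<Sum>i\<in>?S. d i k \<tau>)" by (subst F_eq) simp
      also have "\<dots> = (\<Sum>i\<in>?S. if k = i then d k k \<tau> else 0)"
        by (rule sum.cong) (auto simp: dk(2))
      also have "\<dots> = d k k \<tau>" using d by (auto simp: fun_eq_iff)
      finally show ?thesis ..
    qed
    then show "d = c" using dk(2) by (auto simp: fun_eq_iff c_def single_family_def)
  qed
qed

lemma scalar_product: "bilinear_product (*) sc sc sc"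
proof -
  interpret S: finite_basis "(*) :: complex \<Rightarrow> complex \<Rightarrow> complex" "{1}" by (rule finite_basis_complex)
  show ?thesis by unfold_locales (auto simp: scale_left_distrib scale_right_distrib mult_ac)
qed

lemma families_convolution:
  assumes prd: "bilinear_product s1 s2 sc prd"
    and F: "\<And>k. F k \<in> modular_forms gr s1 \<Gamma> \<alpha> k" "finite (support F)"
    and G: "\<And>k. G k \<in> modular_forms gr s2 \<Gamma> \<beta> k" "finite (support G)"
    and closed: "\<And>k l f h. f \<in> modular_forms gr s1 \<Gamma> \<alpha> k \<Longrightarrow> h \<in> modular_forms gr s2 \<Gamma> \<beta> l \<Longrightarrow>
      (\<lambda>\<tau>. prd (f \<tau>) (h \<tau>)) \<in> forms gr (k + l)"
  shows "weight_convolution prd F G \<in> families gr"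
proof -
  interpret bilinear_product s1 s2 sc prd by fact
  have "(\<lambda>\<tau>. prd (F k \<tau>) (G (n - k) \<tau>)) \<in> forms gr n" for k n
    using closed[OF F(1)[of k] G(1)[of "n - k"]] by simp
  then show ?thesis
    using finite_support_weight_convolution[OF F(2) G(2)]
    by (auto simp: family_sum_mem_iff weight_convolution_def intro!: forms_sum)
qed

lemma families_scalar_convolution [simp]:
  assumes "F \<in> scalar_families gr" "G \<in> families gr"
  shows "weight_convolution sc F G \<in> families gr"
  by (rule families_convolution[OF scalar_product, where \<alpha>="\<lambda>_ z. z" and \<beta>=\<sigma>])
    (use assms in \<open>auto simp: family_sum_mem_iff intro: forms_mult\<close>)

lemma eval_scalar_convolution:
  assumes "F \<in> scalar_families gr" "G \<in> families gr" "z \<noteq> 0"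
  shows "family_eval sc (weight_convolution sc F G) z \<tau> = sc (family_eval (*) F z \<tau>) (family_eval sc G z \<tau>)"
  by (rule bilinear_product.family_eval_weight_convolution[OF scalar_product])
    (use assms in \<open>auto simp: family_sum_mem_iff\<close>)

end

section \<open>Transport of graded structures along bijections\<close>

text \<open>No axioms are assumed for T, just closure: they are pulled back along the injective map
  \<Psi>. In the application T is the quotient that defines the tensor product and M consists of
  modular forms.\<close>

lemma abelian_group_transfer:
  assumes M: "abelian_group M" and bij: "bij_betw \<Psi> (carrier T) (carrier M)"
    and add: "\<And>x y. x \<in> carrier T \<Longrightarrow> y \<in> carrier T \<Longrightarrow> x \<oplus>\<^bsub>T\<^esub> y \<in> carrier T"
      "\<And>x y. x \<in> carrier T \<Longrightarrow> y \<in> carrier T \<Longrightarrow> \<Psi> (x \<oplus>\<^bsub>T\<^esub> y) = \<Psi> x \<oplus>\<^bsub>M\<^esub> \<Psi> y"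
    and zero: "\<zero>\<^bsub>T\<^esub> \<in> carrier T" "\<Psi> \<zero>\<^bsub>T\<^esub> = \<zero>\<^bsub>M\<^esub>"
  shows "abelian_group T"
proof -
  interpret M: abelian_group M by fact
  have inj: "x = y" if "\<Psi> x = \<Psi> y" "x \<in> carrier T" "y \<in> carrier T" for x y
    using bij that by (auto simp: bij_betw_def inj_on_def)
  have cl [simp]: "\<Psi> x \<in> carrier M" if "x \<in> carrier T" for x using bij that by (auto simp: bij_betw_def)
  note [simp] = add zero
  show ?thesis
  proof (rule abelian_groupI)
    fix x y z assume *: "x \<in> carrier T" "y \<in> carrier T" "z \<in> carrier T"
    show "x \<oplus>\<^bsub>T\<^esub> y \<oplus>\<^bsub>T\<^esub> z = x \<oplus>\<^bsub>T\<^esub> (y \<oplus>\<^bsub>T\<^esub> z)" using * by (intro inj) (simp_all add: M.a_assoc)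
    show "x \<oplus>\<^bsub>T\<^esub> y = y \<oplus>\<^bsub>T\<^esub> x" using * by (intro inj) (simp_all add: M.a_comm)
    show "\<zero>\<^bsub>T\<^esub> \<oplus>\<^bsub>T\<^esub> x = x" using * by (intro inj) simp_all
    obtain y where y: "y \<in> carrier T" "\<Psi> y = \<ominus>\<^bsub>M\<^esub> \<Psi> x"
      using bij M.a_inv_closed[OF cl[OF *(1)]] by (metis bij_betw_def imageE)
    then show "\<exists>y\<in>carrier T. y \<oplus>\<^bsub>T\<^esub> x = \<zero>\<^bsub>T\<^esub>"
      using * by (intro bexI[of _ y] inj) (simp_all add: M.l_neg)
  qed simp_all
qed

lemma finsum_transfer:
  assumes M: "abelian_group M" and T: "abelian_group T"
    and add: "\<And>x y. x \<in> carrier T \<Longrightarrow> y \<in> carrier T \<Longrightarrow> \<Psi> (x \<oplus>\<^bsub>T\<^esub> y) = \<Psi> x \<oplus>\<^bsub>M\<^esub> \<Psi> y"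
    and zero: "\<Psi> \<zero>\<^bsub>T\<^esub> = \<zero>\<^bsub>M\<^esub>" and cl: "\<And>x. x \<in> carrier T \<Longrightarrow> \<Psi> x \<in> carrier M"
    and A: "finite A" "\<And>i. i \<in> A \<Longrightarrow> c i \<in> carrier T"
  shows "\<Psi> (finsum T c A) = finsum M (\<lambda>i. \<Psi> (c i)) A"
proof -
  interpret M: abelian_group M by fact
  interpret T: abelian_group T by fact
  show ?thesis using A
  proof (induction A rule: finite_induct)
    case (insert i A)
    then have "c i \<in> carrier T" "c \<in> A \<rightarrow> carrier T" "(\<lambda>i. \<Psi> (c i)) \<in> A \<rightarrow> carrier M" "\<Psi> (c i) \<in> carrier M"
      by (auto simp: cl)
    with insert show ?case by (simp add: add)
  qed (simp add: zero)
qed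

lemma grading_transfer:
  assumes M: "abelian_group M" "grading M" and bij: "bij_betw \<Psi> (carrier T) (carrier M)"
    and add: "\<And>x y. x \<in> carrier T \<Longrightarrow> y \<in> carrier T \<Longrightarrow> x \<oplus>\<^bsub>T\<^esub> y \<in> carrier T"
      "\<And>x y. x \<in> carrier T \<Longrightarrow> y \<in> carrier T \<Longrightarrow> \<Psi> (x \<oplus>\<^bsub>T\<^esub> y) = \<Psi> x \<oplus>\<^bsub>M\<^esub> \<Psi> y"
    and zero: "\<zero>\<^bsub>T\<^esub> \<in> carrier T" "\<Psi> \<zero>\<^bsub>T\<^esub> = \<zero>\<^bsub>M\<^esub>"
    and parts: "\<And>k. graded_part T k \<subseteq> carrier T" "\<And>k. \<Psi> ` graded_part T k = graded_part M k"
  shows "grading T"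
proof -
  interpret M: abelian_group M by fact
  have T: "abelian_group T" by (rule abelian_group_transfer[OF M(1) bij add zero])
  interpret T: abelian_group T by fact
  have inj: "x = y" if "\<Psi> x = \<Psi> y" "x \<in> carrier T" "y \<in> carrier T" for x y
    using bij that by (auto simp: bij_betw_def inj_on_def)
  have cl [simp]: "\<Psi> x \<in> carrier M" if "x \<in> carrier T" for x using bij that by (auto simp: bij_betw_def)
  note [simp] = add zero
  have part_iff: "x \<in> graded_part T k \<longleftrightarrow> \<Psi> x \<in> graded_part M k" if x: "x \<in> carrier T" for x k
  proof
    assume "\<Psi> x \<in> graded_part M k"
    then obtain y where y: "y \<in> graded_part T k" "\<Psi> y = \<Psi> x" using parts(2)[of k] by (metis imageE)
    with x parts(1)[of k] inj[of y x] show "x \<in> graded_part T k" by blast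
  qed (use parts(2)[of k] in blast)
  have neg: "\<Psi> (\<ominus>\<^bsub>T\<^esub> x) = \<ominus>\<^bsub>M\<^esub> \<Psi> x" if x: "x \<in> carrier T" for x
    using M.minus_equality[of "\<Psi> (\<ominus>\<^bsub>T\<^esub> x)" "\<Psi> x"] x add(2)[of "\<ominus>\<^bsub>T\<^esub> x" x] by (simp add: T.l_neg del: add)
  show ?thesis
    unfolding grading_def
  proof (intro conjI allI ballI)
    fix k
    have "additive_subgroup (graded_part M k) M" using M(2) by (simp add: grading_def)
    then interpret P: additive_subgroup "graded_part M k" M .
    show "additive_subgroup (graded_part T k) T"
    proof (rule additive_subgroupI, rule subgroup.intro)
      show "graded_part T k \<subseteq> carrier (add_monoid T)" using parts(1) by simp
      show "\<one>\<^bsub>add_monoid T\<^esub> \<in> graded_part T k" by (simp add: part_iff)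
      fix x y assume "x \<in> graded_part T k" "y \<in> graded_part T k"
      moreover from this have "x \<in> carrier T" "y \<in> carrier T" using parts(1) by blast+
      ultimately show "x \<otimes>\<^bsub>add_monoid T\<^esub> y \<in> graded_part T k" by (simp add: part_iff P.a_closed)
    next
      fix x assume x: "x \<in> graded_part T k"
      then have "x \<in> carrier T" using parts(1) by blast
      with x have "\<ominus>\<^bsub>T\<^esub> x \<in> graded_part T k" by (simp add: part_iff neg P.a_inv_closed)
      then show "inv\<^bsub>add_monoid T\<^esub> x \<in> graded_part T k" by (simp add: a_inv_def)
    qed
  next
    fix x assume x: "x \<in> carrier T"
    define decomp where "decomp = (\<lambda>c. (\<forall>k. c k \<in> graded_part M k) \<and> finite {k. c k \<noteq> \<zero>\<^bsub>M\<^esub>} \<and> \<Psi> x = finsum M c {k. c k \<noteq> \<zero>\<^bsub>M\<^esub>})"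
    have ex1: "\<exists>!c. decomp c" using M(2) x unfolding grading_def decomp_def by simp
    \<comment> \<open>Decompositions of x correspond to decompositions of its image; the index sets
      agree because \<Psi> sends nothing but zero to zero.\<close>
    have equiv: "((\<forall>k. d k \<in> graded_part T k) \<and> finite {k. d k \<noteq> \<zero>\<^bsub>T\<^esub>} \<and> x = finsum T d {k. d k \<noteq> \<zero>\<^bsub>T\<^esub>})
        \<longleftrightarrow> decomp (\<lambda>k. \<Psi> (d k))" if d: "\<And>k. d k \<in> carrier T" for d
    proof -
      have z: "{k. \<Psi> (d k) \<noteq> \<zero>\<^bsub>M\<^esub>} = {k. d k \<noteq> \<zero>\<^bsub>T\<^esub>}"
        using inj[of "d _" "\<zero>\<^bsub>T\<^esub>"] d by auto
      have "x = finsum T d A \<longleftrightarrow> \<Psi> x = finsum M (\<lambda>k. \<Psi> (d k)) A" if "finite A" for A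
      proof -
        have "finsum T d A \<in> carrier T" using d by (intro T.finsum_closed) auto
        moreover have "\<Psi> (finsum T d A) = finsum M (\<lambda>k. \<Psi> (d k)) A"
          by (rule finsum_transfer[OF M(1) T]) (use d that in simp_all)
        ultimately show ?thesis using inj[of x "finsum T d A"] x by metis
      qed
      moreover have "(\<forall>k. d k \<in> graded_part T k) \<longleftrightarrow> (\<forall>k. \<Psi> (d k) \<in> graded_part M k)"
        by (simp only: part_iff[OF d])
      ultimately show ?thesis unfolding decomp_def z by (cases "finite {k. d k \<noteq> \<zero>\<^bsub>T\<^esub>}") simp_all
    qed
    from ex1 obtain c where c: "decomp c" "\<forall>c'. decomp c' \<longrightarrow> c' = c" by (elim ex1E)
    have "\<exists>y. y \<in> graded_part T k \<and> \<Psi> y = c k" for k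
    proof -
      have "c k \<in> \<Psi> ` graded_part T k" using c(1) parts(2)[of k] by (simp add: decomp_def)
      then show ?thesis by auto
    qed
    then have "\<forall>k. \<exists>y. y \<in> graded_part T k \<and> \<Psi> y = c k" ..
    from choice[OF this] obtain d where d: "\<forall>k. d k \<in> graded_part T k \<and> \<Psi> (d k) = c k" ..
    then have dc: "(\<lambda>k. \<Psi> (d k)) = c" and dT: "d k \<in> carrier T" for k using parts(1)[of k] by auto
    show "\<exists>!d. (\<forall>k. d k \<in> graded_part T k) \<and> finite {k. d k \<noteq> \<zero>\<^bsub>T\<^esub>} \<and> x = finsum T d {k. d k \<noteq> \<zero>\<^bsub>T\<^esub>}"
    proof (rule ex1I[of _ d])
      show "(\<forall>k. d k \<in> graded_part T k) \<and> finite {k. d k \<noteq> \<zero>\<^bsub>T\<^esub>} \<and> x = finsum T d {k. d k \<noteq> \<zero>\<^bsub>T\<^esub>}"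
        by (rule equiv[of d, THEN iffD2, OF dT]) (simp only: dc c(1))
      fix d' assume d': "(\<forall>k. d' k \<in> graded_part T k) \<and> finite {k. d' k \<noteq> \<zero>\<^bsub>T\<^esub>} \<and> x = finsum T d' {k. d' k \<noteq> \<zero>\<^bsub>T\<^esub>}"
      then have d'T: "d' k \<in> carrier T" for k using parts(1)[of k] by auto
      have "decomp (\<lambda>k. \<Psi> (d' k))" by (rule equiv[of d', THEN iffD1, OF d'T d'])
      with c(2) have "(\<lambda>k. \<Psi> (d' k)) = c" by (elim allE impE)
      with dc have "\<Psi> (d' k) = \<Psi> (d k)" for k by (metis (no_types))
      then show "d' = d" by (intro ext inj d'T dT)
    qed
  qed
qed

lemma abelian_group_with_scalars:
  assumes "abelian_group M" shows "abelian_group (with_scalars act M)"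
proof -
  interpret abelian_group M by fact
  show ?thesis by (rule abelian_group_transfer[OF assms, of "\<lambda>x. x"]) (simp_all add: bij_betw_def)
qed

lemma grading_with_scalars:
  assumes M: "abelian_group M" "grading M" shows "grading (with_scalars act M)"
proof -
  interpret abelian_group M by fact
  have "graded_part M k \<subseteq> carrier M" for k
    using M(2) additive_subgroup.a_subset[of "graded_part M k" M] by (simp add: grading_def)
  then show ?thesis by (intro grading_transfer[OF M, of "\<lambda>x. x"]) (simp_all add: bij_betw_def)
qed

lemma supported_iff: "(\<forall>l. l \<noteq> k \<longrightarrow> F l = (\<lambda>_. 0)) \<longleftrightarrow> support F \<subseteq> {k}"
  by (auto simp: support_def)

lemma supported_convolution:
  assumes "\<And>u. prd u 0 = 0" "\<forall>n. n \<noteq> k \<longrightarrow> F n = (\<lambda>_. 0)" "\<forall>n. n \<noteq> l \<longrightarrow> G n = (\<lambda>_. 0)" "n \<noteq> k + l"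
  shows "weight_convolution prd F G n = (\<lambda>_. 0)"
proof -
  have "support (weight_convolution prd F G) \<subseteq> {k + l}"
  proof -
    have "support F \<times> support G \<subseteq> {k} \<times> {l}" using assms(2,3) unfolding supported_iff by blast
    from image_mono[OF this, of "\<lambda>(k, l). k + l"] support_weight_convolution[of prd F G, OF assms(1)]
    show ?thesis by simp
  qed
  with assms(4) have "n \<notin> support (weight_convolution prd F G)" by blast
  then show ?thesis by (simp add: support_def)
qed

section \<open>The graded ring of scalar forms and its graded modules\<close>

context modular_forms_space begin

text \<open>Functions are extended by 0 off the half-plane, so the unit does too and evaluates to 0
  there. It still acts as an identity since every family vanishes there, which is the purpose of
  \<open>eval_outside\<close>.\<close>

definition unit_family :: "int \<Rightarrow> complex \<Rightarrow> complex" where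
  "unit_family = (\<lambda>k \<tau>. if k = 0 \<and> \<tau> \<in> upper_half_plane then 1 else 0)"

lemma unit_family_mem: "unit_family \<in> scalar_families gr"
proof -
  interpret S: modular_forms_space "(*)" "{1}" \<Gamma> "\<lambda>_ z. z" by (rule scalar_modular_forms_space[OF Gamma_subset])
  have "(\<lambda>\<tau>. if \<tau> \<in> upper_half_plane then 1 else 0) \<in> scalar_forms gr 0"
    unfolding modular_forms_iff holomorphic_map_complex_iff
  proof (intro conjI ballI allI impI)
    show "(\<lambda>\<tau>. if \<tau> \<in> upper_half_plane then 1 else 0) holomorphic_on upper_half_plane"
      by (rule holomorphic_transform[of "\<lambda>_. 1"]) auto
    show "tame gr g (\<lambda>\<tau>. norm (if \<tau> \<in> upper_half_plane then 1 else 0 :: complex))" for g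
      by (rule tame_mono[OF tame_const[of gr g 1]]) auto
  qed (use Gamma_subset moebius_upper_half_plane in auto)
  then have "single_family 0 (\<lambda>\<tau>. if \<tau> \<in> upper_half_plane then 1 else 0) \<in> scalar_families gr"
    by (rule S.families_single)
  moreover have "single_family 0 (\<lambda>\<tau>. if \<tau> \<in> upper_half_plane then 1 else 0) = unit_family"
    by (auto simp: single_family_def unit_family_def fun_eq_iff)
  ultimately show ?thesis by simp
qed

lemma eval_unit_family: "family_eval (*) unit_family z \<tau> = (if \<tau> \<in> upper_half_plane then 1 else 0)"
proof -
  interpret S: finite_basis "(*) :: complex \<Rightarrow> complex \<Rightarrow> complex" "{1}" by (rule finite_basis_complex)
  show ?thesis by (subst S.family_eval_superset[of "{0}"]) (auto simp: support_def unit_family_def fun_eq_iff)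
qed

lemma eval_outside:
  assumes "F \<in> families gr" "\<tau> \<notin> upper_half_plane" shows "family_eval sc F z \<tau> = 0"
  unfolding family_eval_def using forms_outside[OF families_component[OF assms(1)]] assms(2)
  by (intro sum.neutral) auto

lemma scalar_modular_forms_graded_ring: "graded_ring (scalar_modular_forms gr \<Gamma>)"
proof -
  interpret S: modular_forms_space "(*)" "{1}" \<Gamma> "\<lambda>_ z. z" by (rule scalar_modular_forms_space[OF Gamma_subset])
  note S.eval_add[where gr=gr, simp] S.eval_scalar_convolution[where gr=gr, simp]
    eval_unit_family [simp] unit_family_mem[of gr, simp]
  have comm: "weight_convolution (*) F G = weight_convolution (*) G F"
    if "F \<in> scalar_families gr" "G \<in> scalar_families gr" for F G
    by (rule S.families_eqI[where gr=gr]) (use that in simp_all)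
  have one: "weight_convolution (*) unit_family F = F" if "F \<in> scalar_families gr" for F
    by (rule S.families_eqI[where gr=gr]) (use that S.eval_outside[OF that] in simp_all)
  have cring: "cring (scalar_modular_forms gr \<Gamma>)"
    unfolding scalar_modular_forms_def
  proof (rule cringI)
    show "abelian_group (modular_algebra gr (*) (*) 1 \<Gamma> (\<lambda>_ z. z))" by (rule S.modular_algebra_abelian)
    show "Group.comm_monoid (modular_algebra gr (*) (*) 1 \<Gamma> (\<lambda>_ z. z))"
    proof (rule comm_monoidI)
      fix F G E assume *: "F \<in> carrier (modular_algebra gr (*) (*) 1 \<Gamma> (\<lambda>_ z. z))"
        "G \<in> carrier (modular_algebra gr (*) (*) 1 \<Gamma> (\<lambda>_ z. z))"
        "E \<in> carrier (modular_algebra gr (*) (*) 1 \<Gamma> (\<lambda>_ z. z))"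
      have "weight_convolution (*) (weight_convolution (*) F G) E = weight_convolution (*) F (weight_convolution (*) G E)"
        by (rule S.families_eqI[where gr=gr]) (use * in simp_all)
      then show "F \<otimes>\<^bsub>modular_algebra gr (*) (*) 1 \<Gamma> (\<lambda>_ z. z)\<^esub> G \<otimes>\<^bsub>modular_algebra gr (*) (*) 1 \<Gamma> (\<lambda>_ z. z)\<^esub> E
        = F \<otimes>\<^bsub>modular_algebra gr (*) (*) 1 \<Gamma> (\<lambda>_ z. z)\<^esub> (G \<otimes>\<^bsub>modular_algebra gr (*) (*) 1 \<Gamma> (\<lambda>_ z. z)\<^esub> E)" by simp
    qed (use comm one[unfolded unit_family_def] unit_family_mem[of gr, unfolded unit_family_def] in simp_all)
    fix F G E assume *: "F \<in> carrier (modular_algebra gr (*) (*) 1 \<Gamma> (\<lambda>_ z. z))"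
      "G \<in> carrier (modular_algebra gr (*) (*) 1 \<Gamma> (\<lambda>_ z. z))"
      "E \<in> carrier (modular_algebra gr (*) (*) 1 \<Gamma> (\<lambda>_ z. z))"
    have "weight_convolution (*) (\<lambda>k \<tau>. F k \<tau> + G k \<tau>) E
        = (\<lambda>k \<tau>. weight_convolution (*) F E k \<tau> + weight_convolution (*) G E k \<tau>)"
      by (rule S.families_eqI[where gr=gr]) (use * in \<open>simp_all add: distrib_right\<close>)
    then show "(F \<oplus>\<^bsub>modular_algebra gr (*) (*) 1 \<Gamma> (\<lambda>_ z. z)\<^esub> G) \<otimes>\<^bsub>modular_algebra gr (*) (*) 1 \<Gamma> (\<lambda>_ z. z)\<^esub> E
        = F \<otimes>\<^bsub>modular_algebra gr (*) (*) 1 \<Gamma> (\<lambda>_ z. z)\<^esub> E \<oplus>\<^bsub>modular_algebra gr (*) (*) 1 \<Gamma> (\<lambda>_ z. z)\<^esub> (G \<otimes>\<^bsub>modular_algebra gr (*) (*) 1 \<Gamma> (\<lambda>_ z. z)\<^esub> E)"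
      by simp
  qed
  have grading: "grading (scalar_modular_forms gr \<Gamma>)"
    unfolding scalar_modular_forms_def by (rule S.modular_algebra_grading)
  show ?thesis
    unfolding graded_ring_def
  proof (intro conjI cring grading allI ballI)
    show "\<one>\<^bsub>scalar_modular_forms gr \<Gamma>\<^esub> \<in> graded_part (scalar_modular_forms gr \<Gamma>) 0"
      using unit_family_mem[of gr] by (simp add: scalar_modular_forms_def unit_family_def)
    fix k l F G assume "F \<in> graded_part (scalar_modular_forms gr \<Gamma>) k" "G \<in> graded_part (scalar_modular_forms gr \<Gamma>) l"
    then show "F \<otimes>\<^bsub>scalar_modular_forms gr \<Gamma>\<^esub> G \<in> graded_part (scalar_modular_forms gr \<Gamma>) (k + l)"
      using supported_convolution[of "(*)" k F l G] by (simp add: scalar_modular_forms_def)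
  qed
qed

lemma modular_algebra_graded_module:
  "graded_module_over (scalar_modular_forms gr \<Gamma>) (with_scalars (weight_convolution sc) (modular_algebra gr sc prd u \<Gamma> \<sigma>))"
proof -
  let ?M = "with_scalars (weight_convolution sc) (modular_algebra gr sc prd u \<Gamma> \<sigma>)"
  interpret S: modular_forms_space "(*)" "{1}" \<Gamma> "\<lambda>_ z. z" by (rule scalar_modular_forms_space[OF Gamma_subset])
  note S.eval_add[where gr=gr, simp] S.eval_scalar_convolution[where gr=gr, simp]
    eval_unit_family [simp] unit_family_mem[of gr, simp]
  note eval_add[where gr=gr, simp] eval_scalar_convolution[where gr=gr, simp]
  have module: "Module.module (scalar_modular_forms gr \<Gamma>) ?M"
  proof (rule Module.moduleI)
    show "cring (scalar_modular_forms gr \<Gamma>)" using scalar_modular_forms_graded_ring by (simp add: graded_ring_def)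
    show "abelian_group ?M" by (intro abelian_group_with_scalars modular_algebra_abelian)
    note [simp] = scalar_modular_forms_def
    show "a \<odot>\<^bsub>?M\<^esub> x \<in> carrier ?M" if "a \<in> carrier (scalar_modular_forms gr \<Gamma>)" "x \<in> carrier ?M" for a x
      using that by simp
    show "(a \<oplus>\<^bsub>scalar_modular_forms gr \<Gamma>\<^esub> b) \<odot>\<^bsub>?M\<^esub> x = a \<odot>\<^bsub>?M\<^esub> x \<oplus>\<^bsub>?M\<^esub> b \<odot>\<^bsub>?M\<^esub> x"
      if "a \<in> carrier (scalar_modular_forms gr \<Gamma>)" "b \<in> carrier (scalar_modular_forms gr \<Gamma>)" "x \<in> carrier ?M" for a b x
    proof -
      have "weight_convolution sc (\<lambda>k \<tau>. a k \<tau> + b k \<tau>) x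
          = (\<lambda>k \<tau>. weight_convolution sc a x k \<tau> + weight_convolution sc b x k \<tau>)"
        by (rule families_eqI[where gr=gr]) (use that in \<open>simp_all add: scale_left_distrib\<close>)
      then show ?thesis by simp
    qed
    show "a \<odot>\<^bsub>?M\<^esub> (x \<oplus>\<^bsub>?M\<^esub> y) = a \<odot>\<^bsub>?M\<^esub> x \<oplus>\<^bsub>?M\<^esub> a \<odot>\<^bsub>?M\<^esub> y"
      if "a \<in> carrier (scalar_modular_forms gr \<Gamma>)" "x \<in> carrier ?M" "y \<in> carrier ?M" for a x y
    proof -
      have "weight_convolution sc a (\<lambda>k \<tau>. x k \<tau> + y k \<tau>)
          = (\<lambda>k \<tau>. weight_convolution sc a x k \<tau> + weight_convolution sc a y k \<tau>)"
        by (rule families_eqI[where gr=gr]) (use that in \<open>simp_all add: scale_right_distrib\<close>)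
      then show ?thesis by simp
    qed
    show "(a \<otimes>\<^bsub>scalar_modular_forms gr \<Gamma>\<^esub> b) \<odot>\<^bsub>?M\<^esub> x = a \<odot>\<^bsub>?M\<^esub> (b \<odot>\<^bsub>?M\<^esub> x)"
      if "a \<in> carrier (scalar_modular_forms gr \<Gamma>)" "b \<in> carrier (scalar_modular_forms gr \<Gamma>)" "x \<in> carrier ?M" for a b x
    proof -
      have "weight_convolution sc (weight_convolution (*) a b) x = weight_convolution sc a (weight_convolution sc b x)"
        by (rule families_eqI[where gr=gr]) (use that in simp_all)
      then show ?thesis by simp
    qed
    show "\<one>\<^bsub>scalar_modular_forms gr \<Gamma>\<^esub> \<odot>\<^bsub>?M\<^esub> x = x" if "x \<in> carrier ?M" for x
    proof -
      have x: "x \<in> families gr" using that by simp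
      have "weight_convolution sc unit_family x = x"
        by (rule families_eqI[where gr=gr]) (use x eval_outside[OF x] in simp_all)
      then show ?thesis by (simp add: unit_family_def)
    qed
  qed
  show ?thesis
    unfolding graded_module_over_def
  proof (intro conjI scalar_modular_forms_graded_ring module grading_with_scalars modular_algebra_abelian modular_algebra_grading allI ballI)
    fix k l r x assume "r \<in> graded_part (scalar_modular_forms gr \<Gamma>) k" "x \<in> graded_part ?M l"
    then show "r \<odot>\<^bsub>?M\<^esub> x \<in> graded_part ?M (k + l)"
      using supported_convolution[of sc k r l x] by (simp add: scalar_modular_forms_def)
  qed
qed

end

section \<open>The graded Lie algebra of vector-valued forms\<close>

lemma lie_algebraD:
  assumes "lie_algebra L" "x \<in> carrier L" "y \<in> carrier L" "z \<in> carrier L"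
  shows "(x \<oplus>\<^bsub>L\<^esub> y) \<otimes>\<^bsub>L\<^esub> z = x \<otimes>\<^bsub>L\<^esub> z \<oplus>\<^bsub>L\<^esub> y \<otimes>\<^bsub>L\<^esub> z"
    "z \<otimes>\<^bsub>L\<^esub> (x \<oplus>\<^bsub>L\<^esub> y) = z \<otimes>\<^bsub>L\<^esub> x \<oplus>\<^bsub>L\<^esub> z \<otimes>\<^bsub>L\<^esub> y"
    "(c \<odot>\<^bsub>L\<^esub> x) \<otimes>\<^bsub>L\<^esub> y = c \<odot>\<^bsub>L\<^esub> (x \<otimes>\<^bsub>L\<^esub> y)"
    "x \<otimes>\<^bsub>L\<^esub> (c \<odot>\<^bsub>L\<^esub> y) = c \<odot>\<^bsub>L\<^esub> (x \<otimes>\<^bsub>L\<^esub> y)"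
    "x \<otimes>\<^bsub>L\<^esub> x = \<zero>\<^bsub>L\<^esub>"
    "x \<otimes>\<^bsub>L\<^esub> (y \<otimes>\<^bsub>L\<^esub> z) \<oplus>\<^bsub>L\<^esub> y \<otimes>\<^bsub>L\<^esub> (z \<otimes>\<^bsub>L\<^esub> x) \<oplus>\<^bsub>L\<^esub> z \<otimes>\<^bsub>L\<^esub> (x \<otimes>\<^bsub>L\<^esub> y) = \<zero>\<^bsub>L\<^esub>"
    "x \<otimes>\<^bsub>L\<^esub> y \<in> carrier L"
  using assms unfolding lie_algebra_def by blast+

lemma lie_algebra_of_simps [simp]:
  "carrier (lie_algebra_of sc br) = UNIV" "monoid.mult (lie_algebra_of sc br) = br"
  "zero (lie_algebra_of sc br) = 0" "add (lie_algebra_of sc br) = (+)" "module.smult (lie_algebra_of sc br) = sc"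
  by (simp_all add: lie_algebra_of_def)

locale lie_modular_forms_space = modular_forms_space sc B \<Gamma> \<sigma>
  for sc :: "complex \<Rightarrow> 'v::real_normed_vector \<Rightarrow> 'v" and B \<Gamma> \<sigma> +
  fixes br :: "'v \<Rightarrow> 'v \<Rightarrow> 'v"
  assumes lie: "lie_algebra (lie_algebra_of sc br)"
    and sigma_bracket: "\<gamma> \<in> \<Gamma> \<Longrightarrow> \<sigma> \<gamma> (br u v) = br (\<sigma> \<gamma> u) (\<sigma> \<gamma> v)"
begin

lemma bracket_add: "br (u + v) w = br u w + br v w" "br w (u + v) = br w u + br w v"
  using lie_algebraD(1,2)[OF lie, of u v w] by simp_all

lemma bracket_scale: "br (sc c u) v = sc c (br u v)" "br u (sc c v) = sc c (br u v)"
  using lie_algebraD(3,4)[OF lie, of u v w c for w] by simp_all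

lemma bracket_self: "br u u = 0"
  using lie_algebraD(5)[OF lie, of u u u] by simp

lemma jacobi: "br u (br v w) + br v (br w u) + br w (br u v) = 0"
  using lie_algebraD(6)[OF lie, of u v w] by simp

lemma bracket_product: "bilinear_product sc sc sc br"
  by unfold_locales (simp_all add: bracket_add bracket_scale)

lemma bracket_zero [simp]: "br 0 u = 0" "br u 0 = 0"
  using bilinear_product.prd_zero[OF bracket_product] by simp_all

lemma families_bracket [simp]:
  assumes "F \<in> families gr" "G \<in> families gr"
  shows "weight_convolution br F G \<in> families gr"
  by (rule families_convolution[OF bracket_product, where \<alpha>=\<sigma> and \<beta>=\<sigma>])
    (use assms forms_bilinear[of br, OF bracket_add bracket_scale sigma_bracket _ _ refl] in \<open>simp_all add: family_sum_mem_iff\<close>)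

lemma eval_bracket:
  assumes "F \<in> families gr" "G \<in> families gr" "z \<noteq> 0"
  shows "family_eval sc (weight_convolution br F G) z \<tau> = br (family_eval sc F z \<tau>) (family_eval sc G z \<tau>)"
  by (rule bilinear_product.family_eval_weight_convolution[OF bracket_product])
    (use assms in \<open>auto simp: family_sum_mem_iff\<close>)

lemma eval_zero: "family_eval sc (\<lambda>k \<tau>. 0) z \<tau> = 0"
  by (simp add: family_eval_def support_def)

lemma modular_algebra_graded_lie_algebra: "graded_lie_algebra (modular_algebra gr sc br u \<Gamma> \<sigma>)"
proof -
  let ?M = "modular_algebra gr sc br u \<Gamma> \<sigma>"
  note eval_add[where gr=gr, simp] eval_bracket[where gr=gr, simp] eval_scale[where gr=gr, simp] eval_zero [simp]
  have "lie_algebra ?M"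
    unfolding lie_algebra_def
  proof (intro conjI ballI allI modular_algebra_module)
    fix x assume "x \<in> carrier ?M"
    then have x: "x \<in> families gr" by simp
    have "weight_convolution br x x = (\<lambda>k \<tau>. 0)"
      by (rule families_eqI[where gr=gr]) (use x in \<open>simp_all add: bracket_self\<close>)
    then show "x \<otimes>\<^bsub>?M\<^esub> x = \<zero>\<^bsub>?M\<^esub>" by simp
    fix y assume "y \<in> carrier ?M"
    then have y: "y \<in> families gr" by simp
    show "x \<otimes>\<^bsub>?M\<^esub> y \<in> carrier ?M" using x y by simp
    have "weight_convolution br (\<lambda>k \<tau>. sc c (x k \<tau>)) y = (\<lambda>k \<tau>. sc c (weight_convolution br x y k \<tau>))" for c
      by (rule families_eqI[where gr=gr]) (use x y in \<open>simp_all add: bracket_scale\<close>)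
    then show "(c \<odot>\<^bsub>?M\<^esub> x) \<otimes>\<^bsub>?M\<^esub> y = c \<odot>\<^bsub>?M\<^esub> (x \<otimes>\<^bsub>?M\<^esub> y)" for c by simp
    have "weight_convolution br x (\<lambda>k \<tau>. sc c (y k \<tau>)) = (\<lambda>k \<tau>. sc c (weight_convolution br x y k \<tau>))" for c
      by (rule families_eqI[where gr=gr]) (use x y in \<open>simp_all add: bracket_scale\<close>)
    then show "x \<otimes>\<^bsub>?M\<^esub> (c \<odot>\<^bsub>?M\<^esub> y) = c \<odot>\<^bsub>?M\<^esub> (x \<otimes>\<^bsub>?M\<^esub> y)" for c by simp
    fix z assume "z \<in> carrier ?M"
    then have z: "z \<in> families gr" by simp
    have "weight_convolution br (\<lambda>k \<tau>. x k \<tau> + y k \<tau>) z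
        = (\<lambda>k \<tau>. weight_convolution br x z k \<tau> + weight_convolution br y z k \<tau>)"
      by (rule families_eqI[where gr=gr]) (use x y z in \<open>simp_all add: bracket_add\<close>)
    then show "(x \<oplus>\<^bsub>?M\<^esub> y) \<otimes>\<^bsub>?M\<^esub> z = x \<otimes>\<^bsub>?M\<^esub> z \<oplus>\<^bsub>?M\<^esub> y \<otimes>\<^bsub>?M\<^esub> z" by simp
    have "weight_convolution br z (\<lambda>k \<tau>. x k \<tau> + y k \<tau>)
        = (\<lambda>k \<tau>. weight_convolution br z x k \<tau> + weight_convolution br z y k \<tau>)"
      by (rule families_eqI[where gr=gr]) (use x y z in \<open>simp_all add: bracket_add\<close>)
    then show "z \<otimes>\<^bsub>?M\<^esub> (x \<oplus>\<^bsub>?M\<^esub> y) = z \<otimes>\<^bsub>?M\<^esub> x \<oplus>\<^bsub>?M\<^esub> z \<otimes>\<^bsub>?M\<^esub> y" by simp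
    have "(\<lambda>k \<tau>. (weight_convolution br x (weight_convolution br y z) k \<tau> + weight_convolution br y (weight_convolution br z x) k \<tau>)
        + weight_convolution br z (weight_convolution br x y) k \<tau>) = (\<lambda>k \<tau>. 0)"
      by (rule families_eqI[where gr=gr]) (use x y z in \<open>simp_all add: jacobi\<close>)
    then show "x \<otimes>\<^bsub>?M\<^esub> (y \<otimes>\<^bsub>?M\<^esub> z) \<oplus>\<^bsub>?M\<^esub> y \<otimes>\<^bsub>?M\<^esub> (z \<otimes>\<^bsub>?M\<^esub> x) \<oplus>\<^bsub>?M\<^esub> z \<otimes>\<^bsub>?M\<^esub> (x \<otimes>\<^bsub>?M\<^esub> y) = \<zero>\<^bsub>?M\<^esub>" by simp
  qed
  then show ?thesis
    unfolding graded_lie_algebra_def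
  proof (intro conjI modular_algebra_grading graded_part_submodule allI ballI)
    fix k l x y assume "x \<in> graded_part ?M k" "y \<in> graded_part ?M l"
    then show "x \<otimes>\<^bsub>?M\<^esub> y \<in> graded_part ?M (k + l)"
      using supported_convolution[of br k x l y] by simp
  qed
qed

end

lemma module_transfer:
  assumes M: "Module.module R M" and bij: "bij_betw \<Psi> (carrier T) (carrier M)"
    and add: "\<And>x y. x \<in> carrier T \<Longrightarrow> y \<in> carrier T \<Longrightarrow> x \<oplus>\<^bsub>T\<^esub> y \<in> carrier T"
      "\<And>x y. x \<in> carrier T \<Longrightarrow> y \<in> carrier T \<Longrightarrow> \<Psi> (x \<oplus>\<^bsub>T\<^esub> y) = \<Psi> x \<oplus>\<^bsub>M\<^esub> \<Psi> y"
    and zero: "\<zero>\<^bsub>T\<^esub> \<in> carrier T" "\<Psi> \<zero>\<^bsub>T\<^esub> = \<zero>\<^bsub>M\<^esub>"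
    and smult: "\<And>c x. c \<in> carrier R \<Longrightarrow> x \<in> carrier T \<Longrightarrow> c \<odot>\<^bsub>T\<^esub> x \<in> carrier T"
      "\<And>c x. c \<in> carrier R \<Longrightarrow> x \<in> carrier T \<Longrightarrow> \<Psi> (c \<odot>\<^bsub>T\<^esub> x) = c \<odot>\<^bsub>M\<^esub> \<Psi> x"
  shows "Module.module R T"
proof -
  interpret M: Module.module R M by fact
  have inj: "x = y" if "\<Psi> x = \<Psi> y" "x \<in> carrier T" "y \<in> carrier T" for x y
    using bij that by (auto simp: bij_betw_def inj_on_def)
  have cl: "\<Psi> x \<in> carrier M" if "x \<in> carrier T" for x using bij that by (auto simp: bij_betw_def)
  show ?thesis
  proof (rule Module.moduleI)
    show "cring R" by (rule M.R.is_cring)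
    show "abelian_group T" by (rule abelian_group_transfer[OF M.abelian_group_axioms bij add zero])
  qed (auto intro!: inj simp: add smult cl M.smult_l_distr M.smult_r_distr M.smult_assoc1)
qed

lemma submodule_transfer:
  assumes M: "Module.module R M" and bij: "bij_betw \<Psi> (carrier T) (carrier M)"
    and add: "\<And>x y. x \<in> carrier T \<Longrightarrow> y \<in> carrier T \<Longrightarrow> x \<oplus>\<^bsub>T\<^esub> y \<in> carrier T"
      "\<And>x y. x \<in> carrier T \<Longrightarrow> y \<in> carrier T \<Longrightarrow> \<Psi> (x \<oplus>\<^bsub>T\<^esub> y) = \<Psi> x \<oplus>\<^bsub>M\<^esub> \<Psi> y"
    and zero: "\<zero>\<^bsub>T\<^esub> \<in> carrier T" "\<Psi> \<zero>\<^bsub>T\<^esub> = \<zero>\<^bsub>M\<^esub>"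
    and smult: "\<And>c x. c \<in> carrier R \<Longrightarrow> x \<in> carrier T \<Longrightarrow> c \<odot>\<^bsub>T\<^esub> x \<in> carrier T"
      "\<And>c x. c \<in> carrier R \<Longrightarrow> x \<in> carrier T \<Longrightarrow> \<Psi> (c \<odot>\<^bsub>T\<^esub> x) = c \<odot>\<^bsub>M\<^esub> \<Psi> x"
    and H: "H \<subseteq> carrier T" "submodule (\<Psi> ` H) R M"
  shows "submodule H R T"
proof -
  interpret M: Module.module R M by fact
  interpret T: Module.module R T by (rule module_transfer[OF M bij add zero smult])
  interpret S: submodule "\<Psi> ` H" R M by fact
  have inj: "x = y" if "\<Psi> x = \<Psi> y" "x \<in> carrier T" "y \<in> carrier T" for x y
    using bij that by (auto simp: bij_betw_def inj_on_def)
  have cl: "\<Psi> x \<in> carrier M" if "x \<in> carrier T" for x using bij that by (auto simp: bij_betw_def)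
  have mem: "x \<in> H" if x: "x \<in> carrier T" and \<Psi>x: "\<Psi> x \<in> \<Psi> ` H" for x
  proof -
    from \<Psi>x obtain y where y: "y \<in> H" "\<Psi> x = \<Psi> y" by (elim imageE)
    then have "x = y" using x H(1) by (intro inj) auto
    with y show ?thesis by simp
  qed
  have HT: "x \<in> carrier T" if "x \<in> H" for x using that H(1) by blast
  have neg: "\<Psi> (\<ominus>\<^bsub>T\<^esub> x) = \<ominus>\<^bsub>M\<^esub> \<Psi> x" if x: "x \<in> carrier T" for x
  proof (rule M.minus_equality[symmetric])
    have "\<Psi> (\<ominus>\<^bsub>T\<^esub> x) \<oplus>\<^bsub>M\<^esub> \<Psi> x = \<Psi> (\<ominus>\<^bsub>T\<^esub> x \<oplus>\<^bsub>T\<^esub> x)" using x by (subst add(2)) simp_all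
    then show "\<Psi> (\<ominus>\<^bsub>T\<^esub> x) \<oplus>\<^bsub>M\<^esub> \<Psi> x = \<zero>\<^bsub>M\<^esub>" using x zero by (simp add: T.l_neg)
  qed (use x cl in simp_all)
  show ?thesis
  proof (rule T.submoduleI[OF H(1)])
    show "\<zero>\<^bsub>T\<^esub> \<in> H" using S.one_closed zero by (intro mem) simp_all
    show "\<ominus>\<^bsub>T\<^esub> x \<in> H" if "x \<in> H" for x
      using S.m_inv_closed[of "\<Psi> x"] that HT[OF that] by (intro mem) (simp_all add: neg a_inv_def[symmetric])
    show "x \<oplus>\<^bsub>T\<^esub> y \<in> H" if "x \<in> H" "y \<in> H" for x y
      using S.m_closed[of "\<Psi> x" "\<Psi> y"] that HT by (intro mem) (simp_all add: add)
    show "c \<odot>\<^bsub>T\<^esub> x \<in> H" if "c \<in> carrier R" "x \<in> H" for c x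
      using S.smult_closed[of c "\<Psi> x"] that HT by (intro mem) (simp_all add: smult)
  qed
qed

lemma lie_algebra_transfer:
  fixes M :: "(complex, 'a, 'm) module_scheme" and T :: "(complex, 'b, 'n) module_scheme"
  assumes M: "lie_algebra M" and bij: "bij_betw \<Psi> (carrier T) (carrier M)"
    and add: "\<And>x y. x \<in> carrier T \<Longrightarrow> y \<in> carrier T \<Longrightarrow> x \<oplus>\<^bsub>T\<^esub> y \<in> carrier T"
      "\<And>x y. x \<in> carrier T \<Longrightarrow> y \<in> carrier T \<Longrightarrow> \<Psi> (x \<oplus>\<^bsub>T\<^esub> y) = \<Psi> x \<oplus>\<^bsub>M\<^esub> \<Psi> y"
    and zero: "\<zero>\<^bsub>T\<^esub> \<in> carrier T" "\<Psi> \<zero>\<^bsub>T\<^esub> = \<zero>\<^bsub>M\<^esub>"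
    and smult: "\<And>c x. x \<in> carrier T \<Longrightarrow> c \<odot>\<^bsub>T\<^esub> x \<in> carrier T"
      "\<And>c x. x \<in> carrier T \<Longrightarrow> \<Psi> (c \<odot>\<^bsub>T\<^esub> x) = c \<odot>\<^bsub>M\<^esub> \<Psi> x"
    and mult: "\<And>x y. x \<in> carrier T \<Longrightarrow> y \<in> carrier T \<Longrightarrow> x \<otimes>\<^bsub>T\<^esub> y \<in> carrier T"
      "\<And>x y. x \<in> carrier T \<Longrightarrow> y \<in> carrier T \<Longrightarrow> \<Psi> (x \<otimes>\<^bsub>T\<^esub> y) = \<Psi> x \<otimes>\<^bsub>M\<^esub> \<Psi> y"
  shows "lie_algebra T"
proof -
  have modM: "Module.module complex_field M" using M by (simp only: lie_algebra_def)
  have modT: "Module.module complex_field T"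
    by (rule module_transfer[OF modM bij add zero]) (simp_all add: smult)
  have inj: "x = y" if "\<Psi> x = \<Psi> y" "x \<in> carrier T" "y \<in> carrier T" for x y
    using bij that by (auto simp: bij_betw_def inj_on_def)
  have cl: "\<Psi> x \<in> carrier M" if "x \<in> carrier T" for x using bij that by (auto simp: bij_betw_def)
  note L = lie_algebraD[OF M]
  show ?thesis
    unfolding lie_algebra_def
  proof (intro conjI modT ballI allI)
    fix x assume x: "x \<in> carrier T"
    show "x \<otimes>\<^bsub>T\<^esub> x = \<zero>\<^bsub>T\<^esub>"
      using L(5)[OF cl cl cl, OF x x x] x by (intro inj) (simp_all add: mult zero)
    fix y assume y: "y \<in> carrier T"
    show "x \<otimes>\<^bsub>T\<^esub> y \<in> carrier T" by (rule mult(1)[OF x y])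
    show "(c \<odot>\<^bsub>T\<^esub> x) \<otimes>\<^bsub>T\<^esub> y = c \<odot>\<^bsub>T\<^esub> (x \<otimes>\<^bsub>T\<^esub> y)" for c
      using L(3)[OF cl cl cl, OF x y y, of c] x y by (intro inj) (simp_all add: mult smult)
    show "x \<otimes>\<^bsub>T\<^esub> (c \<odot>\<^bsub>T\<^esub> y) = c \<odot>\<^bsub>T\<^esub> (x \<otimes>\<^bsub>T\<^esub> y)" for c
      using L(4)[OF cl cl cl, OF x y y, of c] x y by (intro inj) (simp_all add: mult smult)
    fix z assume z: "z \<in> carrier T"
    show "(x \<oplus>\<^bsub>T\<^esub> y) \<otimes>\<^bsub>T\<^esub> z = x \<otimes>\<^bsub>T\<^esub> z \<oplus>\<^bsub>T\<^esub> y \<otimes>\<^bsub>T\<^esub> z"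
      using L(1)[OF cl cl cl, OF x y z] x y z by (intro inj) (simp_all add: mult add)
    show "z \<otimes>\<^bsub>T\<^esub> (x \<oplus>\<^bsub>T\<^esub> y) = z \<otimes>\<^bsub>T\<^esub> x \<oplus>\<^bsub>T\<^esub> z \<otimes>\<^bsub>T\<^esub> y"
      using L(2)[OF cl cl cl, OF x y z] x y z by (intro inj) (simp_all add: mult add)
    show "x \<otimes>\<^bsub>T\<^esub> (y \<otimes>\<^bsub>T\<^esub> z) \<oplus>\<^bsub>T\<^esub> y \<otimes>\<^bsub>T\<^esub> (z \<otimes>\<^bsub>T\<^esub> x) \<oplus>\<^bsub>T\<^esub> z \<otimes>\<^bsub>T\<^esub> (x \<otimes>\<^bsub>T\<^esub> y) = \<zero>\<^bsub>T\<^esub>"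
      using L(6)[OF cl cl cl, OF x y z] x y z by (intro inj) (simp_all add: mult add zero)
  qed
qed

section \<open>The weight grading and the tensor product\<close>

locale framed_lie_forms = framed_modular_forms sc B \<rho> wt \<phi> K\<^sub>\<phi> \<Gamma> + lie_modular_forms_space sc B \<Gamma> "restrict_to_SL2_Z \<rho>" br
  for sc :: "complex \<Rightarrow> 'v::real_normed_vector \<Rightarrow> 'v" and B \<rho> wt \<phi> K\<^sub>\<phi> \<Gamma> br +
  assumes rho_bracket: "det A = 1 \<Longrightarrow> \<rho> A (br u v) = br (\<rho> A u) (\<rho> A v)"
begin

abbreviation \<g> :: "(complex, 'v) graded_module" where
  "\<g> \<equiv> weight_graded_lie_algebra sc br \<rho>"

lemma g_simps [simp]:
  "carrier \<g> = UNIV" "monoid.mult \<g> = br" "zero \<g> = 0" "add \<g> = (+)" "module.smult \<g> = sc"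
  by (simp_all add: weight_graded_lie_algebra_def)

lemma g_part_iff_torus: "v \<in> graded_part \<g> k \<longleftrightarrow> (\<forall>a. a \<noteq> 0 \<longrightarrow> \<rho> (torus a) v = sc (a powi k) v)"
  unfolding weight_operator_eq_iff[symmetric] by (simp add: weight_graded_lie_algebra_def mat2_def)

lemma g_part_iff: "v \<in> graded_part \<g> k \<longleftrightarrow> (\<forall>b\<in>B. coord b v \<noteq> 0 \<longrightarrow> wt b = k)"
proof
  assume v: "v \<in> graded_part \<g> k"
  show "\<forall>b\<in>B. coord b v \<noteq> 0 \<longrightarrow> wt b = k"
  proof (intro ballI impI)
    fix b assume b: "b \<in> B" "coord b v \<noteq> 0"
    \<comment> \<open>One torus element separates the weights, because the integer powers of 2 are
      distinct.\<close>
    have "\<rho> (torus 2) v = sc (2 powi k) v" using v unfolding g_part_iff_torus by simp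
    from arg_cong[OF this, of "coord b"] have "2 powi wt b * coord b v = 2 powi k * coord b v"
      using coord_torus[of 2 b v] b(1) by (simp add: coord_scale)
    with b have "(2::complex) powi wt b = 2 powi k" by simp
    then have "norm ((2::complex) powi wt b) = norm ((2::complex) powi k)" by simp
    then have "(2::real) powr of_int (wt b) = 2 powr of_int k" by (simp add: norm_power_int powr_real_of_int')
    then show "wt b = k" by (simp add: powr_inj)
  qed
next
  assume v: "\<forall>b\<in>B. coord b v \<noteq> 0 \<longrightarrow> wt b = k"
  show "v \<in> graded_part \<g> k"
    unfolding g_part_iff_torus
  proof (intro allI impI coord_eqI)
    fix a :: complex and b :: 'v assume "a \<noteq> 0" "b \<in> B"
    then show "coord b (\<rho> (torus a) v) = coord b (sc (a powi k) v)"
      using v by (cases "coord b v = 0") (auto simp: coord_torus coord_scale)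
  qed
qed

lemma basis_in_part: "b \<in> B \<Longrightarrow> b \<in> graded_part \<g> (wt b)"
  unfolding g_part_iff by (auto simp: coord_basis split: if_splits)

lemma g_lie_algebra: "lie_algebra \<g>"
  by (rule lie_algebra_transfer[OF lie, of "\<lambda>x. x"]) (simp_all add: bij_betw_def)

lemma g_module: "Module.module complex_field \<g>"
  using g_lie_algebra by (simp only: lie_algebra_def)

lemma g_abelian: "abelian_group \<g>"
proof -
  interpret Module.module complex_field \<g> by (rule g_module)
  show ?thesis by (rule abelian_group_axioms)
qed

lemma g_finsum: "finite A \<Longrightarrow> finsum \<g> c A = (\<Sum>i\<in>A. c i)"
proof -
  assume "finite A"
  interpret abelian_group \<g> by (rule g_abelian)
  from \<open>finite A\<close> show ?thesis
    by (induction A rule: finite_induct) (simp_all add: finsum_insert Pi_iff)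
qed

lemma g_a_inv: "a_inv \<g> x = - x"
proof -
  interpret abelian_group \<g> by (rule g_abelian)
  show ?thesis using minus_equality[of "- x" x] by simp
qed

lemma coord_neg: "coord b (- v) = - coord b v"
  using coord_scale[of "-1" v b] by simp

lemma g_part_submodule: "submodule (graded_part \<g> k) complex_field \<g>"
  by (rule Module.module.submoduleI[OF g_module])
    (auto simp: g_part_iff g_a_inv coord_neg coord_add coord_scale)

lemma g_grading: "grading \<g>"
  unfolding grading_def
proof (intro conjI allI ballI)
  show "additive_subgroup (graded_part \<g> k) \<g>" for k
    using g_part_submodule[of k] by (intro additive_subgroupI) (simp add: submodule_def)
  fix x assume "x \<in> carrier \<g>"
  define c where "c k = (\<Sum>b\<in>{b\<in>B. wt b = k}. sc (coord b x) b)" for k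
  have cc: "coord b (c k) = (if wt b = k then coord b x else 0)" if b: "b \<in> B" for b :: 'v and k
  proof -
    have "coord b (c k) = (\<Sum>b'\<in>{b\<in>B. wt b = k}. if b = b' then coord b x else 0)"
      unfolding c_def coord_sum by (rule sum.cong) (auto simp: coord_scale coord_basis)
    then show ?thesis using finite_B b by simp
  qed
  have "{k. c k \<noteq> 0} \<subseteq> wt ` B"
  proof
    fix k assume "k \<in> {k. c k \<noteq> 0}"
    then show "k \<in> wt ` B"
      by (auto simp: c_def elim!: sum.not_neutral_contains_not_neutral)
  qed
  then have fin: "finite {k. c k \<noteq> 0}" using finite_B finite_subset by blast
  show "\<exists>!c. (\<forall>k. c k \<in> graded_part \<g> k) \<and> finite {k. c k \<noteq> \<zero>\<^bsub>\<g>\<^esub>} \<and> x = finsum \<g> c {k. c k \<noteq> \<zero>\<^bsub>\<g>\<^esub>}"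
  proof (rule ex1I[of _ c], intro conjI allI)
    show "c k \<in> graded_part \<g> k" for k unfolding g_part_iff by (simp add: cc)
    show "finite {k. c k \<noteq> \<zero>\<^bsub>\<g>\<^esub>}" using fin by simp
    have "x = (\<Sum>k\<in>{k. c k \<noteq> 0}. c k)"
    proof (rule coord_eqI)
      fix b assume b: "b \<in> B"
      have "coord b (\<Sum>k\<in>{k. c k \<noteq> 0}. c k) = (\<Sum>k\<in>{k. c k \<noteq> 0}. if wt b = k then coord b x else 0)"
        by (simp add: coord_sum cc[OF b])
      also have "\<dots> = (if c (wt b) \<noteq> 0 then coord b x else 0)" using fin by simp
      also have "\<dots> = coord b x" using cc[OF b, of "wt b"] by auto
      finally show "coord b x = coord b (\<Sum>k\<in>{k. c k \<noteq> 0}. c k)" ..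
    qed
    then show "x = finsum \<g> c {k. c k \<noteq> \<zero>\<^bsub>\<g>\<^esub>}" using fin by (simp add: g_finsum)
  next
    fix d assume d: "(\<forall>k. d k \<in> graded_part \<g> k) \<and> finite {k. d k \<noteq> \<zero>\<^bsub>\<g>\<^esub>} \<and> x = finsum \<g> d {k. d k \<noteq> \<zero>\<^bsub>\<g>\<^esub>}"
    then have dk: "b \<in> B \<Longrightarrow> wt b \<noteq> k \<Longrightarrow> coord b (d k) = 0" for b :: 'v and k unfolding g_part_iff by blast
    have fd: "finite {k. d k \<noteq> 0}" using d by simp
    have xd: "x = (\<Sum>k\<in>{k. d k \<noteq> 0}. d k)" using d fd by (simp add: g_finsum)
    show "d = c"
    proof (intro ext coord_eqI)
      fix k and b :: 'v assume b: "b \<in> B"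
      have "coord b x = (\<Sum>k\<in>{k. d k \<noteq> 0}. if wt b = k then coord b (d (wt b)) else 0)"
        unfolding xd coord_sum using dk[OF b] by (intro sum.cong) auto
      also have "\<dots> = coord b (d (wt b))" using fd by simp
      finally show "coord b (d k) = coord b (c k)" using dk[OF b] cc[OF b] by auto
    qed
  qed
qed

text \<open>Since the torus acts by automorphisms, the characters of two weight vectors multiply
  under the bracket and their weights add.\<close>

lemma g_graded_lie_algebra: "graded_lie_algebra \<g>"
  unfolding graded_lie_algebra_def
proof (intro conjI g_lie_algebra g_grading g_part_submodule allI ballI)
  fix k l x y assume "x \<in> graded_part \<g> k" "y \<in> graded_part \<g> l"
  then show "x \<otimes>\<^bsub>\<g>\<^esub> y \<in> graded_part \<g> (k + l)"
    unfolding g_part_iff_torus by (simp add: rho_bracket bracket_scale power_int_add mult.commute)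
qed

end

section \<open>Realising formal tensors as families of forms\<close>

lemma lookup_formal_scale: "Poly_Mapping.lookup (formal_scale c x) p = c * Poly_Mapping.lookup x p"
  by (simp add: Poly_Mapping.map.rep_eq when_def)

lemma formal_vector_space: "vector_space (formal_scale :: complex \<Rightarrow> ('a, 'b) formal_sum \<Rightarrow> ('a, 'b) formal_sum)"
  by unfold_locales (auto intro!: poly_mapping_eqI simp: lookup_formal_scale lookup_add algebra_simps)

lemma formal_sum_expansion:
  fixes x :: "('a, 'b) formal_sum"
  shows "x = (\<Sum>p\<in>Poly_Mapping.keys x. formal_scale (Poly_Mapping.lookup x p) (formal_tensor (fst p) (snd p)))"
proof (rule poly_mapping_eqI)
  fix q
  have "Poly_Mapping.lookup (\<Sum>p\<in>Poly_Mapping.keys x. formal_scale (Poly_Mapping.lookup x p) (formal_tensor (fst p) (snd p))) q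
      = (\<Sum>p\<in>Poly_Mapping.keys x. if q = p then Poly_Mapping.lookup x p else 0)"
    unfolding lookup_sum by (rule sum.cong) (auto simp: lookup_formal_scale lookup_single when_def)
  also have "\<dots> = Poly_Mapping.lookup x q" by (simp add: in_keys_iff)
  finally show "Poly_Mapping.lookup x q = Poly_Mapping.lookup (\<Sum>p\<in>Poly_Mapping.keys x. formal_scale (Poly_Mapping.lookup x p) (formal_tensor (fst p) (snd p))) q" ..
qed

context framed_lie_forms begin

text \<open>The form that corresponds to \<open>v \<otimes> F\<close> in the trivialisation by the frame.\<close>

definition twist :: "'v \<Rightarrow> (int \<Rightarrow> complex \<Rightarrow> complex) \<Rightarrow> int \<Rightarrow> complex \<Rightarrow> 'v" where
  "twist v F = (\<lambda>n \<tau>. \<rho> (frame \<tau>) (\<Sum>b\<in>B. sc (coord b v * F (n - wt b) \<tau>) b))"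

lemma twist_add_left: "twist (u + v) F n \<tau> = twist u F n \<tau> + twist v F n \<tau>"
  by (simp add: twist_def coord_add distrib_right scale_left_distrib sum.distrib rho_add)

lemma twist_add_right: "twist v (\<lambda>k \<tau>. F k \<tau> + G k \<tau>) n \<tau> = twist v F n \<tau> + twist v G n \<tau>"
  by (simp add: twist_def distrib_left scale_left_distrib sum.distrib rho_add)

lemma twist_scale_left: "twist (sc c v) F n \<tau> = sc c (twist v F n \<tau>)"
  by (simp add: twist_def coord_scale rho_scale[symmetric] scale_sum_right mult.assoc)

lemma twist_scale_right: "twist v (\<lambda>k \<tau>. c * F k \<tau>) n \<tau> = sc c (twist v F n \<tau>)"
  by (simp add: twist_def rho_scale[symmetric] scale_sum_right mult.left_commute)

lemma scalar_space: "modular_forms_space (*) {1} \<Gamma> (\<lambda>_ z. z)"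
  by (rule scalar_modular_forms_space[OF Gamma_subset])

definition twist_support :: "(int \<Rightarrow> complex \<Rightarrow> complex) \<Rightarrow> int set" where
  "twist_support F = (\<Union>b\<in>B. (\<lambda>k. k + wt b) ` support F)"

lemma twist_support: "support (twist v F) \<subseteq> twist_support F"
proof
  fix n assume n: "n \<in> support (twist v F)"
  show "n \<in> twist_support F"
  proof (rule ccontr)
    assume "n \<notin> twist_support F"
    then have "n - wt b \<notin> support F" if "b \<in> B" for b
      using that by (force simp: twist_support_def image_iff)
    then have "twist v F n = (\<lambda>_. 0)" by (simp add: twist_def not_in_support rho_zero)
    with n show False by (simp add: support_def)
  qed
qed

lemma twist_families:
  assumes F: "F \<in> scalar_families gr"
  shows "twist v F \<in> families gr"
proof -
  interpret S: modular_forms_space "(*)" "{1}" \<Gamma> "\<lambda>_ z. z" by (rule scalar_space)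
  have "finite (twist_support F)"
    using S.families_support[OF F] finite_B by (simp add: twist_support_def)
  then have "finite (support (twist v F))" by (rule finite_subset[OF twist_support])
  moreover have "twist v F n \<in> forms gr n" for n
    unfolding twist_def by (intro frame_form S.forms_scale S.families_component[OF F])
  ultimately show ?thesis by (simp add: family_sum_mem_iff)
qed

text \<open>The shift of weight by wt b in \<open>twist\<close> produces the factor z^(wt b), that
  is, the action of \<open>torus z\<close> on b. A tensor therefore evaluates to a scalar times an
  automorphism applied to its vector, which is the form in which brackets can be compared.\<close>

lemma eval_twist:
  assumes F: "F \<in> scalar_families gr" and z: "z \<noteq> 0"
  shows "family_eval sc (twist v F) z \<tau> = sc (family_eval (*) F z \<tau>) (\<rho> (frame \<tau>) (\<rho> (torus z) v))"
proof -
  interpret S: modular_forms_space "(*)" "{1}" \<Gamma> "\<lambda>_ z. z" by (rule scalar_space)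
  let ?A = "twist_support F"
  note finF = S.families_support[OF F]
  have finA: "finite ?A" using finF finite_B by (simp add: twist_support_def)
  have inner: "(\<Sum>n\<in>?A. z powi n * F (n - wt b) \<tau>) = z powi wt b * family_eval (*) F z \<tau>" if b: "b \<in> B" for b
  proof -
    have "(\<Sum>n\<in>?A. z powi n * F (n - wt b) \<tau>) = (\<Sum>n\<in>(\<lambda>k. k + wt b) ` support F. z powi n * F (n - wt b) \<tau>)"
    proof (rule sum.mono_neutral_right[OF finA])
      show "(\<lambda>k. k + wt b) ` support F \<subseteq> ?A" using b by (auto simp: twist_support_def)
      show "\<forall>n\<in>?A - (\<lambda>k. k + wt b) ` support F. z powi n * F (n - wt b) \<tau> = 0"
      proof
        fix n assume "n \<in> ?A - (\<lambda>k. k + wt b) ` support F"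
        then have "n - wt b \<notin> support F" by (force simp: image_iff)
        then show "z powi n * F (n - wt b) \<tau> = 0" by (simp add: not_in_support)
      qed
    qed
    also have "\<dots> = (\<Sum>k\<in>support F. z powi (k + wt b) * F k \<tau>)"
      by (subst sum.reindex) (auto simp: inj_on_def)
    also have "\<dots> = z powi wt b * family_eval (*) F z \<tau>"
      using z by (simp add: family_eval_def sum_distrib_left power_int_add mult_ac)
    finally show ?thesis .
  qed
  have "family_eval sc (twist v F) z \<tau> = (\<Sum>n\<in>?A. sc (z powi n) (twist v F n \<tau>))"
    by (rule family_eval_superset[OF finA twist_support])
  also have "\<dots> = \<rho> (frame \<tau>) (\<Sum>n\<in>?A. \<Sum>b\<in>B. sc (z powi n * (coord b v * F (n - wt b) \<tau>)) b)"
    by (simp add: twist_def rho_sum rho_scale[symmetric] scale_sum_right)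
  also have "(\<Sum>n\<in>?A. \<Sum>b\<in>B. sc (z powi n * (coord b v * F (n - wt b) \<tau>)) b)
      = (\<Sum>b\<in>B. sc (coord b v * (\<Sum>n\<in>?A. z powi n * F (n - wt b) \<tau>)) b)"
    by (subst sum.swap) (simp add: scale_sum_left sum_distrib_left mult.left_commute)
  also have "\<dots> = (\<Sum>b\<in>B. sc (family_eval (*) F z \<tau> * (coord b v * z powi wt b)) b)"
    by (intro sum.cong refl) (simp add: inner mult_ac)
  also have "\<dots> = sc (family_eval (*) F z \<tau>) (\<rho> (torus z) v)"
    by (simp add: torus_expansion[OF z] scale_sum_right)
  finally show ?thesis by (simp add: rho_scale)
qed

text \<open>The linear extension of \<open>twist\<close> to the free vector space on pairs. On
  admissible formal sums its kernel turns out to be the span of the tensor relations.\<close>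

definition realization :: "('v, int \<Rightarrow> complex \<Rightarrow> complex) formal_sum \<Rightarrow> int \<Rightarrow> complex \<Rightarrow> 'v" where
  "realization x = (\<lambda>n \<tau>. \<Sum>p\<in>Poly_Mapping.keys x. sc (Poly_Mapping.lookup x p) (twist (fst p) (snd p) n \<tau>))"

lemma realization_superset:
  "finite A \<Longrightarrow> Poly_Mapping.keys x \<subseteq> A \<Longrightarrow>
    realization x n \<tau> = (\<Sum>p\<in>A. sc (Poly_Mapping.lookup x p) (twist (fst p) (snd p) n \<tau>))"
  unfolding realization_def by (intro sum.mono_neutral_left) (auto simp: in_keys_iff)

lemma realization_add: "realization (x + y) n \<tau> = realization x n \<tau> + realization y n \<tau>"
proof -
  let ?A = "Poly_Mapping.keys x \<union> Poly_Mapping.keys y"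
  have "realization (x + y) n \<tau> = (\<Sum>p\<in>?A. sc (Poly_Mapping.lookup (x + y) p) (twist (fst p) (snd p) n \<tau>))"
    by (rule realization_superset) (use keys_add[of x y] in auto)
  then show ?thesis
    by (simp add: realization_superset[of ?A] lookup_add scale_left_distrib sum.distrib)
qed

lemma realization_scale: "realization (formal_scale c x) n \<tau> = sc c (realization x n \<tau>)"
proof -
  have "Poly_Mapping.keys (formal_scale c x) \<subseteq> Poly_Mapping.keys x" by (auto simp: in_keys_iff lookup_formal_scale)
  then have "realization (formal_scale c x) n \<tau>
      = (\<Sum>p\<in>Poly_Mapping.keys x. sc (Poly_Mapping.lookup (formal_scale c x) p) (twist (fst p) (snd p) n \<tau>))"
    by (intro realization_superset) auto
  then show ?thesis by (simp add: realization_def lookup_formal_scale scale_sum_right)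
qed

lemma realization_tensor: "realization (formal_tensor v F) n \<tau> = twist v F n \<tau>"
  by (simp add: realization_def)

lemma realization_zero: "realization 0 n \<tau> = 0"
  by (simp add: realization_def)

lemma realization_sum: "realization (sum f I) n \<tau> = (\<Sum>i\<in>I. realization (f i) n \<tau>)"
  by (induction I rule: infinite_finite_induct) (auto simp: realization_add realization_zero)

lemma realization_diff: "realization (x - y) n \<tau> = realization x n \<tau> - realization y n \<tau>"
  using realization_add[of "x - y" y n \<tau>] by simp

abbreviation \<R> :: "growth \<Rightarrow> (complex, int \<Rightarrow> complex \<Rightarrow> complex) graded_module" where
  "\<R> gr \<equiv> scalar_modular_forms gr \<Gamma>"

lemma R_simps [simp]:
  "carrier (\<R> gr) = scalar_families gr" "monoid.mult (\<R> gr) = weight_convolution (*)"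
  "zero (\<R> gr) = (\<lambda>k \<tau>. 0)" "add (\<R> gr) = (\<lambda>F G k \<tau>. F k \<tau> + G k \<tau>)"
  "module.smult (\<R> gr) = (\<lambda>c F k \<tau>. c * F k \<tau>)"
  by (simp_all add: scalar_modular_forms_def)

lemma formal_sums_iff: "x \<in> formal_sums \<g> (\<R> gr) \<longleftrightarrow> (\<forall>p. Poly_Mapping.lookup x p \<noteq> 0 \<longrightarrow> snd p \<in> scalar_families gr)"
proof -
  have "x \<in> formal_sums \<g> (\<R> gr) \<longleftrightarrow> (\<forall>p. p \<in> Poly_Mapping.keys x \<longrightarrow> p \<in> UNIV \<times> scalar_families gr)"
    by (simp only: formal_sums_def mem_Collect_eq subset_iff g_simps R_simps)
  then show ?thesis by (simp only: in_keys_iff mem_Times_iff UNIV_I simp_thms)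
qed

lemma formal_sums_tensor: "F \<in> scalar_families gr \<Longrightarrow> formal_tensor v F \<in> formal_sums \<g> (\<R> gr)"
  by (auto simp: formal_sums_iff lookup_single when_def split: if_splits)

lemma formal_sums_add:
  assumes "x \<in> formal_sums \<g> (\<R> gr)" "y \<in> formal_sums \<g> (\<R> gr)" shows "x + y \<in> formal_sums \<g> (\<R> gr)"
  using assms unfolding formal_sums_iff lookup_add by (metis add.right_neutral)

lemma formal_sums_scale: "x \<in> formal_sums \<g> (\<R> gr) \<Longrightarrow> formal_scale c x \<in> formal_sums \<g> (\<R> gr)"
  unfolding formal_sums_iff lookup_formal_scale mult_eq_0_iff by blast

lemma formal_sums_zero: "0 \<in> formal_sums \<g> (\<R> gr)"
  by (simp add: formal_sums_iff)

lemma formal_sums_sum: "(\<And>i. i \<in> I \<Longrightarrow> f i \<in> formal_sums \<g> (\<R> gr)) \<Longrightarrow> sum f I \<in> formal_sums \<g> (\<R> gr)"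
  by (induction I rule: infinite_finite_induct) (auto simp: formal_sums_add formal_sums_zero)

lemma formal_sums_keys: "x \<in> formal_sums \<g> (\<R> gr) \<Longrightarrow> p \<in> Poly_Mapping.keys x \<Longrightarrow> snd p \<in> scalar_families gr"
  unfolding formal_sums_iff in_keys_iff by blast

lemma realization_families:
  assumes "x \<in> formal_sums \<g> (\<R> gr)" shows "realization x \<in> families gr"
  unfolding realization_def
  by (intro families_sum families_scale twist_families) (rule formal_sums_keys[OF assms])

lemma eval_families_sum:
  assumes "finite I" "\<And>i. i \<in> I \<Longrightarrow> f i \<in> families gr"
  shows "family_eval sc (\<lambda>k \<tau>. \<Sum>i\<in>I. f i k \<tau>) z \<tau> = (\<Sum>i\<in>I. family_eval sc (f i) z \<tau>)"
  using assms
proof (induction I rule: finite_induct)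
  case (insert i I)
  then show ?case using eval_add[where gr=gr, of "f i" "\<lambda>k \<tau>. \<Sum>i\<in>I. f i k \<tau>"] by (simp add: families_sum)
qed (simp add: eval_zero)

lemma eval_realization:
  assumes x: "x \<in> formal_sums \<g> (\<R> gr)" and z: "z \<noteq> 0"
  shows "family_eval sc (realization x) z \<tau> = (\<Sum>p\<in>Poly_Mapping.keys x.
    sc (Poly_Mapping.lookup x p * family_eval (*) (snd p) z \<tau>) (\<rho> (frame \<tau>) (\<rho> (torus z) (fst p))))"
proof -
  have "family_eval sc (realization x) z \<tau> = (\<Sum>p\<in>Poly_Mapping.keys x.
      family_eval sc (\<lambda>n \<tau>. sc (Poly_Mapping.lookup x p) (twist (fst p) (snd p) n \<tau>)) z \<tau>)"
    unfolding realization_def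
    by (rule eval_families_sum[where gr=gr]) (use formal_sums_keys[OF x] in \<open>simp_all add: twist_families\<close>)
  also have "\<dots> = (\<Sum>p\<in>Poly_Mapping.keys x.
    sc (Poly_Mapping.lookup x p * family_eval (*) (snd p) z \<tau>) (\<rho> (frame \<tau>) (\<rho> (torus z) (fst p))))"
    by (rule sum.cong) (use formal_sums_keys[OF x] z in
      \<open>simp_all add: eval_scale[where gr=gr] twist_families eval_twist[where gr=gr]\<close>)
  finally show ?thesis .
qed

lemma formal_mult_closed:
  assumes "x \<in> formal_sums \<g> (\<R> gr)" "y \<in> formal_sums \<g> (\<R> gr)"
  shows "formal_mult \<g> (\<R> gr) x y \<in> formal_sums \<g> (\<R> gr)"
proof -
  interpret S: modular_forms_space "(*)" "{1}" \<Gamma> "\<lambda>_ z. z" by (rule scalar_space)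
  show ?thesis
    unfolding formal_mult_def case_prod_unfold
    by (intro formal_sums_sum formal_sums_scale formal_sums_tensor)
      (use formal_sums_keys[OF assms(1)] formal_sums_keys[OF assms(2)] in simp)
qed

text \<open>After evaluation both sides are the same double sum, because \<rho>(frame) and
  \<rho>(torus) commute with the bracket and evaluation is multiplicative on scalar
  families.\<close>

lemma realization_mult:
  assumes x: "x \<in> formal_sums \<g> (\<R> gr)" and y: "y \<in> formal_sums \<g> (\<R> gr)"
  shows "realization (formal_mult \<g> (\<R> gr) x y) = weight_convolution br (realization x) (realization y)"
proof (rule families_eqI[where gr=gr])
  interpret S: modular_forms_space "(*)" "{1}" \<Gamma> "\<lambda>_ z. z" by (rule scalar_space)
  interpret P: bilinear_product sc sc sc br by (rule bracket_product)
  show "realization (formal_mult \<g> (\<R> gr) x y) \<in> families gr"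
    by (intro realization_families formal_mult_closed x y)
  show "weight_convolution br (realization x) (realization y) \<in> families gr"
    by (intro families_bracket realization_families x y)
  fix z \<tau> :: complex assume z: "z \<noteq> 0"
  let ?e = "\<lambda>F. family_eval (*) F z \<tau>" and ?r = "\<lambda>v. \<rho> (frame \<tau>) (\<rho> (torus z) v)"
  have real: "realization (formal_mult \<g> (\<R> gr) x y) = (\<lambda>n \<tau>. \<Sum>p\<in>Poly_Mapping.keys x. \<Sum>q\<in>Poly_Mapping.keys y.
      sc (Poly_Mapping.lookup x p * Poly_Mapping.lookup y q) (twist (br (fst p) (fst q)) (weight_convolution (*) (snd p) (snd q)) n \<tau>))"
    by (intro ext) (simp only: formal_mult_def case_prod_unfold realization_sum realization_scale realization_tensor g_simps R_simps prod.collapse)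
  have "family_eval sc (realization (formal_mult \<g> (\<R> gr) x y)) z \<tau> = (\<Sum>p\<in>Poly_Mapping.keys x. \<Sum>q\<in>Poly_Mapping.keys y.
      family_eval sc (\<lambda>n \<tau>. sc (Poly_Mapping.lookup x p * Poly_Mapping.lookup y q)
        (twist (br (fst p) (fst q)) (weight_convolution (*) (snd p) (snd q)) n \<tau>)) z \<tau>)"
    unfolding real using formal_sums_keys[OF x] formal_sums_keys[OF y]
    by (subst eval_families_sum[where gr=gr]; (intro sum.cong refl)?)
      (simp_all add: families_sum twist_families eval_families_sum[where gr=gr])
  also have "\<dots> = (\<Sum>p\<in>Poly_Mapping.keys x. \<Sum>q\<in>Poly_Mapping.keys y.
      sc (Poly_Mapping.lookup x p * Poly_Mapping.lookup y q) (sc (?e (snd p) * ?e (snd q)) (?r (br (fst p) (fst q)))))"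
    using formal_sums_keys[OF x] formal_sums_keys[OF y] z
    by (intro sum.cong refl)
      (simp add: eval_scale[where gr=gr] twist_families eval_twist[where gr=gr] S.eval_scalar_convolution[where gr=gr])
  also have "\<dots> = (\<Sum>p\<in>Poly_Mapping.keys x. \<Sum>q\<in>Poly_Mapping.keys y.
      br (sc (Poly_Mapping.lookup x p * ?e (snd p)) (?r (fst p))) (sc (Poly_Mapping.lookup y q * ?e (snd q)) (?r (fst q))))"
    using z by (simp add: bracket_scale rho_bracket mult_ac)
  also have "\<dots> = (\<Sum>p\<in>Poly_Mapping.keys x.
      br (sc (Poly_Mapping.lookup x p * ?e (snd p)) (?r (fst p))) (family_eval sc (realization y) z \<tau>))"
    by (simp only: eval_realization[OF y z] P.prd_sum_right)
  also have "\<dots> = br (family_eval sc (realization x) z \<tau>) (family_eval sc (realization y) z \<tau>)"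
    by (simp only: eval_realization[OF x z] P.prd_sum_left)
  also have "\<dots> = family_eval sc (weight_convolution br (realization x) (realization y)) z \<tau>"
    by (rule eval_bracket[symmetric, where gr=gr]) (intro realization_families x y z)+
  finally show "family_eval sc (realization (formal_mult \<g> (\<R> gr) x y)) z \<tau>
    = family_eval sc (weight_convolution br (realization x) (realization y)) z \<tau>" .
qed

lemma formal_action_closed:
  assumes "r \<in> scalar_families gr" "x \<in> formal_sums \<g> (\<R> gr)"
  shows "formal_action (\<R> gr) r x \<in> formal_sums \<g> (\<R> gr)"
proof -
  interpret S: modular_forms_space "(*)" "{1}" \<Gamma> "\<lambda>_ z. z" by (rule scalar_space)
  show ?thesis
    unfolding formal_action_def case_prod_unfold
    by (intro formal_sums_sum formal_sums_scale formal_sums_tensor)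
      (use assms formal_sums_keys[OF assms(2)] in simp)
qed

lemma realization_action:
  assumes r: "r \<in> scalar_families gr" and x: "x \<in> formal_sums \<g> (\<R> gr)"
  shows "realization (formal_action (\<R> gr) r x) = weight_convolution sc r (realization x)"
proof (rule families_eqI[where gr=gr])
  interpret S: modular_forms_space "(*)" "{1}" \<Gamma> "\<lambda>_ z. z" by (rule scalar_space)
  show "realization (formal_action (\<R> gr) r x) \<in> families gr"
    by (intro realization_families formal_action_closed r x)
  show "weight_convolution sc r (realization x) \<in> families gr"
    by (intro families_scalar_convolution realization_families r x)
  fix z \<tau> :: complex assume z: "z \<noteq> 0"
  let ?e = "\<lambda>F. family_eval (*) F z \<tau>" and ?r = "\<lambda>v. \<rho> (frame \<tau>) (\<rho> (torus z) v)"
  have real: "realization (formal_action (\<R> gr) r x) = (\<lambda>n \<tau>. \<Sum>p\<in>Poly_Mapping.keys x.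
      sc (Poly_Mapping.lookup x p) (twist (fst p) (weight_convolution (*) r (snd p)) n \<tau>))"
    by (intro ext) (simp only: formal_action_def case_prod_unfold realization_sum realization_scale realization_tensor R_simps prod.collapse)
  have "family_eval sc (realization (formal_action (\<R> gr) r x)) z \<tau> = (\<Sum>p\<in>Poly_Mapping.keys x.
      family_eval sc (\<lambda>n \<tau>. sc (Poly_Mapping.lookup x p) (twist (fst p) (weight_convolution (*) r (snd p)) n \<tau>)) z \<tau>)"
    unfolding real using formal_sums_keys[OF x] r
    by (intro eval_families_sum[where gr=gr]) (simp_all add: twist_families)
  also have "\<dots> = (\<Sum>p\<in>Poly_Mapping.keys x. sc (Poly_Mapping.lookup x p) (sc (?e r * ?e (snd p)) (?r (fst p))))"
    using formal_sums_keys[OF x] r z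
    by (intro sum.cong refl)
      (simp add: eval_scale[where gr=gr] twist_families eval_twist[where gr=gr] S.eval_scalar_convolution[where gr=gr])
  also have "\<dots> = sc (?e r) (family_eval sc (realization x) z \<tau>)"
    using z by (simp add: eval_realization[OF x] scale_sum_right mult_ac)
  also have "\<dots> = family_eval sc (weight_convolution sc r (realization x)) z \<tau>"
    by (rule eval_scalar_convolution[symmetric, where gr=gr]) (intro realization_families r x z)+
  finally show "family_eval sc (realization (formal_action (\<R> gr) r x)) z \<tau>
    = family_eval sc (weight_convolution sc r (realization x)) z \<tau>" .
qed

end

section \<open>Inverting bijections that respect graded structures\<close>

lemma graded_lie_algebra_transfer:
  fixes M :: "(complex, 'a, 'm) graded_module_scheme" and T :: "(complex, 'b, 'n) graded_module_scheme"
  assumes M: "graded_lie_algebra M" and bij: "bij_betw \<Psi> (carrier T) (carrier M)"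
    and add: "\<And>x y. x \<in> carrier T \<Longrightarrow> y \<in> carrier T \<Longrightarrow> x \<oplus>\<^bsub>T\<^esub> y \<in> carrier T"
      "\<And>x y. x \<in> carrier T \<Longrightarrow> y \<in> carrier T \<Longrightarrow> \<Psi> (x \<oplus>\<^bsub>T\<^esub> y) = \<Psi> x \<oplus>\<^bsub>M\<^esub> \<Psi> y"
    and zero: "\<zero>\<^bsub>T\<^esub> \<in> carrier T" "\<Psi> \<zero>\<^bsub>T\<^esub> = \<zero>\<^bsub>M\<^esub>"
    and smult: "\<And>c x. x \<in> carrier T \<Longrightarrow> c \<odot>\<^bsub>T\<^esub> x \<in> carrier T"
      "\<And>c x. x \<in> carrier T \<Longrightarrow> \<Psi> (c \<odot>\<^bsub>T\<^esub> x) = c \<odot>\<^bsub>M\<^esub> \<Psi> x"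
    and mult: "\<And>x y. x \<in> carrier T \<Longrightarrow> y \<in> carrier T \<Longrightarrow> x \<otimes>\<^bsub>T\<^esub> y \<in> carrier T"
      "\<And>x y. x \<in> carrier T \<Longrightarrow> y \<in> carrier T \<Longrightarrow> \<Psi> (x \<otimes>\<^bsub>T\<^esub> y) = \<Psi> x \<otimes>\<^bsub>M\<^esub> \<Psi> y"
    and parts: "\<And>k. graded_part T k \<subseteq> carrier T" "\<And>k. \<Psi> ` graded_part T k = graded_part M k"
  shows "graded_lie_algebra T"
proof -
  have lie: "lie_algebra M" and gr: "grading M"
    and sub: "\<And>k. submodule (graded_part M k) complex_field M"
    and deg: "\<And>k l x y. x \<in> graded_part M k \<Longrightarrow> y \<in> graded_part M l \<Longrightarrow> x \<otimes>\<^bsub>M\<^esub> y \<in> graded_part M (k + l)"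
    using M by (simp_all add: graded_lie_algebra_def)
  have modM: "Module.module complex_field M" using lie by (simp only: lie_algebra_def)
  then interpret M: Module.module complex_field M .
  have inj: "x = y" if "\<Psi> x = \<Psi> y" "x \<in> carrier T" "y \<in> carrier T" for x y
    using bij that by (auto simp: bij_betw_def inj_on_def)
  show ?thesis
    unfolding graded_lie_algebra_def
  proof (intro conjI allI ballI)
    show "lie_algebra T" by (rule lie_algebra_transfer[OF lie bij add zero smult mult])
    show "grading T" by (rule grading_transfer[OF M.abelian_group_axioms gr bij add zero parts])
    show "submodule (graded_part T k) complex_field T" for k
      by (rule submodule_transfer[OF modM bij add zero _ _ parts(1)]) (simp_all add: smult parts(2) sub)
    fix k l x y assume xy: "x \<in> graded_part T k" "y \<in> graded_part T l"
    then have T: "x \<in> carrier T" "y \<in> carrier T" using parts(1)[of k] parts(1)[of l] by auto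
    have "\<Psi> x \<in> graded_part M k" "\<Psi> y \<in> graded_part M l" using xy by (simp_all flip: parts(2))
    then have "\<Psi> (x \<otimes>\<^bsub>T\<^esub> y) \<in> \<Psi> ` graded_part T (k + l)" using T deg by (simp add: parts(2) mult)
    then obtain w where w: "w \<in> graded_part T (k + l)" "\<Psi> (x \<otimes>\<^bsub>T\<^esub> y) = \<Psi> w" by (elim imageE)
    then have "x \<otimes>\<^bsub>T\<^esub> y = w" using T mult parts(1)[of "k + l"] by (intro inj) auto
    with w show "x \<otimes>\<^bsub>T\<^esub> y \<in> graded_part T (k + l)" by simp
  qed
qed

text \<open>The natural map leads out of the quotient T, where it is defined on representatives; the
  isomorphism wanted has the opposite direction.\<close>

lemma graded_lie_iso_inv_into:
  fixes M :: "(complex, 'a, 'm) graded_module_scheme" and T :: "(complex, 'b, 'n) graded_module_scheme"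
  assumes M: "graded_lie_algebra M" and bij: "bij_betw \<Psi> (carrier T) (carrier M)"
    and add: "\<And>x y. x \<in> carrier T \<Longrightarrow> y \<in> carrier T \<Longrightarrow> x \<oplus>\<^bsub>T\<^esub> y \<in> carrier T"
      "\<And>x y. x \<in> carrier T \<Longrightarrow> y \<in> carrier T \<Longrightarrow> \<Psi> (x \<oplus>\<^bsub>T\<^esub> y) = \<Psi> x \<oplus>\<^bsub>M\<^esub> \<Psi> y"
    and zero: "\<zero>\<^bsub>T\<^esub> \<in> carrier T" "\<Psi> \<zero>\<^bsub>T\<^esub> = \<zero>\<^bsub>M\<^esub>"
    and smult: "\<And>c x. x \<in> carrier T \<Longrightarrow> c \<odot>\<^bsub>T\<^esub> x \<in> carrier T"
      "\<And>c x. x \<in> carrier T \<Longrightarrow> \<Psi> (c \<odot>\<^bsub>T\<^esub> x) = c \<odot>\<^bsub>M\<^esub> \<Psi> x"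
    and mult: "\<And>x y. x \<in> carrier T \<Longrightarrow> y \<in> carrier T \<Longrightarrow> x \<otimes>\<^bsub>T\<^esub> y \<in> carrier T"
      "\<And>x y. x \<in> carrier T \<Longrightarrow> y \<in> carrier T \<Longrightarrow> \<Psi> (x \<otimes>\<^bsub>T\<^esub> y) = \<Psi> x \<otimes>\<^bsub>M\<^esub> \<Psi> y"
    and parts: "\<And>k. graded_part T k \<subseteq> carrier T" "\<And>k. \<Psi> ` graded_part T k = graded_part M k"
  shows "graded_lie_iso M T (inv_into (carrier T) \<Psi>)"
proof -
  let ?\<Phi> = "inv_into (carrier T) \<Psi>"
  have inj: "inj_on \<Psi> (carrier T)" and im: "\<Psi> ` carrier T = carrier M" using bij by (auto simp: bij_betw_def)
  have \<Phi>: "?\<Phi> x \<in> carrier T" "\<Psi> (?\<Phi> x) = x" if "x \<in> carrier M" for x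
    using that by (auto simp: im[symmetric] inv_into_into f_inv_into_f)
  have eq: "?\<Phi> w = t" if "t \<in> carrier T" "\<Psi> t = w" for t w
    using inv_into_f_f[OF inj that(1)] that(2) by simp
  show ?thesis
    unfolding graded_lie_iso_def
  proof (intro conjI ballI allI)
    show "graded_lie_algebra T" by (rule graded_lie_algebra_transfer[OF M bij add zero smult mult parts])
    show "bij_betw ?\<Phi> (carrier M) (carrier T)" by (rule bij_betw_inv_into[OF bij])
    show "?\<Phi> ` graded_part M k = graded_part T k" for k
      unfolding parts(2)[symmetric] by (rule inv_into_image_cancel[OF inj parts(1)])
  qed (auto intro!: eq M simp: \<Phi> add smult mult)
qed

lemma graded_module_iso_inv_into:
  assumes M: "graded_module_over R M" and bij: "bij_betw \<Psi> (carrier T) (carrier M)"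
    and add: "\<And>x y. x \<in> carrier T \<Longrightarrow> y \<in> carrier T \<Longrightarrow> x \<oplus>\<^bsub>T\<^esub> y \<in> carrier T"
      "\<And>x y. x \<in> carrier T \<Longrightarrow> y \<in> carrier T \<Longrightarrow> \<Psi> (x \<oplus>\<^bsub>T\<^esub> y) = \<Psi> x \<oplus>\<^bsub>M\<^esub> \<Psi> y"
    and zero: "\<zero>\<^bsub>T\<^esub> \<in> carrier T" "\<Psi> \<zero>\<^bsub>T\<^esub> = \<zero>\<^bsub>M\<^esub>"
    and smult: "\<And>c x. c \<in> carrier R \<Longrightarrow> x \<in> carrier T \<Longrightarrow> c \<odot>\<^bsub>T\<^esub> x \<in> carrier T"
      "\<And>c x. c \<in> carrier R \<Longrightarrow> x \<in> carrier T \<Longrightarrow> \<Psi> (c \<odot>\<^bsub>T\<^esub> x) = c \<odot>\<^bsub>M\<^esub> \<Psi> x"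
    and parts: "\<And>k. graded_part T k \<subseteq> carrier T" "\<And>k. \<Psi> ` graded_part T k = graded_part M k"
  shows "graded_module_iso R M T (inv_into (carrier T) \<Psi>)"
proof -
  let ?\<Phi> = "inv_into (carrier T) \<Psi>"
  have inj: "inj_on \<Psi> (carrier T)" and im: "\<Psi> ` carrier T = carrier M" using bij by (auto simp: bij_betw_def)
  have \<Phi>: "?\<Phi> x \<in> carrier T" "\<Psi> (?\<Phi> x) = x" if "x \<in> carrier M" for x
    using that by (auto simp: im[symmetric] inv_into_into f_inv_into_f)
  have eq: "?\<Phi> w = t" if "t \<in> carrier T" "\<Psi> t = w" for t w
    using inv_into_f_f[OF inj that(1)] that(2) by simp
  have R: "graded_ring R" and modM: "Module.module R M" and gr: "grading M"
    and deg: "\<And>k l r x. r \<in> graded_part R k \<Longrightarrow> x \<in> graded_part M l \<Longrightarrow> r \<odot>\<^bsub>M\<^esub> x \<in> graded_part M (k + l)"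
    using M by (simp_all add: graded_module_over_def)
  interpret M: Module.module R M by fact
  have RR: "graded_part R k \<subseteq> carrier R" for k
    using R additive_subgroup.a_subset[of "graded_part R k" R] by (simp add: graded_ring_def grading_def)
  have T: "graded_module_over R T"
    unfolding graded_module_over_def
  proof (intro conjI allI ballI R)
    show "Module.module R T" by (rule module_transfer[OF modM bij add zero smult])
    show "grading T" by (rule grading_transfer[OF M.abelian_group_axioms gr bij add zero parts])
    fix k l r x assume rx: "r \<in> graded_part R k" "x \<in> graded_part T l"
    then have c: "r \<in> carrier R" "x \<in> carrier T" using RR[of k] parts(1)[of l] by auto
    have "\<Psi> x \<in> graded_part M l" using rx by (simp flip: parts(2))
    then have "\<Psi> (r \<odot>\<^bsub>T\<^esub> x) \<in> \<Psi> ` graded_part T (k + l)" using rx c deg by (simp add: parts(2) smult)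
    then obtain w where w: "w \<in> graded_part T (k + l)" "\<Psi> (r \<odot>\<^bsub>T\<^esub> x) = \<Psi> w" by (elim imageE)
    then have "r \<odot>\<^bsub>T\<^esub> x = w" using c smult parts(1)[of "k + l"] inj by (auto simp: inj_on_def)
    with w show "r \<odot>\<^bsub>T\<^esub> x \<in> graded_part T (k + l)" by simp
  qed
  show ?thesis
    unfolding graded_module_iso_def
  proof (intro conjI ballI allI M T)
    show "bij_betw ?\<Phi> (carrier M) (carrier T)" by (rule bij_betw_inv_into[OF bij])
    show "?\<Phi> ` graded_part M k = graded_part T k" for k
      unfolding parts(2)[symmetric] by (rule inv_into_image_cancel[OF inj parts(1)])
  qed (auto intro!: eq simp: \<Phi> add smult)
qed

section \<open>Kernel and image of the realisation\<close>

context framed_lie_forms begin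

abbreviation relations :: "growth \<Rightarrow> ('v, int \<Rightarrow> complex \<Rightarrow> complex) formal_sum set" where
  "relations gr \<equiv> Modules.module.span formal_scale (tensor_relators \<g> (\<R> gr))"

lemma relations_realization:
  assumes "x \<in> relations gr" shows "realization x n \<tau> = 0"
proof -
  interpret F: vector_space "formal_scale :: complex \<Rightarrow> ('v, int \<Rightarrow> complex \<Rightarrow> complex) formal_sum \<Rightarrow> _"
    by (rule formal_vector_space)
  show ?thesis using assms
  proof (induction rule: F.span_induct_alt)
    case (step c x y)
    from step.hyps have "realization x n \<tau> = 0"
      unfolding tensor_relators_def
      by (elim UnE CollectE exE conjE)
        (simp_all only: realization_diff realization_scale realization_tensor g_simps R_simps
          twist_add_left twist_add_right twist_scale_left twist_scale_right, simp_all)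
    with step.IH show ?case by (simp add: realization_add realization_scale)
  qed (simp add: realization_zero)
qed

lemma tensor_relations:
  assumes "F \<in> scalar_families gr" "G \<in> scalar_families gr"
  shows "formal_tensor (u + v) F - formal_tensor u F - formal_tensor v F \<in> relations gr"
    and "formal_tensor v (\<lambda>k \<tau>. F k \<tau> + G k \<tau>) - formal_tensor v F - formal_tensor v G \<in> relations gr"
    and "formal_tensor (sc c v) F - formal_scale c (formal_tensor v F) \<in> relations gr"
    and "formal_tensor v (\<lambda>k \<tau>. c * F k \<tau>) - formal_scale c (formal_tensor v F) \<in> relations gr"
proof -
  interpret F: vector_space "formal_scale :: complex \<Rightarrow> ('v, int \<Rightarrow> complex \<Rightarrow> complex) formal_sum \<Rightarrow> _"
    by (rule formal_vector_space)
  show "formal_tensor (u + v) F - formal_tensor u F - formal_tensor v F \<in> relations gr"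
    by (rule F.span_base) (use assms in \<open>unfold tensor_relators_def g_simps R_simps, blast\<close>)
  show "formal_tensor v (\<lambda>k \<tau>. F k \<tau> + G k \<tau>) - formal_tensor v F - formal_tensor v G \<in> relations gr"
    by (rule F.span_base) (use assms in \<open>unfold tensor_relators_def g_simps R_simps, blast\<close>)
  show "formal_tensor (sc c v) F - formal_scale c (formal_tensor v F) \<in> relations gr"
    by (rule F.span_base) (use assms in \<open>unfold tensor_relators_def g_simps R_simps, blast\<close>)
  show "formal_tensor v (\<lambda>k \<tau>. c * F k \<tau>) - formal_scale c (formal_tensor v F) \<in> relations gr"
    by (rule F.span_base) (use assms in \<open>unfold tensor_relators_def g_simps R_simps, blast\<close>)
qed

lemma relations_closed:
  "0 \<in> relations gr"
  "x \<in> relations gr \<Longrightarrow> y \<in> relations gr \<Longrightarrow> x + y \<in> relations gr"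
  "x \<in> relations gr \<Longrightarrow> y \<in> relations gr \<Longrightarrow> x - y \<in> relations gr"
  "x \<in> relations gr \<Longrightarrow> - x \<in> relations gr"
  "(\<And>i. i \<in> I \<Longrightarrow> f i \<in> relations gr) \<Longrightarrow> sum f I \<in> relations gr"
proof -
  interpret F: vector_space "formal_scale :: complex \<Rightarrow> ('v, int \<Rightarrow> complex \<Rightarrow> complex) formal_sum \<Rightarrow> _"
    by (rule formal_vector_space)
  show "0 \<in> relations gr"
    "x \<in> relations gr \<Longrightarrow> y \<in> relations gr \<Longrightarrow> x + y \<in> relations gr"
    "x \<in> relations gr \<Longrightarrow> y \<in> relations gr \<Longrightarrow> x - y \<in> relations gr"
    "x \<in> relations gr \<Longrightarrow> - x \<in> relations gr"
    "(\<And>i. i \<in> I \<Longrightarrow> f i \<in> relations gr) \<Longrightarrow> sum f I \<in> relations gr"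
    by (simp_all add: F.span_zero F.span_add F.span_diff F.span_neg F.span_sum)
qed

lemma relations_zero_tensor:
  assumes "F \<in> scalar_families gr"
  shows "formal_tensor 0 F \<in> relations gr" and "formal_tensor v (\<lambda>k \<tau>. 0) \<in> relations gr"
proof -
  interpret S: modular_forms_space "(*)" "{1}" \<Gamma> "\<lambda>_ z. z" by (rule scalar_space)
  show "formal_tensor 0 F \<in> relations gr"
    using relations_closed(4)[OF tensor_relations(1)[OF assms assms, of 0 0]] by simp
  show "formal_tensor v (\<lambda>k \<tau>. 0) \<in> relations gr"
    using relations_closed(4)[OF tensor_relations(2)[OF S.families_zero S.families_zero, of v]] by simp
qed

text \<open>The normal form of a tensor: the tensor product is free over the scalar forms with basis
  B, and f lists the coefficients.\<close>

definition basis_form :: "('v \<Rightarrow> int \<Rightarrow> complex \<Rightarrow> complex) \<Rightarrow> ('v, int \<Rightarrow> complex \<Rightarrow> complex) formal_sum" where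
  "basis_form f = (\<Sum>b\<in>B. formal_tensor b (f b))"

lemma tensor_expansion:
  assumes F: "F \<in> scalar_families gr"
  shows "finite A \<Longrightarrow> formal_tensor (\<Sum>b\<in>A. sc (a b) b) F - (\<Sum>b\<in>A. formal_tensor b (\<lambda>k \<tau>. a b * F k \<tau>)) \<in> relations gr"
proof (induction A rule: finite_induct)
  case (insert b A)
  let ?w = "\<Sum>b\<in>A. sc (a b) b"
  \<comment> \<open>Additivity splits off the summand of b, and homogeneity in the left factor and
    then in the right factor moves the scalar \<open>a b\<close> to F. Apart from the induction
    hypothesis, each difference is a relator.\<close>
  have "formal_tensor (sc (a b) b + ?w) F - (formal_tensor b (\<lambda>k \<tau>. a b * F k \<tau>) + (\<Sum>b\<in>A. formal_tensor b (\<lambda>k \<tau>. a b * F k \<tau>)))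
    = ((formal_tensor (sc (a b) b + ?w) F - formal_tensor (sc (a b) b) F - formal_tensor ?w F)
      + (formal_tensor (sc (a b) b) F - formal_scale (a b) (formal_tensor b F)))
      - (formal_tensor b (\<lambda>k \<tau>. a b * F k \<tau>) - formal_scale (a b) (formal_tensor b F))
      + (formal_tensor ?w F - (\<Sum>b\<in>A. formal_tensor b (\<lambda>k \<tau>. a b * F k \<tau>)))"
    by simp
  also have "\<dots> \<in> relations gr"
    by (intro relations_closed tensor_relations[OF F F] insert.IH)
  finally show ?case using insert.hyps by simp
qed (simp add: relations_zero_tensor(1)[OF F])

lemma basis_form_add:
  assumes "\<And>b. f b \<in> scalar_families gr" "\<And>b. g b \<in> scalar_families gr"
  shows "basis_form f + basis_form g - basis_form (\<lambda>b k \<tau>. f b k \<tau> + g b k \<tau>) \<in> relations gr"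
proof -
  have "basis_form f + basis_form g - basis_form (\<lambda>b k \<tau>. f b k \<tau> + g b k \<tau>)
      = (\<Sum>b\<in>B. - (formal_tensor b (\<lambda>k \<tau>. f b k \<tau> + g b k \<tau>) - formal_tensor b (f b) - formal_tensor b (g b)))"
    by (simp add: basis_form_def sum.distrib sum_subtractf sum_negf)
  also have "\<dots> \<in> relations gr"
    by (rule relations_closed(5), rule relations_closed(4), rule tensor_relations(2)[OF assms])
  finally show ?thesis .
qed

lemma tensor_basis_form:
  assumes F: "F \<in> scalar_families gr"
  shows "formal_tensor v F - basis_form (\<lambda>b k \<tau>. coord b v * F k \<tau>) \<in> relations gr"
  using tensor_expansion[OF F finite_B, of "\<lambda>b. coord b v"] by (simp add: coord_expansion basis_form_def)

text \<open>The formal sum is built up one key at a time: each tensor is expanded in its vector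
  argument over B, and coefficients at the same basis vector are merged by additivity in the right
  factor.\<close>

lemma normal_form:
  assumes x: "x \<in> formal_sums \<g> (\<R> gr)"
  shows "\<exists>f. (\<forall>b. f b \<in> scalar_families gr) \<and> x - basis_form f \<in> relations gr"
proof -
  interpret S: modular_forms_space "(*)" "{1}" \<Gamma> "\<lambda>_ z. z" by (rule scalar_space)
  let ?t = "\<lambda>p. formal_scale (Poly_Mapping.lookup x p) (formal_tensor (fst p) (snd p))"
  have "\<exists>f. (\<forall>b. f b \<in> scalar_families gr) \<and> sum ?t A - basis_form f \<in> relations gr"
    if "finite A" "A \<subseteq> Poly_Mapping.keys x" for A
    using that
  proof (induction A rule: finite_induct)
    case empty
    have "basis_form (\<lambda>b k \<tau>. 0) \<in> relations gr"
      unfolding basis_form_def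
      by (rule relations_closed(5), rule relations_zero_tensor(2)[OF S.families_zero])
    from relations_closed(4)[OF this] show ?case by (intro exI[of _ "\<lambda>b k \<tau>. 0"]) simp
  next
    case (insert p A)
    then obtain f where f: "\<forall>b. f b \<in> scalar_families gr" "sum ?t A - basis_form f \<in> relations gr" by auto
    define c v F where "c = Poly_Mapping.lookup x p" and "v = fst p" and "F = snd p"
    have F: "F \<in> scalar_families gr" unfolding F_def by (rule formal_sums_keys[OF x]) (use insert.prems in simp)
    define g where "g = (\<lambda>b k \<tau>. coord b (sc c v) * F k \<tau>)"
    have g: "g b \<in> scalar_families gr" for b unfolding g_def by (rule S.families_scale[OF F])
    have "(formal_scale c (formal_tensor v F) + sum ?t A) - basis_form (\<lambda>b k \<tau>. g b k \<tau> + f b k \<tau>)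
      = (formal_tensor (sc c v) F - basis_form g) - (formal_tensor (sc c v) F - formal_scale c (formal_tensor v F))
        + (sum ?t A - basis_form f) + (basis_form g + basis_form f - basis_form (\<lambda>b k \<tau>. g b k \<tau> + f b k \<tau>))"
      by simp
    also have "\<dots> \<in> relations gr"
      by (intro relations_closed tensor_relations(3)[OF F F] f(2) basis_form_add g f(1)[rule_format]
          tensor_basis_form[OF F, of "sc c v", folded g_def])
    finally have "sum ?t (insert p A) - basis_form (\<lambda>b k \<tau>. g b k \<tau> + f b k \<tau>) \<in> relations gr"
      using insert.hyps unfolding c_def v_def F_def by simp
    then show ?case
      using g f(1) by (intro exI[of _ "\<lambda>b k \<tau>. g b k \<tau> + f b k \<tau>"] conjI allI S.families_add) simp_all
  qed
  from this[OF finite_keys order_refl] show ?thesis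
    unfolding formal_sum_expansion[symmetric] .
qed

lemma realization_basis_form:
  "realization (basis_form f) n \<tau> = \<rho> (frame \<tau>) (\<Sum>b\<in>B. sc (f b (n - wt b) \<tau>) b)"
proof -
  have "twist b F n \<tau> = \<rho> (frame \<tau>) (sc (F (n - wt b) \<tau>) b)" if b: "b \<in> B" for b F
  proof -
    have "(\<Sum>b'\<in>B. sc (coord b' b * F (n - wt b') \<tau>) b') = (\<Sum>b'\<in>B. if b' = b then sc (F (n - wt b) \<tau>) b else 0)"
      by (rule sum.cong) (auto simp: coord_basis[OF b])
    also have "\<dots> = sc (F (n - wt b) \<tau>) b" using finite_B b by simp
    finally show ?thesis by (simp add: twist_def)
  qed
  then show ?thesis by (simp add: basis_form_def realization_sum realization_tensor rho_sum)
qed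

text \<open>For a normal form the coefficients can be recovered from the realisation: apply the
  coframe and read off coordinates. If the realisation is 0, all of them vanish and only zero
  tensors remain.\<close>

lemma realization_kernel:
  assumes x: "x \<in> formal_sums \<g> (\<R> gr)" and 0: "\<And>n \<tau>. realization x n \<tau> = 0"
  shows "x \<in> relations gr"
proof -
  interpret S: modular_forms_space "(*)" "{1}" \<Gamma> "\<lambda>_ z. z" by (rule scalar_space)
  from normal_form[OF x] obtain f where f: "\<forall>b. f b \<in> scalar_families gr" "x - basis_form f \<in> relations gr" by (elim exE conjE)
  have "f b n \<tau> = 0" if b: "b \<in> B" for b n \<tau>
  proof -
    have "realization (basis_form f) (n + wt b) \<tau> = 0"
      using relations_realization[OF f(2), of "n + wt b" \<tau>] 0 by (simp add: realization_diff)
    from arg_cong[OF this, of "\<rho> (coframe \<tau>)"]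
    have "(\<Sum>b'\<in>B. sc (f b' (n + wt b - wt b') \<tau>) b') = 0"
      by (simp add: realization_basis_form rho_zero)
    from coord_unique[OF this b] show ?thesis by simp
  qed
  then have "f b = (\<lambda>k \<tau>. 0)" if "b \<in> B" for b using that by (intro ext)
  then have "basis_form f = (\<Sum>b\<in>B. formal_tensor b (\<lambda>k \<tau>. 0))" by (simp add: basis_form_def)
  also have "\<dots> \<in> relations gr"
    by (rule relations_closed(5), rule relations_zero_tensor(2)[OF S.families_zero])
  finally have "basis_form f \<in> relations gr" .
  from relations_closed(2)[OF f(2) this] show ?thesis by simp
qed

text \<open>The value 0 outside B makes every index a scalar family, as
  \<open>basis_form_closed\<close> asks of all b and not just those in the basis.\<close>

definition frame_coefficient :: "(int \<Rightarrow> complex \<Rightarrow> 'v) \<Rightarrow> 'v \<Rightarrow> int \<Rightarrow> complex \<Rightarrow> complex" where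
  "frame_coefficient F b = (\<lambda>m \<tau>. if b \<in> B then coord b (\<rho> (coframe \<tau>) (F (m + wt b) \<tau>)) else 0)"

lemma frame_coefficient_families:
  assumes F: "F \<in> families gr" shows "frame_coefficient F b \<in> scalar_families gr"
proof (cases "b \<in> B")
  case True
  have "support (frame_coefficient F b) \<subseteq> (\<lambda>k. k - wt b) ` support F"
  proof
    fix m assume "m \<in> support (frame_coefficient F b)"
    then have "m + wt b \<in> support F"
      using not_in_support[of "m + wt b" F] True by (force simp: support_def frame_coefficient_def rho_zero)
    then show "m \<in> (\<lambda>k. k - wt b) ` support F" by (rule rev_image_eqI) simp
  qed
  then have "finite (support (frame_coefficient F b))"
    using families_support[OF F] by (meson finite_imageI finite_subset)
  moreover have "frame_coefficient F b m \<in> scalar_forms gr m" for m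
    using coframe_form[OF families_component[OF F, of "m + wt b"] True] True by (simp add: frame_coefficient_def)
  ultimately show ?thesis by (simp add: family_sum_mem_iff)
next
  case False
  interpret S: modular_forms_space "(*)" "{1}" \<Gamma> "\<lambda>_ z. z" by (rule scalar_space)
  from False show ?thesis using S.families_zero by (simp add: frame_coefficient_def)
qed

lemma realization_frame_coefficient: "realization (basis_form (frame_coefficient F)) = F"
proof (intro ext)
  fix n \<tau>
  have "(\<Sum>b\<in>B. sc (frame_coefficient F b (n - wt b) \<tau>) b) = \<rho> (coframe \<tau>) (F n \<tau>)"
    using coord_expansion[of "\<rho> (coframe \<tau>) (F n \<tau>)"] by (simp add: frame_coefficient_def)
  then show "realization (basis_form (frame_coefficient F)) n \<tau> = F n \<tau>"
    by (simp add: realization_basis_form)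
qed

lemma basis_form_closed: "(\<And>b. f b \<in> scalar_families gr) \<Longrightarrow> basis_form f \<in> formal_sums \<g> (\<R> gr)"
  unfolding basis_form_def by (intro formal_sums_sum formal_sums_tensor)

section \<open>Tensor classes and their operations\<close>

abbreviation formal :: "growth \<Rightarrow> ('v, int \<Rightarrow> complex \<Rightarrow> complex) formal_sum set" where
  "formal gr \<equiv> formal_sums \<g> (\<R> gr)"

definition tensor_class :: "growth \<Rightarrow> ('v, int \<Rightarrow> complex \<Rightarrow> complex) formal_sum \<Rightarrow> ('v, int \<Rightarrow> complex \<Rightarrow> complex) formal_sum set" where
  "tensor_class gr x = tensor_rel \<g> (\<R> gr) `` {x}"

abbreviation \<T> :: "growth \<Rightarrow> (complex, ('v, int \<Rightarrow> complex \<Rightarrow> complex) formal_sum set) graded_module" where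
  "\<T> gr \<equiv> tensor_algebra \<g> (\<R> gr)"

abbreviation \<M> :: "growth \<Rightarrow> (complex, int \<Rightarrow> complex \<Rightarrow> 'v) graded_module" where
  "\<M> gr \<equiv> lie_modular_forms gr sc br \<Gamma> (restrict_to_SL2_Z \<rho>)"

lemma formal_diff:
  assumes "x \<in> formal gr" "y \<in> formal gr" shows "x - y \<in> formal gr"
proof -
  have "formal_scale (- 1) y = - y" by (rule poly_mapping_eqI) (simp add: lookup_formal_scale)
  with formal_sums_add[OF assms(1) formal_sums_scale[OF assms(2), of "- 1"]] show ?thesis
    by (simp only: add_uminus_conv_diff)
qed

text \<open>Turns classes into fibres of the realisation, so that well-definedness of an operation
  can be checked on the resulting forms instead of on relators.\<close>

lemma tensor_class_eq:
  assumes "x \<in> formal gr"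
  shows "tensor_class gr x = {y \<in> formal gr. realization y = realization x}"
proof -
  have "x - y \<in> relations gr \<longleftrightarrow> realization y = realization x" if y: "y \<in> formal gr" for y
  proof
    assume "x - y \<in> relations gr"
    from relations_realization[OF this] show "realization y = realization x"
      by (intro ext) (simp add: realization_diff)
  next
    assume "realization y = realization x"
    then show "x - y \<in> relations gr"
      by (intro realization_kernel formal_diff assms y) (simp add: realization_diff)
  qed
  note equiv = this
  show ?thesis
  proof (rule Set.set_eqI)
    fix y
    have "y \<in> tensor_class gr x \<longleftrightarrow> x \<in> formal gr \<and> y \<in> formal gr \<and> x - y \<in> relations gr"
      by (simp only: tensor_class_def tensor_rel_def Image_singleton_iff mem_Collect_eq case_prod_conv)
    also have "\<dots> \<longleftrightarrow> y \<in> formal gr \<and> realization y = realization x"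
      using assms equiv[of y] by metis
    finally show "y \<in> tensor_class gr x \<longleftrightarrow> y \<in> {y \<in> formal gr. realization y = realization x}"
      by (simp only: mem_Collect_eq)
  qed
qed

lemma tensor_class_iff:
  "x \<in> formal gr \<Longrightarrow> y \<in> tensor_class gr x \<longleftrightarrow> y \<in> formal gr \<and> realization y = realization x"
  by (simp only: tensor_class_eq mem_Collect_eq)

lemma tensor_class_self: "x \<in> formal gr \<Longrightarrow> x \<in> tensor_class gr x"
  by (simp only: tensor_class_iff simp_thms)

lemma tensor_class_eq_iff:
  assumes x: "x \<in> formal gr" and y: "y \<in> formal gr"
  shows "tensor_class gr x = tensor_class gr y \<longleftrightarrow> realization x = realization y"
proof
  assume eq: "tensor_class gr x = tensor_class gr y"
  have "x \<in> tensor_class gr y" unfolding eq[symmetric] by (rule tensor_class_self[OF x])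
  then show "realization x = realization y" unfolding tensor_class_iff[OF y] by (rule conjunct2)
next
  assume eq: "realization x = realization y"
  show "tensor_class gr x = tensor_class gr y" unfolding tensor_class_eq[OF x] tensor_class_eq[OF y] eq ..
qed

definition class_realization :: "('v, int \<Rightarrow> complex \<Rightarrow> complex) formal_sum set \<Rightarrow> int \<Rightarrow> complex \<Rightarrow> 'v" where
  "class_realization P = realization (SOME x. x \<in> P)"

lemma class_realization: "x \<in> formal gr \<Longrightarrow> class_realization (tensor_class gr x) = realization x"
proof -
  assume x: "x \<in> formal gr"
  have "(SOME y. y \<in> tensor_class gr x) \<in> tensor_class gr x"
    by (rule someI[of "\<lambda>y. y \<in> tensor_class gr x", OF tensor_class_self[OF x]])
  then show ?thesis unfolding class_realization_def tensor_class_iff[OF x] by (rule conjunct2)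
qed

lemma T_carrier: "carrier (\<T> gr) = tensor_class gr ` formal gr"
  by (simp only: tensor_algebra_def partial_object.simps quotient_def UNION_singleton_eq_range tensor_class_def[abs_def])

lemma T_carrierE:
  assumes "P \<in> carrier (\<T> gr)" obtains x where "x \<in> formal gr" "P = tensor_class gr x"
  using assms unfolding T_carrier by (elim imageE) (rule that)

lemma tensor_class_carrier: "x \<in> formal gr \<Longrightarrow> tensor_class gr x \<in> carrier (\<T> gr)"
  unfolding T_carrier by (rule imageI)

text \<open>The operations on classes are unions over representatives. If h respects the fibres of
  the realisation, all members of the union are the same class, and the union is over a nonempty
  set.\<close>

lemma class_lift:
  assumes x: "x \<in> formal gr" and op: "\<And>x'. x' \<in> formal gr \<Longrightarrow> realization x' = realization x \<Longrightarrow>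
      h x' \<in> formal gr \<and> realization (h x') = realization (h x)"
  shows "(\<Union>x'\<in>tensor_class gr x. tensor_class gr (h x')) = tensor_class gr (h x)"
proof -
  have "(\<Union>x'\<in>tensor_class gr x. tensor_class gr (h x')) = (\<Union>x'\<in>tensor_class gr x. tensor_class gr (h x))"
  proof (rule SUP_cong[OF refl])
    fix x' assume "x' \<in> tensor_class gr x"
    then have "x' \<in> formal gr" "realization x' = realization x" unfolding tensor_class_iff[OF x] by simp_all
    from op[OF this] op[OF x refl] show "tensor_class gr (h x') = tensor_class gr (h x)"
      by (intro tensor_class_eq_iff[THEN iffD2]) simp_all
  qed
  moreover have "x \<in> tensor_class gr x" by (rule tensor_class_self[OF x])
  then have "tensor_class gr x \<noteq> {}" by (rule ex_in_conv[THEN iffD1, OF exI])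
  ultimately show ?thesis by (simp only: UN_constant if_False)
qed

lemma class_lift2:
  assumes x: "x \<in> formal gr" and y: "y \<in> formal gr"
    and op: "\<And>x' y'. x' \<in> formal gr \<Longrightarrow> y' \<in> formal gr \<Longrightarrow> realization x' = realization x \<Longrightarrow> realization y' = realization y \<Longrightarrow>
      h x' y' \<in> formal gr \<and> realization (h x' y') = realization (h x y)"
  shows "(\<Union>x'\<in>tensor_class gr x. \<Union>y'\<in>tensor_class gr y. tensor_class gr (h x' y')) = tensor_class gr (h x y)"
proof -
  have "(\<Union>y'\<in>tensor_class gr y. tensor_class gr (h x' y')) = tensor_class gr (h x' y)"
    if "x' \<in> tensor_class gr x" for x'
  proof (rule class_lift[OF y])
    have x': "x' \<in> formal gr" "realization x' = realization x"
      using that unfolding tensor_class_iff[OF x] by simp_all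
    fix y' assume "y' \<in> formal gr" "realization y' = realization y"
    with op[OF x'(1) this(1) x'(2) this(2)] op[OF x'(1) y x'(2) refl]
    show "h x' y' \<in> formal gr \<and> realization (h x' y') = realization (h x' y)" by simp
  qed
  then have "(\<Union>x'\<in>tensor_class gr x. \<Union>y'\<in>tensor_class gr y. tensor_class gr (h x' y'))
      = (\<Union>x'\<in>tensor_class gr x. tensor_class gr (h x' y))" by (rule SUP_cong[OF refl])
  also have "\<dots> = tensor_class gr (h x y)" by (rule class_lift[OF x]) (rule op[OF _ y _ refl])
  finally show ?thesis .
qed

lemma T_add:
  assumes "x \<in> formal gr" "y \<in> formal gr"
  shows "tensor_class gr x \<oplus>\<^bsub>\<T> gr\<^esub> tensor_class gr y = tensor_class gr (x + y)"
proof -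
  have "(\<Union>x'\<in>tensor_class gr x. \<Union>y'\<in>tensor_class gr y. tensor_class gr (x' + y')) = tensor_class gr (x + y)"
    by (rule class_lift2[OF assms]) (auto simp: formal_sums_add realization_add intro!: ext)
  then show ?thesis by (simp add: tensor_algebra_def tensor_class_def)
qed

lemma T_mult:
  assumes "x \<in> formal gr" "y \<in> formal gr"
  shows "tensor_class gr x \<otimes>\<^bsub>\<T> gr\<^esub> tensor_class gr y = tensor_class gr (formal_mult \<g> (\<R> gr) x y)"
proof -
  have "(\<Union>x'\<in>tensor_class gr x. \<Union>y'\<in>tensor_class gr y. tensor_class gr (formal_mult \<g> (\<R> gr) x' y'))
      = tensor_class gr (formal_mult \<g> (\<R> gr) x y)"
    by (rule class_lift2[OF assms]) (simp add: assms formal_mult_closed realization_mult)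
  then show ?thesis by (simp add: tensor_algebra_def tensor_class_def)
qed

lemma T_smult:
  assumes "x \<in> formal gr"
  shows "c \<odot>\<^bsub>\<T> gr\<^esub> tensor_class gr x = tensor_class gr (formal_scale c x)"
proof -
  have "(\<Union>x'\<in>tensor_class gr x. tensor_class gr (formal_scale c x')) = tensor_class gr (formal_scale c x)"
    by (rule class_lift[OF assms]) (auto simp: formal_sums_scale realization_scale intro!: ext)
  then show ?thesis by (simp add: tensor_algebra_def tensor_class_def)
qed

lemma T_action:
  assumes "r \<in> scalar_families gr" "x \<in> formal gr"
  shows "r \<odot>\<^bsub>tensor_module \<g> (\<R> gr)\<^esub> tensor_class gr x = tensor_class gr (formal_action (\<R> gr) r x)"
proof -
  have "(\<Union>x'\<in>tensor_class gr x. tensor_class gr (formal_action (\<R> gr) r x')) = tensor_class gr (formal_action (\<R> gr) r x)"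
    by (rule class_lift[OF assms(2)]) (simp add: assms formal_action_closed realization_action)
  then show ?thesis by (simp add: tensor_module_def with_scalars_def tensor_class_def)
qed

lemma T_zero: "\<zero>\<^bsub>\<T> gr\<^esub> = tensor_class gr 0"
  by (simp add: tensor_algebra_def tensor_class_def)

lemma class_realization_bij: "bij_betw class_realization (carrier (\<T> gr)) (families gr)"
  unfolding bij_betw_def
proof
  show "inj_on class_realization (carrier (\<T> gr))"
  proof (rule inj_onI)
    fix P Q assume PQ: "P \<in> carrier (\<T> gr)" "Q \<in> carrier (\<T> gr)" "class_realization P = class_realization Q"
    obtain x where x: "x \<in> formal gr" "P = tensor_class gr x" using PQ(1) by (rule T_carrierE)
    obtain y where y: "y \<in> formal gr" "Q = tensor_class gr y" using PQ(2) by (rule T_carrierE)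
    show "P = Q" using PQ(3) x y by (simp add: class_realization tensor_class_eq_iff)
  qed
  show "class_realization ` carrier (\<T> gr) = families gr"
  proof (intro equalityI subsetI)
    fix F assume "F \<in> class_realization ` carrier (\<T> gr)"
    then show "F \<in> families gr" by (auto simp: T_carrier class_realization realization_families)
  next
    fix F assume F: "F \<in> families gr"
    let ?x = "basis_form (frame_coefficient F)"
    have "?x \<in> formal gr" by (intro basis_form_closed frame_coefficient_families F)
    then have "class_realization (tensor_class gr ?x) = F" "tensor_class gr ?x \<in> carrier (\<T> gr)"
      by (simp_all add: class_realization realization_frame_coefficient T_carrier)
    then show "F \<in> class_realization ` carrier (\<T> gr)" by (metis imageI)
  qed
qed

definition homogeneous_span :: "growth \<Rightarrow> int \<Rightarrow> ('v, int \<Rightarrow> complex \<Rightarrow> complex) formal_sum set" where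
  "homogeneous_span gr n = Modules.module.span formal_scale
     {formal_tensor a b | a b k l. a \<in> graded_part \<g> k \<and> b \<in> graded_part (\<R> gr) l \<and> k + l = n}"

lemma T_part: "graded_part (\<T> gr) n = tensor_class gr ` homogeneous_span gr n"
  by (simp add: tensor_algebra_def homogeneous_span_def tensor_class_def[abs_def])

lemma R_part: "F \<in> graded_part (\<R> gr) k \<longleftrightarrow> F \<in> scalar_families gr \<and> (\<forall>l. l \<noteq> k \<longrightarrow> F l = (\<lambda>_. 0))"
  by (simp add: scalar_modular_forms_def)

text \<open>A vector of weight k has coordinates only at basis vectors with wt b = k, so twisting a
  family concentrated in weight l gives one concentrated in weight k + l.\<close>

lemma homogeneous_span_realization:
  assumes "x \<in> homogeneous_span gr n"
  shows "x \<in> formal gr \<and> (\<forall>m. m \<noteq> n \<longrightarrow> realization x m = (\<lambda>_. 0))"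
proof -
  interpret F: vector_space "formal_scale :: complex \<Rightarrow> ('v, int \<Rightarrow> complex \<Rightarrow> complex) formal_sum \<Rightarrow> _"
    by (rule formal_vector_space)
  show ?thesis using assms unfolding homogeneous_span_def
  proof (induction rule: F.span_induct_alt)
    case base
    show ?case by (simp add: formal_sums_zero realization_zero fun_eq_iff)
  next
    case (step c x y)
    then obtain v F k l where x: "x = formal_tensor v F" "v \<in> graded_part \<g> k" "F \<in> scalar_families gr"
      "\<forall>m. m \<noteq> l \<longrightarrow> F m = (\<lambda>_. 0)" "k + l = n" unfolding R_part by blast
    have "twist v F m \<tau> = 0" if "m \<noteq> n" for m \<tau>
    proof -
      have "coord b v * F (m - wt b) \<tau> = 0" if b: "b \<in> B" for b
      proof (cases "coord b v = 0")
        case False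
        then have "wt b = k" using x(2) b unfolding g_part_iff by blast
        with \<open>m \<noteq> n\<close> x(5) have "m - wt b \<noteq> l" by auto
        with x(4) show ?thesis by simp
      qed simp
      then have "(\<Sum>b\<in>B. sc (coord b v * F (m - wt b) \<tau>) b) = 0" by (intro sum.neutral) simp
      then show ?thesis by (simp add: twist_def rho_zero)
    qed
    then have "realization x m \<tau> = 0" if "m \<noteq> n" for m \<tau>
      unfolding x(1) realization_tensor using that by simp
    moreover have "x \<in> formal gr" unfolding x(1) by (rule formal_sums_tensor[OF x(3)])
    ultimately show ?case using step.IH
      by (simp add: formal_sums_add formal_sums_scale realization_add realization_scale fun_eq_iff)
  qed
qed

lemma T_part_carrier: "graded_part (\<T> gr) n \<subseteq> carrier (\<T> gr)"
  unfolding T_part T_carrier using homogeneous_span_realization by blast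

lemma T_part_image: "class_realization ` graded_part (\<T> gr) n = graded_part (\<M> gr) n"
proof (intro equalityI subsetI)
  fix F assume "F \<in> class_realization ` graded_part (\<T> gr) n"
  then obtain x where x: "x \<in> homogeneous_span gr n" "F = class_realization (tensor_class gr x)"
    unfolding T_part by blast
  from homogeneous_span_realization[OF x(1)] x(2) show "F \<in> graded_part (\<M> gr) n"
    by (simp add: class_realization lie_modular_forms_def realization_families)
next
  interpret F: vector_space "formal_scale :: complex \<Rightarrow> ('v, int \<Rightarrow> complex \<Rightarrow> complex) formal_sum \<Rightarrow> _"
    by (rule formal_vector_space)
  fix F assume "F \<in> graded_part (\<M> gr) n"
  then have F: "F \<in> families gr" "\<And>m. m \<noteq> n \<Longrightarrow> F m = (\<lambda>_. 0)" by (simp_all add: lie_modular_forms_def)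
  let ?x = "basis_form (frame_coefficient F)"
  \<comment> \<open>If F is concentrated in weight n, the normal form of its preimage is homogeneous
    term by term: b has weight wt b and its coefficient has weight n - wt b.\<close>
  have "formal_tensor b (frame_coefficient F b) \<in> homogeneous_span gr n" if b: "b \<in> B" for b
    unfolding homogeneous_span_def
  proof (rule F.span_base, intro CollectI exI conjI)
    show "b \<in> graded_part \<g> (wt b)" by (rule basis_in_part[OF b])
    show "frame_coefficient F b \<in> graded_part (\<R> gr) (n - wt b)"
      unfolding R_part using frame_coefficient_families[OF F(1)] F(2)
      by (auto simp: frame_coefficient_def rho_zero fun_eq_iff)
  qed simp_all
  then have x: "?x \<in> homogeneous_span gr n"
    unfolding basis_form_def homogeneous_span_def by (rule F.span_sum)
  have "class_realization (tensor_class gr ?x) = F"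
    using homogeneous_span_realization[OF x] by (simp add: class_realization realization_frame_coefficient)
  then show "F \<in> class_realization ` graded_part (\<T> gr) n" unfolding T_part using x by (metis imageI)
qed

lemma T_operations:
  assumes "P \<in> carrier (\<T> gr)" "Q \<in> carrier (\<T> gr)"
  shows "P \<oplus>\<^bsub>\<T> gr\<^esub> Q \<in> carrier (\<T> gr)"
    and "class_realization (P \<oplus>\<^bsub>\<T> gr\<^esub> Q) = class_realization P \<oplus>\<^bsub>\<M> gr\<^esub> class_realization Q"
    and "c \<odot>\<^bsub>\<T> gr\<^esub> P \<in> carrier (\<T> gr)"
    and "class_realization (c \<odot>\<^bsub>\<T> gr\<^esub> P) = c \<odot>\<^bsub>\<M> gr\<^esub> class_realization P"
    and "P \<otimes>\<^bsub>\<T> gr\<^esub> Q \<in> carrier (\<T> gr)"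
    and "class_realization (P \<otimes>\<^bsub>\<T> gr\<^esub> Q) = class_realization P \<otimes>\<^bsub>\<M> gr\<^esub> class_realization Q"
    and "r \<in> scalar_families gr \<Longrightarrow> r \<odot>\<^bsub>tensor_module \<g> (\<R> gr)\<^esub> P \<in> carrier (\<T> gr)"
    and "r \<in> scalar_families gr \<Longrightarrow> class_realization (r \<odot>\<^bsub>tensor_module \<g> (\<R> gr)\<^esub> P) = weight_convolution sc r (class_realization P)"
proof -
  obtain x where x: "x \<in> formal gr" "P = tensor_class gr x" using assms(1) by (rule T_carrierE)
  obtain y where y: "y \<in> formal gr" "Q = tensor_class gr y" using assms(2) by (rule T_carrierE)
  note [simp] = x y T_add T_mult T_smult T_action class_realization tensor_class_carrier
    formal_sums_add formal_sums_scale formal_mult_closed formal_action_closed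
    realization_mult realization_action lie_modular_forms_def
  show "P \<oplus>\<^bsub>\<T> gr\<^esub> Q \<in> carrier (\<T> gr)" "c \<odot>\<^bsub>\<T> gr\<^esub> P \<in> carrier (\<T> gr)" "P \<otimes>\<^bsub>\<T> gr\<^esub> Q \<in> carrier (\<T> gr)"
    "class_realization (P \<otimes>\<^bsub>\<T> gr\<^esub> Q) = class_realization P \<otimes>\<^bsub>\<M> gr\<^esub> class_realization Q"
    "r \<in> scalar_families gr \<Longrightarrow> r \<odot>\<^bsub>tensor_module \<g> (\<R> gr)\<^esub> P \<in> carrier (\<T> gr)"
    "r \<in> scalar_families gr \<Longrightarrow> class_realization (r \<odot>\<^bsub>tensor_module \<g> (\<R> gr)\<^esub> P) = weight_convolution sc r (class_realization P)"
    by simp_all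
  show "class_realization (P \<oplus>\<^bsub>\<T> gr\<^esub> Q) = class_realization P \<oplus>\<^bsub>\<M> gr\<^esub> class_realization Q"
    by (simp add: realization_add fun_eq_iff)
  show "class_realization (c \<odot>\<^bsub>\<T> gr\<^esub> P) = c \<odot>\<^bsub>\<M> gr\<^esub> class_realization P"
    by (simp add: realization_scale fun_eq_iff)
qed

lemma T_zero_facts:
  "\<zero>\<^bsub>\<T> gr\<^esub> \<in> carrier (\<T> gr)" "class_realization \<zero>\<^bsub>\<T> gr\<^esub> = \<zero>\<^bsub>\<M> gr\<^esub>"
  by (simp_all add: T_zero tensor_class_carrier formal_sums_zero class_realization lie_modular_forms_def realization_zero fun_eq_iff)

theorem modular_forms_isomorphism:
  "\<exists>\<Phi>. graded_lie_iso (\<M> gr) (\<T> gr) \<Phi> \<and>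
    graded_module_iso (\<R> gr) (lie_modular_forms_module gr sc br \<Gamma> (restrict_to_SL2_Z \<rho>)) (tensor_module \<g> (\<R> gr)) \<Phi>"
proof (intro exI conjI)
  let ?MM = "lie_modular_forms_module gr sc br \<Gamma> (restrict_to_SL2_Z \<rho>)" and ?TM = "tensor_module \<g> (\<R> gr)"
  have bij: "bij_betw class_realization (carrier (\<T> gr)) (carrier (\<M> gr))"
    using class_realization_bij by (simp add: lie_modular_forms_def)
  show "graded_lie_iso (\<M> gr) (\<T> gr) (inv_into (carrier (\<T> gr)) class_realization)"
  proof (rule graded_lie_iso_inv_into[OF _ bij])
    show "graded_lie_algebra (\<M> gr)"
      unfolding lie_modular_forms_def by (rule modular_algebra_graded_lie_algebra)
  qed (simp_all add: T_operations T_zero_facts T_part_carrier T_part_image)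
  have TM: "carrier ?TM = carrier (\<T> gr)" "zero ?TM = zero (\<T> gr)" "add ?TM = add (\<T> gr)" "graded_part ?TM = graded_part (\<T> gr)"
    by (simp_all add: tensor_module_def)
  have MM: "carrier ?MM = carrier (\<M> gr)" "zero ?MM = zero (\<M> gr)" "add ?MM = add (\<M> gr)" "graded_part ?MM = graded_part (\<M> gr)"
    "module.smult ?MM = weight_convolution sc"
    by (simp_all add: lie_modular_forms_module_def)
  have "graded_module_iso (\<R> gr) ?MM ?TM (inv_into (carrier ?TM) class_realization)"
  proof (rule graded_module_iso_inv_into)
    show "graded_module_over (\<R> gr) ?MM"
      unfolding lie_modular_forms_module_def lie_modular_forms_def by (rule modular_algebra_graded_module)
    show "bij_betw class_realization (carrier ?TM) (carrier ?MM)" unfolding TM MM by (rule bij)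
  qed (unfold TM MM R_simps, (rule T_operations T_zero_facts T_part_carrier T_part_image; assumption)+)
  then show "graded_module_iso (\<R> gr) ?MM ?TM (inv_into (carrier (\<T> gr)) class_realization)" unfolding TM .
qed

end

section \<open>From the hypotheses to a basis of weight vectors and a frame\<close>

lemma complex_lie_group_hom_sl2_representation:
  assumes "finite_basis sc B" and hom: "complex_lie_group_hom sc br \<rho>"
  shows "sl2_representation sc B \<rho>" and "det A = 1 \<Longrightarrow> \<rho> A (br u v) = br (\<rho> A u) (\<rho> A v)"
proof -
  interpret finite_basis sc B by fact
  have aut: "\<rho> A \<in> lie_automorphisms sc br" if "det A = 1" for A
  proof -
    have "\<rho> A \<in> connected_component_set (lie_automorphisms sc br) id"
      using hom that by (simp add: complex_lie_group_hom_def hom_def SL2_def lie_automorphisms_0_def Pi_iff)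
    then show ?thesis by (rule subsetD[OF connected_component_subset])
  qed
  then show "det A = 1 \<Longrightarrow> \<rho> A (br u v) = br (\<rho> A u) (\<rho> A v)"
    by (simp add: lie_automorphisms_def)
  have mult: "\<rho> (A ** A') = \<rho> A \<circ> \<rho> A'" if "det A = 1" "det A' = 1" for A A'
    using hom that by (simp add: complex_lie_group_hom_def hom_def SL2_def lie_automorphisms_0_def)
  show "sl2_representation sc B \<rho>"
  proof (rule sl2_representation.intro[OF assms(1) sl2_representation_axioms.intro])
    fix A A' :: "complex^2^2" and v assume "det A = 1" "det A' = 1"
    then show "\<rho> (A ** A') v = \<rho> A (\<rho> A' v)" by (simp add: mult)
  next
    fix v
    \<comment> \<open>Multiplicativity makes \<rho> at the identity matrix idempotent, and an
      injective idempotent map is the identity.\<close>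
    have "inj (\<rho> (mat 1))" using aut[of "mat 1"] by (simp add: lie_automorphisms_def bij_def)
    moreover have "\<rho> (mat 1) (\<rho> (mat 1) v) = \<rho> (mat 1) v"
      using fun_cong[OF mult[of "mat 1" "mat 1"], of v] by simp
    ultimately show "\<rho> (mat 1) v = v" by (rule injD)
  next
    fix A :: "complex^2^2" assume "det A = 1"
    then show "Vector_Spaces.linear sc sc (\<rho> A)" using aut by (simp add: lie_automorphisms_def)
  next
    fix v show "holomorphic_map matrix_scale sc (\<lambda>A. \<rho> A v) {A. det A = 1}"
      using hom by (simp add: complex_lie_group_hom_def SL2_def)
  qed
qed

lemma framed_lie_forms_exist:
  fixes sc :: "complex \<Rightarrow> 'g::real_normed_vector \<Rightarrow> 'g"
  assumes "complex_normed_space sc" "finite_dimensional_vector_space sc B\<^sub>0"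
    and lie: "lie_algebra (lie_algebra_of sc br)"
    and Gamma: "\<Gamma> \<subseteq> carrier SL2_Z"
    and hom: "complex_lie_group_hom sc br \<rho>"
  obtains B wt \<phi> K where "framed_lie_forms sc B \<rho> wt \<phi> K \<Gamma> br"
proof -
  interpret complex_normed_space sc by fact
  interpret fd: finite_dimensional_vector_space sc B\<^sub>0 by fact
  have "finite_basis sc B\<^sub>0"
    by unfold_locales (rule fd.finite_Basis fd.independent_Basis fd.span_Basis)+
  then interpret S: sl2_representation sc B\<^sub>0 \<rho>
    by (rule complex_lie_group_hom_sl2_representation[OF _ hom])
  \<comment> \<open>The given basis serves to produce one of weight vectors; from here on the
    representation is taken with respect to the new basis.\<close>
  obtain B wt where B: "finite_basis sc B"
    and wt: "\<And>b a. b \<in> B \<Longrightarrow> a \<noteq> 0 \<Longrightarrow> \<rho> (torus a) b = sc (a powi wt b) b"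
    using S.weight_basis_exists by blast
  note rep = complex_lie_group_hom_sl2_representation[OF B hom]
  interpret R: sl2_representation sc B \<rho> by (rule rep(1))
  obtain \<phi> K where phi: "\<phi> holomorphic_on {\<tau>. Im \<tau> > 0}"
    "\<And>\<tau>. Im \<tau> > 0 \<Longrightarrow> \<phi> (\<tau> + 1) = \<phi> \<tau>"
    "\<And>\<tau>. Im \<tau> > 0 \<Longrightarrow> \<phi> (- 1 / \<tau>) = \<tau>\<^sup>2 * \<phi> \<tau> + \<tau>"
    "\<And>\<tau>. Im \<tau> \<ge> 1 \<Longrightarrow> cmod (\<phi> \<tau>) \<le> K * cmod \<tau> ^ 3"
    using quasimodular_connection by metis
  have det: "det (complex_matrix \<gamma>) = 1" if "\<gamma> \<in> \<Gamma>" for \<gamma>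
    using Gamma that by (intro det_complex_matrix) blast
  have "modular_frame sc B \<rho> wt \<phi> K"
  proof unfold_locales
    show "\<phi> holomorphic_on upper_half_plane" using phi(1) by (simp add: upper_half_plane_def)
    show "quasimodular \<phi> \<gamma>" if "\<gamma> \<in> carrier SL2_Z" for \<gamma>
      using phi(2,3) that by (rule quasimodular_all)
  qed (fact wt phi(4))+
  moreover have "modular_forms_space sc B \<Gamma> (restrict_to_SL2_Z \<rho>)"
    by (rule modular_forms_space.intro[OF B modular_forms_space_axioms.intro[OF Gamma]])
      (simp only: restrict_to_SL2_Z_def R.rho_linear det)
  moreover from this have "lie_modular_forms_space sc B \<Gamma> (restrict_to_SL2_Z \<rho>) br"
    by (rule lie_modular_forms_space.intro[OF _ lie_modular_forms_space_axioms.intro[OF lie]])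
      (simp only: restrict_to_SL2_Z_def rep(2) det)
  ultimately have "framed_lie_forms sc B \<rho> wt \<phi> K \<Gamma> br"
    by (intro framed_lie_forms.intro framed_modular_forms.intro framed_lie_forms_axioms.intro rep(2))
  then show ?thesis by (rule that)
qed

theorem theorem1p1:
  fixes sc :: "complex \<Rightarrow> 'g::real_normed_vector \<Rightarrow> 'g"
    and br :: "'g \<Rightarrow> 'g \<Rightarrow> 'g"
    and \<Gamma> :: "(int^2^2) set"
    and \<rho>_bar :: "complex^2^2 \<Rightarrow> 'g \<Rightarrow> 'g"
  assumes "complex_normed_space sc"
    and "\<exists>Basis. finite_dimensional_vector_space sc Basis"
    and "simple_lie_algebra (lie_algebra_of sc br)"
    and "subgroup \<Gamma> SL2_Z"
    and "finite (rcosets\<^bsub>SL2_Z\<^esub> \<Gamma>)"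
    and "complex_lie_group_hom sc br \<rho>_bar"
  shows "let \<rho> = restrict_to_SL2_Z \<rho>_bar;
             G = weight_graded_lie_algebra sc br \<rho>_bar
         in graded_lie_algebra G
          \<and> (\<exists>\<Phi>. graded_lie_iso
                   (lie_modular_forms Polynomial sc br \<Gamma> \<rho>)
                   (tensor_algebra G (scalar_modular_forms Polynomial \<Gamma>)) \<Phi>
               \<and> graded_module_iso (scalar_modular_forms Polynomial \<Gamma>)
                   (lie_modular_forms_module Polynomial sc br \<Gamma> \<rho>)
                   (tensor_module G (scalar_modular_forms Polynomial \<Gamma>)) \<Phi>)
          \<and> (\<exists>\<Phi>. graded_lie_iso
                   (lie_modular_forms Exponential sc br \<Gamma> \<rho>)
                   (tensor_algebra G (scalar_modular_forms Exponential \<Gamma>)) \<Phi>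
               \<and> graded_module_iso (scalar_modular_forms Exponential \<Gamma>)
                   (lie_modular_forms_module Exponential sc br \<Gamma> \<rho>)
                   (tensor_module G (scalar_modular_forms Exponential \<Gamma>)) \<Phi>)"
proof -
  obtain B\<^sub>0 where "finite_dimensional_vector_space sc B\<^sub>0" using assms(2) ..
  moreover have "lie_algebra (lie_algebra_of sc br)"
    using assms(3) by (rule simple_lie_algebra_def[THEN iffD1, THEN conjunct1])
  ultimately obtain B wt \<phi> K where "framed_lie_forms sc B \<rho>_bar wt \<phi> K \<Gamma> br"
    by (rule framed_lie_forms_exist[OF assms(1) _ _ subgroup.subset[OF assms(4)] assms(6)])
  then interpret framed_lie_forms sc B \<rho>_bar wt \<phi> K \<Gamma> br .
  show ?thesis
    unfolding Let_def by (intro conjI g_graded_lie_algebra modular_forms_isomorphism)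
qed

end
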